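(* Let $T,\epsilon,s$ be real numbers with $0<\epsilon<\frac{T}{2}$ and $s\in\left(-\frac74,\frac52\right)\setminus\left\{\frac12,\frac32\right\}$. Let $u_0,u_T\in H^s(0,+\infty)$. Then there exists a function $$u\in L^2_{\mathrm{loc}}([0,T]\times(0,+\infty))\cap C([0,\epsilon];H^s(0,+\infty))\cap C([T-\epsilon,T];H^s(0,+\infty))$$ such that $$u_t+u_x+u_{xxx}-u_{xxxxx}=0 \ \text{ in } \mathcal{D}'((0,T)\times(0,+\infty)),\qquad u(0,x)=u_0 \ \text{ in } (0,+\infty),$$ and $u(T,x)=u_T$ in $(0,+\infty)$. *)

theory Defs
  imports "HOL-Analysis.Analysis"
begin

definition supp_cl :: "('a::topological_space \<Rightarrow> real) \<Rightarrow> 'a set" where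
  "supp_cl f = closure {x. f x \<noteq> 0}"

definition smooth1 :: "(real \<Rightarrow> real) \<Rightarrow> bool" where
  "smooth1 f \<longleftrightarrow> (\<forall>k x. ((deriv ^^ k) f) differentiable (at x))"

definition test1 :: "real set \<Rightarrow> (real \<Rightarrow> real) \<Rightarrow> bool" where
  "test1 U f \<longleftrightarrow> smooth1 f \<and> compact (supp_cl f) \<and> supp_cl f \<subseteq> U"

definition pdiff :: "bool \<Rightarrow> (real \<times> real \<Rightarrow> real) \<Rightarrow> (real \<times> real \<Rightarrow> real)" where
  "pdiff d f = (\<lambda>(t, x). if d then deriv (\<lambda>\<tau>. f (\<tau>, x)) t else deriv (\<lambda>y. f (t, y)) x)"

fun pds :: "bool list \<Rightarrow> (real \<times> real \<Rightarrow> real) \<Rightarrow> (real \<times> real \<Rightarrow> real)" where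
  "pds [] f = f"
| "pds (d # ds) f = pdiff d (pds ds f)"

definition smooth2 :: "(real \<times> real \<Rightarrow> real) \<Rightarrow> bool" where
  "smooth2 f \<longleftrightarrow> (\<forall>ds. continuous_on UNIV (pds ds f) \<and>
      (\<forall>t x. (\<lambda>\<tau>. pds ds f (\<tau>, x)) differentiable (at t) \<and>
             (\<lambda>y. pds ds f (t, y)) differentiable (at x)))"

definition test2 :: "(real \<times> real) set \<Rightarrow> (real \<times> real \<Rightarrow> real) \<Rightarrow> bool" where
  "test2 U f \<longleftrightarrow> smooth2 f \<and> compact (supp_cl f) \<and> supp_cl f \<subseteq> U"

text \<open>Real distributions are represented as real functionals on real test functions.\<close>
type_synonym distr = "(real \<Rightarrow> real) \<Rightarrow> real"

definition FT :: "(real \<Rightarrow> real) \<Rightarrow> real \<Rightarrow> complex" where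
  "FT f \<xi> = integral\<^sup>L lborel (\<lambda>x. complex_of_real (f x) * cis (- (x * \<xi>)))"

text \<open>g (a function on the frequency side) represents the distribution S in H^s(R):
  g is in the weighted L^2 space with weight (1+xi^2)^s and S is the tempered
  distribution whose Fourier transform is g (tested against C_c^infinity(R), which is
  dense in the Schwartz space).\<close>
definition Hs_rep :: "real \<Rightarrow> (real \<Rightarrow> complex) \<Rightarrow> distr \<Rightarrow> bool" where
  "Hs_rep s g S \<longleftrightarrow> g \<in> borel_measurable lborel \<and>
     integrable lborel (\<lambda>\<xi>. (1 + \<xi>\<^sup>2) powr s * (cmod (g \<xi>))\<^sup>2) \<and>
     (\<forall>\<phi>. test1 UNIV \<phi> \<longrightarrow>
        complex_of_real (S \<phi>) = integral\<^sup>L lborel (\<lambda>\<xi>. g \<xi> * cnj (FT \<phi> \<xi>)) / (2 * pi))"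

definition Hs_half_rep :: "real \<Rightarrow> (real \<Rightarrow> complex) \<Rightarrow> distr \<Rightarrow> bool" where
  "Hs_half_rep s g T \<longleftrightarrow> (\<exists>S. Hs_rep s g S \<and> (\<forall>\<phi>. test1 {0<..} \<phi> \<longrightarrow> T \<phi> = S \<phi>))"

definition Hs_half :: "real \<Rightarrow> distr set" where
  "Hs_half s = {T. \<exists>g. Hs_half_rep s g T}"

definition Hs_half_norm :: "real \<Rightarrow> distr \<Rightarrow> real" where
  "Hs_half_norm s T = Inf {sqrt (integral\<^sup>L lborel (\<lambda>\<xi>. (1 + \<xi>\<^sup>2) powr s * (cmod (g \<xi>))\<^sup>2)) / (2 * pi)
                           | g. Hs_half_rep s g T}"

definition distr_eq_half :: "distr \<Rightarrow> distr \<Rightarrow> bool" where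
  "distr_eq_half T1 T2 \<longleftrightarrow> (\<forall>\<phi>. test1 {0<..} \<phi> \<longrightarrow> T1 \<phi> = T2 \<phi>)"

definition cont_Hs_half :: "real \<Rightarrow> real set \<Rightarrow> (real \<Rightarrow> distr) \<Rightarrow> bool" where
  "cont_Hs_half s I v \<longleftrightarrow> (\<forall>t\<in>I. v t \<in> Hs_half s) \<and>
     (\<forall>t\<in>I. \<forall>e>0. \<exists>\<delta>>0. \<forall>t'\<in>I. \<bar>t' - t\<bar> < \<delta> \<longrightarrow>
        Hs_half_norm s (\<lambda>\<phi>. v t' \<phi> - v t \<phi>) < e)"

definition section_distr :: "(real \<times> real \<Rightarrow> real) \<Rightarrow> real \<Rightarrow> distr" where
  "section_distr u t = (\<lambda>\<phi>. integral\<^sup>L lborel (\<lambda>x. u (t, x) * \<phi> x))"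

definition L2_loc :: "(real \<times> real) set \<Rightarrow> (real \<times> real \<Rightarrow> real) \<Rightarrow> bool" where
  "L2_loc \<Omega> u \<longleftrightarrow> u \<in> borel_measurable lborel \<and>
     (\<forall>K. compact K \<and> K \<subseteq> \<Omega> \<longrightarrow> set_integrable lborel K (\<lambda>p. (u p)\<^sup>2))"

definition weak_sol :: "real \<Rightarrow> (real \<times> real \<Rightarrow> real) \<Rightarrow> bool" where
  "weak_sol T u \<longleftrightarrow> (\<forall>\<phi>. test2 ({0<..<T} \<times> {0<..}) \<phi> \<longrightarrow>
     integral\<^sup>L lborel (\<lambda>p. u p * (- pds [True] \<phi> p - pds [False] \<phi> p
        - pds [False, False, False] \<phi> p + pds [False, False, False, False, False] \<phi> p)) = 0)"

end

theory Submission
  imports Defs "HOL-Probability.Probability"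
begin

text \<open>
  Let \<open>P = \<partial>\<^sub>t + \<partial>\<^sub>x + \<partial>\<^sub>x^3 - \<partial>\<^sub>x^5\<close>. Since no lateral boundary condition is imposed, the two ends of the
  time interval decouple: it suffices to solve \<open>P w = 0\<close> on the whole plane with \<open>w\<close> equal to the
  group solution \<open>U\<close> of the initial data up to time \<open>\<epsilon>\<close> and \<open>w = 0\<close> from time \<open>T - \<epsilon>\<close> on. The equation is
  invariant under \<open>(t, x) \<mapsto> (T - t, - x)\<close>, so the terminal data are reached by the reflection of such
  a solution, and the sum of the two solves the problem.

  For \<open>s \<ge> - 2\<close> the group solution is locally square integrable because the group gains two
  derivatives locally. At almost every time \<open>a\<close> it can be cut off: \<open>P\<close> maps the restriction of \<open>U\<close> to
  \<open>t < a\<close> to the source \<open>- U(a, x)\<close> at time \<open>a\<close>. This source is cancelled by a superposition of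
  translates of solutions of \<open>P V = \<delta>\<close> that live in a short time interval and are as small as desired
  on a prescribed bounded set on one side of the source, so that the superposition converges locally.
  They exist because \<open>P\<close> has order five in \<open>x\<close> and order one in \<open>t\<close>: Cauchy data on \<open>x = 0\<close> that
  are of Gevrey class two in \<open>t\<close>, in particular data cut off in time, give a power series in \<open>x\<close> that
  converges everywhere.
\<close>

section \<open>Test functions and superposition\<close>

text \<open>The fundamental solution integrates plane waves over the frequencies with imaginary part
  1, where the imaginary part of z^5 + z^3 - z grows like 5 \<xi>^4. Forward in time the waves then
  decay like exp(- 4 t \<xi>^4); the price is a factor exp(- x), harmless as long as only bounded
  sets of x are controlled. This decay in frequency is also what makes the Cauchy data on x = 0
  Gevrey in t. Every singularity in time is a power t^(- a) with a < 1/2, so that the result stays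
  square integrable. Two obstacles shape the rest. The group solution is only known to be square
  integrable against a Gaussian, so the solution issued from a source at y has to be as small as
  exp(- y^2 / 2) near the origin; this is why Gaussian weights appear everywhere. And the cut takes
  place on a single time slice, which a statement in L^2 of the plane does not see; the
  approximations of the group solution must therefore converge on almost every slice, for all test
  functions at once.\<close>

lemma integrable_continuous_bounded_support:
  fixes f :: "real \<Rightarrow> 'a::euclidean_space"
  assumes "continuous_on UNIV f" "\<And>x. A \<le> \<bar>x\<bar> \<Longrightarrow> f x = 0"
  shows "integrable lborel f"
proof -
  have "integrable lborel (\<lambda>x. indicator {-A..A} x *\<^sub>R f x)"
    using borel_integrable_compact[of "{-A..A}" f] continuous_on_subset[OF assms(1)] by auto
  also have "(\<lambda>x. indicator {-A..A} x *\<^sub>R f x) = f"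
    using assms(2) by (auto simp: fun_eq_iff indicator_def)
  finally show ?thesis .
qed

text \<open>All boundary terms below originate here: a half-line leaves the value of f at its
  endpoint. The cut in time uses the left half-line, the jump in space the right one.\<close>

lemma integral_deriv_bounded_support:
  fixes f f' :: "real \<Rightarrow> complex"
  assumes d: "\<And>x. (f has_vector_derivative f' x) (at x)" and c: "continuous_on UNIV f'"
    and z: "\<And>x. A \<le> \<bar>x\<bar> \<Longrightarrow> f x = 0" "\<And>x. A \<le> \<bar>x\<bar> \<Longrightarrow> f' x = 0"
  shows "(\<integral>x. f' x \<partial>lborel) = 0"
    and "(\<integral>x. indicator {a<..} x *\<^sub>R f' x \<partial>lborel) = - f a"
    and "(\<integral>x. indicator {..<a} x *\<^sub>R f' x \<partial>lborel) = f a"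
proof -
  define B where "B = \<bar>A\<bar> + \<bar>a\<bar> + 1"
  have B: "A \<le> B" "-B \<le> a" "a \<le> B" "0 < B" "A < B" "- B < a" "a < B" by (auto simp: B_def)
  have [measurable]: "f' \<in> borel_measurable borel"
    using c by (rule borel_measurable_continuous_onI)
  have FTC: "u \<le> v \<Longrightarrow> (\<integral>x. indicator {u..v} x *\<^sub>R f' x \<partial>lborel) = f v - f u" for u v
    by (intro integral_FTC_Icc) (auto intro: d has_vector_derivative_at_within continuous_on_subset[OF c])
  have zB: "f B = 0" "f (-B) = 0" using z B by auto
  have ind: "indicator {-B..B} x *\<^sub>R f' x = f' x" for x
    using z(2)[of x] B by (auto simp: indicator_def)
  show "(\<integral>x. f' x \<partial>lborel) = 0"
    using FTC[of "-B" B] B zB by (simp add: ind)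
  have "(\<integral>x. indicator {a<..} x *\<^sub>R f' x \<partial>lborel) = (\<integral>x. indicator {a..B} x *\<^sub>R f' x \<partial>lborel)"
  proof (intro integral_cong_AE)
    show "AE x in lborel. indicator {a<..} x *\<^sub>R f' x = indicator {a..B} x *\<^sub>R f' x"
      using AE_lborel_singleton[of a]
    proof eventually_elim
      fix x assume "x \<noteq> a"
      then show "indicator {a<..} x *\<^sub>R f' x = indicator {a..B} x *\<^sub>R f' x"
        using z(2)[of x] B by (auto simp: indicator_def)
    qed
  qed auto
  then show "(\<integral>x. indicator {a<..} x *\<^sub>R f' x \<partial>lborel) = - f a"
    using FTC[of a B] B zB by simp
  have "(\<integral>x. indicator {..<a} x *\<^sub>R f' x \<partial>lborel) = (\<integral>x. indicator {-B..a} x *\<^sub>R f' x \<partial>lborel)"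
  proof (intro integral_cong_AE)
    show "AE x in lborel. indicator {..<a} x *\<^sub>R f' x = indicator {-B..a} x *\<^sub>R f' x"
      using AE_lborel_singleton[of a]
    proof eventually_elim
      fix x assume "x \<noteq> a"
      then show "indicator {..<a} x *\<^sub>R f' x = indicator {-B..a} x *\<^sub>R f' x"
        using z(2)[of x] B by (auto simp: indicator_def)
    qed
  qed auto
  then show "(\<integral>x. indicator {..<a} x *\<^sub>R f' x \<partial>lborel) = f a"
    using FTC[of "-B" a] B zB by simp
qed

lemma integrable_mult_indicator_Icc: "integrable lborel (\<lambda>x. M * indicator {a..b::real} x :: real)"
  by (intro integrable_mult_right integrable_real_indicator) (auto simp: emeasure_lborel_Icc_eq)

lemma (in pair_sigma_finite) integrable_mult_pair:
  fixes f :: "'a \<Rightarrow> real" and g :: "'b \<Rightarrow> real"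
  assumes f: "integrable M1 f" and g: "integrable M2 g"
  shows "integrable (M1 \<Otimes>\<^sub>M M2) (\<lambda>p. f (fst p) * g (snd p))"
proof (rule Fubini_integrable)
  have [measurable]: "f \<in> borel_measurable M1" "g \<in> borel_measurable M2" using f g by auto
  show "(\<lambda>p. f (fst p) * g (snd p)) \<in> borel_measurable (M1 \<Otimes>\<^sub>M M2)" by measurable
  show "integrable M1 (\<lambda>x. \<integral>y. norm (f (fst (x, y)) * g (snd (x, y))) \<partial>M2)"
    using f by (simp add: abs_mult)
  show "AE x in M1. integrable M2 (\<lambda>y. f (fst (x, y)) * g (snd (x, y)))"
    using g by simp
qed

text \<open>The bound is uniform in x and merely integrable in t because each singularity met here
  is an integrable power of the time elapsed since one instant, locally uniformly in x. The class
  pairs with box tests and is stable under superposition.\<close>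

definition local_dom :: "(real \<times> real \<Rightarrow> complex) \<Rightarrow> bool" where
  "local_dom w \<longleftrightarrow> w \<in> borel_measurable borel \<and>
     (\<forall>A. \<exists>\<gamma>. integrable lborel \<gamma> \<and> (\<forall>t x. \<bar>t\<bar> \<le> A \<longrightarrow> \<bar>x\<bar> \<le> A \<longrightarrow> norm (w (t, x)) \<le> \<gamma> t))"

text \<open>Continuity and bounded support are all that a convergent pairing needs; smoothness
  enters only through the chains of derivatives in \<open>test_family\<close>.\<close>

definition box_test :: "(real \<times> real \<Rightarrow> real) \<Rightarrow> bool" where
  "box_test h \<longleftrightarrow> continuous_on UNIV h \<and> (\<exists>A. \<forall>t x. A \<le> \<bar>t\<bar> \<or> A \<le> \<bar>x\<bar> \<longrightarrow> h (t, x) = 0)"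

lemma box_test_cont: "box_test h \<Longrightarrow> continuous_on UNIV h" by (simp add: box_test_def)

lemma box_test_measurable: "box_test h \<Longrightarrow> h \<in> borel_measurable borel"
  by (auto simp: box_test_def intro: borel_measurable_continuous_onI)

lemma box_test_bound:
  assumes "box_test h"
  obtains A M where "0 < A" "0 \<le> M" "\<And>t x. \<bar>h (t, x)\<bar> \<le> M"
    "\<And>t x. A \<le> \<bar>t\<bar> \<or> A \<le> \<bar>x\<bar> \<Longrightarrow> h (t, x) = 0"
proof -
  obtain A where A: "\<And>t x. A \<le> \<bar>t\<bar> \<or> A \<le> \<bar>x\<bar> \<Longrightarrow> h (t, x) = 0" and c: "continuous_on UNIV h"
    using assms by (auto simp: box_test_def)
  define B where "B = \<bar>A\<bar> + 1"
  have "compact ({-B..B} \<times> {-B..B})" by (intro compact_Times) auto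
  then have "bounded (h ` ({-B..B} \<times> {-B..B}))"
    by (intro compact_imp_bounded compact_continuous_image continuous_on_subset[OF c]) auto
  then obtain M where M: "\<And>p. p \<in> {-B..B} \<times> {-B..B} \<Longrightarrow> \<bar>h p\<bar> \<le> M"
    by (auto simp: bounded_iff)
  have "\<bar>h (t, x)\<bar> \<le> \<bar>M\<bar>" for t x
  proof (cases "\<bar>t\<bar> \<le> B \<and> \<bar>x\<bar> \<le> B")
    case True then show ?thesis using M[of "(t, x)"] by (auto simp: abs_le_iff)
  next
    case False
    then have "A \<le> \<bar>t\<bar> \<or> A \<le> \<bar>x\<bar>" by (auto simp: B_def)
    then show ?thesis using A[of t x] by auto
  qed
  moreover have "\<And>t x. B \<le> \<bar>t\<bar> \<or> B \<le> \<bar>x\<bar> \<Longrightarrow> h (t, x) = 0" using A by (force simp: B_def)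
  ultimately show thesis using that[of B "\<bar>M\<bar>"] by (auto simp: B_def)
qed

lemma box_test_add: "box_test f \<Longrightarrow> box_test g \<Longrightarrow> box_test (\<lambda>p. f p + g p)"
proof -
  assume a: "box_test f" "box_test g"
  obtain A M where A: "\<And>t x. A \<le> \<bar>t\<bar> \<or> A \<le> \<bar>x\<bar> \<Longrightarrow> f (t, x) = 0" using box_test_bound[OF a(1)] by metis
  obtain B M where B: "\<And>t x. B \<le> \<bar>t\<bar> \<or> B \<le> \<bar>x\<bar> \<Longrightarrow> g (t, x) = 0" using box_test_bound[OF a(2)] by metis
  show ?thesis unfolding box_test_def
    using a A B by (intro conjI exI[of _ "max A B"]) (auto intro!: continuous_intros simp: box_test_def)
qed

lemma box_test_uminus: "box_test f \<Longrightarrow> box_test (\<lambda>p. - f p)"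
  unfolding box_test_def by (auto intro!: continuous_intros)

lemma local_dom_integrable:
  assumes w: "local_dom w" and h: "box_test h"
  shows "integrable lborel (\<lambda>p. w p * complex_of_real (h p))"
proof -
  obtain A M where A: "0 < A" "0 \<le> M" "\<And>t x. \<bar>h (t, x)\<bar> \<le> M"
    "\<And>t x. A \<le> \<bar>t\<bar> \<or> A \<le> \<bar>x\<bar> \<Longrightarrow> h (t, x) = 0" using box_test_bound[OF h] by blast
  obtain \<gamma> where g: "integrable lborel \<gamma>" "\<And>t x. \<bar>t\<bar> \<le> A \<Longrightarrow> \<bar>x\<bar> \<le> A \<Longrightarrow> norm (w (t, x)) \<le> \<gamma> t"
    using w unfolding local_dom_def by metis
  have [measurable]: "w \<in> borel_measurable borel" "h \<in> borel_measurable borel"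
    using w box_test_measurable[OF h] by (auto simp: local_dom_def)
  have i: "integrable lborel (\<lambda>x. M * indicator {-A..A} x :: real)"
    by (rule integrable_mult_indicator_Icc)
  have "integrable (lborel \<Otimes>\<^sub>M lborel) (\<lambda>p. \<bar>\<gamma> (fst p)\<bar> * (M * indicator {-A..A} (snd p)))"
    by (intro lborel_pair.integrable_mult_pair integrable_abs g i)
  then have "integrable lborel (\<lambda>p. \<bar>\<gamma> (fst p)\<bar> * (M * indicator {-A..A} (snd p)))"
    by (simp add: lborel_prod)
  then show ?thesis
  proof (rule Bochner_Integration.integrable_bound)
    show "AE p in lborel. norm (w p * complex_of_real (h p)) \<le> norm (\<bar>\<gamma> (fst p)\<bar> * (M * indicator {-A..A} (snd p)))"
    proof (rule AE_I2, clarsimp simp: norm_mult abs_mult)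
      fix t x
      show "cmod (w (t, x)) * \<bar>h (t, x)\<bar> \<le> \<bar>\<gamma> t\<bar> * (\<bar>M\<bar> * indicator {-A..A} x)"
      proof (cases "\<bar>t\<bar> \<le> A \<and> \<bar>x\<bar> \<le> A")
        case True
        then have "cmod (w (t, x)) * \<bar>h (t, x)\<bar> \<le> \<bar>\<gamma> t\<bar> * \<bar>M\<bar>"
          using g(2)[of t x] A(2) A(3)[of t x] by (intro mult_mono) auto
        then show ?thesis using True by (auto simp: indicator_def)
      next
        case False
        then have "h (t, x) = 0" using A(4)[of t x] by auto
        then show ?thesis by simp
      qed
    qed
  qed auto
qed

lemma local_dom_continuous:
  assumes "continuous_on UNIV w" shows "local_dom w"
  unfolding local_dom_def
proof (intro conjI allI)
  show "w \<in> borel_measurable borel" using assms by (rule borel_measurable_continuous_onI)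
  fix A :: real
  have "compact ({-A..A} \<times> {-A..A})" by (intro compact_Times) auto
  then have "bounded (w ` ({-A..A} \<times> {-A..A}))"
    by (intro compact_imp_bounded compact_continuous_image continuous_on_subset[OF assms]) auto
  then obtain M where M: "\<And>p. p \<in> {-A..A} \<times> {-A..A} \<Longrightarrow> norm (w p) \<le> M"
    by (auto simp: bounded_iff)
  show "\<exists>\<gamma>. integrable lborel \<gamma> \<and> (\<forall>t x. \<bar>t\<bar> \<le> A \<longrightarrow> \<bar>x\<bar> \<le> A \<longrightarrow> norm (w (t, x)) \<le> \<gamma> t)"
    using M by (intro exI[of _ "\<lambda>t. M * indicator {-A..A} t"] conjI integrable_mult_indicator_Icc) (auto simp: indicator_def abs_le_iff)
qed

lemma local_dom_restrict:
  assumes w: "local_dom w" and S: "S \<in> sets borel"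
  shows "local_dom (\<lambda>p. indicator S p *\<^sub>R w p)"
  unfolding local_dom_def
proof (intro conjI allI)
  have [measurable]: "w \<in> borel_measurable borel" using w by (auto simp: local_dom_def)
  show "(\<lambda>p. indicator S p *\<^sub>R w p) \<in> borel_measurable borel" using S by measurable
  fix A :: real
  obtain \<gamma> where g: "integrable lborel \<gamma>" "\<And>t x. \<bar>t\<bar> \<le> A \<Longrightarrow> \<bar>x\<bar> \<le> A \<Longrightarrow> norm (w (t, x)) \<le> \<gamma> t"
    using w unfolding local_dom_def by metis
  have "norm (indicator S (t, x) *\<^sub>R w (t, x)) \<le> \<gamma> t" if "\<bar>t\<bar> \<le> A" "\<bar>x\<bar> \<le> A" for t x
    using g(2)[OF that] order_trans[OF norm_ge_zero g(2)[OF that]] by (auto simp: indicator_def)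
  then show "\<exists>\<gamma>. integrable lborel \<gamma> \<and> (\<forall>t x. \<bar>t\<bar> \<le> A \<longrightarrow> \<bar>x\<bar> \<le> A \<longrightarrow> norm (indicator S (t, x) *\<^sub>R w (t, x)) \<le> \<gamma> t)"
    using g(1) by blast
qed

lemma local_dom_add:
  assumes "local_dom v" "local_dom w" shows "local_dom (\<lambda>p. v p + w p)"
  unfolding local_dom_def
proof (intro conjI allI)
  have [measurable]: "v \<in> borel_measurable borel" "w \<in> borel_measurable borel" using assms by (auto simp: local_dom_def)
  show "(\<lambda>p. v p + w p) \<in> borel_measurable borel" by measurable
  fix A :: real
  obtain \<gamma> where g: "integrable lborel \<gamma>" "\<And>t x. \<bar>t\<bar> \<le> A \<Longrightarrow> \<bar>x\<bar> \<le> A \<Longrightarrow> norm (v (t, x)) \<le> \<gamma> t"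
    using assms unfolding local_dom_def by metis
  obtain \<gamma>' where g': "integrable lborel \<gamma>'" "\<And>t x. \<bar>t\<bar> \<le> A \<Longrightarrow> \<bar>x\<bar> \<le> A \<Longrightarrow> norm (w (t, x)) \<le> \<gamma>' t"
    using assms unfolding local_dom_def by metis
  show "\<exists>\<gamma>. integrable lborel \<gamma> \<and> (\<forall>t x. \<bar>t\<bar> \<le> A \<longrightarrow> \<bar>x\<bar> \<le> A \<longrightarrow> norm (v (t, x) + w (t, x)) \<le> \<gamma> t)"
    using g g' by (intro exI[of _ "\<lambda>t. \<gamma> t + \<gamma>' t"]) (auto intro!: norm_triangle_mono)
qed

lemma local_dom_cmult:
  assumes "local_dom w" shows "local_dom (\<lambda>p. c * w p)"
  unfolding local_dom_def
proof (intro conjI allI)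
  have [measurable]: "w \<in> borel_measurable borel" using assms by (auto simp: local_dom_def)
  show "(\<lambda>p. c * w p) \<in> borel_measurable borel" by measurable
  fix A :: real
  obtain \<gamma> where g: "integrable lborel \<gamma>" "\<And>t x. \<bar>t\<bar> \<le> A \<Longrightarrow> \<bar>x\<bar> \<le> A \<Longrightarrow> norm (w (t, x)) \<le> \<gamma> t"
    using assms unfolding local_dom_def by metis
  show "\<exists>\<gamma>. integrable lborel \<gamma> \<and> (\<forall>t x. \<bar>t\<bar> \<le> A \<longrightarrow> \<bar>x\<bar> \<le> A \<longrightarrow> norm (c * w (t, x)) \<le> \<gamma> t)"
    using g by (intro exI[of _ "\<lambda>t. norm c * \<gamma> t"]) (auto simp: norm_mult intro!: mult_left_mono)
qed

text \<open>Fubini: the majorant is a product of a function of the parameter and a function of t, so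
  over a box in x the triple integral factorises.\<close>

lemma superposition:
  fixes w :: "real \<Rightarrow> real \<times> real \<Rightarrow> complex"
  assumes meas: "(\<lambda>r. w (fst r) (snd r)) \<in> borel_measurable borel"
    and dom: "\<And>A. \<exists>\<beta> \<gamma>. integrable lborel \<beta> \<and> integrable lborel \<gamma> \<and>
      (\<forall>p t x. \<bar>t\<bar> \<le> A \<longrightarrow> \<bar>x\<bar> \<le> A \<longrightarrow> norm (w p (t, x)) \<le> \<beta> p * \<gamma> t)"
  shows "local_dom (\<lambda>q. \<integral>p. w p q \<partial>lborel)"
    and "box_test h \<Longrightarrow> (\<integral>q. (\<integral>p. w p q \<partial>lborel) * complex_of_real (h q) \<partial>lborel) =
            (\<integral>p. (\<integral>q. w p q * complex_of_real (h q) \<partial>lborel) \<partial>lborel)"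
proof -
  have m1: "(\<lambda>r. w (fst r) (snd r)) \<in> borel_measurable (lborel \<Otimes>\<^sub>M lborel)"
    using meas by (simp add: lborel_prod)
  have m2: "(\<lambda>(q, p). w p q) \<in> borel_measurable (lborel \<Otimes>\<^sub>M lborel)"
    using measurable_compose[OF measurable_pair_swap' m1] by (simp add: case_prod_beta' comp_def)
  have sec: "(\<lambda>p. w p q) \<in> borel_measurable lborel" for q
    using measurable_compose[OF _ m1, of "\<lambda>p. (p, q)" lborel] by simp
  show "local_dom (\<lambda>q. \<integral>p. w p q \<partial>lborel)"
    unfolding local_dom_def
  proof (intro conjI allI)
    have "(\<lambda>q. \<integral>p. w p q \<partial>lborel) \<in> borel_measurable lborel"
      by (rule lborel.borel_measurable_lebesgue_integral[OF m2])
    then show "(\<lambda>q. \<integral>p. w p q \<partial>lborel) \<in> borel_measurable borel" by simp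
    fix A :: real
    obtain \<beta> \<gamma> where g: "integrable lborel \<beta>" "integrable lborel \<gamma>"
      "\<And>p t x. \<bar>t\<bar> \<le> A \<Longrightarrow> \<bar>x\<bar> \<le> A \<Longrightarrow> norm (w p (t, x)) \<le> \<beta> p * \<gamma> t"
      using dom[of A] by metis
    have "norm (\<integral>p. w p (t, x) \<partial>lborel) \<le> (\<integral>p. \<beta> p \<partial>lborel) * \<gamma> t" if "\<bar>t\<bar> \<le> A" "\<bar>x\<bar> \<le> A" for t x
    proof -
      have i: "integrable lborel (\<lambda>p. \<beta> p * \<gamma> t)" using g(1) by auto
      have "norm (\<integral>p. w p (t, x) \<partial>lborel) \<le> (\<integral>p. \<beta> p * \<gamma> t \<partial>lborel)"
      proof (rule Bochner_Integration.integral_norm_bound_integral[OF Bochner_Integration.integrable_bound[OF i] i])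
        show "(\<lambda>p. w p (t, x)) \<in> borel_measurable lborel" by (rule sec)
        have "norm (w p (t, x)) \<le> \<beta> p * \<gamma> t" for p by (rule g(3)[OF that])
        then show "AE p in lborel. norm (w p (t, x)) \<le> norm (\<beta> p * \<gamma> t)"
          by (intro AE_I2) (metis abs_ge_self order_trans real_norm_def)
        show "norm (w p (t, x)) \<le> \<beta> p * \<gamma> t" for p by (rule g(3)[OF that])
      qed
      then show ?thesis by simp
    qed
    then show "\<exists>\<gamma>. integrable lborel \<gamma> \<and> (\<forall>t x. \<bar>t\<bar> \<le> A \<longrightarrow> \<bar>x\<bar> \<le> A \<longrightarrow> norm (\<integral>p. w p (t, x) \<partial>lborel) \<le> \<gamma> t)"
      using g(2) by (intro exI[of _ "\<lambda>t. (\<integral>p. \<beta> p \<partial>lborel) * \<gamma> t"]) auto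
  qed
  assume h: "box_test h"
  obtain A M where A: "0 < A" "0 \<le> M" "\<And>t x. \<bar>h (t, x)\<bar> \<le> M"
    "\<And>t x. A \<le> \<bar>t\<bar> \<or> A \<le> \<bar>x\<bar> \<Longrightarrow> h (t, x) = 0" using box_test_bound[OF h] by blast
  obtain \<beta> \<gamma> where g: "integrable lborel \<beta>" "integrable lborel \<gamma>"
      "\<And>p t x. \<bar>t\<bar> \<le> A \<Longrightarrow> \<bar>x\<bar> \<le> A \<Longrightarrow> norm (w p (t, x)) \<le> \<beta> p * \<gamma> t"
      using dom[of A] by metis
  have mh[measurable]: "h \<in> borel_measurable borel" using box_test_measurable[OF h] .
  have i: "integrable lborel (\<lambda>x. M * indicator {-A..A} x :: real)"
    by (rule integrable_mult_indicator_Icc)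
  have "integrable (lborel \<Otimes>\<^sub>M lborel) (\<lambda>p. \<bar>\<gamma> (fst p)\<bar> * (M * indicator {-A..A} (snd p)))"
    by (intro lborel_pair.integrable_mult_pair integrable_abs g i)
  then have "integrable lborel (\<lambda>p. \<bar>\<gamma> (fst p)\<bar> * (M * indicator {-A..A} (snd p)))"
    by (simp add: lborel_prod)
  then have dominating: "integrable (lborel \<Otimes>\<^sub>M lborel) (\<lambda>r. \<bar>\<beta> (fst r)\<bar> * (\<bar>\<gamma> (fst (snd r))\<bar> * (M * indicator {-A..A} (snd (snd r)))))"
    by (rule lborel_pair.integrable_mult_pair[OF integrable_abs[OF g(1)]])
  have "integrable (lborel \<Otimes>\<^sub>M lborel) (\<lambda>(p, q). w p q * complex_of_real (h q))"
  proof (rule Bochner_Integration.integrable_bound[OF dominating])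
    show "(\<lambda>(p, q). w p q * complex_of_real (h q)) \<in> borel_measurable (lborel \<Otimes>\<^sub>M lborel)"
      using m1 by (simp add: case_prod_beta')
    show "AE r in lborel \<Otimes>\<^sub>M lborel. norm (case r of (p, q) \<Rightarrow> w p q * complex_of_real (h q)) \<le>
      norm (\<bar>\<beta> (fst r)\<bar> * (\<bar>\<gamma> (fst (snd r))\<bar> * (M * indicator {-A..A} (snd (snd r)))))"
    proof (rule AE_I2, clarsimp simp: norm_mult abs_mult)
      fix p t x
      show "cmod (w p (t, x)) * \<bar>h (t, x)\<bar> \<le> \<bar>\<beta> p\<bar> * (\<bar>\<gamma> t\<bar> * (\<bar>M\<bar> * indicator {-A..A} x))"
      proof (cases "\<bar>t\<bar> \<le> A \<and> \<bar>x\<bar> \<le> A")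
        case True
        then have "cmod (w p (t, x)) * \<bar>h (t, x)\<bar> \<le> \<bar>\<beta> p * \<gamma> t\<bar> * \<bar>M\<bar>"
          using g(3)[of t x p] A(2) A(3)[of t x] by (intro mult_mono) auto
        then show ?thesis using True by (auto simp: indicator_def abs_mult mult_ac)
      next
        case False
        then have "h (t, x) = 0" using A(4)[of t x] by auto
        then show ?thesis by simp
      qed
    qed
  qed
  from lborel_pair.Fubini_integral[OF this]
  have "(\<integral>q. (\<integral>p. w p q * complex_of_real (h q) \<partial>lborel) \<partial>lborel) =
     (\<integral>p. (\<integral>q. w p q * complex_of_real (h q) \<partial>lborel) \<partial>lborel)" by simp
  then show "(\<integral>q. (\<integral>p. w p q \<partial>lborel) * complex_of_real (h q) \<partial>lborel) =
            (\<integral>p. (\<integral>q. w p q * complex_of_real (h q) \<partial>lborel) \<partial>lborel)" by simp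
qed

section \<open>The weak equation and plane waves\<close>

text \<open>\<open>F j\<close> plays the part of the j-th x-derivative of \<open>F 0\<close>, and
  \<open>Ft\<close> that of its t-derivative. Carrying the derivatives along, instead of applying
  \<open>deriv\<close>, turns translation and reflection of test functions into plain
  substitutions.\<close>

definition test_family :: "(nat \<Rightarrow> real \<times> real \<Rightarrow> real) \<Rightarrow> (real \<times> real \<Rightarrow> real) \<Rightarrow> bool" where
  "test_family F Ft \<longleftrightarrow> (\<forall>j. box_test (F j)) \<and> box_test Ft \<and>
     (\<forall>j t x. ((\<lambda>y. F j (t, y)) has_real_derivative F (Suc j) (t, x)) (at x)) \<and>
     (\<forall>t x. ((\<lambda>s. F 0 (s, x)) has_real_derivative Ft (t, x)) (at t))"

text \<open>The formal transpose of P applied to \<open>F 0\<close>. A distributional identity P w =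
  f thus reads: w paired with \<open>adj F Ft\<close> equals f paired with
  \<open>F 0\<close>.\<close>

definition adj :: "(nat \<Rightarrow> real \<times> real \<Rightarrow> real) \<Rightarrow> (real \<times> real \<Rightarrow> real) \<Rightarrow> real \<times> real \<Rightarrow> real" where
  "adj F Ft p = - Ft p - F 1 p - F 3 p + F 5 p"

lemma test_familyD:
  assumes "test_family F Ft"
  shows "box_test (F j)" "box_test Ft"
    "((\<lambda>y. F j (t, y)) has_real_derivative F (Suc j) (t, x)) (at x)"
    "((\<lambda>s. F 0 (s, x)) has_real_derivative Ft (t, x)) (at t)"
  using assms by (auto simp: test_family_def)

lemma box_test_adj: "test_family F Ft \<Longrightarrow> box_test (adj F Ft)"
proof -
  assume "test_family F Ft"
  note T = test_familyD[OF this]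
  have "box_test (\<lambda>p. (- Ft p) + ((- F 1 p) + ((- F 3 p) + F 5 p)))"
    by (intro box_test_add box_test_uminus T)
  also have "(\<lambda>p. (- Ft p) + ((- F 1 p) + ((- F 3 p) + F 5 p))) = adj F Ft" by (auto simp: adj_def fun_eq_iff)
  finally show ?thesis .
qed

section \<open>Slices of test functions and integration by parts against exponentials\<close>

lemma box_test_section_x:
  assumes "box_test h"
  shows "continuous_on UNIV (\<lambda>x. h (t, x))" "\<exists>A. \<forall>x. A \<le> \<bar>x\<bar> \<longrightarrow> h (t, x) = 0"
    using box_test_cont[OF assms] box_test_bound[OF assms]
    by (auto intro!: continuous_intros continuous_on_compose2[of UNIV h]) metis

lemma box_test_section_t:
  assumes "box_test h"
  shows "continuous_on UNIV (\<lambda>t. h (t, x))" "\<exists>A. \<forall>t. A \<le> \<bar>t\<bar> \<longrightarrow> h (t, x) = 0"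
    using box_test_cont[OF assms] box_test_bound[OF assms]
    by (auto intro!: continuous_intros continuous_on_compose2[of UNIV h]) metis

lemma integral_exp_parts:
  fixes f f' :: "real \<Rightarrow> complex" and c :: complex
  assumes d: "\<And>x. (f has_vector_derivative f' x) (at x)" and cf: "continuous_on UNIV f" "continuous_on UNIV f'"
    and z: "\<exists>A. \<forall>x. A \<le> \<bar>x\<bar> \<longrightarrow> f x = 0" "\<exists>A. \<forall>x. A \<le> \<bar>x\<bar> \<longrightarrow> f' x = 0"
  shows "(\<integral>x. exp (c * of_real x) * f' x \<partial>lborel) = - c * (\<integral>x. exp (c * of_real x) * f x \<partial>lborel)"
    and "(\<integral>x. indicator {..<a} x *\<^sub>R (exp (c * of_real x) * f' x) \<partial>lborel) =
       exp (c * of_real a) * f a - c * (\<integral>x. indicator {..<a} x *\<^sub>R (exp (c * of_real x) * f x) \<partial>lborel)"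
proof -
  obtain A B where A: "\<And>x. A \<le> \<bar>x\<bar> \<Longrightarrow> f x = 0" "\<And>x. B \<le> \<bar>x\<bar> \<Longrightarrow> f' x = 0" using z by auto
  define g where "g x = exp (c * of_real x) * f x" for x :: real
  define g' where "g' x = exp (c * of_real x) * f' x + c * (exp (c * of_real x) * f x)" for x :: real
  have e: "((\<lambda>x::real. exp (c * of_real x)) has_vector_derivative c * exp (c * of_real x)) (at x)" for x
    by (rule has_vector_derivative_real_field) (auto intro!: derivative_eq_intros)
  have dg: "(g has_vector_derivative g' x) (at x)" for x
    unfolding g_def g'_def by (rule derivative_eq_intros e d refl)+ (simp add: algebra_simps)
  have cg: "continuous_on UNIV g'" unfolding g'_def by (intro continuous_intros cf)
  have zg: "max A B \<le> \<bar>x\<bar> \<Longrightarrow> g x = 0" "max A B \<le> \<bar>x\<bar> \<Longrightarrow> g' x = 0" for x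
    using A by (auto simp: g_def g'_def)
  note I = integral_deriv_bounded_support[of g g' "max A B", OF dg cg zg]
  have i1: "integrable lborel (\<lambda>x. exp (c * of_real x) * f' x)"
    by (rule integrable_continuous_bounded_support[of _ B]) (use A in \<open>auto intro!: continuous_intros cf\<close>)
  have i2: "integrable lborel (\<lambda>x. exp (c * of_real x) * f x)"
    by (rule integrable_continuous_bounded_support[of _ A]) (use A in \<open>auto intro!: continuous_intros cf\<close>)
  have j1: "integrable lborel (\<lambda>x. indicator {..<a} x *\<^sub>R (exp (c * of_real x) * f' x))"
    by (rule integrable_mult_indicator[OF _ i1]) auto
  have j2: "integrable lborel (\<lambda>x. indicator {..<a} x *\<^sub>R (exp (c * of_real x) * f x))"
    by (rule integrable_mult_indicator[OF _ i2]) auto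
  show "(\<integral>x. exp (c * of_real x) * f' x \<partial>lborel) = - c * (\<integral>x. exp (c * of_real x) * f x \<partial>lborel)"
    using I(1) i1 i2 unfolding g'_def by (simp add: eq_neg_iff_add_eq_0)
  have "(\<integral>x. indicator {..<a} x *\<^sub>R g' x \<partial>lborel) = 
    (\<integral>x. indicator {..<a} x *\<^sub>R (exp (c * of_real x) * f' x) + c * (indicator {..<a} x *\<^sub>R (exp (c * of_real x) * f x)) \<partial>lborel)"
    unfolding g'_def by (intro Bochner_Integration.integral_cong) (auto simp: algebra_simps)
  also have "\<dots> = (\<integral>x. indicator {..<a} x *\<^sub>R (exp (c * of_real x) * f' x) \<partial>lborel) + c * (\<integral>x. indicator {..<a} x *\<^sub>R (exp (c * of_real x) * f x) \<partial>lborel)"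
    by (subst Bochner_Integration.integral_add[OF j1 integrable_mult_right[OF j2]]) (simp only: integral_mult_right_zero)
  finally show "(\<integral>x. indicator {..<a} x *\<^sub>R (exp (c * of_real x) * f' x) \<partial>lborel) =
       exp (c * of_real a) * f a - c * (\<integral>x. indicator {..<a} x *\<^sub>R (exp (c * of_real x) * f x) \<partial>lborel)"
    using I(3)[of a] by (simp add: g_def algebra_simps)
qed

lemma has_vector_derivative_of_real_complex:
  "(f has_real_derivative D) (at x) \<Longrightarrow> ((\<lambda>x. complex_of_real (f x)) has_vector_derivative complex_of_real D) (at x)"
  by (rule has_vector_derivative_of_real) (simp add: has_real_derivative_iff_has_vector_derivative)

definition omega :: "complex \<Rightarrow> complex" where "omega z = z ^ 5 + z ^ 3 - z"

definition plane_wave :: "complex \<Rightarrow> real \<times> real \<Rightarrow> complex" where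
  "plane_wave z p = exp (\<i> * omega z * of_real (fst p)) * exp (\<i> * z * of_real (snd p))"

lemma continuous_plane_wave: "continuous_on UNIV (plane_wave z)"
  unfolding plane_wave_def by (intro continuous_intros)

lemma integral_lborel_pair_iterated:
  fixes f :: "real \<times> real \<Rightarrow> complex"
  assumes "integrable lborel f"
  shows "(\<integral>p. f p \<partial>lborel) = (\<integral>t. (\<integral>x. f (t, x) \<partial>lborel) \<partial>lborel)"
    and "(\<integral>p. f p \<partial>lborel) = (\<integral>x. (\<integral>t. f (t, x) \<partial>lborel) \<partial>lborel)"
    and "integrable lborel (\<lambda>t. \<integral>x. f (t, x) \<partial>lborel)" "integrable lborel (\<lambda>x. \<integral>t. f (t, x) \<partial>lborel)"
proof -
  have i: "integrable (lborel \<Otimes>\<^sub>M lborel) (case_prod (\<lambda>t x. f (t, x)))" using assms by (simp add: lborel_prod)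
  show "(\<integral>p. f p \<partial>lborel) = (\<integral>t. (\<integral>x. f (t, x) \<partial>lborel) \<partial>lborel)"
    using lborel_pair.integral_fst[OF i] by (simp add: lborel_prod)
  show "(\<integral>p. f p \<partial>lborel) = (\<integral>x. (\<integral>t. f (t, x) \<partial>lborel) \<partial>lborel)"
    using lborel_pair.integral_snd[OF i] by (simp add: lborel_prod)
  show "integrable lborel (\<lambda>t. \<integral>x. f (t, x) \<partial>lborel)" "integrable lborel (\<lambda>x. \<integral>t. f (t, x) \<partial>lborel)"
    using lborel_pair.integrable_fst[OF i] lborel_pair.integrable_snd[OF i] by auto
qed

lemma plane_wave_x_parts:
  assumes T: "test_family F Ft"
  shows "(\<integral>x. plane_wave z (t, x) * complex_of_real (F j (t, x)) \<partial>lborel) =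
    (- (\<i> * z)) ^ j * (\<integral>x. plane_wave z (t, x) * complex_of_real (F 0 (t, x)) \<partial>lborel)"
proof (induction j)
  case (Suc j)
  note T = test_familyD[OF T]
  have "(\<integral>x. exp ((\<i> * z) * of_real x) * complex_of_real (F (Suc j) (t, x)) \<partial>lborel) =
    - (\<i> * z) * (\<integral>x. exp ((\<i> * z) * of_real x) * complex_of_real (F j (t, x)) \<partial>lborel)"
    by (rule integral_exp_parts(1))
       (use box_test_section_x[OF T(1)] in \<open>auto intro!: has_vector_derivative_of_real_complex T(3) continuous_intros\<close>)
  then have "(\<integral>x. plane_wave z (t, x) * complex_of_real (F (Suc j) (t, x)) \<partial>lborel) =
    - (\<i> * z) * (\<integral>x. plane_wave z (t, x) * complex_of_real (F j (t, x)) \<partial>lborel)"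
    by (simp add: plane_wave_def mult.assoc)
  then show ?case using Suc by simp
qed simp

text \<open>Integration by parts in x produces - i \<open>omega z\<close> times the pairing with
  \<open>F 0\<close>, integration in t produces + i \<open>omega z\<close> times the same pairing.
  They cancel, and only the boundary value at the cut t = a is left.\<close>

lemma plane_wave_weak:
  assumes T: "test_family F Ft"
  shows "(\<integral>p. (indicator ({..<a} \<times> UNIV) p *\<^sub>R plane_wave z p) * complex_of_real (adj F Ft p) \<partial>lborel) =
    - (\<integral>x. plane_wave z (a, x) * complex_of_real (F 0 (a, x)) \<partial>lborel)"
proof -
  note T' = test_familyD[OF T]
  let ?S = "{..<a} \<times> (UNIV :: real set)"
  let ?w = "\<lambda>p. indicator ?S p *\<^sub>R plane_wave z p"
  have S: "?S \<in> sets borel" by (intro borel_open open_Times) auto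
  have ld: "local_dom ?w" by (intro local_dom_restrict local_dom_continuous continuous_plane_wave S)
  have int: "box_test h \<Longrightarrow> integrable lborel (\<lambda>p. ?w p * complex_of_real (h p))" for h
    by (rule local_dom_integrable[OF ld])
  have ind: "indicator ?S (t, x) = (indicator {..<a} t :: real)" for t x by (auto simp: indicator_def)
  have ad: "adj F Ft = (\<lambda>p. (- Ft p) + ((- F 1 p) + ((- F 3 p) + F 5 p)))" by (auto simp: adj_def fun_eq_iff)
  have b: "box_test (\<lambda>p. - Ft p)" "box_test (\<lambda>p. (- F 1 p) + ((- F 3 p) + F 5 p))"
    by (intro box_test_add box_test_uminus T')+
  let ?I0 = "\<integral>p. ?w p * complex_of_real (F 0 p) \<partial>lborel"
  have 1: "(\<integral>p. ?w p * complex_of_real ((- F 1 p) + ((- F 3 p) + F 5 p)) \<partial>lborel) = - (\<i> * omega z) * ?I0"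
  proof -
    have sec: "integrable lborel (\<lambda>x. plane_wave z (t, x) * complex_of_real (F j (t, x)))" for t j
      using box_test_section_x[OF T'(1)[of j], of t]
      by (auto intro!: integrable_continuous_bounded_support continuous_intros simp: plane_wave_def)
    have "(\<integral>p. ?w p * complex_of_real ((- F 1 p) + ((- F 3 p) + F 5 p)) \<partial>lborel) =
      (\<integral>t. indicator {..<a} t *\<^sub>R (\<integral>x. plane_wave z (t, x) * complex_of_real ((- F 1 (t, x)) + ((- F 3 (t, x)) + F 5 (t, x))) \<partial>lborel) \<partial>lborel)"
      by (subst integral_lborel_pair_iterated(1)[OF int[OF b(2)]]) (simp only: ind mult_scaleR_left integral_scaleR_right)
    also have "(\<lambda>t. (\<integral>x. plane_wave z (t, x) * complex_of_real ((- F 1 (t, x)) + ((- F 3 (t, x)) + F 5 (t, x))) \<partial>lborel)) =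
      (\<lambda>t. - (\<i> * omega z) * (\<integral>x. plane_wave z (t, x) * complex_of_real (F 0 (t, x)) \<partial>lborel))"
    proof
      fix t
      have "(\<integral>x. plane_wave z (t, x) * complex_of_real ((- F 1 (t, x)) + ((- F 3 (t, x)) + F 5 (t, x))) \<partial>lborel) =
         (\<integral>x. - (plane_wave z (t, x) * complex_of_real (F 1 (t, x))) + (- (plane_wave z (t, x) * complex_of_real (F 3 (t, x))) + plane_wave z (t, x) * complex_of_real (F 5 (t, x))) \<partial>lborel)"
        by (intro Bochner_Integration.integral_cong) (auto simp: algebra_simps)
      also have "\<dots> = - (\<integral>x. plane_wave z (t, x) * complex_of_real (F 1 (t, x)) \<partial>lborel) + (- (\<integral>x. plane_wave z (t, x) * complex_of_real (F 3 (t, x)) \<partial>lborel) + (\<integral>x. plane_wave z (t, x) * complex_of_real (F 5 (t, x)) \<partial>lborel))"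
        using sec by simp
      also have "\<dots> = - (\<i> * omega z) * (\<integral>x. plane_wave z (t, x) * complex_of_real (F 0 (t, x)) \<partial>lborel)"
        by (subst (1 2 3) plane_wave_x_parts[OF T])
           (simp add: omega_def algebra_simps power_mult_distrib power_numeral_reduce)
      finally show "(\<integral>x. plane_wave z (t, x) * complex_of_real ((- F 1 (t, x)) + ((- F 3 (t, x)) + F 5 (t, x))) \<partial>lborel) =
         - (\<i> * omega z) * (\<integral>x. plane_wave z (t, x) * complex_of_real (F 0 (t, x)) \<partial>lborel)" .
    qed
    also have "(\<integral>t. indicator {..<a} t *\<^sub>R (- (\<i> * omega z) * (\<integral>x. plane_wave z (t, x) * complex_of_real (F 0 (t, x)) \<partial>lborel)) \<partial>lborel) = 
      - (\<i> * omega z) * (\<integral>t. indicator {..<a} t *\<^sub>R (\<integral>x. plane_wave z (t, x) * complex_of_real (F 0 (t, x)) \<partial>lborel) \<partial>lborel)"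
      by (simp only: mult_scaleR_right[symmetric] integral_mult_right_zero)
    also have "(\<integral>t. indicator {..<a} t *\<^sub>R (\<integral>x. plane_wave z (t, x) * complex_of_real (F 0 (t, x)) \<partial>lborel) \<partial>lborel) = ?I0"
      by (subst integral_lborel_pair_iterated(1)[OF int[OF T'(1)]]) (simp only: ind mult_scaleR_left integral_scaleR_right)
    finally show ?thesis .
  qed
  have 2: "(\<integral>p. ?w p * complex_of_real (- Ft p) \<partial>lborel) = \<i> * omega z * ?I0 - (\<integral>x. plane_wave z (a, x) * complex_of_real (F 0 (a, x)) \<partial>lborel)"
  proof -
    have ix: "integrable lborel (\<lambda>x. plane_wave z (a, x) * complex_of_real (F 0 (a, x)))"
      using box_test_section_x[OF T'(1)[of 0], of a]
      by (auto intro!: integrable_continuous_bounded_support continuous_intros simp: plane_wave_def)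
    have tpart: "(\<integral>t. ?w (t, x) * complex_of_real (- Ft (t, x)) \<partial>lborel) =
      \<i> * omega z * (\<integral>t. ?w (t, x) * complex_of_real (F 0 (t, x)) \<partial>lborel) - plane_wave z (a, x) * complex_of_real (F 0 (a, x))" for x
    proof -
      have alg: "A1 = c * A0 - (ea * ex) * f" if "I1 = ea * f - c * I0" "A1 = - ex * I1" "A0 = ex * I0" for A1 A0 I1 I0 ea ex f c :: complex
        unfolding that by (simp add: algebra_simps)
      have 1: "(\<integral>t. indicator {..<a} t *\<^sub>R (exp ((\<i> * omega z) * of_real t) * complex_of_real (Ft (t, x))) \<partial>lborel) =
       exp ((\<i> * omega z) * of_real a) * complex_of_real (F 0 (a, x)) - (\<i> * omega z) * (\<integral>t. indicator {..<a} t *\<^sub>R (exp ((\<i> * omega z) * of_real t) * complex_of_real (F 0 (t, x))) \<partial>lborel)"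
        by (rule integral_exp_parts(2))
         (use box_test_section_t[OF T'(1)] box_test_section_t[OF T'(2)] in \<open>auto intro!: has_vector_derivative_of_real_complex T' continuous_intros\<close>)
      have 2: "(\<integral>t. ?w (t, x) * complex_of_real (- Ft (t, x)) \<partial>lborel) = 
        - exp (\<i> * z * of_real x) * (\<integral>t. indicator {..<a} t *\<^sub>R (exp ((\<i> * omega z) * of_real t) * complex_of_real (Ft (t, x))) \<partial>lborel)"
        by (subst integral_mult_right_zero[symmetric], intro Bochner_Integration.integral_cong) (auto simp: ind plane_wave_def)
      have 3: "(\<integral>t. ?w (t, x) * complex_of_real (F 0 (t, x)) \<partial>lborel) = 
        exp (\<i> * z * of_real x) * (\<integral>t. indicator {..<a} t *\<^sub>R (exp ((\<i> * omega z) * of_real t) * complex_of_real (F 0 (t, x))) \<partial>lborel)"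
        by (subst integral_mult_right_zero[symmetric], intro Bochner_Integration.integral_cong) (auto simp: ind plane_wave_def)
      have "plane_wave z (a, x) = exp ((\<i> * omega z) * of_real a) * exp (\<i> * z * of_real x)" by (simp add: plane_wave_def)
      then show ?thesis using alg[OF 1 2 3] by (simp only:)
    qed
    have "(\<integral>p. ?w p * complex_of_real (- Ft p) \<partial>lborel) = (\<integral>x. \<i> * omega z * (\<integral>t. ?w (t, x) * complex_of_real (F 0 (t, x)) \<partial>lborel) - plane_wave z (a, x) * complex_of_real (F 0 (a, x)) \<partial>lborel)"
      by (subst integral_lborel_pair_iterated(2)[OF int[OF b(1)]]) (simp only: tpart)
    also have "\<dots> = (\<integral>x. \<i> * omega z * (\<integral>t. ?w (t, x) * complex_of_real (F 0 (t, x)) \<partial>lborel) \<partial>lborel) - (\<integral>x. plane_wave z (a, x) * complex_of_real (F 0 (a, x)) \<partial>lborel)"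
      by (intro Bochner_Integration.integral_diff integrable_mult_right integral_lborel_pair_iterated(4) int T' ix)
    also have "(\<integral>x. \<i> * omega z * (\<integral>t. ?w (t, x) * complex_of_real (F 0 (t, x)) \<partial>lborel) \<partial>lborel) = \<i> * omega z * ?I0"
      by (subst integral_lborel_pair_iterated(2)[OF int[OF T'(1)]]) simp
    finally show ?thesis .
  qed
  have "(\<integral>p. ?w p * complex_of_real (adj F Ft p) \<partial>lborel) = 
    (\<integral>p. ?w p * complex_of_real (- Ft p) + ?w p * complex_of_real ((- F 1 p) + ((- F 3 p) + F 5 p)) \<partial>lborel)"
    unfolding ad by (intro Bochner_Integration.integral_cong) (auto simp: algebra_simps)
  also have "\<dots> = (\<integral>p. ?w p * complex_of_real (- Ft p) \<partial>lborel) + (\<integral>p. ?w p * complex_of_real ((- F 1 p) + ((- F 3 p) + F 5 p)) \<partial>lborel)"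
    by (intro Bochner_Integration.integral_add int b)
  finally show ?thesis unfolding 1 2 by simp
qed

section \<open>Fourier transforms of test functions\<close>

lemma integrable_inverse_1_plus_square': "integrable lborel (\<lambda>x::real. inverse (1 + x\<^sup>2))"
  using integrable_inverse_1_plus_square by (simp add: set_integrable_def einterval_def)

lemma std_normal_density_eq: "std_normal_density x = exp (- x\<^sup>2 / 2) / sqrt (2 * pi)"
  by (simp add: normal_density_def)

lemma integrable_std_normal_density: "integrable lborel std_normal_density"
  by (rule integrable_normal_density) simp

lemma std_normal_char:
  "(\<integral>x. exp (\<i> * of_real (t * x)) * complex_of_real (std_normal_density x) \<partial>lborel) = complex_of_real (exp (- t\<^sup>2 / 2))"
proof -
  have "complex_of_real (exp (- t\<^sup>2 / 2)) = char std_normal_distribution t" by (simp add: char_std_normal_distribution)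
  also have "\<dots> = (\<integral>x. std_normal_density x *\<^sub>R exp (\<i> * of_real (t * x)) \<partial>lborel)"
    unfolding char_def by (subst integral_density) auto
  finally show ?thesis by (simp add: scaleR_conv_of_real mult.commute)
qed

text \<open>The transform is damped by exp(- (\<delta> \<xi>)^2 / 2), the integrals are exchanged,
  and the explicit transform of the Gaussian turns the left side into an average of f over width
  \<delta>; then \<delta> tends to 0. Two derivatives of f make its transform O(1 / (1 + \<xi>^2)),
  so that dominated convergence removes the damping.\<close>

lemma fourier_inversion_at_0:
  fixes f f' f'' :: "real \<Rightarrow> complex"
  assumes d: "\<And>x. (f has_vector_derivative f' x) (at x)" "\<And>x. (f' has_vector_derivative f'' x) (at x)"
    and c: "continuous_on UNIV f''"
    and z: "\<And>x. A \<le> \<bar>x\<bar> \<Longrightarrow> f x = 0" "\<And>x. A \<le> \<bar>x\<bar> \<Longrightarrow> f' x = 0" "\<And>x. A \<le> \<bar>x\<bar> \<Longrightarrow> f'' x = 0"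
  shows "(\<integral>\<xi>. (\<integral>x. exp (\<i> * of_real \<xi> * of_real x) * f x \<partial>lborel) \<partial>lborel) = 2 * pi * f 0"
proof -
  have cf: "continuous_on UNIV f" "continuous_on UNIV f'"
    using d by (auto intro!: continuous_at_imp_continuous_on has_vector_derivative_continuous)
  have [measurable]: "f \<in> borel_measurable borel" using cf by (auto intro: borel_measurable_continuous_onI)
  define fh where "fh \<xi> = (\<integral>x. exp (\<i> * of_real \<xi> * of_real x) * f x \<partial>lborel)" for \<xi> :: real
  have mfh[measurable]: "fh \<in> borel_measurable borel" unfolding fh_def by measurable
  have i0: "integrable lborel f" "integrable lborel f''"
    by (rule integrable_continuous_bounded_support[OF _ z(1)] integrable_continuous_bounded_support[OF _ z(3)], (rule cf c), assumption)+
  define M where "M = (\<integral>x. norm (f x) \<partial>lborel) + (\<integral>x. norm (f'' x) \<partial>lborel)"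
  have bound: "norm (fh \<xi>) \<le> M * inverse (1 + \<xi>\<^sup>2)" for \<xi>
  proof -
    have "(\<integral>x. exp (\<i> * of_real \<xi> * of_real x) * f'' x \<partial>lborel) = - (\<i> * of_real \<xi>) * (\<integral>x. exp (\<i> * of_real \<xi> * of_real x) * f' x \<partial>lborel)"
      by (rule integral_exp_parts(1)[OF d(2) cf(2) c]) (use z in blast)+
    also have "(\<integral>x. exp (\<i> * of_real \<xi> * of_real x) * f' x \<partial>lborel) = - (\<i> * of_real \<xi>) * fh \<xi>"
      unfolding fh_def by (rule integral_exp_parts(1)[OF d(1) cf]) (use z in blast)+
    finally have "norm (\<integral>x. exp (\<i> * of_real \<xi> * of_real x) * f'' x \<partial>lborel) = \<xi>\<^sup>2 * norm (fh \<xi>)"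
      by (simp add: norm_mult power2_eq_square)
    moreover have "norm (\<integral>x. exp (\<i> * of_real \<xi> * of_real x) * f'' x \<partial>lborel) \<le> (\<integral>x. norm (f'' x) \<partial>lborel)"
      by (rule order_trans[OF integral_norm_bound]) (simp add: norm_mult)
    moreover have "norm (fh \<xi>) \<le> (\<integral>x. norm (f x) \<partial>lborel)"
      unfolding fh_def by (rule order_trans[OF integral_norm_bound]) (simp add: norm_mult)
    ultimately have "(1 + \<xi>\<^sup>2) * norm (fh \<xi>) \<le> M" by (simp add: M_def algebra_simps)
    moreover have "0 < 1 + \<xi>\<^sup>2" by (simp add: add_pos_nonneg)
    ultimately show ?thesis by (simp add: field_simps)
  qed
  have idom: "integrable lborel (\<lambda>\<xi>. M * inverse (1 + \<xi>\<^sup>2))"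
    by (intro integrable_mult_right integrable_inverse_1_plus_square')
  define \<delta> where "\<delta> n = inverse (real (Suc n))" for n
  have \<delta>pos: "\<delta> n > 0" for n by (simp add: \<delta>_def)
  have \<delta>0: "\<delta> \<longlonglongrightarrow> 0" unfolding \<delta>_def by (rule LIMSEQ_inverse_real_of_nat)
  have L1: "(\<lambda>n. \<integral>\<xi>. fh \<xi> * of_real (exp (- (\<delta> n * \<xi>)\<^sup>2 / 2)) \<partial>lborel) \<longlonglongrightarrow> (\<integral>\<xi>. fh \<xi> \<partial>lborel)"
  proof (rule integral_dominated_convergence[OF _ _ idom])
    show "AE \<xi> in lborel. (\<lambda>n. fh \<xi> * of_real (exp (- (\<delta> n * \<xi>)\<^sup>2 / 2))) \<longlonglongrightarrow> fh \<xi>"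
    proof (rule AE_I2)
      fix \<xi> :: real
      have "(\<lambda>n. fh \<xi> * of_real (exp (- (\<delta> n * \<xi>)\<^sup>2 / 2))) \<longlonglongrightarrow> fh \<xi> * of_real (exp (- (0 * \<xi>)\<^sup>2 / 2))"
        by (intro tendsto_intros \<delta>0) simp
      then show "(\<lambda>n. fh \<xi> * of_real (exp (- (\<delta> n * \<xi>)\<^sup>2 / 2))) \<longlonglongrightarrow> fh \<xi>" by simp
    qed
    show "AE \<xi> in lborel. norm (fh \<xi> * of_real (exp (- (\<delta> n * \<xi>)\<^sup>2 / 2))) \<le> M * inverse (1 + \<xi>\<^sup>2)" for n
    proof (rule AE_I2)
      fix \<xi> :: real
      have "norm (fh \<xi> * of_real (exp (- (\<delta> n * \<xi>)\<^sup>2 / 2))) \<le> norm (fh \<xi>) * 1"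
        unfolding norm_mult by (intro mult_left_mono) auto
      then show "norm (fh \<xi> * of_real (exp (- (\<delta> n * \<xi>)\<^sup>2 / 2))) \<le> M * inverse (1 + \<xi>\<^sup>2)" using bound[of \<xi>] by simp
    qed
  qed auto
  obtain K where K: "\<And>x. norm (f x) \<le> K"
  proof -
    have "bounded (f ` {-\<bar>A\<bar>..\<bar>A\<bar>})"
      by (intro compact_imp_bounded compact_continuous_image continuous_on_subset[OF cf(1)]) auto
    then obtain K where K: "\<forall>x\<in>{-\<bar>A\<bar>..\<bar>A\<bar>}. norm (f x) \<le> K" by (auto simp: bounded_iff)
    have "x \<in> {-\<bar>A\<bar>..\<bar>A\<bar>}" if "\<not> A \<le> \<bar>x\<bar>" for x using that by auto
    then have "norm (f x) \<le> max K 0" for x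
      using K z(1)[of x] by (cases "A \<le> \<bar>x\<bar>") (auto simp: le_max_iff_disj)
    then show thesis using that by blast
  qed
  have L2: "(\<lambda>n. \<integral>y. f (\<delta> n * y) * of_real (std_normal_density y) \<partial>lborel) \<longlonglongrightarrow> (\<integral>y. f 0 * of_real (std_normal_density y) \<partial>lborel)"
  proof (rule integral_dominated_convergence[where w="\<lambda>y. K * std_normal_density y"])
    show "integrable lborel (\<lambda>y. K * std_normal_density y)" by (intro integrable_mult_right integrable_std_normal_density)
    show "AE y in lborel. (\<lambda>n. f (\<delta> n * y) * of_real (std_normal_density y)) \<longlonglongrightarrow> f 0 * of_real (std_normal_density y)"
    proof (rule AE_I2)
      fix y :: real
      have "(\<lambda>n. \<delta> n * y) \<longlonglongrightarrow> 0 * y" by (intro tendsto_intros \<delta>0)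
      then have "(\<lambda>n. f (\<delta> n * y)) \<longlonglongrightarrow> f 0"
        using continuous_on_tendsto_compose[OF cf(1), of "\<lambda>n. \<delta> n * y" 0] by auto
      then show "(\<lambda>n. f (\<delta> n * y) * of_real (std_normal_density y)) \<longlonglongrightarrow> f 0 * of_real (std_normal_density y)"
        by (intro tendsto_intros)
    qed
    show "AE y in lborel. norm (f (\<delta> n * y) * of_real (std_normal_density y)) \<le> K * std_normal_density y" for n
      by (auto intro!: AE_I2 mult_right_mono K simp: norm_mult)
  qed auto
  have eq: "(\<integral>\<xi>. fh \<xi> * of_real (exp (- (\<delta> n * \<xi>)\<^sup>2 / 2)) \<partial>lborel) = 2 * pi * (\<integral>y. f (\<delta> n * y) * of_real (std_normal_density y) \<partial>lborel)" for n
  proof -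
    let ?g = "\<lambda>\<xi>. sqrt (2 * pi) * std_normal_density (0 + \<delta> n * \<xi>)"
    have g: "exp (- (\<delta> n * \<xi>)\<^sup>2 / 2) = ?g \<xi>" for \<xi> by (simp add: std_normal_density_eq)
    have ig: "integrable lborel ?g"
      by (intro integrable_mult_right lborel_integrable_real_affine integrable_std_normal_density) (use \<delta>pos[of n] in auto)
    have ifn: "integrable lborel (\<lambda>x. norm (f x))" using i0 by auto
    have dm: "integrable (lborel \<Otimes>\<^sub>M lborel) (\<lambda>p. ?g (fst p) * norm (f (snd p)))"
      by (rule lborel_pair.integrable_mult_pair[OF ig ifn])
    have ip: "integrable (lborel \<Otimes>\<^sub>M lborel) (\<lambda>(\<xi>, x). exp (\<i> * of_real \<xi> * of_real x) * f x * of_real (?g \<xi>))"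
      by (rule Bochner_Integration.integrable_bound[OF dm]) (auto simp: norm_mult abs_mult mult_ac)
    have "(\<integral>\<xi>. fh \<xi> * of_real (exp (- (\<delta> n * \<xi>)\<^sup>2 / 2)) \<partial>lborel) =
      (\<integral>\<xi>. (\<integral>x. exp (\<i> * of_real \<xi> * of_real x) * f x * of_real (?g \<xi>) \<partial>lborel) \<partial>lborel)"
      unfolding g fh_def by (simp only: integral_mult_left_zero)
    also have "\<dots> = (\<integral>x. (\<integral>\<xi>. exp (\<i> * of_real \<xi> * of_real x) * f x * of_real (?g \<xi>) \<partial>lborel) \<partial>lborel)"
      using lborel_pair.Fubini_integral[OF ip] by simp
    also have "\<dots> = (\<integral>x. f x * of_real (2 * pi / \<delta> n * std_normal_density (x / \<delta> n)) \<partial>lborel)"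
    proof (intro Bochner_Integration.integral_cong refl)
      fix x :: real
      have "(\<integral>\<xi>. exp (\<i> * of_real \<xi> * of_real x) * f x * of_real (?g \<xi>) \<partial>lborel) =
        f x * of_real (sqrt (2 * pi)) * (\<integral>\<xi>. exp (\<i> * of_real \<xi> * of_real x) * of_real (std_normal_density (0 + \<delta> n * \<xi>)) \<partial>lborel)"
        by (subst integral_mult_right_zero[symmetric], intro Bochner_Integration.integral_cong) auto
      also have "(\<integral>\<xi>. exp (\<i> * of_real \<xi> * of_real x) * of_real (std_normal_density (0 + \<delta> n * \<xi>)) \<partial>lborel) = 
         of_real (1 / \<delta> n) * (\<integral>\<eta>. exp (\<i> * of_real (x / \<delta> n * \<eta>)) * complex_of_real (std_normal_density \<eta>) \<partial>lborel)"
        using \<delta>pos[of n] by (subst lborel_integral_real_affine[where c="1 / \<delta> n" and t=0]) (auto simp: scaleR_conv_of_real mult_ac)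
      also have "\<dots> = of_real (1 / \<delta> n * exp (- (x / \<delta> n)\<^sup>2 / 2))" unfolding std_normal_char by (simp only: of_real_mult)
      also have "f x * of_real (sqrt (2 * pi)) * of_real (1 / \<delta> n * exp (- (x / \<delta> n)\<^sup>2 / 2)) = f x * of_real (2 * pi / \<delta> n * std_normal_density (x / \<delta> n))"
      proof -
        have "sqrt (2 * pi) * (1 / \<delta> n * exp (- (x / \<delta> n)\<^sup>2 / 2)) = 2 * pi / \<delta> n * std_normal_density (x / \<delta> n)"
        proof -
          have gen: "s > 0 \<Longrightarrow> s * (1 / d * e) = s * s / d * (e / s)" for s d e :: real by simp
          show ?thesis unfolding std_normal_density_eq using gen[of "sqrt (2 * pi)"] by simp
        qed
        then show ?thesis by (simp only: mult.assoc of_real_mult[symmetric])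
      qed
      finally show "(\<integral>\<xi>. exp (\<i> * of_real \<xi> * of_real x) * f x * of_real (?g \<xi>) \<partial>lborel) = f x * of_real (2 * pi / \<delta> n * std_normal_density (x / \<delta> n))" .
    qed
    \<comment> \<open>Substituting x = \<delta> y replaces the concentrating Gaussian by a fixed
      density, so that the limit only uses that f is bounded and continuous.\<close>
    also have "\<dots> = \<bar>\<delta> n\<bar> *\<^sub>R (\<integral>y. f (0 + \<delta> n * y) * of_real (2 * pi / \<delta> n * std_normal_density ((0 + \<delta> n * y) / \<delta> n)) \<partial>lborel)"
      by (rule lborel_integral_real_affine) (use \<delta>pos[of n] in auto)
    also have "\<dots> = (\<integral>y. \<bar>\<delta> n\<bar> *\<^sub>R (f (0 + \<delta> n * y) * of_real (2 * pi / \<delta> n * std_normal_density ((0 + \<delta> n * y) / \<delta> n))) \<partial>lborel)" by simp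
    also have "\<dots> = (\<integral>y. 2 * pi * (f (\<delta> n * y) * of_real (std_normal_density y)) \<partial>lborel)"
      using \<delta>pos[of n] by (intro Bochner_Integration.integral_cong refl) (auto simp: scaleR_conv_of_real)
    finally show ?thesis by simp
  qed
  have "(\<integral>y. f 0 * of_real (std_normal_density y) \<partial>lborel) = f 0"
    using std_normal_char[of 0] by simp
  then have "(\<lambda>n. 2 * pi * (\<integral>y. f (\<delta> n * y) * of_real (std_normal_density y) \<partial>lborel)) \<longlonglongrightarrow> 2 * pi * f 0"
    using tendsto_mult_left[OF L2] by simp
  with L1 have "(\<integral>\<xi>. fh \<xi> \<partial>lborel) = 2 * pi * f 0" unfolding eq by (rule LIMSEQ_unique)
  then show ?thesis by (simp add: fh_def)
qed

text \<open>(1 + \<xi>^2)^2 is 1 + 2 \<xi>^2 + \<xi>^4, and each power of \<xi> is one integration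
  by parts. The exponent is chosen to match (1 + \<xi>^2)^(-2), the weakest Sobolev weight that
  occurs later.\<close>

lemma fourier_decay:
  fixes D :: "nat \<Rightarrow> real \<Rightarrow> complex"
  assumes d: "\<And>j x. (D j has_vector_derivative D (Suc j) x) (at x)"
    and z: "\<And>j x. A \<le> \<bar>x\<bar> \<Longrightarrow> D j x = 0"
  shows "\<exists>M. \<forall>\<xi>. norm (\<integral>x. exp (\<i> * of_real \<xi> * of_real x) * D 0 x \<partial>lborel) * (1 + \<xi>\<^sup>2)\<^sup>2 \<le> M"
proof -
  have c: "continuous_on UNIV (D j)" for j
    using d by (auto intro!: continuous_at_imp_continuous_on has_vector_derivative_continuous)
  define I where "I j \<xi> = (\<integral>x. exp (\<i> * of_real \<xi> * of_real x) * D j x \<partial>lborel)" for j and \<xi> :: real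
  have rec: "I (Suc j) \<xi> = - (\<i> * of_real \<xi>) * I j \<xi>" for j \<xi>
    unfolding I_def by (rule integral_exp_parts(1)[OF d c c]) (use z in blast)+
  have nI: "norm (I j \<xi>) = \<bar>\<xi>\<bar> ^ j * norm (I 0 \<xi>)" for j \<xi>
    by (induction j) (simp_all add: rec norm_mult)
  have bI: "norm (I j \<xi>) \<le> (\<integral>x. norm (D j x) \<partial>lborel)" for j \<xi>
    unfolding I_def by (rule order_trans[OF integral_norm_bound]) (simp add: norm_mult)
  have "norm (I 0 \<xi>) * (1 + \<xi>\<^sup>2)\<^sup>2 = norm (I 0 \<xi>) + 2 * norm (I 2 \<xi>) + norm (I 4 \<xi>)" for \<xi>
    unfolding nI[of 2] nI[of 4] by (simp add: power2_eq_square power4_eq_xxxx algebra_simps abs_mult_self_eq)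
  then have "norm (I 0 \<xi>) * (1 + \<xi>\<^sup>2)\<^sup>2 \<le> (\<integral>x. norm (D 0 x) \<partial>lborel) + 2 * (\<integral>x. norm (D 2 x) \<partial>lborel) + (\<integral>x. norm (D 4 x) \<partial>lborel)" for \<xi>
    using bI[of 0 \<xi>] bI[of 2 \<xi>] bI[of 4 \<xi>] by simp
  then show ?thesis unfolding I_def by blast
qed

section \<open>Gevrey cutoff functions\<close>

text \<open>Entire chains of derivatives are carried as data because the coefficients
  \<open>csol\<close> consume time derivatives of arbitrarily high order, each with its own Gevrey
  bound.\<close>

definition deriv_seq :: "(nat \<Rightarrow> real \<Rightarrow> complex) \<Rightarrow> bool" where
  "deriv_seq D \<longleftrightarrow> (\<forall>k t. (D k has_vector_derivative D (Suc k) t) (at t))"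

lemma deriv_seqD: "deriv_seq D \<Longrightarrow> (D k has_vector_derivative D (Suc k) t) (at t)"
  by (simp add: deriv_seq_def)

lemma deriv_seq_continuous: "deriv_seq D \<Longrightarrow> continuous_on S (D k)"
  by (meson deriv_seqD continuous_at_imp_continuous_on has_vector_derivative_continuous)

definition leibniz_seq :: "(nat \<Rightarrow> real \<Rightarrow> complex) \<Rightarrow> (nat \<Rightarrow> real \<Rightarrow> complex) \<Rightarrow> nat \<Rightarrow> real \<Rightarrow> complex" where
  "leibniz_seq D E k t = (\<Sum>l\<le>k. of_nat (k choose l) * (D l t * E (k - l) t))"

lemma leibniz_sum_Suc:
  fixes a :: "nat \<Rightarrow> nat \<Rightarrow> complex"
  shows "(\<Sum>l\<le>k. of_nat (k choose l) * (a (Suc l) (k - l) + a l (Suc (k - l)))) =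
    (\<Sum>l\<le>Suc k. of_nat (Suc k choose l) * a l (Suc k - l))"
proof -
  have "(\<Sum>l\<le>Suc k. of_nat (Suc k choose l) * a l (Suc k - l)) =
    a 0 (Suc k) + (\<Sum>l\<le>k. of_nat (Suc k choose Suc l) * a (Suc l) (k - l))"
    by (subst sum.atMost_Suc_shift) simp
  also have "\<dots> = (\<Sum>l\<le>k. of_nat (k choose l) * a (Suc l) (k - l)) + (a 0 (Suc k) + (\<Sum>l\<le>k. of_nat (k choose Suc l) * a (Suc l) (k - l)))"
    by (simp add: sum.distrib algebra_simps)
  also have "a 0 (Suc k) + (\<Sum>l\<le>k. of_nat (k choose Suc l) * a (Suc l) (k - l)) = (\<Sum>l\<le>Suc k. of_nat (k choose l) * a l (Suc k - l))"
    by (subst sum.atMost_Suc_shift) simp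
  also have "\<dots> = (\<Sum>l\<le>k. of_nat (k choose l) * a l (Suc (k - l)))"
    by (simp add: Suc_diff_le)
  finally show ?thesis by (simp add: sum.distrib algebra_simps)
qed

lemma deriv_seq_leibniz:
  assumes "deriv_seq D" "deriv_seq E" shows "deriv_seq (leibniz_seq D E)"
  unfolding deriv_seq_def
proof (intro allI)
  fix k t
  have "((\<lambda>t. \<Sum>l\<le>k. of_nat (k choose l) * (D l t * E (k - l) t)) has_vector_derivative
     (\<Sum>l\<le>k. of_nat (k choose l) * (D (Suc l) t * E (k - l) t + D l t * E (Suc (k - l)) t))) (at t)"
    by (rule derivative_eq_intros deriv_seqD[OF assms(1)] deriv_seqD[OF assms(2)] refl)+ (simp add: algebra_simps)
  then show "(leibniz_seq D E k has_vector_derivative leibniz_seq D E (Suc k) t) (at t)"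
    using leibniz_sum_Suc[of k "\<lambda>i j. D i t * E j t"] by (simp add: leibniz_seq_def[abs_def])
qed

text \<open>Gevrey class two is an algebra: (k choose l) l! (k - l)! is k!, the second factor l! (k
  - l)! is at most k!, and the k + 1 terms of the sum are absorbed by 2^k. This is why R
  doubles.\<close>

lemma leibniz_seq_bound:
  assumes D: "\<And>k. norm (D k t) \<le> C * R ^ k * (fact k)\<^sup>2" and E: "\<And>k. norm (E k t) \<le> C' * R ^ k * (fact k)\<^sup>2"
    and "0 \<le> R" "0 \<le> C" "0 \<le> C'"
  shows "norm (leibniz_seq D E k t) \<le> C * C' * (2 * R) ^ k * (fact k)\<^sup>2"
proof -
  have "norm (leibniz_seq D E k t) \<le> (\<Sum>l\<le>k. norm (of_nat (k choose l) * (D l t * E (k - l) t)))"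
    unfolding leibniz_seq_def by (rule norm_sum)
  also have "\<dots> \<le> (\<Sum>l\<le>k. C * C' * R ^ k * (fact k)\<^sup>2)"
  proof (intro sum_mono)
    fix l assume "l \<in> {..k}" then have l: "l \<le> k" by simp
    have "norm (of_nat (k choose l) * (D l t * E (k - l) t)) = real (k choose l) * (norm (D l t) * norm (E (k - l) t))"
      by (simp add: norm_mult)
    also have "\<dots> \<le> real (k choose l) * ((C * R ^ l * (fact l)\<^sup>2) * (C' * R ^ (k - l) * (fact (k - l))\<^sup>2))"
      using assms by (intro mult_left_mono mult_mono D E) auto
    also have "\<dots> = C * C' * (R ^ l * R ^ (k - l)) * ((real (k choose l) * fact l * fact (k - l)) * (fact l * fact (k - l)))"
      by (simp add: power2_eq_square mult_ac)
    also have "R ^ l * R ^ (k - l) = R ^ k" using l by (simp flip: power_add)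
    also have "real (k choose l) * fact l * fact (k - l) = fact k"
      using binomial_fact_lemma[OF l] by (metis (no_types, lifting) of_nat_fact of_nat_mult mult.commute mult.left_commute)
    also have "C * C' * R ^ k * (fact k * (fact l * fact (k - l))) \<le> C * C' * R ^ k * (fact k * fact k)"
    proof (intro mult_left_mono)
      have "fact l * fact (k - l) \<le> (fact k :: nat)"
        using binomial_fact_lemma[OF l] l by (metis zero_less_binomial le_add1 mult.right_neutral mult_le_mono2 One_nat_def Suc_leI)
      then show "fact l * fact (k - l) \<le> (fact k :: real)" by (metis of_nat_fact of_nat_le_iff of_nat_mult)
    qed (use assms in auto)
    finally show "norm (of_nat (k choose l) * (D l t * E (k - l) t)) \<le> C * C' * R ^ k * (fact k)\<^sup>2"
      by (simp add: power2_eq_square)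
  qed
  also have "\<dots> = real (Suc k) * (C * C' * R ^ k * (fact k)\<^sup>2)" by simp
  also have "\<dots> \<le> 2 ^ k * (C * C' * R ^ k * (fact k)\<^sup>2)"
  proof (intro mult_right_mono)
    have "Suc k \<le> 2 ^ k" by (simp add: Suc_leI)
    then show "real (Suc k) \<le> 2 ^ k" by (metis of_nat_le_iff of_nat_numeral of_nat_power)
  qed (use assms in auto)
  finally show ?thesis by (simp add: power_mult_distrib mult_ac)
qed

lemma deriv_seq_affine:
  assumes "deriv_seq D" shows "deriv_seq (\<lambda>k t. of_real (c ^ k) * D k (c * t + d))"
  unfolding deriv_seq_def
proof (intro allI)
  fix k t
  have "((D k \<circ> (\<lambda>t. c * t + d)) has_vector_derivative c *\<^sub>R D (Suc k) (c * t + d)) (at t)"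
    by (rule vector_diff_chain_at) (auto intro!: derivative_eq_intros deriv_seqD[OF assms])
  then show "((\<lambda>t. of_real (c ^ k) * D k (c * t + d)) has_vector_derivative of_real (c ^ Suc k) * D (Suc k) (c * t + d)) (at t)"
    by (auto simp: comp_def scaleR_conv_of_real mult_ac intro!: derivative_eq_intros)
qed

text \<open>The classical flat function exp(- 1/t), multiplied by a power of 1/t: linear
  combinations of this family are closed under differentiation, so all derivatives of exp(- 1/t) can
  be estimated by counting.\<close>

definition flat :: "nat \<Rightarrow> real \<Rightarrow> real" where
  "flat j t = (if t \<le> 0 then 0 else inverse t ^ j * exp (- inverse t))"

lemma power_exp_le_fact: "0 \<le> (x::real) \<Longrightarrow> x ^ j * exp (- x) \<le> fact j"
proof -
  assume x: "0 \<le> x"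
  have "(\<Sum>n\<in>{j}. x ^ n /\<^sub>R fact n) \<le> exp x"
    unfolding exp_def by (rule sum_le_suminf[OF summable_exp_generic]) (use x in auto)
  then show ?thesis by (simp add: exp_minus field_simps)
qed

lemma flat_bounds: "0 \<le> flat j t" "flat j t \<le> fact j"
  using power_exp_le_fact[of "inverse t" j] by (auto simp: flat_def)

lemma flat_deriv: "(flat j has_real_derivative flat (j + 2) t - real j * flat (j + 1) t) (at t)"
proof -
  consider "t > 0" | "t < 0" | "t = 0" by linarith
  then show ?thesis
  proof cases
    case 1
    have "((\<lambda>t. inverse t ^ j * exp (- inverse t)) has_real_derivative
        real j * (- (inverse t * inverse t)) * inverse t ^ (j - 1) * exp (- inverse t) +
        inverse t ^ j * (exp (- inverse t) * (inverse t * inverse t))) (at t)"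
      using 1 by (auto intro!: derivative_eq_intros)
    also have "real j * (- (inverse t * inverse t)) * inverse t ^ (j - 1) * exp (- inverse t) +
        inverse t ^ j * (exp (- inverse t) * (inverse t * inverse t)) = flat (j + 2) t - real j * flat (j + 1) t"
      using 1 by (cases j) (simp_all add: flat_def algebra_simps)
    finally have "((\<lambda>t. inverse t ^ j * exp (- inverse t)) has_real_derivative flat (j + 2) t - real j * flat (j + 1) t) (at t)" .
    then show ?thesis
      by (rule has_field_derivative_transform_within_open[where S="{0<..}"]) (use 1 in \<open>auto simp: flat_def\<close>)
  next
    case 2
    have "((\<lambda>t. 0) has_real_derivative flat (j + 2) t - real j * flat (j + 1) t) (at t)"
      using 2 by (auto simp: flat_def)
    then show ?thesis
      by (rule has_field_derivative_transform_within_open[where S="{..<0}"]) (use 2 in \<open>auto simp: flat_def\<close>)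
  next
    case 3
    \<comment> \<open>Two powers of 1/h are traded for h^2, which makes the difference quotient at 0
      of order h.\<close>
    have b: "\<bar>flat j h\<bar> \<le> fact (j + 2) * h\<^sup>2" for h
    proof (cases "h \<le> 0")
      case False
      then have "flat j h = flat (j + 2) h * h\<^sup>2" by (simp add: flat_def power_add power2_eq_square field_simps)
      then show ?thesis using flat_bounds[of "j + 2" h] by (simp add: abs_mult mult_right_mono)
    qed (simp add: flat_def)
    have "((\<lambda>h. (flat j (0 + h) - flat j 0) / h) \<longlongrightarrow> 0) (at 0)"
    proof (rule Lim_null_comparison)
      show "\<forall>\<^sub>F h in at 0. norm ((flat j (0 + h) - flat j 0) / h) \<le> fact (j + 2) * \<bar>h\<bar>"
      proof (rule always_eventually, rule allI)
        fix h :: real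
        show "norm ((flat j (0 + h) - flat j 0) / h) \<le> fact (j + 2) * \<bar>h\<bar>"
        proof -
          have gen: "\<bar>y / h\<bar> \<le> c * \<bar>h\<bar>" if "\<bar>y\<bar> \<le> c * h\<^sup>2" "0 \<le> c" for y c :: real
            using that by (cases "h = 0") (auto simp: divide_le_eq abs_mult_self_eq power2_eq_square mult.assoc)
          show ?thesis using gen[OF b] by (simp add: flat_def[of j 0] del: fact_Suc)
        qed
      qed
      show "((\<lambda>h::real. fact (j + 2) * \<bar>h\<bar>) \<longlongrightarrow> 0) (at 0)"
        by (intro tendsto_eq_intros refl | simp)+
    qed
    then show ?thesis unfolding DERIV_def 3 by (simp add: flat_def)
  qed
qed

fun flat_d :: "nat \<Rightarrow> nat \<Rightarrow> real \<Rightarrow> real" where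
  "flat_d 0 j t = flat j t"
| "flat_d (Suc k) j t = flat_d k (j + 2) t - real j * flat_d k (j + 1) t"

lemma flat_d_deriv: "(flat_d k j has_real_derivative flat_d (Suc k) j t) (at t)"
proof (induction k arbitrary: j)
  case 0
  then show ?case using flat_deriv[of j t] by (simp add: fun_eq_iff flat_d.simps(1)[abs_def])
next
  case (Suc k)
  have "flat_d (Suc k) j = (\<lambda>t. flat_d k (j + 2) t - real j * flat_d k (j + 1) t)" by (simp add: fun_eq_iff)
  moreover have "((\<lambda>t. flat_d k (j + 2) t - real j * flat_d k (j + 1) t) has_real_derivative 
     flat_d (Suc k) (j + 2) t - real j * flat_d (Suc k) (j + 1) t) (at t)"
    by (rule derivative_eq_intros Suc refl | simp)+
  ultimately show ?case by simp
qed

text \<open>A derivative raises the power of 1/t by two, or by one with a factor j. Since y^n exp(-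
  y) is at most n! for y \<ge> 0, both branches cost at most (j + 2 k)!, and having two branches
  costs 2^k. For j = 0 the outcome (2 k)! is k!^2 up to 4^k, that is Gevrey class two.\<close>

lemma flat_d_bound: "\<bar>flat_d k j t\<bar> \<le> 2 ^ k * fact (j + 2 * k)"
proof (induction k arbitrary: j)
  case 0
  then show ?case using flat_bounds[of j t] by simp
next
  case (Suc k)
  have "\<bar>flat_d (Suc k) j t\<bar> \<le> \<bar>flat_d k (j + 2) t\<bar> + real j * \<bar>flat_d k (j + 1) t\<bar>"
    by (simp add: abs_mult order_trans[OF abs_triangle_ineq4])
  also have "\<dots> \<le> 2 ^ k * fact (j + 2 + 2 * k) + real j * (2 ^ k * fact (j + 1 + 2 * k))"
    by (intro add_mono mult_left_mono Suc) auto
  also have "real j * (2 ^ k * fact (j + 1 + 2 * k)) \<le> real (j + 2 + 2 * k) * (2 ^ k * fact (j + 1 + 2 * k))"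
    by (intro mult_right_mono) auto
  also have "\<dots> = 2 ^ k * fact (j + 2 + 2 * k)"
    using fact_Suc[of "j + 1 + 2 * k", where 'a=real] by simp
  finally have F: "\<bar>flat_d (Suc k) j t\<bar> \<le> 2 ^ k * fact (j + 2 + 2 * k) + 2 ^ k * fact (j + 2 + 2 * k)" by simp
  have e: "j + 2 * Suc k = j + 2 + 2 * k" by simp
  show ?case unfolding e using F by (simp only: power_Suc mult_2 distrib_right)
qed

lemma flat_d_neg: "t \<le> 0 \<Longrightarrow> flat_d k j t = 0"
  by (induction k arbitrary: j) (auto simp: flat_def)

lemma fact_double_le: "fact (2 * k) \<le> (4::real) ^ k * (fact k)\<^sup>2"
proof (induction k)
  case (Suc k)
  have "fact (2 * Suc k) = (real (2 * k + 2) * real (2 * k + 1)) * fact (2 * k)"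
    using fact_Suc[of "2 * k + 1", where 'a=real] fact_Suc[of "2 * k", where 'a=real] by simp
  also have "\<dots> \<le> (4 * (real (Suc k))\<^sup>2) * (4 ^ k * (fact k)\<^sup>2)"
  proof (rule mult_mono[OF _ Suc])
    show "real (2 * k + 2) * real (2 * k + 1) \<le> 4 * (real (Suc k))\<^sup>2" by (simp add: power2_eq_square algebra_simps)
  qed auto
  finally show ?case by (simp add: power2_eq_square algebra_simps)
qed simp

section \<open>Bump and cutoff of Gevrey class two\<close>

definition flat_seq :: "nat \<Rightarrow> real \<Rightarrow> complex" where "flat_seq k t = of_real (flat_d k 0 t)"

lemma flat_seq_deriv: "deriv_seq flat_seq"
  unfolding deriv_seq_def flat_seq_def
  by (intro allI has_vector_derivative_of_real) (simp add: flat_d_deriv has_real_derivative_iff_has_vector_derivative[symmetric] del: flat_d.simps)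

lemma flat_seq_bound: "norm (flat_seq k t) \<le> 1 * 8 ^ k * (fact k)\<^sup>2"
proof -
  have "norm (flat_seq k t) \<le> 2 ^ k * fact (2 * k)" using flat_d_bound[of k 0 t] by (simp add: flat_seq_def)
  also have "\<dots> \<le> 2 ^ k * (4 ^ k * (fact k)\<^sup>2)" by (intro mult_left_mono fact_double_le) auto
  also have "\<dots> = 8 ^ k * (fact k)\<^sup>2" by (simp add: mult.assoc[symmetric] power_mult_distrib[symmetric])
  finally show ?thesis by simp
qed

text \<open>The flat function at 0 times its mirror image at 1, divided by its integral. The rate 16
  is the common rate 8 of both factors, doubled by the Leibniz rule.\<close>

lemma gevrey_bump:
  obtains \<rho> C R where "deriv_seq \<rho>" "0 \<le> C" "1 \<le> R" "\<And>k t. norm (\<rho> k t) \<le> C * R ^ k * (fact k)\<^sup>2"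
    "\<And>k t. t \<le> 0 \<or> 1 \<le> t \<Longrightarrow> \<rho> k t = 0" "(\<integral>t. \<rho> 0 t \<partial>lborel) = 1"
proof -
  define E where "E k t = of_real ((-1) ^ k) * flat_seq k ((-1) * t + 1)" for k t
  define B where "B = leibniz_seq flat_seq E"
  have dE: "deriv_seq E" unfolding E_def by (rule deriv_seq_affine[OF flat_seq_deriv])
  have dB: "deriv_seq B" unfolding B_def by (rule deriv_seq_leibniz[OF flat_seq_deriv dE])
  have bE: "norm (E k t) \<le> 1 * 8 ^ k * (fact k)\<^sup>2" for k t
    using flat_seq_bound[of k "1 - t"] by (simp add: E_def norm_mult norm_power)
  have bB: "norm (B k t) \<le> 1 * 16 ^ k * (fact k)\<^sup>2" for k t
    using leibniz_seq_bound[of flat_seq t 1 8 E 1 k, OF flat_seq_bound bE] by (simp add: B_def)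
  have zB: "t \<le> 0 \<or> 1 \<le> t \<Longrightarrow> B k t = 0" for k t
    unfolding B_def leibniz_seq_def E_def flat_seq_def by (auto intro!: sum.neutral simp: flat_d_neg)
  define r where "r t = flat 0 t * flat 0 (1 - t)" for t
  have B0: "B 0 t = of_real (r t)" for t by (simp add: B_def leibniz_seq_def E_def flat_seq_def r_def)
  have cB: "continuous_on UNIV (B 0)" by (rule deriv_seq_continuous[OF dB])
  have cr: "isCont r t" for t
  proof -
    have "continuous_on UNIV (\<lambda>t. Re (B 0 t))" by (intro continuous_intros cB)
    then show ?thesis by (simp add: B0 continuous_on_eq_continuous_at)
  qed
  have "\<exists>F. \<forall>x::real. -\<infinity> < ereal x \<longrightarrow> ereal x < \<infinity> \<longrightarrow> (F has_vector_derivative r x) (at x)"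
    by (rule einterval_antiderivative) (auto intro: cr)
  then obtain \<Phi> where \<Phi>: "\<And>x. (\<Phi> has_real_derivative r x) (at x)"
    by (auto simp: has_real_derivative_iff_has_vector_derivative)
  have "\<Phi> 0 < \<Phi> 1"
  proof (rule DERIV_pos_imp_increasing_open[of 0 1 \<Phi>])
    show "\<exists>y. DERIV \<Phi> x :> y \<and> 0 < y" if "0 < x" "x < 1" for x
      using \<Phi>[of x] that by (intro exI[of _ "r x"]) (auto simp: r_def flat_def)
    show "continuous_on {0..1} \<Phi>" by (intro continuous_at_imp_continuous_on ballI DERIV_isCont[OF \<Phi>])
  qed simp
  define K where "K = \<Phi> 1 - \<Phi> 0"
  have K: "K > 0" using \<open>\<Phi> 0 < \<Phi> 1\<close> by (simp add: K_def)
  have "(\<integral>t. r t * indicator {0..1} t \<partial>lborel) = K"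
    unfolding K_def by (rule integral_FTC_Icc_real) (auto intro: \<Phi> cr)
  moreover have "r t * indicator {0..1} t = r t" for t by (auto simp: r_def flat_def indicator_def)
  ultimately have intr: "(\<integral>t. r t \<partial>lborel) = K" by simp
  define \<rho> where "\<rho> k t = of_real (1 / K) * B k t" for k t
  show thesis
  proof (rule that[of \<rho> "1 / K" 16])
    show "deriv_seq \<rho>" unfolding deriv_seq_def \<rho>_def
      by (auto intro!: derivative_eq_intros deriv_seqD[OF dB])
    show "0 \<le> 1 / K" "(1::real) \<le> 16" using K by auto
    show "norm (\<rho> k t) \<le> 1 / K * 16 ^ k * (fact k)\<^sup>2" for k t
      using bB[of k t] K by (simp add: \<rho>_def norm_mult norm_divide field_simps)
    show "\<rho> k t = 0" if "t \<le> 0 \<or> 1 \<le> t" for k t using zB[OF that] by (simp add: \<rho>_def)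
    show "(\<integral>t. \<rho> 0 t \<partial>lborel) = 1"
      using K by (simp add: \<rho>_def B0 intr flip: of_real_mult del: of_real_divide)
  qed
qed

text \<open>One minus the primitive of the unit bump. Both plateaus are exact: data multiplied by
  the cutoff are unchanged, with all their derivatives, before the transition and vanish identically
  after it.\<close>

lemma gevrey_cutoff:
  obtains \<theta> C R where "deriv_seq \<theta>" "0 \<le> C" "1 \<le> R" "\<And>k t. norm (\<theta> k t) \<le> C * R ^ k * (fact k)\<^sup>2"
    "\<And>t. t \<le> 0 \<Longrightarrow> \<theta> 0 t = 1" "\<And>k t. t \<le> 0 \<Longrightarrow> 0 < k \<Longrightarrow> \<theta> k t = 0"
    "\<And>k t. 1 \<le> t \<Longrightarrow> \<theta> k t = 0"
proof -
  obtain \<rho> C R where \<rho>: "deriv_seq \<rho>" "0 \<le> C" "1 \<le> R" "\<And>k t. norm (\<rho> k t) \<le> C * R ^ k * (fact k)\<^sup>2"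
    "\<And>k t. t \<le> 0 \<or> 1 \<le> t \<Longrightarrow> \<rho> k t = 0" "(\<integral>t. \<rho> 0 t \<partial>lborel) = 1" by (rule gevrey_bump) (rule that; assumption)
  have c0: "continuous_on S (\<rho> 0)" for S by (rule deriv_seq_continuous[OF \<rho>(1)])
  have "\<exists>F. \<forall>x::real. -\<infinity> < ereal x \<longrightarrow> ereal x < \<infinity> \<longrightarrow> (F has_vector_derivative \<rho> 0 x) (at x)"
    by (rule einterval_antiderivative) (use c0[of UNIV] in \<open>auto simp: continuous_on_eq_continuous_at\<close>)
  then obtain \<Phi> where \<Phi>: "\<And>x. (\<Phi> has_vector_derivative \<rho> 0 x) (at x)" by auto
  have FTC: "(\<integral>t. indicator {u..v} t *\<^sub>R \<rho> 0 t \<partial>lborel) = \<Phi> v - \<Phi> u" if "u \<le> v" for u v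
    by (rule integral_FTC_Icc[OF that]) (auto intro: \<Phi> has_vector_derivative_at_within c0)
  have left: "\<Phi> t = \<Phi> 0" if "t \<le> 0" for t
  proof -
    have "(\<lambda>s. indicator {t..0} s *\<^sub>R \<rho> 0 s) = (\<lambda>s. 0)" using \<rho>(5) by (auto simp: fun_eq_iff indicator_def)
    then show ?thesis using FTC[OF that] by simp
  qed
  have right: "\<Phi> t = \<Phi> 1" if "1 \<le> t" for t
  proof -
    have "(\<lambda>s. indicator {1..t} s *\<^sub>R \<rho> 0 s) = (\<lambda>s. 0)" using \<rho>(5) by (auto simp: fun_eq_iff indicator_def)
    then show ?thesis using FTC[OF that] by simp
  qed
  have "(\<lambda>s. indicator {0..1} s *\<^sub>R \<rho> 0 s) = \<rho> 0" using \<rho>(5) by (auto simp: fun_eq_iff indicator_def)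
  then have one: "\<Phi> 1 - \<Phi> 0 = 1" using FTC[of 0 1] \<rho>(6) by simp
  define \<theta> where "\<theta> k t = (case k of 0 \<Rightarrow> 1 - (\<Phi> t - \<Phi> 0) | Suc k \<Rightarrow> - \<rho> k t)" for k t
  have cF: "continuous_on UNIV \<Phi>"
    by (intro continuous_at_imp_continuous_on ballI has_vector_derivative_continuous[OF \<Phi>])
  have "bounded ((\<lambda>t. 1 - (\<Phi> t - \<Phi> 0)) ` {0..1})"
    by (intro compact_imp_bounded compact_continuous_image continuous_intros continuous_on_subset[OF cF]) auto
  then obtain K where K: "\<forall>t\<in>{0..1}. norm (1 - (\<Phi> t - \<Phi> 0)) \<le> K" by (auto simp: bounded_iff)
  have K': "norm (1 - (\<Phi> t - \<Phi> 0)) \<le> K + 1" for t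
  proof -
    have "0 \<le> K" using K[rule_format, of 0] by (auto intro: order_trans[OF norm_ge_zero])
    consider "t \<le> 0" | "1 \<le> t" | "t \<in> {0..1}" by fastforce
    then show ?thesis
    proof cases
      case 1 then show ?thesis using left[OF 1] \<open>0 \<le> K\<close> by simp
    next
      case 2 then show ?thesis using right[OF 2] one \<open>0 \<le> K\<close> by simp
    next
      case 3 then show ?thesis using K[rule_format, of t] by simp
    qed
  qed
  define C' where "C' = C + \<bar>K\<bar> + 1"
  show thesis
  proof (rule that[of \<theta> C' R])
    show "deriv_seq \<theta>"
      unfolding deriv_seq_def
    proof (intro allI)
      fix k t show "(\<theta> k has_vector_derivative \<theta> (Suc k) t) (at t)"
        by (cases k) (auto simp: \<theta>_def[abs_def] intro!: derivative_eq_intros \<Phi> deriv_seqD[OF \<rho>(1)])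
    qed
    show "0 \<le> C'" "1 \<le> R" using \<rho> by (auto simp: C'_def)
    show "norm (\<theta> k t) \<le> C' * R ^ k * (fact k)\<^sup>2" for k t
    proof (cases k)
      case 0
      then show ?thesis using K'[of t] \<rho>(2) by (simp add: \<theta>_def C'_def)
    next
      case (Suc l)
      have "norm (\<theta> k t) \<le> C * R ^ l * (fact l)\<^sup>2" using \<rho>(4)[of l t] Suc by (simp add: \<theta>_def)
      also have "\<dots> \<le> C' * R ^ k * (fact k)\<^sup>2"
        using \<rho>(2,3) Suc by (intro mult_mono power_mono power_increasing fact_mono) (auto simp: C'_def)
      finally show ?thesis .
    qed
    show "t \<le> 0 \<Longrightarrow> \<theta> 0 t = 1" for t by (simp add: \<theta>_def left[of t])
    show "t \<le> 0 \<Longrightarrow> 0 < k \<Longrightarrow> \<theta> k t = 0" for k t using \<rho>(5) by (cases k) (auto simp: \<theta>_def)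
    show "1 \<le> t \<Longrightarrow> \<theta> k t = 0" for k t using \<rho>(5) right[of t] one by (cases k) (auto simp: \<theta>_def)
  qed
qed

section \<open>Power series solutions in space\<close>

text \<open>The equation solved for its highest x-derivative reads \<partial>_x^5 u = \<partial>_t u
  + \<partial>_x u + \<partial>_x^3 u. Here \<open>csol c j k t\<close> is the k-th t-derivative of
  the j-th x-derivative of u at x = 0; the first five x-derivatives are the free Cauchy data
  \<open>c\<close>.\<close>

function csol :: "(nat \<Rightarrow> nat \<Rightarrow> real \<Rightarrow> complex) \<Rightarrow> nat \<Rightarrow> nat \<Rightarrow> real \<Rightarrow> complex" where
  "csol c j k t = (if j < 5 then c j k t else csol c (j - 2) k t + csol c (j - 4) k t + csol c (j - 5) (Suc k) t)"
  by auto
termination by (relation "Wellfounded.measure (\<lambda>(c, j, k, t). j)") auto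

declare csol.simps [simp del]

lemma csol_init: "j < 5 \<Longrightarrow> csol c j k t = c j k t"
  by (subst csol.simps) simp

lemma csol_rec: "csol c (j + 5) k t = csol c (j + 3) k t + csol c (j + 1) k t + csol c j (Suc k) t"
  by (subst csol.simps) (simp add: numeral_eq_Suc)

lemma csol_induct [case_names init rec]:
  assumes "\<And>j. j < 5 \<Longrightarrow> P j" and "\<And>j. P (j + 3) \<Longrightarrow> P (j + 1) \<Longrightarrow> P j \<Longrightarrow> P (j + 5)"
  shows "P (j :: nat)"
proof (induction j rule: less_induct)
  case (less j)
  show ?case
  proof (cases "j < 5")
    case False
    then obtain i where "j = i + 5" by (metis add.commute le_Suc_ex not_less)
    then show ?thesis using less assms(2)[of i] by auto
  qed (rule assms(1))
qed

lemma csol_deriv: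
  assumes "\<And>j. j < 5 \<Longrightarrow> deriv_seq (c j)"
  shows "deriv_seq (csol c j)"
proof (induction j rule: csol_induct)
  case (init j)
  have "csol c j = c j" using init by (auto simp: fun_eq_iff csol_init)
  then show ?case using assms[OF init] by simp
next
  case (rec j)
  show ?case unfolding deriv_seq_def
  proof (intro allI)
    fix k t
    have "csol c (j + 5) k = (\<lambda>t. csol c (j + 3) k t + csol c (j + 1) k t + csol c j (Suc k) t)"
      by (auto simp: fun_eq_iff csol_rec)
    moreover have "((\<lambda>t. csol c (j + 3) k t + csol c (j + 1) k t + csol c j (Suc k) t) has_vector_derivative
        csol c (j + 5) (Suc k) t) (at t)"
      unfolding csol_rec by (intro derivative_intros deriv_seqD rec)
    ultimately show "(csol c (j + 5) k has_vector_derivative csol c (j + 5) (Suc k) t) (at t)" by simp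
  qed
qed

lemma fact_square_le: "(fact k)\<^sup>2 \<le> sqrt (fact (5 * k))"
proof (rule real_le_rsqrt)
  have "((fact k)\<^sup>2)\<^sup>2 = (fact k :: real) ^ 4" by (simp flip: power_mult)
  also have "\<dots> \<le> fact (5 * k)"
  proof (induction k)
    case (Suc k)
    have e: "5 * Suc k = Suc (Suc (Suc (Suc (Suc (5 * k)))))" by simp
    have "(fact (Suc k) :: real) ^ 4 = real (Suc k) ^ 4 * fact k ^ 4"
      by (simp only: fact_Suc power_mult_distrib)
    also have "\<dots> \<le> (real (5 * k + 5) * (real (5 * k + 4) * (real (5 * k + 3) * (real (5 * k + 2) * real (5 * k + 1))))) * fact (5 * k)"
    proof (rule mult_mono[OF _ Suc])
      have "real (Suc k) ^ 4 = real (Suc k) * (real (Suc k) * (real (Suc k) * (real (Suc k) * 1)))" by (simp add: power4_eq_xxxx)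
      also have "\<dots> \<le> real (5 * k + 5) * (real (5 * k + 4) * (real (5 * k + 3) * (real (5 * k + 2) * real (5 * k + 1))))"
        by (intro mult_mono) auto
      finally show "real (Suc k) ^ 4 \<le> real (5 * k + 5) * (real (5 * k + 4) * (real (5 * k + 3) * (real (5 * k + 2) * real (5 * k + 1))))" .
    qed auto
    also have "\<dots> = fact (5 * Suc k)" unfolding e fact_Suc by (simp add: mult.assoc add_ac)
    finally show ?case .
  qed simp
  finally show "((fact k)\<^sup>2)\<^sup>2 \<le> (fact (5 * k) :: real)" .
qed

text \<open>The recursion exchanges five steps in x for one time derivative, and (5 k + j)! is
  invariant under this exchange, which makes it the natural weight. Gevrey class two enters as k!^2
  \<le> sqrt((5 k)!). For k = 0 the bound grows like sqrt(j!), so that division by j! leaves a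
  series converging for all x; any Gevrey class below five would have this effect. The factor 3 in 3
  R pays for the three terms of the recursion.\<close>

lemma csol_bound:
  assumes b: "\<And>j k. j < 5 \<Longrightarrow> norm (c j k t) \<le> C * R ^ k * (fact k)\<^sup>2" and R: "1 \<le> R" and C: "0 \<le> C"
  shows "norm (csol c j k t) \<le> C * (3 * R) ^ j * R ^ k * sqrt (fact (5 * k + j))"
proof (induction j arbitrary: k rule: csol_induct)
  case (init j)
  have "norm (csol c j k t) \<le> C * R ^ k * (fact k)\<^sup>2" using b[OF init] init by (simp add: csol_init)
  also have "\<dots> \<le> C * R ^ k * sqrt (fact (5 * k + j))"
    using R C fact_square_le[of k] by (intro mult_left_mono order_trans[OF fact_square_le]) (auto simp: fact_mono)
  also have "\<dots> = C * 1 * R ^ k * sqrt (fact (5 * k + j))" by simp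
  also have "\<dots> \<le> C * (3 * R) ^ j * R ^ k * sqrt (fact (5 * k + j))"
    using R C by (intro mult_right_mono mult_left_mono one_le_power) auto
  finally show ?case .
next
  case (rec j)
  define S where "S = sqrt (fact (5 * k + (j + 5)) :: real)"
  have S0: "0 \<le> S" by (simp add: S_def)
  have s: "sqrt (fact (5 * k + (j + 3))) \<le> S" "sqrt (fact (5 * k + (j + 1))) \<le> S" "sqrt (fact (5 * Suc k + j)) = S"
    by (auto simp: S_def intro!: real_sqrt_le_mono fact_mono simp del: fact_Suc) (simp add: algebra_simps)
  have r: "1 \<le> 3 * R" using R by simp
  let ?r = "3 * R"
  have "norm (csol c (j + 5) k t) \<le> norm (csol c (j + 3) k t) + norm (csol c (j + 1) k t) + norm (csol c j (Suc k) t)"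
    unfolding csol_rec by (meson norm_triangle_ineq norm_triangle_le order_trans add_mono order_refl)
  also have "\<dots> \<le> C * ?r ^ (j + 3) * R ^ k * sqrt (fact (5 * k + (j + 3))) + C * ?r ^ (j + 1) * R ^ k * sqrt (fact (5 * k + (j + 1))) + C * ?r ^ j * R ^ Suc k * sqrt (fact (5 * Suc k + j))"
    by (intro add_mono rec)
  also have "\<dots> \<le> C * ?r ^ (j + 3) * R ^ k * S + C * ?r ^ (j + 3) * R ^ k * S + C * ?r ^ (j + 3) * R ^ k * S"
  proof (intro add_mono)
    show "C * ?r ^ (j + 3) * R ^ k * sqrt (fact (5 * k + (j + 3))) \<le> C * ?r ^ (j + 3) * R ^ k * S"
      using s R C by (intro mult_left_mono) auto
    show "C * ?r ^ (j + 1) * R ^ k * sqrt (fact (5 * k + (j + 1))) \<le> C * ?r ^ (j + 3) * R ^ k * S"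
      using s R C r by (intro mult_mono mult_right_mono mult_left_mono power_increasing) auto
    have "?r ^ j * R ^ Suc k \<le> ?r ^ j * (?r * R ^ k)" using R by (intro mult_left_mono) auto
    also have "\<dots> = ?r ^ (j + 1) * R ^ k" by simp
    also have "\<dots> \<le> ?r ^ (j + 3) * R ^ k" using r R by (intro mult_right_mono power_increasing) auto
    finally have "C * S * (?r ^ j * R ^ Suc k) \<le> C * S * (?r ^ (j + 3) * R ^ k)" using C S0 by (intro mult_left_mono) auto
    then show "C * ?r ^ j * R ^ Suc k * sqrt (fact (5 * Suc k + j)) \<le> C * ?r ^ (j + 3) * R ^ k * S"
      unfolding s(3) by (simp add: mult_ac)
  qed
  also have "\<dots> = 3 * (C * ?r ^ (j + 3) * R ^ k * S)" by simp
  also have "\<dots> \<le> ?r ^ 2 * (C * ?r ^ (j + 3) * R ^ k * S)"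
  proof (rule mult_right_mono)
    have "3 * 1 \<le> ?r * ?r" using R by (intro mult_mono) auto
    then show "3 \<le> ?r ^ 2" by (simp add: power2_eq_square)
  qed (use R C S0 in auto)
  also have "\<dots> = C * ?r ^ (j + 5) * R ^ k * S"
    by (simp add: power_add power2_eq_square numeral_eq_Suc mult_ac)
  finally show ?case by (simp add: S_def)
qed

section \<open>The power series and its convergence\<close>

lemma summable_power_sqrt_fact: "summable (\<lambda>j. y ^ j / sqrt (fact j) :: real)"
proof (rule summable_ratio_test[of "1/2" "nat \<lceil>(2 * y)\<^sup>2\<rceil>"])
  fix n assume n: "nat \<lceil>(2 * y)\<^sup>2\<rceil> \<le> n"
  then have "(2 * y)\<^sup>2 \<le> real n" by linarith
  then have "(2 * y)\<^sup>2 \<le> real (Suc n)" by simp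
  then have "\<bar>2 * y\<bar> \<le> sqrt (real (Suc n))" by (intro real_le_rsqrt) simp
  then have "\<bar>y\<bar> / sqrt (real (Suc n)) \<le> 1 / 2" by (simp add: divide_le_eq)
  then have "(\<bar>y\<bar> / sqrt (real (Suc n))) * (\<bar>y\<bar> ^ n / sqrt (fact n)) \<le> 1 / 2 * (\<bar>y\<bar> ^ n / sqrt (fact n))"
    by (rule mult_right_mono) auto
  moreover have "norm (y ^ Suc n / sqrt (fact (Suc n))) = (\<bar>y\<bar> / sqrt (real (Suc n))) * (\<bar>y\<bar> ^ n / sqrt (fact n))"
    unfolding fact_Suc of_nat_id real_sqrt_mult by (simp add: abs_mult power_abs abs_divide)
  moreover have "norm (y ^ n / sqrt (fact n)) = \<bar>y\<bar> ^ n / sqrt (fact n)" by (simp add: power_abs abs_divide)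
  ultimately show "norm (y ^ Suc n / sqrt (fact (Suc n))) \<le> 1 / 2 * norm (y ^ n / sqrt (fact n))"
    by (simp only:)
qed simp

definition growth :: "real \<Rightarrow> real" where "growth y = (\<Sum>j. y ^ j / sqrt (fact j))"

lemma growth_nonneg: "0 \<le> y \<Longrightarrow> 0 \<le> growth y"
  unfolding growth_def by (rule suminf_nonneg[OF summable_power_sqrt_fact]) auto

definition esol_term :: "(nat \<Rightarrow> nat \<Rightarrow> real \<Rightarrow> complex) \<Rightarrow> nat \<Rightarrow> real \<times> real \<Rightarrow> complex" where
  "esol_term c j p = csol c j 0 (fst p) * of_real (snd p ^ j / fact j)"

definition esol :: "(nat \<Rightarrow> nat \<Rightarrow> real \<Rightarrow> complex) \<Rightarrow> real \<times> real \<Rightarrow> complex" where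
  "esol c p = (\<Sum>j. esol_term c j p)"

lemma esol_term_bound:
  assumes b: "\<And>j k. j < 5 \<Longrightarrow> norm (c j k t) \<le> C * R ^ k * (fact k)\<^sup>2" and R: "1 \<le> R" and C: "0 \<le> C" and x: "\<bar>x\<bar> \<le> A"
  shows "norm (esol_term c j (t, x)) \<le> C * ((3 * R * A) ^ j / sqrt (fact j))"
proof -
  have "norm (esol_term c j (t, x)) = norm (csol c j 0 t) * (\<bar>x\<bar> ^ j / fact j)"
    by (simp add: esol_term_def norm_mult norm_divide norm_power)
  also have "\<dots> \<le> (C * (3 * R) ^ j * sqrt (fact j)) * (A ^ j / fact j)"
    using csol_bound[of c t C R j 0, OF b R C] R C x by (intro mult_mono divide_right_mono power_mono) auto
  also have "\<dots> = C * ((3 * R * A) ^ j * (sqrt (fact j) / fact j))" by (simp add: power_mult_distrib)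
  also have "sqrt (fact j) / fact j = 1 / sqrt (fact j :: real)" by (simp add: divide_simps)
  finally show ?thesis by simp
qed

lemma esol_bound:
  assumes b: "\<And>j k. j < 5 \<Longrightarrow> norm (c j k t) \<le> C * R ^ k * (fact k)\<^sup>2" and R: "1 \<le> R" and C: "0 \<le> C" and x: "\<bar>x\<bar> \<le> A"
  shows "norm (esol c (t, x)) \<le> C * growth (3 * R * A)" "summable (\<lambda>j. norm (esol_term c j (t, x)))"
proof -
  have s: "summable (\<lambda>j. C * ((3 * R * A) ^ j / sqrt (fact j)))"
    by (intro summable_mult summable_power_sqrt_fact)
  have tb: "norm (esol_term c j (t, x)) \<le> C * ((3 * R * A) ^ j / sqrt (fact j))" for j
    by (rule esol_term_bound) (use b R C x in auto)
  show sn: "summable (\<lambda>j. norm (esol_term c j (t, x)))"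
    by (rule summable_comparison_test'[OF s, of 0]) (use tb in auto)
  have "norm (esol c (t, x)) \<le> (\<Sum>j. norm (esol_term c j (t, x)))"
    unfolding esol_def by (rule summable_norm[OF sn])
  also have "\<dots> \<le> (\<Sum>j. C * ((3 * R * A) ^ j / sqrt (fact j)))"
    by (rule suminf_le[OF tb sn s])
  also have "\<dots> = C * growth (3 * R * A)" unfolding growth_def by (rule suminf_mult[OF summable_power_sqrt_fact])
  finally show "norm (esol c (t, x)) \<le> C * growth (3 * R * A)" .
qed

text \<open>The constants depend on the time window because the data of a plane wave may grow
  exponentially as t tends to - \<infinity>.\<close>

definition gevrey_data :: "(nat \<Rightarrow> nat \<Rightarrow> real \<Rightarrow> complex) \<Rightarrow> bool" where
  "gevrey_data c \<longleftrightarrow> (\<forall>j<5. deriv_seq (c j)) \<and>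
     (\<forall>A. \<exists>C\<ge>0. \<exists>R\<ge>1. \<forall>t. \<bar>t\<bar> \<le> A \<longrightarrow> (\<forall>j<5. \<forall>k. norm (c j k t) \<le> C * R ^ k * (fact k)\<^sup>2))"

lemma gevrey_dataE:
  assumes "gevrey_data c"
  obtains C R where "0 \<le> C" "1 \<le> R" "\<And>t j k. \<bar>t\<bar> \<le> A \<Longrightarrow> j < 5 \<Longrightarrow> norm (c j k t) \<le> C * R ^ k * (fact k)\<^sup>2"
  using assms unfolding gevrey_data_def by metis

lemma gevrey_data_csol: "gevrey_data c \<Longrightarrow> deriv_seq (csol c j)"
  by (rule csol_deriv) (simp add: gevrey_data_def)

lemma continuous_esol_term: "gevrey_data c \<Longrightarrow> continuous_on S (esol_term c j)"
  unfolding esol_term_def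
  by (intro continuous_intros continuous_on_compose2[OF deriv_seq_continuous[OF gevrey_data_csol, of c UNIV j 0]]) auto

lemma continuous_esol:
  assumes c: "gevrey_data c" shows "continuous_on UNIV (esol c)"
proof (rule continuous_at_imp_continuous_on, rule ballI)
  fix p :: "real \<times> real"
  define A where "A = \<bar>fst p\<bar> + \<bar>snd p\<bar> + 1"
  define S where "S = {-A<..<A} \<times> {-A<..<A}"
  have S: "open S" "p \<in> S" by (auto simp: S_def A_def mem_Times_iff intro!: open_Times) 
  obtain C R where CR: "0 \<le> C" "1 \<le> R" "\<And>t j k. \<bar>t\<bar> \<le> A \<Longrightarrow> j < 5 \<Longrightarrow> norm (c j k t) \<le> C * R ^ k * (fact k)\<^sup>2"
    using gevrey_dataE[OF c] by metis
  have u: "uniform_limit S (\<lambda>n p. \<Sum>j<n. esol_term c j p) (\<lambda>p. \<Sum>j. esol_term c j p) sequentially"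
  proof (rule Weierstrass_m_test)
    show "summable (\<lambda>j. C * ((3 * R * A) ^ j / sqrt (fact j)))"
      by (intro summable_mult summable_power_sqrt_fact)
    fix j q assume "q \<in> S"
    then obtain t x where q: "q = (t, x)" "\<bar>t\<bar> \<le> A" "\<bar>x\<bar> \<le> A" by (auto simp: S_def abs_le_iff)
    show "norm (esol_term c j q) \<le> C * ((3 * R * A) ^ j / sqrt (fact j))"
      unfolding q(1) by (rule esol_term_bound) (use CR q in auto)
  qed
  have "continuous_on S (\<lambda>p. \<Sum>j. esol_term c j p)"
    by (rule uniform_limit_theorem[OF _ u]) (auto intro!: always_eventually continuous_on_sum continuous_esol_term c)
  then have "continuous_on S (esol c)" by (simp add: esol_def[abs_def])
  then show "isCont (esol c) p" using S by (simp add: continuous_on_eq_continuous_at)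
qed

section \<open>The weak equation for the power series\<close>

lemma fact_add_le: "fact (i + m) \<le> (2::real) ^ (i + m) * fact i * fact m"
proof -
  have "fact (i + m) = fact i * fact m * (i + m choose i)"
    using binomial_fact_lemma[of i "i + m"] by simp
  also have "\<dots> \<le> fact i * fact m * 2 ^ (i + m)"
    by (intro mult_left_mono binomial_le_pow2) auto
  finally have "fact (i + m) \<le> fact i * fact m * (2::nat) ^ (i + m)" .
  then have "real (fact (i + m)) \<le> real (fact i * fact m * 2 ^ (i + m))" by (rule of_nat_mono)
  then show ?thesis by (simp add: mult_ac)
qed

text \<open>Prepared for pairings with x^i / i!. An excess of at most five in the total order j + 5
  k over i costs only a geometric factor and sqrt(5!) = sqrt 120; the remaining sqrt(i!) is beaten
  by i!.\<close>

lemma csol_bound_shift: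
  assumes b: "\<And>j k. j < 5 \<Longrightarrow> norm (c j k t) \<le> C * R ^ k * (fact k)\<^sup>2" and R: "1 \<le> R" and C: "0 \<le> C"
    and le: "j + 5 * k \<le> i + 5"
  shows "norm (csol c j k t) \<le> C * ((3 * R * R) * 2) ^ (i + 5) * sqrt 120 * sqrt (fact i)"
proof -
  have "norm (csol c j k t) \<le> C * (3 * R) ^ j * R ^ k * sqrt (fact (5 * k + j))"
    by (rule csol_bound) (use b R C in auto)
  also have "\<dots> \<le> C * (3 * R) ^ (i + 5) * R ^ (i + 5) * (2 ^ (i + 5) * (sqrt (fact i) * sqrt 120))"
  proof (intro mult_mono power_increasing)
    have "sqrt (fact (5 * k + j)) \<le> sqrt (fact (i + 5))" using le by (intro real_sqrt_le_mono fact_mono) simp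
    also have "\<dots> \<le> sqrt (2 ^ (i + 5) * fact i * fact 5)" by (intro real_sqrt_le_mono fact_add_le)
    also have "\<dots> = sqrt (2 ^ (i + 5)) * (sqrt (fact i) * sqrt 120)" by (simp add: real_sqrt_mult fact_numeral)
    also have "\<dots> \<le> 2 ^ (i + 5) * (sqrt (fact i) * sqrt 120)"
      by (intro mult_right_mono real_le_lsqrt) (auto simp: power2_eq_square)
    finally show "sqrt (fact (5 * k + j)) \<le> 2 ^ (i + 5) * (sqrt (fact i) * sqrt 120)" .
  qed (use le R C in auto)
  also have "\<dots> = C * ((3 * R * R) * 2) ^ (i + 5) * sqrt 120 * sqrt (fact i)"
    by (simp only: power_mult_distrib mult_ac)
  finally show ?thesis .
qed

lemma sums_shift_zero:
  fixes f :: "nat \<Rightarrow> complex"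
  assumes "(\<lambda>i. f (i + m)) sums a"
  shows "(\<lambda>j. if m \<le> j then f j else 0) sums a"
proof -
  have "(\<lambda>i. (if m \<le> i + m then f (i + m) else 0)) sums a" using assms by simp
  then have "(\<lambda>j. if m \<le> j then f j else 0) sums (a + (\<Sum>j<m. if m \<le> j then f j else 0))"
    by (subst (asm) sums_iff_shift) auto
  moreover have "(\<Sum>j<m. if m \<le> j then f j else 0) = 0" by (intro sum.neutral) auto
  ultimately show ?thesis by simp
qed

text \<open>The case \<open>H = UNIV\<close> says that the series solves the equation on the whole plane; in the case
  \<open>H = {0<..}\<close> the jump of its fourth derivative across \<open>x = 0\<close> produces the boundary term.\<close>

lemma esol_weak:
  fixes c :: "nat \<Rightarrow> nat \<Rightarrow> real \<Rightarrow> complex" and \<kappa> :: real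
  assumes c: "gevrey_data c" and T: "test_family F Ft"
    and H: "(H = UNIV \<and> \<kappa> = 0) \<or> (H = {0<..} \<and> \<kappa> = 1 \<and> (\<forall>j<4. \<forall>k t. c j k t = 0))"
  shows "(\<integral>p. (indicator H (snd p) *\<^sub>R esol c p) * complex_of_real (adj F Ft p) \<partial>lborel) =
     - of_real \<kappa> * (\<integral>t. c 4 0 t * complex_of_real (F 0 (t, 0)) \<partial>lborel)"
proof -
  note T' = test_familyD[OF T]
  have Hm[measurable]: "H \<in> sets borel" using H by auto
  have Hm2: "UNIV \<times> H \<in> sets (borel :: (real \<times> real) measure)"
    using H by (auto intro!: borel_open open_Times)
  have ind: "indicator (UNIV \<times> H) p = (indicator H (snd p) :: real)" for p :: "real \<times> real"
    by (auto simp: indicator_def mem_Times_iff)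
  have dcs: "deriv_seq (csol c j)" for j by (rule gevrey_data_csol[OF c])
  have ccs: "continuous_on UNIV (csol c j k)" for j k by (rule deriv_seq_continuous[OF dcs])
  obtain A1 M1 where A1: "0 < A1" "0 \<le> M1" "\<And>t x. \<bar>adj F Ft (t, x)\<bar> \<le> M1" "\<And>t x. A1 \<le> \<bar>t\<bar> \<or> A1 \<le> \<bar>x\<bar> \<Longrightarrow> adj F Ft (t, x) = 0"
    using box_test_bound[OF box_test_adj[OF T]] by blast
  obtain A2 M2 where A2: "0 < A2" "0 \<le> M2" "\<And>t x. \<bar>F 0 (t, x)\<bar> \<le> M2" "\<And>t x. A2 \<le> \<bar>t\<bar> \<or> A2 \<le> \<bar>x\<bar> \<Longrightarrow> F 0 (t, x) = 0"
    using box_test_bound[OF T'(1)] by blast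
  define A where "A = A1 + A2"
  define M where "M = M1 + M2"
  have A: "0 < A" "0 \<le> M" "\<And>t x. \<bar>adj F Ft (t, x)\<bar> \<le> M" "\<And>t x. A \<le> \<bar>t\<bar> \<or> A \<le> \<bar>x\<bar> \<Longrightarrow> adj F Ft (t, x) = 0"
    "\<And>t x. \<bar>F 0 (t, x)\<bar> \<le> M" "\<And>t x. A \<le> \<bar>t\<bar> \<or> A \<le> \<bar>x\<bar> \<Longrightarrow> F 0 (t, x) = 0"
    using A1 A2 by (auto simp: A_def M_def add_increasing add_increasing2)
  obtain C R where CR: "0 \<le> C" "1 \<le> R" "\<And>t j k. \<bar>t\<bar> \<le> A \<Longrightarrow> j < 5 \<Longrightarrow> norm (c j k t) \<le> C * R ^ k * (fact k)\<^sup>2"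
    using gevrey_dataE[OF c] by metis

  \<comment> \<open>The series is never differentiated term by term in x. Each term is tested on its
    own: the x-derivatives stay on the test function, and integration by parts lowers the power
    x^i.\<close>
  define w where "w i k j p = indicator H (snd p) *\<^sub>R (csol c j k (fst p) * of_real (snd p ^ i / fact i))" for i k j and p :: "real \<times> real"
  have ldw: "local_dom (w i k j)" for i k j
  proof -
    have "local_dom (\<lambda>p. indicator (UNIV \<times> H) p *\<^sub>R (csol c j k (fst p) * of_real (snd p ^ i / fact i)))"
      by (intro local_dom_restrict local_dom_continuous Hm2 continuous_intros continuous_on_compose2[OF ccs]) auto
    then show ?thesis by (simp add: w_def[abs_def] ind)
  qed
  have intw: "box_test h \<Longrightarrow> integrable lborel (\<lambda>p. w i k j p * complex_of_real (h p))" for i k j h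
    by (rule local_dom_integrable[OF ldw])
  define X where "X i m t = (\<integral>x. indicator H x *\<^sub>R complex_of_real (x ^ i / fact i * F m (t, x)) \<partial>lborel)" for i m t
  define \<beta> where "\<beta> j k i = (\<integral>t. csol c j k t * X i 0 t \<partial>lborel)" for j k i

  have wF: "(\<integral>p. w i k j p * complex_of_real (F m p) \<partial>lborel) = (\<integral>t. csol c j k t * X i m t \<partial>lborel)"
    and iX: "integrable lborel (\<lambda>t. csol c j k t * X i m t)" for i k j m
  proof -
    have e: "(\<integral>x. w i k j (t, x) * complex_of_real (F m (t, x)) \<partial>lborel) = csol c j k t * X i m t" for t
      unfolding X_def w_def by (subst integral_mult_right_zero[symmetric], intro Bochner_Integration.integral_cong) auto
    show "(\<integral>p. w i k j p * complex_of_real (F m p) \<partial>lborel) = (\<integral>t. csol c j k t * X i m t \<partial>lborel)"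
      by (subst integral_lborel_pair_iterated(1)[OF intw[OF T'(1)]]) (simp only: e)
    show "integrable lborel (\<lambda>t. csol c j k t * X i m t)"
      using integral_lborel_pair_iterated(3)[OF intw[OF T'(1)], of i k j m] by (simp only: e)
  qed

  \<comment> \<open>One integration by parts lowers the power of x and the order of the derivative
    together. A boundary value at x = 0 survives only once the power is exhausted, and only if H has
    an endpoint there, which \<kappa> records.\<close>
  have Xsuc: "X (Suc i) (Suc m) t = - X i m t" and X0: "X 0 (Suc m) t = - of_real \<kappa> * F m (t, 0)" for i m t
  proof -
    obtain B where B: "\<And>x. B \<le> \<bar>x\<bar> \<Longrightarrow> F m (t, x) = 0" using box_test_section_x(2)[OF T'(1)] by blast
    obtain B' where B': "\<And>x. B' \<le> \<bar>x\<bar> \<Longrightarrow> F (Suc m) (t, x) = 0" using box_test_section_x(2)[OF T'(1)] by blast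
    have cF: "continuous_on UNIV (\<lambda>x. F m (t, x))" for m by (rule box_test_section_x(1)[OF T'(1)])
    define g where "g x = complex_of_real (x ^ Suc i / fact (Suc i) * F m (t, x))" for x
    define g' where "g' x = complex_of_real (x ^ Suc i / fact (Suc i) * F (Suc m) (t, x)) + complex_of_real (x ^ i / fact i * F m (t, x))" for x
    have dg: "(g has_vector_derivative g' x) (at x)" for x
      unfolding g_def g'_def of_real_add[symmetric]
    proof (rule has_vector_derivative_of_real_complex)
      have "((\<lambda>x. x ^ Suc i / fact (Suc i)) has_real_derivative x ^ i / fact i) (at x)"
        by (rule derivative_eq_intros refl | simp)+
      from DERIV_mult[OF this T'(3)[of m t x]]
      show "((\<lambda>x. x ^ Suc i / fact (Suc i) * F m (t, x)) has_real_derivative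
         x ^ Suc i / fact (Suc i) * F (Suc m) (t, x) + x ^ i / fact i * F m (t, x)) (at x)"
        by (simp add: mult_ac add_ac)
    qed
    have cg: "continuous_on UNIV g'" unfolding g'_def by (intro continuous_intros cF) auto
    have zg: "g x = 0" "g' x = 0" if "max B B' \<le> \<bar>x\<bar>" for x using that B B' by (auto simp: g_def g'_def)
    note I = integral_deriv_bounded_support[of g g' "max B B'", OF dg cg zg]
    have "(\<integral>x. indicator H x *\<^sub>R g' x \<partial>lborel) = 0"
      using H
    proof
      assume "H = UNIV \<and> \<kappa> = 0" then show ?thesis using I(1) by simp
    next
      assume "H = {0<..} \<and> \<kappa> = 1 \<and> (\<forall>j<4. \<forall>k t. c j k t = 0)" then show ?thesis using I(2)[of 0] by (simp add: g_def)
    qed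
    moreover have "integrable lborel (\<lambda>x. indicator H x *\<^sub>R complex_of_real (x ^ Suc i / fact (Suc i) * F (Suc m) (t, x)))"
      by (rule integrable_mult_indicator[OF _ integrable_continuous_bounded_support[of _ B']])
         (use B' in \<open>auto intro!: continuous_intros cF simp del: fact_Suc power_Suc\<close>)
    moreover have "integrable lborel (\<lambda>x. indicator H x *\<^sub>R complex_of_real (x ^ i / fact i * F m (t, x)))"
      by (rule integrable_mult_indicator[OF _ integrable_continuous_bounded_support[of _ B]])
         (use B in \<open>auto intro!: continuous_intros cF\<close>)
    moreover have "(\<integral>x. indicator H x *\<^sub>R g' x \<partial>lborel) = (\<integral>x. indicator H x *\<^sub>R complex_of_real (x ^ Suc i / fact (Suc i) * F (Suc m) (t, x)) +
       indicator H x *\<^sub>R complex_of_real (x ^ i / fact i * F m (t, x)) \<partial>lborel)"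
      unfolding g'_def by (simp only: scaleR_add_right)
    ultimately have "X (Suc i) (Suc m) t + X i m t = 0"
      unfolding X_def by (simp only: Bochner_Integration.integral_add)
    then show "X (Suc i) (Suc m) t = - X i m t" by (simp add: eq_neg_iff_add_eq_0)
    have d0: "((\<lambda>x. complex_of_real (F m (t, x))) has_vector_derivative complex_of_real (F (Suc m) (t, x))) (at x)" for x
      by (rule has_vector_derivative_of_real_complex[OF T'(3)])
    have c0: "continuous_on UNIV (\<lambda>x. complex_of_real (F (Suc m) (t, x)))" by (intro continuous_intros cF)
    have z0: "complex_of_real (F m (t, x)) = 0" "complex_of_real (F (Suc m) (t, x)) = 0" if "max B B' \<le> \<bar>x\<bar>" for x
      using that B B' by auto
    note J = integral_deriv_bounded_support[of "\<lambda>x. complex_of_real (F m (t, x))" "\<lambda>x. complex_of_real (F (Suc m) (t, x))" "max B B'", OF d0 c0 z0]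
    show "X 0 (Suc m) t = - of_real \<kappa> * F m (t, 0)"
      using H
    proof
      assume "H = UNIV \<and> \<kappa> = 0" then show ?thesis using J(1) by (simp add: X_def)
    next
      assume "H = {0<..} \<and> \<kappa> = 1 \<and> (\<forall>j<4. \<forall>k t. c j k t = 0)" then show ?thesis using J(2)[of 0] by (simp add: X_def)
    qed
  qed
  have Xle: "X (i + m) m t = (-1) ^ m * X i 0 t" for i m t
    by (induction m) (simp_all add: Xsuc)
  have Xgt: "X j (j + Suc m) t = (-1) ^ j * (- of_real \<kappa> * F m (t, 0))" for j m t
    by (induction j) (simp_all add: Xsuc X0)

  \<comment> \<open>For m > j the power of x runs out first. On the half-line the coefficients with
    j < 4 vanish, so among m = 1, 3, 5 only m = 5 with j = 4 leaves a boundary term.\<close>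
  have csX: "csol c j 0 t * X j m t = (if m \<le> j then (-1) ^ m * (csol c j 0 t * X (j - m) 0 t) else 0) +
      (if j = 4 then - of_real \<kappa> * (csol c 4 0 t * of_real (F (m - 5) (t, 0))) * of_bool (m = 5) else 0)" if "m \<in> {1,3,5}" for j m t
  proof (cases "m \<le> j")
    case True
    then show ?thesis using Xle[of "j - m" m t] that by auto
  next
    case False
    then have e: "X j m t = (-1) ^ j * (- of_real \<kappa> * F (m - Suc j) (t, 0))" using Xgt[of j "m - Suc j" t] by simp
    show ?thesis
    proof (cases "j = 4")
      case True
      then show ?thesis using False e that by auto
    next
      case j: False
      then have "j < 4" using False that by auto
      then have "csol c j 0 t = 0 \<or> \<kappa> = 0" using H by (auto simp: csol_init)
      then show ?thesis using False j e by auto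
    qed
  qed

  have Xb: "norm (X i 0 t) \<le> M * (2 * A) * (A ^ i / fact i)" "\<bar>t\<bar> \<ge> A \<Longrightarrow> X i 0 t = 0" for i t
  proof -
    have ib: "integrable lborel (\<lambda>x. (M * (A ^ i / fact i)) * indicator {-A..A} x)" by (rule integrable_mult_indicator_Icc)
    have bd: "norm (indicator H x *\<^sub>R complex_of_real (x ^ i / fact i * F 0 (t, x))) \<le> (M * (A ^ i / fact i)) * indicator {-A..A} x" for x
    proof (cases "\<bar>x\<bar> \<le> A")
      case True
      have "norm (indicator H x *\<^sub>R complex_of_real (x ^ i / fact i * F 0 (t, x))) \<le> \<bar>x\<bar> ^ i / fact i * \<bar>F 0 (t, x)\<bar>"
        by (auto simp: indicator_def norm_mult abs_mult power_abs norm_divide norm_power)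
      also have "\<dots> \<le> A ^ i / fact i * M" using True A by (intro mult_mono divide_right_mono power_mono) auto
      finally show ?thesis using True by (auto simp: indicator_def abs_le_iff mult_ac)
    next
      case False
      then have "F 0 (t, x) = 0" using A(6)[of t x] by auto
      then show ?thesis using A by auto
    qed
    have "norm (X i 0 t) \<le> (\<integral>x. (M * (A ^ i / fact i)) * indicator {-A..A} x \<partial>lborel)"
      unfolding X_def
    proof (rule Bochner_Integration.integral_norm_bound_integral[OF _ ib bd])
      show "integrable lborel (\<lambda>x. indicator H x *\<^sub>R complex_of_real (x ^ i / fact i * F 0 (t, x)))"
        by (rule integrable_mult_indicator[OF _ integrable_continuous_bounded_support[of _ A]])
         (use A(6) in \<open>auto intro!: continuous_intros box_test_section_x(1)[OF T'(1)]\<close>)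
    qed
    then show "norm (X i 0 t) \<le> M * (2 * A) * (A ^ i / fact i)" using A(1) by (simp add: mult_ac)
    show "X i 0 t = 0" if "\<bar>t\<bar> \<ge> A" using A(6)[of t] that by (simp add: X_def)
  qed

  \<comment> \<open>A common summable majorant for all \<open>\<beta> j k i\<close> whose total
    order j + 5 k exceeds i by at most five. It makes the four series below converge separately, so
    that they can be re-indexed and recombined.\<close>
  define Q where "Q i = C * ((3 * R * R) * 2) ^ 5 * sqrt 120 * M * (2 * A) * (2 * A) * ((((3 * R * R) * 2) * A) ^ i / sqrt (fact i))" for i
  have sQ: "summable Q" unfolding Q_def by (intro summable_mult summable_power_sqrt_fact)
  have \<beta>b: "norm (\<beta> j k i) \<le> Q i" if le: "j + 5 * k \<le> i + 5" for j k i
  proof -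
    define q where "q = (C * ((3 * R * R) * 2) ^ (i + 5) * sqrt 120 * sqrt (fact i)) * (M * (2 * A) * (A ^ i / fact i))"
    have ib: "integrable lborel (\<lambda>t. q * indicator {-A..A} t)" by (rule integrable_mult_indicator_Icc)
    have "norm (\<beta> j k i) \<le> (\<integral>t. q * indicator {-A..A} t \<partial>lborel)"
      unfolding \<beta>_def
    proof (rule Bochner_Integration.integral_norm_bound_integral[OF iX ib])
      fix t :: real
      show "norm (csol c j k t * X i 0 t) \<le> q * indicator {-A..A} t"
      proof (cases "\<bar>t\<bar> \<le> A")
        case True
        have "norm (csol c j k t) \<le> C * ((3 * R * R) * 2) ^ (i + 5) * sqrt 120 * sqrt (fact i)"
          by (rule csol_bound_shift[OF _ CR(2,1) le]) (use CR(3) True in auto)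
        then have "norm (csol c j k t * X i 0 t) \<le> q"
          unfolding q_def norm_mult by (intro mult_mono Xb(1)) (use CR in auto)
        then show ?thesis using True by (auto simp: indicator_def abs_le_iff)
      next
        case False
        then show ?thesis using Xb(2)[of t i] by (auto simp: indicator_def)
      qed
    qed
    also have "\<dots> = q * (2 * A)" using A(1) by simp
    also have "\<dots> = Q i"
    proof -
      have s: "sqrt (fact i) / fact i = 1 / sqrt (fact i :: real)" by (simp add: divide_simps)
      have "q * (2 * A) = C * ((3 * R * R) * 2) ^ 5 * sqrt 120 * M * (2 * A) * (2 * A) * ((((3 * R * R) * 2) * A) ^ i * (sqrt (fact i) / fact i))"
        unfolding q_def by (simp add: power_add power_mult_distrib mult_ac)
      then show ?thesis unfolding s Q_def by simp
    qed
    finally show ?thesis .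
  qed
  have s\<beta>: "summable (\<lambda>i. \<beta> (i + m) k i)" if "m + 5 * k \<le> 5" for m k
    by (rule summable_comparison_test'[OF sQ, of 0]) (use that in \<open>auto intro!: \<beta>b\<close>)
  define a where "a m = (\<Sum>i. \<beta> (i + m) 0 i)" for m
  define a' where "a' = (\<Sum>i. \<beta> i 1 i)"
  have sa: "(\<lambda>i. \<beta> (i + m) 0 i) sums a m" if "m \<le> 5" for m
    unfolding a_def by (rule summable_sums[OF s\<beta>]) (use that in auto)
  have sa': "(\<lambda>i. \<beta> i 1 i) sums a'"
    unfolding a'_def using summable_sums[OF s\<beta>[of 0 1]] by simp
  \<comment> \<open>After re-indexing to a common power x^i the four series cancel term by term:
    this is the recursion \<open>csol_rec\<close>, the equation for the coefficient of x^i /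
    i!.\<close>
  have "(\<lambda>i. \<beta> i 1 i + \<beta> (i + 1) 0 i + \<beta> (i + 3) 0 i - \<beta> (i + 5) 0 i) sums (a' + a 1 + a 3 - a 5)"
    by (intro sums_add sums_diff sa sa') auto
  moreover have "\<beta> i 1 i + \<beta> (i + 1) 0 i + \<beta> (i + 3) 0 i - \<beta> (i + 5) 0 i = 0" for i
  proof -
    have "\<beta> (i + 5) 0 i = (\<integral>t. csol c (i + 3) 0 t * X i 0 t + csol c (i + 1) 0 t * X i 0 t + csol c i 1 t * X i 0 t \<partial>lborel)"
      unfolding \<beta>_def csol_rec by (simp add: algebra_simps)
    also have "\<dots> = \<beta> (i + 3) 0 i + \<beta> (i + 1) 0 i + \<beta> i 1 i"
      unfolding \<beta>_def by (subst Bochner_Integration.integral_add | intro iX Bochner_Integration.integrable_add | rule refl)+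
    finally show ?thesis by simp
  qed
  ultimately have "(\<lambda>i::nat. 0) sums (a' + a 1 + a 3 - a 5)" by (simp only:)
  then have azero: "a' + a 1 + a 3 - a 5 = 0" using sums_unique2 sums_zero by blast

  define bd where "bd = (\<integral>t. c 4 0 t * complex_of_real (F 0 (t, 0)) \<partial>lborel)"
  have csXint: "(\<integral>t. csol c j 0 t * X j m t \<partial>lborel) = (-1) ^ m * (if m \<le> j then \<beta> j 0 (j - m) else 0) +
      (if j = 4 then - of_real \<kappa> * bd * of_bool (m = 5) else 0)" if m: "m \<in> {1,3,5}" for j m
  proof -
    have c4: "csol c 4 0 t = c 4 0 t" for t by (simp add: csol_init)
    have b4: "bd = (\<integral>t. csol c 4 0 t * complex_of_real (F 0 (t, 0)) \<partial>lborel)" by (simp add: bd_def c4)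
    consider "m \<le> j" "j \<noteq> 4 \<or> m \<noteq> 5" | "\<not> m \<le> j" "j = 4" "m = 5" | "\<not> m \<le> j" "j \<noteq> 4" | "m \<le> j" "j = 4" "m = 5"
      using m by force
    then show ?thesis
    proof cases
      case 1
      then have "(\<lambda>t. csol c j 0 t * X j m t) = (\<lambda>t. (-1) ^ m * (csol c j 0 t * X (j - m) 0 t))"
        using csX[OF m, of j] by (auto simp: fun_eq_iff)
      then show ?thesis using 1 by (auto simp: \<beta>_def)
    next
      case 2
      then have "(\<lambda>t. csol c j 0 t * X j m t) = (\<lambda>t. - of_real \<kappa> * (csol c 4 0 t * complex_of_real (F 0 (t, 0))))"
        using csX[OF m, of j] by (auto simp: fun_eq_iff)
      then show ?thesis using 2 by (simp add: b4)
    next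
      case 3
      then have "(\<lambda>t. csol c j 0 t * X j m t) = (\<lambda>t. 0)"
        using csX[OF m, of j] by (auto simp: fun_eq_iff)
      then show ?thesis using 3 by simp
    qed auto
  qed

  have tm: "(\<integral>p. w j 0 j p * complex_of_real (adj F Ft p) \<partial>lborel) =
     \<beta> j 1 j + (if 1 \<le> j then \<beta> j 0 (j - 1) else 0) + (if 3 \<le> j then \<beta> j 0 (j - 3) else 0) - (if 5 \<le> j then \<beta> j 0 (j - 5) else 0)
       + (if j = 4 then - of_real \<kappa> * bd else 0)" for j
  proof -
    have t1: "(\<integral>p. w j 0 j p * complex_of_real (Ft p) \<partial>lborel) = - \<beta> j 1 j"
    proof -
      have e: "(\<integral>t. w j 0 j (t, x) * complex_of_real (Ft (t, x)) \<partial>lborel) = - (\<integral>t. w j 1 j (t, x) * complex_of_real (F 0 (t, x)) \<partial>lborel)" for x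
      proof -
        define g where "g t = csol c j 0 t * complex_of_real (F 0 (t, x))" for t
        define g' where "g' t = csol c j 0 t * complex_of_real (Ft (t, x)) + csol c j 1 t * complex_of_real (F 0 (t, x))" for t
        obtain B where B: "\<And>t. B \<le> \<bar>t\<bar> \<Longrightarrow> F 0 (t, x) = 0" using box_test_section_t(2)[OF T'(1)] by blast
        obtain B' where B': "\<And>t. B' \<le> \<bar>t\<bar> \<Longrightarrow> Ft (t, x) = 0" using box_test_section_t(2)[OF T'(2)] by blast
        have cF: "continuous_on UNIV (\<lambda>t. F 0 (t, x))" "continuous_on UNIV (\<lambda>t. Ft (t, x))" by (rule box_test_section_t(1)[OF T'(1)] box_test_section_t(1)[OF T'(2)])+
        have dg: "(g has_vector_derivative g' t) (at t)" for t
          unfolding g_def g'_def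
          using has_vector_derivative_mult[OF deriv_seqD[OF dcs, of j 0 t] has_vector_derivative_of_real_complex[OF T'(4)[of x t]]]
          by simp
        have "(\<integral>t. g' t \<partial>lborel) = 0"
          by (rule integral_deriv_bounded_support(1)[of g g' "max B B'", OF dg])
             (use B B' in \<open>auto simp: g_def g'_def intro!: continuous_intros ccs cF\<close>)
        moreover have "integrable lborel (\<lambda>t. csol c j 0 t * complex_of_real (Ft (t, x)))"
          by (rule integrable_continuous_bounded_support[of _ B']) (use B' in \<open>auto intro!: continuous_intros ccs cF\<close>)
        moreover have "integrable lborel (\<lambda>t. csol c j 1 t * complex_of_real (F 0 (t, x)))"
          by (rule integrable_continuous_bounded_support[of _ B]) (use B in \<open>auto intro!: continuous_intros ccs cF\<close>)
        ultimately have z: "(\<integral>t. csol c j 0 t * complex_of_real (Ft (t, x)) \<partial>lborel) = - (\<integral>t. csol c j 1 t * complex_of_real (F 0 (t, x)) \<partial>lborel)"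
          unfolding g'_def by (simp add: eq_neg_iff_add_eq_0)
        have "w j k j (t, x) * y = (of_real (indicator H x * (x ^ j / fact j))) * (csol c j k t * y)" for t y k
          by (auto simp: w_def indicator_def)
        then show ?thesis using z by (simp only: integral_mult_right_zero mult_minus_right)
      qed
      have "(\<integral>p. w j 0 j p * complex_of_real (Ft p) \<partial>lborel) = (\<integral>x. - (\<integral>t. w j 1 j (t, x) * complex_of_real (F 0 (t, x)) \<partial>lborel) \<partial>lborel)"
        by (subst integral_lborel_pair_iterated(2)[OF intw[OF T'(2)]]) (simp only: e)
      also have "\<dots> = - (\<integral>p. w j 1 j p * complex_of_real (F 0 p) \<partial>lborel)"
        by (subst integral_lborel_pair_iterated(2)[OF intw[OF T'(1)]]) simp
      finally show ?thesis unfolding wF \<beta>_def .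
    qed
    have "(\<integral>p. w j 0 j p * complex_of_real (adj F Ft p) \<partial>lborel) = (\<integral>p. - (w j 0 j p * complex_of_real (Ft p)) - w j 0 j p * complex_of_real (F 1 p)
       - w j 0 j p * complex_of_real (F 3 p) + w j 0 j p * complex_of_real (F 5 p) \<partial>lborel)"
      by (intro Bochner_Integration.integral_cong) (auto simp: adj_def algebra_simps)
    also have "\<dots> = - (\<integral>p. w j 0 j p * complex_of_real (Ft p) \<partial>lborel) - (\<integral>p. w j 0 j p * complex_of_real (F 1 p) \<partial>lborel)
       - (\<integral>p. w j 0 j p * complex_of_real (F 3 p) \<partial>lborel) + (\<integral>p. w j 0 j p * complex_of_real (F 5 p) \<partial>lborel)"
      using intw[OF T'(1)] intw[OF T'(2)] by simp
    also have "\<dots> = \<beta> j 1 j + (if 1 \<le> j then \<beta> j 0 (j - 1) else 0) + (if 3 \<le> j then \<beta> j 0 (j - 3) else 0) - (if 5 \<le> j then \<beta> j 0 (j - 5) else 0)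
       + (if j = 4 then - of_real \<kappa> * bd else 0)"
      unfolding t1 wF by (subst (1 2 3) csXint) auto
    finally show ?thesis .
  qed

  \<comment> \<open>The partial sums are dominated on the box supporting the test function by the
    convergent majorant of \<open>esol_term_bound\<close>, so summation and pairing commute.\<close>
  have "(\<lambda>j. \<integral>p. w j 0 j p * complex_of_real (adj F Ft p) \<partial>lborel) sums (\<integral>p. (\<Sum>j. w j 0 j p * complex_of_real (adj F Ft p)) \<partial>lborel)"
  proof (rule sums_integral[OF intw[OF box_test_adj[OF T]]])
    let ?Q = "\<lambda>j. C * ((3 * R * A) ^ j / sqrt (fact j)) * M"
    have sQ': "summable ?Q" by (intro summable_mult summable_mult2 summable_power_sqrt_fact)
    have bd: "norm (w j 0 j p * complex_of_real (adj F Ft p)) \<le> ?Q j * indicator ({-A..A} \<times> {-A..A}) p" for j p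
    proof -
      obtain t x where p: "p = (t, x)" by force
      show ?thesis
      proof (cases "\<bar>t\<bar> \<le> A \<and> \<bar>x\<bar> \<le> A")
        case True
        have "norm (w j 0 j p) \<le> norm (esol_term c j (t, x))" by (auto simp: p w_def esol_term_def indicator_def)
        also have "\<dots> \<le> C * ((3 * R * A) ^ j / sqrt (fact j))" by (rule esol_term_bound) (use CR True in auto)
        finally have "norm (w j 0 j p * complex_of_real (adj F Ft p)) \<le> ?Q j"
          unfolding norm_mult by (intro mult_mono) (use A(3)[of t x] CR A p in auto)
        then show ?thesis using True by (auto simp: p indicator_def abs_le_iff)
      next
        case False
        then have "adj F Ft p = 0" using A(4)[of t x] by (auto simp: p)
        then show ?thesis using CR A by (auto simp: indicator_def)
      qed
    qed
    have le: "norm (w j 0 j p * complex_of_real (adj F Ft p)) \<le> ?Q j" for j p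
      using bd[of j p] CR A by (auto simp: indicator_def split: if_splits intro: order_trans)
    show "AE p in lborel. summable (\<lambda>j. norm (w j 0 j p * complex_of_real (adj F Ft p)))"
      by (rule AE_I2, rule summable_comparison_test'[OF sQ', of 0]) (use le in auto)
    have ibox: "integrable lborel (\<lambda>p. indicator ({-A..A} \<times> {-A..A}) p :: real)"
      by (intro integrable_real_indicator emeasure_bounded_finite bounded_Times bounded_closed_interval)
         (auto intro!: borel_closed closed_Times)
    show "summable (\<lambda>j. \<integral>p. norm (w j 0 j p * complex_of_real (adj F Ft p)) \<partial>lborel)"
    proof (rule summable_comparison_test'[of "\<lambda>j. ?Q j * (\<integral>p. indicator ({-A..A} \<times> {-A..A}) p \<partial>lborel)" 0])
      show "summable (\<lambda>j. ?Q j * (\<integral>p. indicator ({-A..A} \<times> {-A..A}) p \<partial>(lborel :: (real \<times> real) measure)))"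
        by (intro summable_mult2 sQ')
      fix j
      have "(\<integral>p. norm (w j 0 j p * complex_of_real (adj F Ft p)) \<partial>lborel) \<le> (\<integral>p. ?Q j * indicator ({-A..A} \<times> {-A..A}) p \<partial>lborel)"
        by (intro integral_mono integrable_norm intw[OF box_test_adj[OF T]] integrable_mult_right ibox bd)
      then show "norm (\<integral>p. norm (w j 0 j p * complex_of_real (adj F Ft p)) \<partial>lborel) \<le> ?Q j * (\<integral>p. indicator ({-A..A} \<times> {-A..A}) p \<partial>lborel)"
        by simp
    qed
  qed
  moreover have "(\<lambda>j. \<integral>p. w j 0 j p * complex_of_real (adj F Ft p) \<partial>lborel) sums (a' + a 1 + a 3 - a 5 + (- of_real \<kappa> * bd))"
    unfolding tm
  proof (intro sums_add sums_diff sa')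
    show "(\<lambda>j. if 1 \<le> j then \<beta> j 0 (j - 1) else 0) sums a 1" by (rule sums_shift_zero) (use sa[of 1] in simp)
    show "(\<lambda>j. if 3 \<le> j then \<beta> j 0 (j - 3) else 0) sums a 3" by (rule sums_shift_zero) (use sa[of 3] in simp)
    show "(\<lambda>j. if 5 \<le> j then \<beta> j 0 (j - 5) else 0) sums a 5" by (rule sums_shift_zero) (use sa[of 5] in simp)
    show "(\<lambda>j. if j = 4 then - of_real \<kappa> * bd else 0) sums (- of_real \<kappa> * bd)" by (rule sums_single)
  qed
  ultimately have "(\<integral>p. (\<Sum>j. w j 0 j p * complex_of_real (adj F Ft p)) \<partial>lborel) = - of_real \<kappa> * bd"
  proof -
    assume "(\<lambda>j. \<integral>p. w j 0 j p * complex_of_real (adj F Ft p) \<partial>lborel) sums (\<integral>p. (\<Sum>j. w j 0 j p * complex_of_real (adj F Ft p)) \<partial>lborel)"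
      "(\<lambda>j. \<integral>p. w j 0 j p * complex_of_real (adj F Ft p) \<partial>lborel) sums (a' + a 1 + a 3 - a 5 + (- of_real \<kappa> * bd))"
    from sums_unique2[OF this] show ?thesis unfolding azero by simp
  qed
  moreover have "(\<Sum>j. w j 0 j p * complex_of_real (adj F Ft p)) = (indicator H (snd p) *\<^sub>R esol c p) * complex_of_real (adj F Ft p)" for p
  proof (cases "\<bar>fst p\<bar> \<le> A")
    case True
    have s: "summable (\<lambda>j. esol_term c j p)"
      using esol_bound(2)[of c "fst p" C R "snd p" "\<bar>snd p\<bar>"] CR True by (auto intro: summable_norm_cancel)
    have e: "w j 0 j p * complex_of_real (adj F Ft p) = (of_real (indicator H (snd p)) * complex_of_real (adj F Ft p)) * esol_term c j p" for j
      by (auto simp: w_def esol_term_def indicator_def)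
    show ?thesis unfolding esol_def e suminf_mult[OF s] by (simp add: scaleR_conv_of_real mult_ac)
  next
    case False
    then have "adj F Ft p = 0" using A(4)[of "fst p" "snd p"] by auto
    then show ?thesis by simp
  qed
  ultimately show ?thesis by (simp add: bd_def)
qed

section \<open>A fundamental solution of short duration\<close>

lemma integrable_has_integral_nonneg:
  fixes f :: "real \<Rightarrow> real"
  assumes [measurable]: "f \<in> borel_measurable borel" and "\<And>x. 0 \<le> f x" and "(f has_integral I) UNIV"
  shows "integrable lborel f"
proof (rule integrableI_nonneg)
  show "(\<integral>\<^sup>+ x. ennreal (f x) \<partial>lborel) < \<infinity>"
    using nn_integral_has_integral_lborel[OF assms] by simp
qed (use assms in auto)

text \<open>The model of every time singularity below. Squaring doubles the exponent, so square
  integrability needs a < 1/2; the exponents 1/3 and 2/5 used later respect this.\<close>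

definition sing :: "real \<Rightarrow> real \<Rightarrow> real" where
  "sing a t = (if 0 < t \<and> t \<le> 1 then t powr (- a) else 0)"

lemma sing_nonneg: "0 \<le> sing a t" by (simp add: sing_def)

lemma measurable_sing [measurable]: "sing a \<in> borel_measurable borel"
  unfolding sing_def[abs_def] by measurable

lemma integrable_sing: "a < 1 \<Longrightarrow> integrable lborel (sing a)"
proof -
  assume a: "a < 1"
  have "((\<lambda>x. x powr (- a)) has_integral (1 powr (- a + 1) / (- a + 1))) {0..1}"
    using a by (intro has_integral_powr_from_0) auto
  then have "((\<lambda>x. if x \<in> {0..1} then x powr (- a) else 0) has_integral (1 powr (- a + 1) / (- a + 1))) UNIV"
    by (subst has_integral_restrict_UNIV)
  moreover have "(\<lambda>x. if x \<in> {0..1} then x powr (- a) else 0) = sing a"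
    by (auto simp: sing_def fun_eq_iff)
  ultimately show ?thesis by (intro integrable_has_integral_nonneg[of _ "1 powr (- a + 1) / (- a + 1)"]) (auto simp: sing_nonneg)
qed

text \<open>The exponent 1/3 has to serve two purposes: |\<xi>|^(-4/3) is integrable at infinity,
  and the matching time factor t^(-1/3) is square integrable at 0. Any exponent strictly between 1/4
  and 1/2 has both properties.\<close>

definition decay :: "real \<Rightarrow> real" where "decay \<xi> = (1 + \<xi> ^ 4) powr (- 1/3)"

lemma one_plus_pow4: "1 \<le> 1 + (\<xi>::real) ^ 4" by simp

lemma decay_pos: "0 < decay \<xi>"
proof -
  have "1 + \<xi> ^ 4 \<noteq> 0" using one_plus_pow4[of \<xi>] by linarith
  then show ?thesis by (simp add: decay_def)
qed

lemma integrable_decay: "integrable lborel decay"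
proof -
  define f where "f x = (if x \<in> {1..} then x powr (-4/3) else 0)" for x :: real
  have "((\<lambda>x::real. x powr (-4/3)) has_integral -(1 powr (-4/3+1)) / (-4/3+1)) {1..}"
    by (rule has_integral_powr_to_inf) auto
  then have h: "(f has_integral -(1 powr (-4/3+1)) / (-4/3+1)) UNIV"
    unfolding f_def by (subst has_integral_restrict_UNIV)
  have [measurable]: "f \<in> borel_measurable borel" unfolding f_def by measurable
  have i: "integrable lborel f" by (rule integrable_has_integral_nonneg[OF _ _ h]) (auto simp: f_def)
  have i': "integrable lborel (\<lambda>x. f (0 + (-1) * x))" by (rule lborel_integrable_real_affine[OF i]) simp
  have i1: "integrable lborel (\<lambda>x::real. 1 * indicator {-1..1} x :: real)" by (rule integrable_mult_indicator_Icc)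
  have "integrable lborel (\<lambda>x. (1 * indicator {-1..1} x + f x) + f (0 + (-1) * x))"
    by (intro Bochner_Integration.integrable_add i i' i1)
  then show ?thesis
  proof (rule Bochner_Integration.integrable_bound)
    show "decay \<in> borel_measurable lborel" unfolding decay_def[abs_def] by measurable
    have pw: "(1 + \<xi> ^ 4) powr (- 1/3) \<le> \<xi> powr (-4/3)" if "1 \<le> \<xi>" for \<xi> :: real
    proof -
      have "\<xi> powr (-4/3) = (\<xi> ^ 4) powr (-1/3)" 
        using that powr_numeral[of \<xi> "num.Bit0 (num.Bit0 num.One)"] powr_powr[of \<xi> 4 "-1/3"] by simp
      then show ?thesis using that by (simp add: powr_mono2')
    qed
    have "norm (decay \<xi>) \<le> (1 * indicator {-1..1} \<xi> + f \<xi>) + f (0 + (-1) * \<xi>)" for \<xi>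
    proof -
      consider "1 \<le> \<xi>" | "1 \<le> - \<xi>" | "\<xi> \<in> {-1..1}" by fastforce
      then show ?thesis
      proof cases
        case 1 then show ?thesis using pw[of \<xi>] decay_pos[of \<xi>] by (auto simp: decay_def f_def indicator_def)
      next
        case 2 then show ?thesis using pw[of "- \<xi>"] decay_pos[of \<xi>] by (auto simp: decay_def f_def indicator_def)
      next
        case 3
        have "decay \<xi> \<le> 1" using powr_mono2'[of "-1/3" 1 "1 + \<xi> ^ 4"] by (simp add: decay_def)
        then show ?thesis using 3 decay_pos[of \<xi>] by (auto simp: f_def)
      qed
    qed
    then show "AE \<xi> in lborel. norm (decay \<xi>) \<le> norm ((1 * indicator {-1..1} \<xi> + f \<xi>) + f (0 + (-1) * \<xi>))"
      by (intro AE_I2) (smt (verit) real_norm_def)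
  qed
qed

lemma AE_fst_neq: "AE p in (lborel :: (real \<times> real) measure). fst p \<noteq> a"
proof (rule AE_I[where N="{a} \<times> UNIV"])
  have "emeasure (lborel \<Otimes>\<^sub>M lborel) ({a} \<times> (UNIV :: real set)) = emeasure lborel {a} * emeasure lborel (UNIV :: real set)"
    by (rule lborel.emeasure_pair_measure_Times) auto
  then show "emeasure (lborel :: (real \<times> real) measure) ({a} \<times> UNIV) = 0" by (simp add: lborel_prod)
  show "{a} \<times> UNIV \<in> sets (lborel :: (real \<times> real) measure)" by (simp add: borel_closed closed_Times)
qed auto

section \<open>Plane waves on the line of imaginary part one\<close>

lemma Im_omega_shift: "Im (omega (of_real \<xi> + \<i>)) = 5 * \<xi> ^ 4 - 7 * \<xi>\<^sup>2 - 1"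
  unfolding omega_def by (simp add: power_numeral_reduce algebra_simps power2_eq_square power4_eq_xxxx)

text \<open>On this line a plane wave decays forward in time as if the equation were parabolic of
  order four, up to a factor exp(14 t). The constant 14 is what completing the square in \<xi>^4 - 7
  \<xi>^2 + 13 leaves.\<close>

lemma Im_omega_shift_ge: "4 * \<xi> ^ 4 - 14 \<le> Im (omega (of_real \<xi> + \<i>))"
proof -
  have "0 \<le> (\<xi>\<^sup>2 - 7/2)\<^sup>2 + 3/4" by simp
  also have "(\<xi>\<^sup>2 - 7/2)\<^sup>2 + 3/4 = \<xi> ^ 4 - 7 * \<xi>\<^sup>2 + 13" by (simp add: power2_eq_square power4_eq_xxxx algebra_simps)
  finally show ?thesis unfolding Im_omega_shift by simp
qed

lemma norm_shift: "norm (of_real \<xi> + \<i>) ^ 2 = 1 + \<xi>\<^sup>2" "1 \<le> norm (of_real \<xi> + \<i>)"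
  by (auto simp: cmod_def)

lemma one_plus_sq_le: "(1 + (\<xi>::real)\<^sup>2)\<^sup>2 \<le> 2 * (1 + \<xi> ^ 4)"
proof -
  have "0 \<le> (1 - \<xi>\<^sup>2)\<^sup>2" by simp
  then show ?thesis by (simp add: power2_eq_square power4_eq_xxxx algebra_simps)
qed

text \<open>The square on the right is deliberately generous: its k-th power, weighed against an
  exponential in 1 + \<xi>^4, produces (2 k)!, which is Gevrey class two like the cutoff.\<close>

lemma norm_omega_shift_le: "norm (omega (of_real \<xi> + \<i>)) \<le> 12 * (1 + \<xi> ^ 4)\<^sup>2"
proof -
  let ?r = "norm (of_real \<xi> + \<i>)"
  have "norm (omega (of_real \<xi> + \<i>)) \<le> ?r ^ 5 + ?r ^ 3 + ?r ^ 1"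
    unfolding omega_def using order_trans[OF norm_triangle_ineq4 add_mono[OF norm_triangle_ineq order_refl]]
    by (metis norm_power power_one_right)
  also have "\<dots> \<le> ?r ^ 8 + ?r ^ 8 + ?r ^ 8"
    using norm_shift(2)[of \<xi>] by (intro add_mono power_increasing) auto
  also have "\<dots> = 3 * ((?r ^ 2) ^ 2) ^ 2" by (simp flip: power_mult)
  also have "\<dots> = 3 * ((1 + \<xi>\<^sup>2)\<^sup>2)\<^sup>2" by (simp only: norm_shift(1))
  also have "\<dots> \<le> 3 * (2 * (1 + \<xi> ^ 4))\<^sup>2" by (intro mult_left_mono power_mono one_plus_sq_le) auto
  also have "\<dots> = 12 * (1 + \<xi> ^ 4)\<^sup>2" by (simp only: power_mult_distrib) simp
  finally show ?thesis .
qed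

text \<open>With y = t \<xi>^4, exp(- y) \<le> 1 / (1 + y) \<le> (1 + y)^(-1/3), and 1 + y dominates
  t (1 + \<xi>^4) for t \<le> 1. The result separates t from \<xi>, the form that
  \<open>superposition\<close> asks for.\<close>

lemma exp_quartic_decay:
  assumes "0 < t" and that: "t \<le> 1"
  shows "exp (- (4 * t * \<xi> ^ 4)) \<le> t powr (- 1/3) * decay \<xi>"
proof -
  define y where "y = t * \<xi> ^ 4"
  have y: "0 \<le> y" using assms by (simp add: y_def)
  have "exp (- (4 * t * \<xi> ^ 4)) \<le> exp (- y)" using y by (simp add: y_def)
  also have "\<dots> \<le> (1 + y) powr (- 1)"
    using exp_ge_add_one_self[of y] y by (simp add: exp_minus powr_minus le_imp_inverse_le)
  also have "\<dots> \<le> (1 + y) powr (- 1/3)" using y by (intro powr_mono) auto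
  also have "\<dots> \<le> (t * (1 + \<xi> ^ 4)) powr (- 1/3)"
  proof (rule powr_mono2')
    show "0 < t * (1 + \<xi> ^ 4)" using assms one_plus_pow4[of \<xi>] by (intro mult_pos_pos) linarith+
    show "t * (1 + \<xi> ^ 4) \<le> 1 + y" using that by (simp add: y_def algebra_simps)
  qed simp
  also have "\<dots> = t powr (- 1/3) * decay \<xi>"
    using assms one_plus_pow4[of \<xi>] by (simp add: decay_def powr_mult)
  finally show ?thesis .
qed

text \<open>(1 + \<xi>^2)^2 is the size of z^4 for z = \<xi> + i, the largest factor among the five
  Cauchy data of a plane wave on x = 0.\<close>

lemma exp_quartic_moment:
  assumes b: "0 < b" "b \<le> 1"
  shows "(1 + \<xi>\<^sup>2)\<^sup>2 * exp (- (2 * b * \<xi> ^ 4)) \<le> (4 * exp 2 / (2 * b)\<^sup>2) * decay \<xi>"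
proof -
  define y where "y = 1 + \<xi> ^ 4"
  have y: "1 \<le> y" by (simp add: y_def)
  have "(2 * b * y)\<^sup>2 * exp (- (2 * b * y)) \<le> fact 2" using y b by (intro power_exp_le_fact) auto
  then have "y\<^sup>2 * exp (- (2 * b * y)) \<le> 2 / (2 * b)\<^sup>2" using b by (simp add: field_simps power_mult_distrib fact_2)
  then have "2 * exp 2 * (y\<^sup>2 * exp (- (2 * b * y))) \<le> 2 * exp 2 * (2 / (2 * b)\<^sup>2)" by (intro mult_left_mono) auto
  moreover have "exp (- (2 * b * \<xi> ^ 4)) \<le> exp 2 * exp (- (2 * b * y))"
    using b by (simp add: y_def algebra_simps flip: exp_add)
  moreover have "1 \<le> y * y powr (-1/3)"
  proof -
    have "1 \<le> y powr (1 + -1/3)" using y by (intro ge_one_powr_ge_zero) auto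
    then show ?thesis using y by (simp add: powr_mult_base)
  qed
  ultimately have "(1 + \<xi>\<^sup>2)\<^sup>2 * exp (- (2 * b * \<xi> ^ 4)) \<le> (2 * y) * (exp 2 * exp (- (2 * b * y))) * (y * y powr (-1/3))"
  proof -
    have "(1 + \<xi>\<^sup>2)\<^sup>2 * exp (- (2 * b * \<xi> ^ 4)) * 1 \<le> (2 * y) * (exp 2 * exp (- (2 * b * y))) * (y * y powr (-1/3))"
      using one_plus_sq_le[of \<xi>] y \<open>1 \<le> y * y powr (-1/3)\<close> \<open>exp (- (2 * b * \<xi> ^ 4)) \<le> exp 2 * exp (- (2 * b * y))\<close>
      by (intro mult_mono) (auto simp: y_def)
    then show ?thesis by simp
  qed
  also have "\<dots> = (2 * exp 2 * (y\<^sup>2 * exp (- (2 * b * y)))) * y powr (-1/3)" by (simp add: power2_eq_square)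
  also have "\<dots> \<le> (2 * exp 2 * (2 / (2 * b)\<^sup>2)) * y powr (-1/3)"
    using \<open>2 * exp 2 * (y\<^sup>2 * exp (- (2 * b * y))) \<le> 2 * exp 2 * (2 / (2 * b)\<^sup>2)\<close> by (intro mult_right_mono) auto
  finally show ?thesis by (simp add: decay_def y_def)
qed

section \<open>Plane waves as power series\<close>

lemma csol_plane:
  assumes "\<And>j k. j < 5 \<Longrightarrow> c j k t = (\<i> * z) ^ j * ((\<i> * omega z) ^ k * E)"
  shows "csol c j k t = (\<i> * z) ^ j * ((\<i> * omega z) ^ k * E)"
proof (induction j arbitrary: k rule: csol_induct)
  case (init j) then show ?case using assms by (simp add: csol_init)
next
  case (rec j)
  have "(\<i> * z) ^ 5 = (\<i> * z) ^ 3 + (\<i> * z) + \<i> * omega z"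
    by (simp add: omega_def power_mult_distrib power_numeral_reduce algebra_simps)
  then have "(\<i> * z) ^ (j + 5) = (\<i> * z) ^ (j + 3) + (\<i> * z) ^ (j + 1) + (\<i> * z) ^ j * (\<i> * omega z)"
    by (simp only: power_add distrib_left power_one_right)
  then show ?case unfolding csol_rec rec by (simp add: algebra_simps)
qed

text \<open>The x-derivatives of a plane wave at x = 0 obey the recursion since (iz)^5 = (iz)^3 + iz
  + i \<open>omega z\<close>. The series at time t sees the data and their derivatives at time t
  only, so it reproduces the wave at every time where the data do.\<close>

lemma esol_plane:
  assumes "\<And>j k. j < 5 \<Longrightarrow> c j k t = (\<i> * z) ^ j * ((\<i> * omega z) ^ k * exp (\<i> * omega z * of_real t))"
  shows "esol c (t, x) = plane_wave z (t, x)"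
proof -
  have "(\<lambda>j. exp (\<i> * omega z * of_real t) * ((\<i> * z * of_real x) ^ j /\<^sub>R fact j)) sums (exp (\<i> * omega z * of_real t) * exp (\<i> * z * of_real x))"
    by (intro sums_mult exp_converges)
  moreover have "exp (\<i> * omega z * of_real t) * ((\<i> * z * of_real x) ^ j /\<^sub>R fact j) = esol_term c j (t, x)" for j
  proof -
    have "csol c j 0 t = (\<i> * z) ^ j * ((\<i> * omega z) ^ 0 * exp (\<i> * omega z * of_real t))"
      by (rule csol_plane) (rule assms)
    then show ?thesis
      unfolding esol_term_def fst_conv snd_conv
      by (simp only: power_mult_distrib scaleR_conv_of_real divide_inverse of_real_mult of_real_power of_real_inverse power_0 mult_1_left mult_ac)
  qed
  ultimately show ?thesis unfolding esol_def plane_wave_def by (simp add: sums_iff)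
qed

lemma deriv_seq_exp: "deriv_seq (\<lambda>k t. a ^ k * exp (a * of_real t))"
  unfolding deriv_seq_def
proof (intro allI)
  fix k t
  have "((\<lambda>t::real. exp (a * of_real t)) has_vector_derivative a * exp (a * of_real t)) (at t)"
    by (rule has_vector_derivative_real_field) (auto intro!: derivative_eq_intros)
  then have "((\<lambda>t::real. a ^ k * exp (a * of_real t)) has_vector_derivative a ^ k * (a * exp (a * of_real t))) (at t)"
    by (rule has_vector_derivative_mult_right)
  then show "((\<lambda>t::real. a ^ k * exp (a * of_real t)) has_vector_derivative a ^ Suc k * exp (a * of_real t)) (at t)"
    by (simp add: mult_ac)
qed

lemma deriv_seq_cmult: "deriv_seq D \<Longrightarrow> deriv_seq (\<lambda>k t. a * D k t)"
  unfolding deriv_seq_def by (auto intro!: has_vector_derivative_mult_right)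

lemma esol_zero: "(\<And>j k. j < 5 \<Longrightarrow> c j k t = 0) \<Longrightarrow> esol c (t, x) = 0"
  using esol_bound(1)[of c t 0 1 x "\<bar>x\<bar>"] by simp

lemma leibniz_seq_const1:
  assumes "D 0 t = 1" "\<And>k. 0 < k \<Longrightarrow> D k t = 0"
  shows "leibniz_seq D E k t = E k t"
proof -
  have "(\<Sum>l\<le>k. of_nat (k choose l) * (D l t * E (k - l) t)) = (\<Sum>l\<in>{0}. of_nat (k choose l) * (D l t * E (k - l) t))"
    by (rule sum.mono_neutral_right) (use assms in auto)
  then show ?thesis using assms by (simp add: leibniz_seq_def)
qed

text \<open>The decay exp(- 4 b \<xi>^4) is split in two. With y = 1 + \<xi>^4, one half pays for k
  time derivatives through (2 b y)^(2 k) exp(- 2 b y) \<le> (2 k)!; the other half stays available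
  for the integration over \<xi>. The exponent 16 bounds 14 + 2 b.\<close>

lemma exp_wave_bound:
  fixes \<xi> :: real
  assumes b: "0 < b" "b \<le> t" "t \<le> 1"
  defines "a \<equiv> \<i> * omega (of_real \<xi> + \<i>)"
  shows "norm (a ^ k * exp (a * of_real t)) \<le> (exp 16 * exp (- (2 * b * \<xi> ^ 4))) * (12 / b\<^sup>2) ^ k * (fact k)\<^sup>2"
proof -
  define y where "y = 1 + \<xi> ^ 4"
  have y: "1 \<le> y" "0 \<le> \<xi> ^ 4" by (auto simp: y_def)
  have "norm (exp (a * of_real t)) = exp (- t * Im (omega (of_real \<xi> + \<i>)))"
    by (simp add: a_def norm_exp_eq_Re)
  also have "\<dots> \<le> exp (14 - 4 * b * \<xi> ^ 4)"
  proof -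
    have "t * (4 * \<xi> ^ 4 - 14) \<le> t * Im (omega (of_real \<xi> + \<i>))" using b by (intro mult_left_mono Im_omega_shift_ge) auto
    moreover have "b * (4 * \<xi> ^ 4) \<le> t * (4 * \<xi> ^ 4)" using b y by (intro mult_right_mono) auto
    moreover have "t * 14 \<le> 14" using b by simp
    ultimately show ?thesis by (simp add: algebra_simps)
  qed
  finally have e: "norm (exp (a * of_real t)) \<le> exp (14 - 4 * b * \<xi> ^ 4)" .
  have "norm a \<le> 12 * y\<^sup>2" using norm_omega_shift_le[of \<xi>] by (simp add: a_def norm_mult y_def)
  then have "norm (a ^ k * exp (a * of_real t)) \<le> (12 * y\<^sup>2) ^ k * exp (14 - 4 * b * \<xi> ^ 4)"
    unfolding norm_mult norm_power by (intro mult_mono power_mono e) auto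
  also have "exp (14 - 4 * b * \<xi> ^ 4) = exp (14 + 2 * b) * exp (- (2 * b * \<xi> ^ 4)) * exp (- (2 * b * y))"
    by (simp add: y_def algebra_simps flip: exp_add)
  also have "(12 * y\<^sup>2) ^ k * (exp (14 + 2 * b) * exp (- (2 * b * \<xi> ^ 4)) * exp (- (2 * b * y))) =
      (exp (14 + 2 * b) * exp (- (2 * b * \<xi> ^ 4))) * (12 / (2 * b)\<^sup>2) ^ k * ((2 * b * y) ^ (2 * k) * exp (- (2 * b * y)))"
  proof -
    have gen: "(12 * y\<^sup>2) ^ k * (u * v * w) = (u * v) * (12 / q\<^sup>2) ^ k * ((q * y) ^ (2 * k) * w)" if "0 < q" for q u v w :: real
      using that by (simp add: power_mult_distrib power_divide power_mult[symmetric])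
    show ?thesis by (rule gen) (use b in simp)
  qed
  also have "\<dots> \<le> (exp (14 + 2 * b) * exp (- (2 * b * \<xi> ^ 4))) * (12 / (2 * b)\<^sup>2) ^ k * (4 ^ k * (fact k)\<^sup>2)"
    using b y by (intro mult_left_mono order_trans[OF power_exp_le_fact fact_double_le]) auto
  also have "\<dots> = (exp (14 + 2 * b) * exp (- (2 * b * \<xi> ^ 4))) * ((12 / (2 * b)\<^sup>2) * 4) ^ k * (fact k)\<^sup>2"
    by (simp only: power_mult_distrib mult_ac)
  also have "(12 / (2 * b)\<^sup>2) * 4 = 12 / b\<^sup>2" using b by (simp add: power_mult_distrib)
  also have "(exp (14 + 2 * b) * exp (- (2 * b * \<xi> ^ 4))) * (12 / b\<^sup>2) ^ k * (fact k)\<^sup>2 \<le> (exp 16 * exp (- (2 * b * \<xi> ^ 4))) * (12 / b\<^sup>2) ^ k * (fact k)\<^sup>2"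
    using b by (intro mult_right_mono) auto
  finally show ?thesis .
qed

text \<open>The plane waves with imaginary part 1, restricted to t > 0 and integrated over \<xi>,
  already form a fundamental solution. To end it by time 2 b, each wave is replaced by the series
  solution whose data on x = 0 are multiplied by a cutoff in time: it is still the wave up to time
  b, it is zero from 2 b on, and in between its Gevrey bounds keep the decay in \<xi>, so that the
  integral still converges.\<close>

lemma controlled_fundamental_solution:
  assumes b: "0 < b" "b \<le> 1/2"
  obtains N :: "real \<times> real \<Rightarrow> complex" where
    "local_dom N"
    "\<And>t x. t \<le> 0 \<or> 2 * b \<le> t \<Longrightarrow> N (t, x) = 0"
    "\<And>X. \<exists>C\<ge>0. \<forall>t x. \<bar>x\<bar> \<le> X \<longrightarrow> norm (N (t, x)) \<le> C * sing (1/3) t"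
    "continuous_on ({0<..} \<times> UNIV) N"
    "\<And>F Ft. test_family F Ft \<Longrightarrow> (\<integral>p. N p * complex_of_real (adj F Ft p) \<partial>lborel) = complex_of_real (F 0 (0, 0))"
proof -
  obtain \<theta> C R where \<theta>: "deriv_seq \<theta>" "0 \<le> C" "1 \<le> R" "\<And>k t. norm (\<theta> k t) \<le> C * R ^ k * (fact k)\<^sup>2"
    "\<And>t. t \<le> 0 \<Longrightarrow> \<theta> 0 t = 1" "\<And>k t. t \<le> 0 \<Longrightarrow> 0 < k \<Longrightarrow> \<theta> k t = 0"
    "\<And>k t. 1 \<le> t \<Longrightarrow> \<theta> k t = 0" by (rule gevrey_cutoff) (rule that; assumption)
  \<comment> \<open>The rescaling moves the transition of the cutoff from [0, 1] to
    [b, 2 b].\<close>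
  define cut where "cut k t = of_real ((1 / b) ^ k) * \<theta> k ((1 / b) * t + (- 1))" for k t
  have dcut: "deriv_seq cut" unfolding cut_def by (rule deriv_seq_affine[OF \<theta>(1)])
  have bcut: "norm (cut k t) \<le> C * (R / b) ^ k * (fact k)\<^sup>2" for k t
  proof -
    have "norm (cut k t) = (1 / b) ^ k * norm (\<theta> k ((1 / b) * t + (- 1)))" using b by (simp add: cut_def norm_mult norm_power norm_divide)
    also have "\<dots> \<le> (1 / b) ^ k * (C * R ^ k * (fact k)\<^sup>2)" using b by (intro mult_left_mono \<theta>(4)) auto
    finally show ?thesis by (simp add: power_divide mult_ac)
  qed
  have cut1: "cut 0 t = 1" "0 < k \<Longrightarrow> cut k t = 0" if "t \<le> b" for t k
    using that b \<theta>(5,6) by (auto simp: cut_def)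
  have cut0: "cut k t = 0" if "2 * b \<le> t" for k t
    using that b \<theta>(7)[of "(1 / b) * t + (- 1)" k] by (simp add: cut_def field_simps)
  define zt where "zt \<xi> = complex_of_real \<xi> + \<i>" for \<xi>
  define W where "W \<xi> k t = (\<i> * omega (zt \<xi>)) ^ k * exp (\<i> * omega (zt \<xi>) * of_real t)" for \<xi> k t
  have dW: "deriv_seq (W \<xi>)" for \<xi> unfolding W_def by (rule deriv_seq_exp)
  \<comment> \<open>The x-derivatives of the plane wave on x = 0, times the cutoff; \<open>k\<close>
    counts time derivatives of the product.\<close>
  define c where "c \<xi> j k t = (\<i> * zt \<xi>) ^ j * leibniz_seq cut (W \<xi>) k t" for \<xi> j k t
  have dc: "deriv_seq (c \<xi> j)" for \<xi> j
    unfolding c_def by (intro deriv_seq_cmult deriv_seq_leibniz dcut dW)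
  have nz: "norm ((\<i> * zt \<xi>) ^ j) \<le> (1 + \<xi>\<^sup>2)\<^sup>2" if "j < 5" for j \<xi>
  proof -
    have "norm ((\<i> * zt \<xi>) ^ j) = norm (zt \<xi>) ^ j" by (simp add: norm_mult norm_power)
    also have "\<dots> \<le> norm (zt \<xi>) ^ 4" using that norm_shift(2)[of \<xi>] by (intro power_increasing) (auto simp: zt_def)
    also have "\<dots> = (norm (zt \<xi>) ^ 2) ^ 2" by (simp flip: power_mult)
    finally show ?thesis by (simp only: zt_def norm_shift(1))
  qed
  \<comment> \<open>A common Gevrey rate for the cutoff and the wave, because
    \<open>leibniz_seq_bound\<close> wants the same rate in both factors.\<close>
  define R1 where "R1 = R / b + 12 / b\<^sup>2"
  have Rb: "1 \<le> R / b" "R / b \<le> R1" "12 / b\<^sup>2 \<le> R1" "1 \<le> R1" "0 \<le> R / b" "0 \<le> 12 / b\<^sup>2"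
  proof -
    show "1 \<le> R / b" using b \<theta>(3) by (simp add: field_simps)
    show "0 \<le> 12 / b\<^sup>2" by simp
    then show "R / b \<le> R1" by (simp add: R1_def)
    show "12 / b\<^sup>2 \<le> R1" using \<open>1 \<le> R / b\<close> by (simp add: R1_def)
    show "1 \<le> R1" "0 \<le> R / b" using \<open>1 \<le> R / b\<close> \<open>R / b \<le> R1\<close> by auto
  qed
  have bcut': "norm (cut k t) \<le> C * r ^ k * (fact k)\<^sup>2" if "R / b \<le> r" for k t r
    using Rb that \<theta>(2) by (intro order_trans[OF bcut] mult_right_mono mult_left_mono power_mono) auto
  have bc: "norm (c \<xi> j k t) \<le> ((1 + \<xi>\<^sup>2)\<^sup>2 * (C * (exp 16 * exp (- (2 * b * \<xi> ^ 4))))) * (2 * R1) ^ k * (fact k)\<^sup>2"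
    if "b \<le> t" "t \<le> 1" "j < 5" for \<xi> j k t
  proof -
    have "norm (W \<xi> k t) \<le> (exp 16 * exp (- (2 * b * \<xi> ^ 4))) * R1 ^ k * (fact k)\<^sup>2" for k
    proof -
      have "norm (W \<xi> k t) \<le> (exp 16 * exp (- (2 * b * \<xi> ^ 4))) * (12 / b\<^sup>2) ^ k * (fact k)\<^sup>2"
        unfolding W_def zt_def by (rule exp_wave_bound) (use that b in auto)
      also have "\<dots> \<le> (exp 16 * exp (- (2 * b * \<xi> ^ 4))) * R1 ^ k * (fact k)\<^sup>2"
        using Rb by (intro mult_right_mono mult_left_mono power_mono) auto
      finally show ?thesis .
    qed
    then have "norm (leibniz_seq cut (W \<xi>) k t) \<le> C * (exp 16 * exp (- (2 * b * \<xi> ^ 4))) * (2 * R1) ^ k * (fact k)\<^sup>2"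
      using Rb \<theta>(2) by (intro leibniz_seq_bound bcut') auto
    then have "norm (c \<xi> j k t) \<le> (1 + \<xi>\<^sup>2)\<^sup>2 * (C * (exp 16 * exp (- (2 * b * \<xi> ^ 4))) * (2 * R1) ^ k * (fact k)\<^sup>2)"
      unfolding c_def norm_mult using nz[OF that(3), of \<xi>] by (intro mult_mono) (auto simp: norm_mult)
    then show ?thesis by (simp only: mult.assoc)
  qed
  \<comment> \<open>Here the constants may depend on \<xi>: this only makes the series converge at
    all times. The estimate that can be integrated over \<xi> is \<open>bc\<close>, restricted to b
    \<le> t \<le> 1.\<close>
  have gd: "gevrey_data (c \<xi>)" for \<xi>
    unfolding gevrey_data_def
  proof (intro conjI allI impI)
    fix A :: real
    let ?o = "norm (omega (zt \<xi>))"
    define r where "r = R / b + ?o"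
    have bW: "norm (W \<xi> k t) \<le> exp (?o * A) * r ^ k * (fact k)\<^sup>2" if "\<bar>t\<bar> \<le> A" for k t
    proof -
      have "norm (W \<xi> k t) \<le> ?o ^ k * exp (?o * A)"
      proof -
        have "Re (\<i> * omega (zt \<xi>) * of_real t) \<le> norm (\<i> * omega (zt \<xi>) * of_real t)" by (rule complex_Re_le_cmod)
        also have "\<dots> = ?o * \<bar>t\<bar>" by (simp add: norm_mult)
        also have "\<dots> \<le> ?o * A" using that by (intro mult_left_mono) auto
        finally show ?thesis unfolding W_def norm_mult norm_power by (auto simp: norm_exp_eq_Re norm_mult intro!: mult_left_mono)
      qed
      also have "\<dots> \<le> exp (?o * A) * r ^ k * 1" using Rb by (simp add: mult.commute r_def power_mono)
      also have "\<dots> \<le> exp (?o * A) * r ^ k * (fact k)\<^sup>2" using Rb by (intro mult_left_mono) (auto simp: r_def)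
      finally show ?thesis .
    qed
    have "norm (c \<xi> j k t) \<le> ((1 + \<xi>\<^sup>2)\<^sup>2 * (C * exp (?o * A))) * (2 * r) ^ k * (fact k)\<^sup>2" if "\<bar>t\<bar> \<le> A" "j < 5" for j k t
    proof -
      have "norm (leibniz_seq cut (W \<xi>) k t) \<le> C * exp (?o * A) * (2 * r) ^ k * (fact k)\<^sup>2"
        using Rb \<theta>(2) that by (intro leibniz_seq_bound bcut' bW) (auto simp: r_def)
      then have "norm (c \<xi> j k t) \<le> (1 + \<xi>\<^sup>2)\<^sup>2 * (C * exp (?o * A) * (2 * r) ^ k * (fact k)\<^sup>2)"
        unfolding c_def norm_mult using nz[OF that(2), of \<xi>] by (intro mult_mono) (auto simp: norm_mult)
      then show ?thesis by (simp only: mult.assoc)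
    qed
    moreover have "0 \<le> (1 + \<xi>\<^sup>2)\<^sup>2 * (C * exp (?o * A))" "1 \<le> 2 * r" using \<theta>(2) Rb by (auto simp: r_def add_increasing2)
    ultimately show "\<exists>C\<ge>0. \<exists>R\<ge>1. \<forall>t. \<bar>t\<bar> \<le> A \<longrightarrow> (\<forall>j<5. \<forall>k. norm (c \<xi> j k t) \<le> C * R ^ k * (fact k)\<^sup>2)" by blast
  qed (rule dc)
  have early: "esol (c \<xi>) (t, x) = plane_wave (zt \<xi>) (t, x)" if "t \<le> b" for \<xi> t x
    
  proof (rule esol_plane)
    fix j k :: nat
    have "leibniz_seq cut (W \<xi>) k t = W \<xi> k t" by (rule leibniz_seq_const1) (use cut1[OF that] in auto)
    then show "c \<xi> j k t = (\<i> * zt \<xi>) ^ j * ((\<i> * omega (zt \<xi>)) ^ k * exp (\<i> * omega (zt \<xi>) * of_real t))"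
      by (simp add: c_def W_def)
  qed
  have late: "esol (c \<xi>) (t, x) = 0" if "2 * b \<le> t" for \<xi> t x
    by (rule esol_zero) (use that in \<open>auto simp: c_def leibniz_seq_def cut0\<close>)

  define e where "e \<xi> p = indicator ({0<..} \<times> UNIV) p *\<^sub>R esol (c \<xi>) p" for \<xi> p
  \<comment> \<open>Three regimes: nothing outside the lifetime, the explicit wave up to time b, the
    Gevrey bound between b and 2 b. In the last one t \<le> 1, so inserting
    \<open>sing (1/3) t\<close> only enlarges the bound.\<close>
  have ebound: "\<exists>K\<ge>0. \<forall>\<xi> t x. \<bar>x\<bar> \<le> X \<longrightarrow> norm (e \<xi> (t, x)) \<le> K * decay \<xi> * sing (1/3) t" for X
  proof -
    define K1 where "K1 = exp (14 + \<bar>X\<bar>)"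
    define K2 where "K2 = C * exp 16 * growth (3 * (2 * R1) * \<bar>X\<bar>) * (4 * exp 2 / (2 * b)\<^sup>2)"
    have g0: "0 \<le> growth (3 * (2 * R1) * \<bar>X\<bar>)" using Rb by (intro growth_nonneg) auto
    have K0: "0 \<le> K1" "0 \<le> K2" using g0 \<theta>(2) by (auto simp: K1_def K2_def)
    have "norm (e \<xi> (t, x)) \<le> (K1 + K2) * decay \<xi> * sing (1/3) t" if x: "\<bar>x\<bar> \<le> X" for \<xi> t x
    proof -
      have d0: "0 \<le> decay \<xi>" using decay_pos[of \<xi>] by simp
      consider "t \<le> 0 \<or> 2 * b \<le> t" | "0 < t" "t \<le> b" | "b < t" "t < 2 * b" by linarith
      then show ?thesis
      proof cases
        case 1
        then have "e \<xi> (t, x) = 0" using late by (auto simp: e_def)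
        then show ?thesis using K0 d0 sing_nonneg by simp
      next
        case 2
        have "norm (plane_wave (zt \<xi>) (t, x)) = exp (- t * Im (omega (zt \<xi>))) * exp (- x)"
          by (simp add: plane_wave_def norm_mult norm_exp_eq_Re zt_def)
        also have "\<dots> \<le> exp (14 - 4 * t * \<xi> ^ 4) * exp \<bar>X\<bar>"
        proof (intro mult_mono)
          have "t * (4 * \<xi> ^ 4 - 14) \<le> t * Im (omega (zt \<xi>))" unfolding zt_def using 2 by (intro mult_left_mono Im_omega_shift_ge) auto
          moreover have "t * 14 \<le> 14" using 2 b by simp
          ultimately show "exp (- t * Im (omega (zt \<xi>))) \<le> exp (14 - 4 * t * \<xi> ^ 4)" by (simp add: algebra_simps)
        qed (use x in auto)
        also have "\<dots> = K1 * exp (- (4 * t * \<xi> ^ 4))" by (simp add: K1_def exp_add exp_diff exp_minus field_simps)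
        also have "\<dots> \<le> K1 * (t powr (- 1/3) * decay \<xi>)" using 2 b by (intro mult_left_mono exp_quartic_decay K0) auto
        also have "\<dots> = K1 * decay \<xi> * sing (1/3) t" using 2 b by (simp add: sing_def)
        also have "\<dots> \<le> (K1 + K2) * decay \<xi> * sing (1/3) t" using K0 d0 by (intro mult_right_mono sing_nonneg) auto
        finally show ?thesis using 2 early[of t \<xi> x] by (auto simp: e_def)
      next
        case 3
        have "norm (e \<xi> (t, x)) = norm (esol (c \<xi>) (t, x))" using 3 b by (simp add: e_def)
        also have "\<dots> \<le> ((1 + \<xi>\<^sup>2)\<^sup>2 * (C * (exp 16 * exp (- (2 * b * \<xi> ^ 4))))) * growth (3 * (2 * R1) * \<bar>X\<bar>)"
          by (rule esol_bound(1)) (use 3 b x Rb \<theta>(2) bc in auto)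
        also have "\<dots> = C * exp 16 * growth (3 * (2 * R1) * \<bar>X\<bar>) * ((1 + \<xi>\<^sup>2)\<^sup>2 * exp (- (2 * b * \<xi> ^ 4)))" by (simp only: mult_ac)
        also have "\<dots> \<le> C * exp 16 * growth (3 * (2 * R1) * \<bar>X\<bar>) * ((4 * exp 2 / (2 * b)\<^sup>2) * decay \<xi>)"
          using b g0 \<theta>(2) by (intro mult_left_mono exp_quartic_moment) auto
        also have "\<dots> = K2 * decay \<xi> * 1" by (simp add: K2_def)
        also have "\<dots> \<le> (K1 + K2) * decay \<xi> * sing (1/3) t"
        proof (intro mult_mono)
          have "1 \<le> t powr (- (1/3))" using powr_mono2'[of "- (1/3)" t 1] 3 b by simp
          then show "1 \<le> sing (1/3) t" using 3 b by (simp add: sing_def)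
        qed (use K0 d0 in auto)
        finally show ?thesis .
      qed
    qed
    then show ?thesis using K0 by (intro exI[of _ "K1 + K2"]) auto
  qed
  have emeas: "(\<lambda>r. e (fst r) (snd r)) \<in> borel_measurable borel"
  proof -
    have ccut: "continuous_on UNIV (cut k)" for k by (rule deriv_seq_continuous[OF dcut])
    have cc: "continuous_on UNIV (\<lambda>r. c (fst r) j k (snd r))" for j k
      unfolding c_def leibniz_seq_def W_def zt_def omega_def
      by (intro continuous_intros continuous_on_compose2[OF ccut]) auto
    have ccs: "continuous_on UNIV (\<lambda>r. csol (c (fst r)) j k (snd r))" for j k
    proof (induction j arbitrary: k rule: csol_induct)
      case (init j) then show ?case using cc by (simp add: csol_init)
    next
      case (rec j) show ?case unfolding csol_rec by (intro continuous_intros rec)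
    qed
    have m1: "(\<lambda>r. csol (c (fst r)) j 0 (fst (snd r))) \<in> borel_measurable (borel :: (real \<times> real \<times> real) measure)" for j
    proof -
      have "continuous_on UNIV (\<lambda>r. csol (c (fst (fst r, fst (snd r)))) j 0 (snd (fst r, fst (snd r))))" for r :: "real \<times> real \<times> real"
        by (rule continuous_on_compose2[OF ccs[of j 0], of UNIV "\<lambda>r. (fst r, fst (snd r))"]) (auto intro!: continuous_intros)
      then show ?thesis by (intro borel_measurable_continuous_onI) simp
    qed
    have m2: "(\<lambda>r. complex_of_real (snd (snd r) ^ j / fact j)) \<in> borel_measurable (borel :: (real \<times> real \<times> real) measure)" for j
      by (intro borel_measurable_continuous_onI continuous_intros) auto
    have [measurable]: "(\<lambda>r. esol_term (c (fst r)) j (snd r)) \<in> borel_measurable (borel :: (real \<times> real \<times> real) measure)" for j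
      unfolding esol_term_def using m1 m2 by (intro borel_measurable_times)
    have m3: "(\<lambda>r. esol (c (fst r)) (snd r)) \<in> borel_measurable (borel :: (real \<times> real \<times> real) measure)"
      unfolding esol_def by measurable
    have "UNIV \<times> {0<..} \<times> UNIV \<in> sets (borel :: (real \<times> real \<times> real) measure)" by (intro borel_open open_Times) auto
    then have "(\<lambda>r. indicator (UNIV \<times> {0<..} \<times> UNIV) r *\<^sub>R esol (c (fst r)) (snd r)) \<in> borel_measurable (borel :: (real \<times> real \<times> real) measure)"
      using m3 by measurable
    moreover have "(\<lambda>r. indicator (UNIV \<times> {0<..} \<times> UNIV) r *\<^sub>R esol (c (fst r)) (snd r)) = (\<lambda>r. e (fst r) (snd r))"
      by (auto simp: fun_eq_iff e_def indicator_def)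
    ultimately show ?thesis by simp
  qed
  have edom: "\<exists>\<beta> \<gamma>. integrable lborel \<beta> \<and> integrable lborel \<gamma> \<and>
      (\<forall>\<xi> t x. \<bar>t\<bar> \<le> A \<longrightarrow> \<bar>x\<bar> \<le> A \<longrightarrow> norm (e \<xi> (t, x)) \<le> \<beta> \<xi> * \<gamma> t)" for A
  proof -
    obtain K where "0 \<le> K" "\<And>\<xi> t x. \<bar>x\<bar> \<le> A \<Longrightarrow> norm (e \<xi> (t, x)) \<le> K * decay \<xi> * sing (1/3) t" using ebound[of A] by blast
    then show ?thesis
      by (intro exI[of _ "\<lambda>\<xi>. K * decay \<xi>"] exI[of _ "sing (1/3)"] conjI integrable_mult_right integrable_decay integrable_sing) auto
  qed
  note sp = superposition[OF emeas edom]
  define N where "N p = of_real (1 / (2 * pi)) * (\<integral>\<xi>. e \<xi> p \<partial>lborel)" for p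
  have esec: "(\<lambda>\<xi>. e \<xi> p) \<in> borel_measurable borel" for p
    using measurable_compose[OF _ emeas, of "\<lambda>\<xi>. (\<xi>, p)" borel] by (simp add: borel_measurable_continuous_onI continuous_intros)
  show thesis
  proof (rule that[of N])
    show "local_dom N" unfolding N_def by (intro local_dom_cmult sp(1))
    show "N (t, x) = 0" if "t \<le> 0 \<or> 2 * b \<le> t" for t x
    proof -
      have "e \<xi> (t, x) = 0" for \<xi> using that late by (auto simp: e_def)
      then show ?thesis by (simp add: N_def)
    qed
    show "\<exists>C\<ge>0. \<forall>t x. \<bar>x\<bar> \<le> X \<longrightarrow> norm (N (t, x)) \<le> C * sing (1/3) t" for X
    proof -
      obtain K where K: "0 \<le> K" "\<And>\<xi> t x. \<bar>x\<bar> \<le> X \<Longrightarrow> norm (e \<xi> (t, x)) \<le> K * decay \<xi> * sing (1/3) t" using ebound[of X] by blast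
      have "norm (N (t, x)) \<le> (1 / (2 * pi) * K * (\<integral>\<xi>. decay \<xi> \<partial>lborel)) * sing (1/3) t" if "\<bar>x\<bar> \<le> X" for t x
      proof -
        have i: "integrable lborel (\<lambda>\<xi>. K * decay \<xi> * sing (1/3) t)" by (intro integrable_mult_left integrable_mult_right integrable_decay)
        have "norm (\<integral>\<xi>. e \<xi> (t, x) \<partial>lborel) \<le> (\<integral>\<xi>. K * decay \<xi> * sing (1/3) t \<partial>lborel)"
        proof (rule Bochner_Integration.integral_norm_bound_integral[OF Bochner_Integration.integrable_bound[OF i] i])
          show "AE \<xi> in lborel. norm (e \<xi> (t, x)) \<le> norm (K * decay \<xi> * sing (1/3) t)"
            by (rule AE_I2) (use K(2)[OF that] in \<open>auto intro: order_trans[OF _ abs_ge_self]\<close>)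
        qed (use K(2)[OF that] esec in auto)
        then have "(1 / (2 * pi)) * norm (\<integral>\<xi>. e \<xi> (t, x) \<partial>lborel) \<le> (1 / (2 * pi)) * (K * (\<integral>\<xi>. decay \<xi> \<partial>lborel) * sing (1/3) t)"
          by (intro mult_left_mono) auto
        then show ?thesis unfolding N_def by (simp add: norm_mult norm_divide)
      qed
      moreover have "0 \<le> 1 / (2 * pi) * K * (\<integral>\<xi>. decay \<xi> \<partial>lborel)"
        using K(1) decay_pos by (intro mult_nonneg_nonneg integral_nonneg_AE AE_I2) (auto intro: less_imp_le)
      ultimately show ?thesis by blast
    qed
    \<comment> \<open>Away from t = 0 the majorant is uniform in t, so continuity passes through the
      frequency integral. It is what later makes the distance between \<open>N\<close> and its time
      mollification small.\<close>
    show "continuous_on ({0<..} \<times> UNIV) N"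
    proof (rule continuous_at_imp_continuous_on, rule ballI)
      fix p :: "real \<times> real" assume "p \<in> {0<..} \<times> UNIV"
      then have p: "0 < fst p" by (auto simp: mem_Times_iff)
      define \<delta> where "\<delta> = min (fst p / 2) 1"
      have \<delta>: "0 < \<delta>" "\<delta> < fst p" "\<delta> \<le> 1" using p by (auto simp: \<delta>_def)
      define X where "X = \<bar>snd p\<bar> + 1"
      define S where "S = {\<delta><..} \<times> {-X<..<X}"
      have S: "open S" "p \<in> S" using \<delta> by (auto simp: S_def X_def mem_Times_iff intro!: open_Times)
      obtain K where K: "0 \<le> K" "\<And>\<xi> t x. \<bar>x\<bar> \<le> X \<Longrightarrow> norm (e \<xi> (t, x)) \<le> K * decay \<xi> * sing (1/3) t" using ebound[of X] by blast
      have dom: "norm (e \<xi> q) \<le> K * decay \<xi> * \<delta> powr (- (1/3))" if "q \<in> S" for \<xi> q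
      proof -
        obtain t x where q0: "q = (t, x)" by force
        have q: "q = (t, x)" "\<delta> < t" "\<bar>x\<bar> \<le> X" using that q0 by (auto simp: S_def)
        have "sing (1/3) t \<le> \<delta> powr (- (1/3))" using q \<delta> by (auto simp: sing_def intro!: powr_mono2')
        then show ?thesis unfolding q(1) using K(1) decay_pos[of \<xi>] by (intro order_trans[OF K(2)[OF q(3)] mult_left_mono]) auto
      qed
      have "continuous_on S N"
        unfolding continuous_on_sequentially N_def comp_def
      proof (intro allI ballI impI)
        fix q qs assume q: "q \<in> S" and qs: "(\<forall>n. qs n \<in> S) \<and> qs \<longlonglongrightarrow> q"
        have "(\<lambda>n. \<integral>\<xi>. e \<xi> (qs n) \<partial>lborel) \<longlonglongrightarrow> (\<integral>\<xi>. e \<xi> q \<partial>lborel)"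
        proof (rule integral_dominated_convergence[where w="\<lambda>\<xi>. K * decay \<xi> * \<delta> powr (- (1/3))"])
          show "integrable lborel (\<lambda>\<xi>. K * decay \<xi> * \<delta> powr (- (1/3)))" by (intro integrable_mult_left integrable_mult_right integrable_decay)
          show "AE \<xi> in lborel. (\<lambda>n. e \<xi> (qs n)) \<longlonglongrightarrow> e \<xi> q"
          proof (rule AE_I2)
            fix \<xi> :: real
            have "(\<lambda>n. esol (c \<xi>) (qs n)) \<longlonglongrightarrow> esol (c \<xi>) q"
              by (rule continuous_on_tendsto_compose[OF continuous_esol[OF gd]]) (use qs in auto)
            moreover have "e \<xi> r = esol (c \<xi>) r" if "r \<in> S" for r
              using that \<delta> by (auto simp: e_def S_def indicator_def)
            ultimately show "(\<lambda>n. e \<xi> (qs n)) \<longlonglongrightarrow> e \<xi> q" using q qs by simp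
          qed
          show "AE \<xi> in lborel. norm (e \<xi> (qs n)) \<le> K * decay \<xi> * \<delta> powr (- (1/3))" for n
            using dom qs by auto
        qed (use esec in auto)
        then show "(\<lambda>n. of_real (1 / (2 * pi)) * (\<integral>\<xi>. e \<xi> (qs n) \<partial>lborel)) \<longlonglongrightarrow> of_real (1 / (2 * pi)) * (\<integral>\<xi>. e \<xi> q \<partial>lborel)"
          by (intro tendsto_intros)
      qed
      then show "isCont N p" using S by (simp add: continuous_on_eq_continuous_at)
    qed
    fix F Ft assume T: "test_family F Ft"
    note T' = test_familyD[OF T]
    \<comment> \<open>Up to the null set t = 0, \<open>e \<xi>\<close> is the series, which solves
      the equation everywhere, minus the plane wave on t < 0, whose source is known. What remains is
      the transform of exp(- x) \<open>F 0 (0, x)\<close>; inversion at x = 0 makes the factor exp(-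
      x) disappear.\<close>
    have ew: "(\<integral>p. e \<xi> p * complex_of_real (adj F Ft p) \<partial>lborel) = (\<integral>x. exp (\<i> * of_real \<xi> * of_real x) * (exp (- of_real x) * complex_of_real (F 0 (0, x))) \<partial>lborel)" for \<xi>
    proof -
      let ?q = "\<lambda>p. indicator ({..<0} \<times> UNIV) p *\<^sub>R plane_wave (zt \<xi>) p"
      have S0: "{..<0} \<times> UNIV \<in> sets (borel :: (real \<times> real) measure)" "{0<..} \<times> UNIV \<in> sets (borel :: (real \<times> real) measure)" by (intro borel_open open_Times; simp)+
      have lq: "local_dom ?q" by (intro local_dom_restrict local_dom_continuous continuous_plane_wave S0)
      have le: "local_dom (esol (c \<xi>))" by (intro local_dom_continuous continuous_esol gd)
      have le': "local_dom (e \<xi>)" unfolding e_def by (intro local_dom_restrict le S0)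
      note bt = box_test_adj[OF T]
      have "(\<integral>p. e \<xi> p * complex_of_real (adj F Ft p) \<partial>lborel) = (\<integral>p. esol (c \<xi>) p * complex_of_real (adj F Ft p) - ?q p * complex_of_real (adj F Ft p) \<partial>lborel)"
      proof (rule integral_cong_AE)
        show "(\<lambda>p. e \<xi> p * complex_of_real (adj F Ft p)) \<in> borel_measurable lborel"
          using local_dom_integrable[OF le' bt] by (rule borel_measurable_integrable)
        show "(\<lambda>p. esol (c \<xi>) p * complex_of_real (adj F Ft p) - ?q p * complex_of_real (adj F Ft p)) \<in> borel_measurable lborel"
          using local_dom_integrable[OF le bt] local_dom_integrable[OF lq bt] by (intro borel_measurable_diff borel_measurable_integrable)
        show "AE p in lborel. e \<xi> p * complex_of_real (adj F Ft p) = esol (c \<xi>) p * complex_of_real (adj F Ft p) - ?q p * complex_of_real (adj F Ft p)"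
          using AE_fst_neq[of 0]
        proof eventually_elim
          fix p :: "real \<times> real" assume "fst p \<noteq> 0"
          then show "e \<xi> p * complex_of_real (adj F Ft p) = esol (c \<xi>) p * complex_of_real (adj F Ft p) - ?q p * complex_of_real (adj F Ft p)"
            using early[of "fst p" \<xi> "snd p"] b by (cases "fst p < 0") (auto simp: e_def indicator_def mem_Times_iff)
        qed
      qed
      also have "\<dots> = (\<integral>p. esol (c \<xi>) p * complex_of_real (adj F Ft p) \<partial>lborel) - (\<integral>p. ?q p * complex_of_real (adj F Ft p) \<partial>lborel)"
        by (intro Bochner_Integration.integral_diff local_dom_integrable le lq bt)
      also have "(\<integral>p. esol (c \<xi>) p * complex_of_real (adj F Ft p) \<partial>lborel) = 0"
        using esol_weak[OF gd T, where H=UNIV and \<kappa>=0] by simp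
      also have "(\<integral>p. ?q p * complex_of_real (adj F Ft p) \<partial>lborel) = - (\<integral>x. plane_wave (zt \<xi>) (0, x) * complex_of_real (F 0 (0, x)) \<partial>lborel)"
        by (rule plane_wave_weak[OF T])
      also have "(\<lambda>x. plane_wave (zt \<xi>) (0, x) * complex_of_real (F 0 (0, x))) = (\<lambda>x. exp (\<i> * of_real \<xi> * of_real x) * (exp (- of_real x) * complex_of_real (F 0 (0, x))))"
        by (auto simp: plane_wave_def zt_def fun_eq_iff algebra_simps simp flip: exp_add)
      finally show ?thesis by simp
    qed
    have "(\<integral>p. N p * complex_of_real (adj F Ft p) \<partial>lborel) = of_real (1 / (2 * pi)) * (\<integral>p. (\<integral>\<xi>. e \<xi> p \<partial>lborel) * complex_of_real (adj F Ft p) \<partial>lborel)"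
      unfolding N_def by (simp only: mult.assoc integral_mult_right_zero)
    also have "(\<integral>p. (\<integral>\<xi>. e \<xi> p \<partial>lborel) * complex_of_real (adj F Ft p) \<partial>lborel) = (\<integral>\<xi>. (\<integral>x. exp (\<i> * of_real \<xi> * of_real x) * (exp (- of_real x) * complex_of_real (F 0 (0, x))) \<partial>lborel) \<partial>lborel)"
      unfolding sp(2)[OF box_test_adj[OF T]] ew ..
    also have "\<dots> = 2 * pi * (exp (- of_real 0) * complex_of_real (F 0 (0, 0)))"
    proof -
      obtain A0 A1 A2 where A: "\<And>x. A0 \<le> \<bar>x\<bar> \<Longrightarrow> F 0 (0, x) = 0" "\<And>x. A1 \<le> \<bar>x\<bar> \<Longrightarrow> F 1 (0, x) = 0" "\<And>x. A2 \<le> \<bar>x\<bar> \<Longrightarrow> F 2 (0, x) = 0"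
        using box_test_section_x(2)[OF T'(1)] by metis
      have ex: "((\<lambda>x::real. exp (- of_real x)) has_vector_derivative - exp (- complex_of_real x)) (at x)" for x
        by (rule has_vector_derivative_real_field) (auto intro!: derivative_eq_intros)
      have dF: "((\<lambda>x. complex_of_real (F j (0, x))) has_vector_derivative complex_of_real (F (Suc j) (0, x))) (at x)" for j x
        by (rule has_vector_derivative_of_real_complex[OF T'(3)])
      have d1: "((\<lambda>x. exp (- of_real x) * complex_of_real (F 0 (0, x))) has_vector_derivative exp (- of_real x) * complex_of_real (F 1 (0, x) - F 0 (0, x))) (at x)" for x
        using has_vector_derivative_mult[OF ex dF[of 0 x]] by (simp add: algebra_simps)
      have d2: "((\<lambda>x. exp (- of_real x) * complex_of_real (F 1 (0, x) - F 0 (0, x))) has_vector_derivative exp (- of_real x) * complex_of_real (F 2 (0, x) - 2 * F 1 (0, x) + F 0 (0, x))) (at x)" for x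
        using has_vector_derivative_mult[OF ex has_vector_derivative_diff[OF dF[of 1 x] dF[of 0 x]]] by (simp add: algebra_simps numeral_2_eq_2)
      show ?thesis
        by (rule fourier_inversion_at_0[OF d1 d2, where A="max A0 (max A1 A2)"])
           (use A in \<open>auto intro!: continuous_intros box_test_section_x(1)[OF T'(1)]\<close>)
    qed
    finally show "(\<integral>p. N p * complex_of_real (adj F Ft p) \<partial>lborel) = complex_of_real (F 0 (0, 0))" by simp
  qed
qed

section \<open>One-sided fundamental solutions\<close>

text \<open>For translates in time the majorant is a convolution kernel, jointly integrable in the
  parameter and t but not a product, so \<open>superposition\<close> does not apply.\<close>

lemma integral_superposition:
  fixes w :: "real \<Rightarrow> real \<times> real \<Rightarrow> complex"
  assumes meas: "(\<lambda>r. w (fst r) (snd r)) \<in> borel_measurable borel"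
    and h: "box_test h"
    and dom: "\<And>A. \<exists>B. integrable lborel (\<lambda>r :: real \<times> real. B (fst r) (snd r)) \<and>
      (\<forall>p t x. \<bar>t\<bar> \<le> A \<longrightarrow> \<bar>x\<bar> \<le> A \<longrightarrow> norm (w p (t, x)) \<le> B p t)"
  shows "(\<integral>q. (\<integral>p. w p q \<partial>lborel) * complex_of_real (h q) \<partial>lborel) =
            (\<integral>p. (\<integral>q. w p q * complex_of_real (h q) \<partial>lborel) \<partial>lborel)"
proof -
  obtain A M where A: "0 < A" "0 \<le> M" "\<And>t x. \<bar>h (t, x)\<bar> \<le> M"
    "\<And>t x. A \<le> \<bar>t\<bar> \<or> A \<le> \<bar>x\<bar> \<Longrightarrow> h (t, x) = 0" using box_test_bound[OF h] by blast
  obtain B where B: "integrable lborel (\<lambda>r :: real \<times> real. B (fst r) (snd r))"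
      "\<And>p t x. \<bar>t\<bar> \<le> A \<Longrightarrow> \<bar>x\<bar> \<le> A \<Longrightarrow> norm (w p (t, x)) \<le> B p t"
      using dom[of A] by metis
  have mh[measurable]: "h \<in> borel_measurable borel" using box_test_measurable[OF h] .
  have m1: "(\<lambda>r. w (fst r) (snd r)) \<in> borel_measurable (lborel \<Otimes>\<^sub>M lborel)"
    using meas by (simp add: lborel_prod)
  have mw: "(\<lambda>(p, q). w p q * complex_of_real (h q)) \<in> borel_measurable (lborel \<Otimes>\<^sub>M lborel)"
    using m1 by (simp add: case_prod_beta')
  have mB: "(\<lambda>r. ennreal \<bar>B (fst r) (snd r)\<bar>) \<in> borel_measurable (lborel \<Otimes>\<^sub>M lborel)"
    using borel_measurable_integrable[OF B(1)] by (simp add: lborel_prod)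
  have mBp[measurable]: "B p \<in> borel_measurable borel" for p
    using measurable_compose[OF _ borel_measurable_integrable[OF B(1)], of "\<lambda>t. (p, t)" borel]
    by (simp add: borel_measurable_continuous_onI continuous_intros)
  have bd: "norm (w p (t, x) * complex_of_real (h (t, x))) \<le> \<bar>B p t\<bar> * (M * indicator {-A..A} x)" for p t x
  proof (cases "\<bar>t\<bar> \<le> A \<and> \<bar>x\<bar> \<le> A")
    case True
    then have "norm (w p (t, x)) * \<bar>h (t, x)\<bar> \<le> \<bar>B p t\<bar> * M"
      using B(2)[of t x p] A(2) A(3)[of t x] by (intro mult_mono) auto
    then show ?thesis using True by (auto simp: indicator_def norm_mult abs_le_iff)
  next
    case False
    then have "h (t, x) = 0" using A(4)[of t x] by auto
    then show ?thesis using A(2) by simp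
  qed
  have "(\<integral>\<^sup>+r. norm (case r of (p, q) \<Rightarrow> w p q * complex_of_real (h q)) \<partial>(lborel \<Otimes>\<^sub>M lborel)) =
    (\<integral>\<^sup>+p. (\<integral>\<^sup>+q. ennreal (norm (w p q * complex_of_real (h q))) \<partial>lborel) \<partial>lborel)"
    by (subst lborel.nn_integral_fst[symmetric]) (use mw in \<open>auto simp: case_prod_beta'\<close>)
  also have "\<dots> \<le> (\<integral>\<^sup>+p. (\<integral>\<^sup>+q. ennreal \<bar>B p (fst q)\<bar> * ennreal (M * indicator {-A..A} (snd q)) \<partial>lborel) \<partial>lborel)"
    by (intro nn_integral_mono) (use bd A(2) in \<open>auto simp: ennreal_mult[symmetric] split_paired_all simp del: ennreal_mult\<close>)
  also have "\<dots> = (\<integral>\<^sup>+p. (\<integral>\<^sup>+t. ennreal \<bar>B p t\<bar> \<partial>lborel) * ennreal (M * (2 * A)) \<partial>lborel)"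
  proof (intro nn_integral_cong)
    fix p
    have "(\<integral>\<^sup>+q. ennreal \<bar>B p (fst q)\<bar> * ennreal (M * indicator {-A..A} (snd q)) \<partial>lborel) =
      (\<integral>\<^sup>+t. (\<integral>\<^sup>+x. ennreal \<bar>B p t\<bar> * ennreal (M * indicator {-A..A} x) \<partial>lborel) \<partial>lborel)"
      unfolding lborel_prod[symmetric] by (subst lborel.nn_integral_fst[symmetric]) auto
    also have "\<dots> = (\<integral>\<^sup>+t. ennreal \<bar>B p t\<bar> * ennreal (M * (2 * A)) \<partial>lborel)"
    proof -
      have "(\<integral>\<^sup>+x. ennreal (M * indicator {-A..A} x) \<partial>lborel) = ennreal (M * (2 * A))"
        by (subst nn_integral_eq_integral[OF integrable_mult_indicator_Icc]) (use A in auto)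
      then show ?thesis by (simp add: nn_integral_cmult)
    qed
    also have "\<dots> = (\<integral>\<^sup>+t. ennreal \<bar>B p t\<bar> \<partial>lborel) * ennreal (M * (2 * A))"
      by (rule nn_integral_multc) simp
    finally show "(\<integral>\<^sup>+q. ennreal \<bar>B p (fst q)\<bar> * ennreal (M * indicator {-A..A} (snd q)) \<partial>lborel) = (\<integral>\<^sup>+t. ennreal \<bar>B p t\<bar> \<partial>lborel) * ennreal (M * (2 * A))" .
  qed
  also have "\<dots> = (\<integral>\<^sup>+p. (\<integral>\<^sup>+t. ennreal \<bar>B p t\<bar> \<partial>lborel) \<partial>lborel) * ennreal (M * (2 * A))"
    using lborel.borel_measurable_nn_integral_fst[OF mB] by (intro nn_integral_multc) simp
  also have "(\<integral>\<^sup>+p. (\<integral>\<^sup>+t. ennreal \<bar>B p t\<bar> \<partial>lborel) \<partial>lborel) = (\<integral>\<^sup>+r. ennreal \<bar>B (fst r) (snd r)\<bar> \<partial>lborel)"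
    using lborel.nn_integral_fst[OF mB] by (simp add: lborel_prod)
  also have "\<dots> * ennreal (M * (2 * A)) < \<infinity>"
    using B(1) by (simp add: integrable_iff_bounded ennreal_mult_less_top)
  finally have "integrable (lborel \<Otimes>\<^sub>M lborel) (\<lambda>(p, q). w p q * complex_of_real (h q))"
    using mw by (intro integrableI_bounded) auto
  from lborel_pair.Fubini_integral[OF this] show ?thesis by simp
qed

section \<open>Translation of weak solutions\<close>

lemma integral_translate:
  fixes f :: "'a::euclidean_space \<Rightarrow> 'b::{banach, second_countable_topology}"
  assumes "f \<in> borel_measurable borel"
  shows "(\<integral>p. f (p + d) \<partial>lborel) = (\<integral>p. f p \<partial>lborel)"
proof -
  have "(\<integral>p. f p \<partial>lborel) = (\<integral>p. f p \<partial>(distr lborel borel ((+) d)))" by (simp add: lborel_distr_plus)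
  also have "\<dots> = (\<integral>p. f (d + p) \<partial>lborel)" using assms by (subst integral_distr) auto
  finally show ?thesis by (simp add: add.commute)
qed

lemma box_test_translate: "box_test h \<Longrightarrow> box_test (\<lambda>p. h (p + d))"
proof -
  assume h: "box_test h"
  obtain A where A: "\<And>t x. A \<le> \<bar>t\<bar> \<or> A \<le> \<bar>x\<bar> \<Longrightarrow> h (t, x) = 0" using h by (auto simp: box_test_def)
  have "h ((t, x) + d) = 0" if "A + \<bar>fst d\<bar> + \<bar>snd d\<bar> \<le> \<bar>t\<bar> \<or> A + \<bar>fst d\<bar> + \<bar>snd d\<bar> \<le> \<bar>x\<bar>" for t x
  proof -
    have gen: "A \<le> \<bar>a + e\<bar>" if "A + (\<bar>e\<bar> + f) \<le> \<bar>a\<bar>" "0 \<le> f" for a e f :: real using that by linarith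
    have "A \<le> \<bar>t + fst d\<bar> \<or> A \<le> \<bar>x + snd d\<bar>"
      using that
    proof
      assume "A + \<bar>fst d\<bar> + \<bar>snd d\<bar> \<le> \<bar>t\<bar>"
      then show ?thesis using gen[of "fst d" "\<bar>snd d\<bar>" t] by (simp only: add.assoc abs_ge_zero simp_thms)
    next
      assume "A + \<bar>fst d\<bar> + \<bar>snd d\<bar> \<le> \<bar>x\<bar>"
      then show ?thesis using gen[of "snd d" "\<bar>fst d\<bar>" x] by (simp only: add.assoc add.commute[of "\<bar>fst d\<bar>"] abs_ge_zero simp_thms)
    qed
    then show ?thesis using A[of "t + fst d" "x + snd d"] by (simp add: plus_prod_def)
  qed
  then show ?thesis unfolding box_test_def
  proof (intro conjI exI[of _ "A + \<bar>fst d\<bar> + \<bar>snd d\<bar>"] allI impI)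
    show "continuous_on UNIV (\<lambda>p. h (p + d))"
      by (rule continuous_on_compose2[OF box_test_cont[OF h]]) (auto intro!: continuous_intros)
  qed
qed

lemma test_family_translate:
  assumes "test_family F Ft" shows "test_family (\<lambda>j p. F j (p + d)) (\<lambda>p. Ft (p + d))"
proof -
  note T = test_familyD[OF assms]
  have "((\<lambda>y. F j ((t, y) + d)) has_real_derivative F (Suc j) ((t, x) + d)) (at x)" for j t x
    using DERIV_shift[THEN iffD1, OF T(3)[of j "t + fst d" "x + snd d"]] by (simp add: plus_prod_def add.commute)
  moreover have "((\<lambda>s. F 0 ((s, x) + d)) has_real_derivative Ft ((t, x) + d)) (at t)" for t x
    using DERIV_shift[THEN iffD1, OF T(4)[of "x + snd d" "t + fst d"]] by (simp add: plus_prod_def add.commute)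
  ultimately show ?thesis unfolding test_family_def using T(1,2) by (auto intro: box_test_translate)
qed

lemma weak_translate:
  assumes w: "w \<in> borel_measurable borel" and T: "test_family F Ft"
  shows "(\<integral>p. w (p - d) * complex_of_real (adj F Ft p) \<partial>lborel) =
    (\<integral>p. w p * complex_of_real (adj (\<lambda>j p. F j (p + d)) (\<lambda>p. Ft (p + d)) p) \<partial>lborel)"
proof -
  have m: "(\<lambda>p. w (p - d) * complex_of_real (adj F Ft p)) \<in> borel_measurable borel"
    by (intro borel_measurable_times measurable_compose[OF _ w] measurable_compose[OF box_test_measurable[OF box_test_adj[OF T]]]) auto
  have "(\<integral>p. w (p - d) * complex_of_real (adj F Ft p) \<partial>lborel) = (\<integral>p. w (p + d - d) * complex_of_real (adj F Ft (p + d)) \<partial>lborel)"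
    by (rule integral_translate[OF m, symmetric])
  then show ?thesis by (simp add: adj_def)
qed

section \<open>Averaging the time singularity\<close>

lemma sing_mono: "a \<le> a' \<Longrightarrow> sing a t \<le> sing a' t"
  by (auto simp: sing_def intro!: powr_mono')

lemma sing_ge_one: "0 < t \<Longrightarrow> t \<le> 1 \<Longrightarrow> 0 \<le> a \<Longrightarrow> 1 \<le> sing a t"
  using powr_mono2'[of "- a" t 1] by (simp add: sing_def)

lemma integral_sing_below:
  assumes "a < 1" "0 < t" "t \<le> 1"
  shows "integrable lborel (\<lambda>s. indicator {..t} s * sing a s)"
    and "(\<integral>s. indicator {..t} s * sing a s \<partial>lborel) = t powr (1 - a) / (1 - a)"
proof -
  show i: "integrable lborel (\<lambda>s. indicator {..t} s * sing a s)"
    using integrable_mult_indicator[OF _ integrable_sing[OF assms(1)], of "{..t}"] by simp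
  have "((\<lambda>x. x powr (- a)) has_integral (t powr (- a + 1) / (- a + 1))) {0..t}"
    using assms by (intro has_integral_powr_from_0) auto
  then have "((\<lambda>x. if x \<in> {0..t} then x powr (- a) else 0) has_integral (t powr (- a + 1) / (- a + 1))) UNIV"
    by (subst has_integral_restrict_UNIV)
  moreover have "(\<lambda>x. if x \<in> {0..t} then x powr (- a) else 0) = (\<lambda>s. indicator {..t} s * sing a s)"
    using assms by (auto simp: sing_def fun_eq_iff indicator_def)
  ultimately have "((\<lambda>s. indicator {..t} s * sing a s) has_integral (t powr (- a + 1) / (- a + 1))) UNIV" by simp
  with has_integral_integral_lborel[OF i] show "(\<integral>s. indicator {..t} s * sing a s \<partial>lborel) = t powr (1 - a) / (1 - a)"
    by (auto dest: has_integral_unique simp: add.commute)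
qed

text \<open>Averaging over a past interval of length \<eta> does not worsen t^(-1/3), uniformly in
  \<eta>. For t \<le> 2 \<eta> the factor 1/\<eta> is at most 2/t and the integral of s^(-1/3) up to
  t is 3/2 t^(2/3); for t > 2 \<eta> the shifted time stays above t/2.\<close>

lemma sing_convolution_bound:
  assumes \<eta>: "0 < \<eta>" and M: "0 \<le> M" and t: "t \<le> 1"
  shows "(\<integral>\<tau>. (M / \<eta> * indicator {0..\<eta>} \<tau>) * sing (1/3) (t - \<tau>) \<partial>lborel) \<le> 3 * M * sing (1/3) t"
    and "integrable lborel (\<lambda>\<tau>. (M / \<eta> * indicator {0..\<eta>} \<tau>) * sing (1/3) (t - \<tau>))"
proof -
  have "integrable lborel (\<lambda>\<tau>. sing (1/3) (t + (-1) * \<tau>))"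
    by (intro lborel_integrable_real_affine integrable_sing) auto
  then have isg': "integrable lborel (\<lambda>\<tau>. sing (1/3) (t - \<tau>))" by simp
  have "integrable lborel (\<lambda>\<tau>. M / \<eta> * (indicator {0..\<eta>} \<tau> *\<^sub>R sing (1/3) (t - \<tau>)))"
    by (intro integrable_mult_right integrable_mult_indicator isg') auto
  then show i: "integrable lborel (\<lambda>\<tau>. (M / \<eta> * indicator {0..\<eta>} \<tau>) * sing (1/3) (t - \<tau>))" by (simp add: mult.assoc)
  consider "t \<le> 0" | "0 < t" "t \<le> 2 * \<eta>" | "0 < t" "2 * \<eta> < t" by linarith
  then show "(\<integral>\<tau>. (M / \<eta> * indicator {0..\<eta>} \<tau>) * sing (1/3) (t - \<tau>) \<partial>lborel) \<le> 3 * M * sing (1/3) t"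
  proof cases
    case 1
    have "(\<lambda>\<tau>. (M / \<eta> * indicator {0..\<eta>} \<tau>) * sing (1/3) (t - \<tau>)) = (\<lambda>_. 0)"
      using 1 by (auto simp: fun_eq_iff indicator_def sing_def)
    then show ?thesis using M by (simp add: sing_nonneg)
  next
    case 2
    define J where "J = (\<lambda>s. indicator {..t} s * sing (1/3) s)"
    note isb = integral_sing_below[of "1/3" t, OF _ 2(1) t]
    have iJ: "integrable lborel J" and vJ: "(\<integral>s. J s \<partial>lborel) = 3/2 * t powr (2/3)"
      using isb by (auto simp: J_def)
    have iJ': "integrable lborel (\<lambda>\<tau>. M / \<eta> * J (t + (-1) * \<tau>))"
      by (intro integrable_mult_right lborel_integrable_real_affine iJ) auto
    have "(\<integral>\<tau>. (M / \<eta> * indicator {0..\<eta>} \<tau>) * sing (1/3) (t - \<tau>) \<partial>lborel) \<le> (\<integral>\<tau>. M / \<eta> * J (t + (-1) * \<tau>) \<partial>lborel)"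
      by (rule integral_mono[OF i iJ']) (use M \<eta> in \<open>auto simp: J_def indicator_def sing_nonneg\<close>)
    also have "\<dots> = M / \<eta> * (\<integral>\<tau>. J (t + (-1) * \<tau>) \<partial>lborel)" by simp
    also have "(\<integral>\<tau>. J (t + (-1) * \<tau>) \<partial>lborel) = (\<integral>s. J s \<partial>lborel)"
      using lborel_integral_real_affine[of "-1" J t] by simp
    also have "M / \<eta> * (\<integral>s. J s \<partial>lborel) \<le> M * (2 / t) * (3/2 * t powr (2/3))"
    proof -
      have "1 / \<eta> \<le> 2 / t" using 2 \<eta> by (simp add: field_simps)
      then have "M * (1 / \<eta>) * (3/2 * t powr (2/3)) \<le> M * (2 / t) * (3/2 * t powr (2/3))" using M by (intro mult_right_mono mult_left_mono) auto
      then show ?thesis by (simp add: vJ)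
    qed
    also have "\<dots> = 3 * M * (t powr (2/3) / t)" by simp
    also have "t powr (2/3) / t = t powr (2/3 - 1)" by (subst powr_diff) (use 2 in simp)
    also have "3 * M * t powr (2/3 - 1) = 3 * M * sing (1/3) t" using 2 t by (simp add: sing_def)
    finally show ?thesis .
  next
    case 3
    have i1: "integrable lborel (\<lambda>\<tau>. (M / \<eta> * (2 * sing (1/3) t)) * indicator {0..\<eta>} \<tau>)" by (rule integrable_mult_indicator_Icc)
    have "(\<integral>\<tau>. (M / \<eta> * indicator {0..\<eta>} \<tau>) * sing (1/3) (t - \<tau>) \<partial>lborel) \<le> (\<integral>\<tau>. (M / \<eta> * (2 * sing (1/3) t)) * indicator {0..\<eta>} \<tau> \<partial>lborel)"
    proof (rule integral_mono[OF i i1])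
      fix \<tau> :: real
      show "(M / \<eta> * indicator {0..\<eta>} \<tau>) * sing (1/3) (t - \<tau>) \<le> (M / \<eta> * (2 * sing (1/3) t)) * indicator {0..\<eta>} \<tau>"
      proof (cases "\<tau> \<in> {0..\<eta>}")
        case True
        then have tt: "t / 2 \<le> t - \<tau>" "t - \<tau> \<le> 1" "0 < t - \<tau>" using 3 t by auto
        have "sing (1/3) (t - \<tau>) \<le> (t / 2) powr (- (1/3))" using tt 3 by (auto simp: sing_def intro!: powr_mono2')
        also have "\<dots> = t powr (- (1/3)) * 2 powr (1/3)" using 3 by (simp add: powr_divide powr_minus_divide)
        also have "\<dots> \<le> t powr (- (1/3)) * 2 powr 1" by (intro mult_left_mono powr_mono) auto
        finally have "sing (1/3) (t - \<tau>) \<le> 2 * sing (1/3) t" using 3 t by (simp add: sing_def)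
        then have "M / \<eta> * sing (1/3) (t - \<tau>) \<le> M / \<eta> * (2 * sing (1/3) t)" using M \<eta> by (intro mult_left_mono) auto
        then show ?thesis using True by simp
      qed simp
    qed
    also have "\<dots> = 2 * M * sing (1/3) t" using \<eta> by simp
    also have "\<dots> \<le> 3 * M * sing (1/3) t" using M by (intro mult_right_mono sing_nonneg) auto
    finally show ?thesis .
  qed
qed

lemma integrable_convolution_kernel:
  fixes f g :: "real \<Rightarrow> real"
  assumes f: "integrable lborel f" and g: "integrable lborel g"
  shows "integrable lborel (\<lambda>r :: real \<times> real. f (fst r) * g (snd r - fst r))"
proof -
  have [measurable]: "f \<in> borel_measurable borel" "g \<in> borel_measurable borel" using f g by auto
  have tr: "integrable lborel (\<lambda>t. g (t - \<tau>))" for \<tau>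
    using lborel_integrable_real_affine[OF g, of 1 "-\<tau>"] by simp
  have "integrable (lborel \<Otimes>\<^sub>M lborel) (\<lambda>r :: real \<times> real. f (fst r) * g (snd r - fst r))"
  proof (rule lborel_pair.Fubini_integrable)
    show "(\<lambda>r :: real \<times> real. f (fst r) * g (snd r - fst r)) \<in> borel_measurable (lborel \<Otimes>\<^sub>M lborel)" by measurable
    have "(\<integral>t. norm (f (fst (\<tau>, t)) * g (snd (\<tau>, t) - fst (\<tau>, t))) \<partial>lborel) = norm (f \<tau>) * (\<integral>t. norm (g t) \<partial>lborel)" for \<tau>
    proof -
      have "(\<integral>t. norm (g (t + (- \<tau>))) \<partial>lborel) = (\<integral>t. norm (g t) \<partial>lborel)"
        by (rule integral_translate) measurable
      then show ?thesis by (simp add: abs_mult)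
    qed
    then show "integrable lborel (\<lambda>\<tau>. \<integral>t. norm (f (fst (\<tau>, t)) * g (snd (\<tau>, t) - fst (\<tau>, t))) \<partial>lborel)"
      using f by (simp del: real_norm_def)
    show "AE \<tau> in lborel. integrable lborel (\<lambda>t. f (fst (\<tau>, t)) * g (snd (\<tau>, t) - fst (\<tau>, t)))"
      using tr by simp
  qed
  then show ?thesis by (simp add: lborel_prod)
qed

text \<open>The source is moved to infinity: \<open>N\<close> minus its time mollification is small, and the mollified
  source is carried by a solution living on one side of it only.\<close>

lemma one_sided_fundamental_solution:
  fixes side :: bool
  assumes b: "0 < b" "b \<le> 1/4" and \<delta>: "0 < \<delta>"
  obtains V :: "real \<times> real \<Rightarrow> complex" where
    "local_dom V"
    "\<And>t x. t \<le> 0 \<or> 3 * b \<le> t \<Longrightarrow> V (t, x) = 0"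
    "\<And>Y. \<exists>C\<ge>0. \<forall>t x. \<bar>x\<bar> \<le> Y \<longrightarrow> norm (V (t, x)) \<le> C * sing (2/5) t"
    "\<And>t x. \<bar>x\<bar> \<le> X \<Longrightarrow> (if side then x \<le> 0 else 0 < x) \<Longrightarrow> norm (V (t, x)) \<le> \<delta> * sing (2/5) t"
    "\<And>F Ft. test_family F Ft \<Longrightarrow> (\<integral>p. V p * complex_of_real (adj F Ft p) \<partial>lborel) = complex_of_real (F 0 (0, 0))"
proof -
  have b2: "b \<le> 1/2" using b by simp
  obtain N where N: "local_dom N" "\<And>t x. t \<le> 0 \<or> 2 * b \<le> t \<Longrightarrow> N (t, x) = 0"
    "\<And>X. \<exists>C\<ge>0. \<forall>t x. \<bar>x\<bar> \<le> X \<longrightarrow> norm (N (t, x)) \<le> C * sing (1/3) t"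
    "continuous_on ({0<..} \<times> UNIV) N"
    "\<And>F Ft. test_family F Ft \<Longrightarrow> (\<integral>p. N p * complex_of_real (adj F Ft p) \<partial>lborel) = complex_of_real (F 0 (0, 0))"
    by (rule controlled_fundamental_solution[OF b(1) b2]) (rule that; assumption)
  obtain \<rho> M R where \<rho>: "deriv_seq \<rho>" "0 \<le> M" "1 \<le> R" "\<And>k t. norm (\<rho> k t) \<le> M * R ^ k * (fact k)\<^sup>2"
    "\<And>k t. t \<le> 0 \<or> 1 \<le> t \<Longrightarrow> \<rho> k t = 0" "(\<integral>t. \<rho> 0 t \<partial>lborel) = 1" by (rule gevrey_bump) (rule that; assumption)
  have mN[measurable]: "N \<in> borel_measurable borel" using N(1) by (simp add: local_dom_def)
  \<comment> \<open>A bump of unit mass on [0, \<eta>]: the mollification looks only at the past, so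
    nothing appears before time 0 and the lifetime grows from 2 b to at most 3 b.\<close>
  define rh where "rh \<eta> k t = of_real (1 / \<eta>) * (of_real ((1 / \<eta>) ^ k) * \<rho> k ((1 / \<eta>) * t + 0))" for \<eta> k t
  have drh: "deriv_seq (rh \<eta>)" for \<eta> unfolding rh_def by (intro deriv_seq_cmult deriv_seq_affine \<rho>(1))
  have mrh[measurable]: "rh \<eta> k \<in> borel_measurable borel" for \<eta> k
    by (rule borel_measurable_continuous_onI[OF deriv_seq_continuous[OF drh]])
  have rh0: "rh \<eta> k t = 0" if "0 < \<eta>" "t \<le> 0 \<or> \<eta> \<le> t" for \<eta> k t
    using that \<rho>(5)[of "t / \<eta>" k] by (auto simp: rh_def field_simps)
  have rhb: "norm (rh \<eta> 0 t) \<le> M / \<eta> * indicator {0..\<eta>} t" if "0 < \<eta>" for \<eta> t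
  proof (cases "t \<in> {0..\<eta>}")
    case True
    then show ?thesis using \<rho>(4)[of 0 "t / \<eta>"] that by (simp add: rh_def norm_mult norm_divide field_simps)
  next
    case False then show ?thesis using rh0[OF that, of t 0] by auto
  qed
  have rhi: "integrable lborel (rh \<eta> 0)" if "0 < \<eta>" for \<eta>
    by (rule integrable_continuous_bounded_support[of _ \<eta>, OF deriv_seq_continuous[OF drh]]) (use rh0[OF that] that in \<open>auto simp: abs_if split: if_splits\<close>)
  have rh1: "(\<integral>t. rh \<eta> 0 t \<partial>lborel) = 1" if "0 < \<eta>" for \<eta>
  proof -
    have "(1::complex) = \<bar>1 / \<eta>\<bar> *\<^sub>R (\<integral>t. \<rho> 0 (0 + 1 / \<eta> * t) \<partial>lborel)"
      using lborel_integral_real_affine[of "1 / \<eta>" "\<rho> 0" 0] that \<rho>(6) by simp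
    then show ?thesis using that by (simp add: rh_def scaleR_conv_of_real)
  qed
  define Nm where "Nm \<eta> p = (\<integral>\<tau>. rh \<eta> 0 \<tau> * N (p - (\<tau>, 0)) \<partial>lborel)" for \<eta> p
  have mw: "(\<lambda>r. rh \<eta> 0 (fst r) * N (snd r - (fst r, 0))) \<in> borel_measurable borel" for \<eta>
  proof (intro borel_measurable_times)
    show "(\<lambda>r. rh \<eta> 0 (fst r)) \<in> borel_measurable (borel :: (real \<times> real \<times> real) measure)"
      by (intro measurable_compose[OF _ mrh] borel_measurable_continuous_onI continuous_intros)
    show "(\<lambda>r. N (snd r - (fst r, 0))) \<in> borel_measurable (borel :: (real \<times> real \<times> real) measure)"
      by (intro measurable_compose[OF _ mN] borel_measurable_continuous_onI continuous_intros)
  qed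
  have secN[measurable]: "(\<lambda>\<tau>. N (p - (\<tau>, 0))) \<in> borel_measurable borel" for p
    by (intro measurable_compose[OF _ mN] borel_measurable_continuous_onI continuous_intros)
  have mNm: "Nm \<eta> \<in> borel_measurable borel" for \<eta>
  proof -
    have "(\<lambda>r. rh \<eta> 0 (snd r)) \<in> borel_measurable (borel :: ((real \<times> real) \<times> real) measure)"
      by (intro measurable_compose[OF _ mrh] borel_measurable_continuous_onI continuous_intros)
    moreover have "(\<lambda>r. N (fst r - (snd r, 0))) \<in> borel_measurable (borel :: ((real \<times> real) \<times> real) measure)"
      by (intro measurable_compose[OF _ mN] borel_measurable_continuous_onI continuous_intros)
    ultimately have "(\<lambda>(q, \<tau>). rh \<eta> 0 \<tau> * N (q - (\<tau>, 0))) \<in> borel_measurable (lborel \<Otimes>\<^sub>M lborel)"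
      by (simp add: case_prod_beta' lborel_prod)
    from lborel.borel_measurable_lebesgue_integral[OF this] show ?thesis unfolding Nm_def by simp
  qed
  have kernel_bound: "norm (rh \<eta> 0 \<tau> * N ((t, x) - (\<tau>, 0))) \<le> C * ((M / \<eta> * indicator {0..\<eta>} \<tau>) * sing (1/3) (t - \<tau>))"
    if "0 < \<eta>" "0 \<le> C" "\<And>t x. \<bar>x\<bar> \<le> Y \<Longrightarrow> norm (N (t, x)) \<le> C * sing (1/3) t" "\<bar>x\<bar> \<le> Y" for \<eta> \<tau> t x C Y
  proof -
    have "norm (rh \<eta> 0 \<tau>) * norm (N (t - \<tau>, x)) \<le> (M / \<eta> * indicator {0..\<eta>} \<tau>) * (C * sing (1/3) (t - \<tau>))"
      using that \<rho>(2) by (intro mult_mono rhb that) auto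
    then show ?thesis by (simp add: norm_mult mult_ac)
  qed
  have Nm0: "Nm \<eta> (t, x) = 0" if "0 < \<eta>" "\<eta> \<le> b" "t \<le> 0 \<or> 3 * b \<le> t" for \<eta> t x
  proof -
    have "rh \<eta> 0 \<tau> * N ((t, x) - (\<tau>, 0)) = 0" for \<tau>
    proof (cases "\<tau> \<le> 0 \<or> \<eta> \<le> \<tau>")
      case True then show ?thesis using rh0 that by simp
    next
      case False
      then have "t - \<tau> \<le> 0 \<or> 2 * b \<le> t - \<tau>" using that by auto
      then show ?thesis using N(2)[of "t - \<tau>" x] by simp
    qed
    then show ?thesis unfolding Nm_def by (simp only: Bochner_Integration.integral_zero)
  qed
  have Nm_int: "integrable lborel (\<lambda>\<tau>. rh \<eta> 0 \<tau> * N ((t, x) - (\<tau>, 0)))"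
    and Nm_bound: "norm (Nm \<eta> (t, x)) \<le> 3 * M * C * sing (1/3) t"
    if "0 < \<eta>" "\<eta> \<le> b" "0 \<le> C" "\<And>t x. \<bar>x\<bar> \<le> Y \<Longrightarrow> norm (N (t, x)) \<le> C * sing (1/3) t" "\<bar>x\<bar> \<le> Y" "t \<le> 1" for \<eta> t x C Y
  proof -
    note kb = kernel_bound[OF that(1,3,4,5)]
    note sc = sing_convolution_bound[OF that(1) \<rho>(2) that(6)]
    have i: "integrable lborel (\<lambda>\<tau>. C * ((M / \<eta> * indicator {0..\<eta>} \<tau>) * sing (1/3) (t - \<tau>)))"
      by (intro integrable_mult_right sc(2))
    show ii: "integrable lborel (\<lambda>\<tau>. rh \<eta> 0 \<tau> * N ((t, x) - (\<tau>, 0)))"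
    proof (rule Bochner_Integration.integrable_bound[OF i])
      show "(\<lambda>\<tau>. rh \<eta> 0 \<tau> * N ((t, x) - (\<tau>, 0))) \<in> borel_measurable lborel" using secN by measurable
      show "AE \<tau> in lborel. norm (rh \<eta> 0 \<tau> * N ((t, x) - (\<tau>, 0))) \<le> norm (C * ((M / \<eta> * indicator {0..\<eta>} \<tau>) * sing (1/3) (t - \<tau>)))"
      proof (rule AE_I2)
        fix \<tau> :: real
        have "norm z \<le> r \<Longrightarrow> norm z \<le> norm r" for z :: complex and r :: real by simp
        from this[OF kb] show "norm (rh \<eta> 0 \<tau> * N ((t, x) - (\<tau>, 0))) \<le> norm (C * ((M / \<eta> * indicator {0..\<eta>} \<tau>) * sing (1/3) (t - \<tau>)))" .
      qed
    qed
    have "norm (Nm \<eta> (t, x)) \<le> (\<integral>\<tau>. C * ((M / \<eta> * indicator {0..\<eta>} \<tau>) * sing (1/3) (t - \<tau>)) \<partial>lborel)"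
      unfolding Nm_def by (rule Bochner_Integration.integral_norm_bound_integral[OF ii i]) (rule kb)
    also have "\<dots> = C * (\<integral>\<tau>. (M / \<eta> * indicator {0..\<eta>} \<tau>) * sing (1/3) (t - \<tau>) \<partial>lborel)" by simp
    also have "\<dots> \<le> C * (3 * M * sing (1/3) t)" using that(3) by (intro mult_left_mono sc(1))
    finally show "norm (Nm \<eta> (t, x)) \<le> 3 * M * C * sing (1/3) t" by (simp add: mult_ac)
  qed
  have Nm_bound': "\<exists>C\<ge>0. \<forall>t x. \<bar>x\<bar> \<le> Y \<longrightarrow> norm (Nm \<eta> (t, x)) \<le> C * sing (1/3) t" if "0 < \<eta>" "\<eta> \<le> b" for \<eta> Y
  proof -
    obtain C where C: "0 \<le> C" "\<And>t x. \<bar>x\<bar> \<le> Y \<Longrightarrow> norm (N (t, x)) \<le> C * sing (1/3) t" using N(3)[of Y] by blast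
    have "norm (Nm \<eta> (t, x)) \<le> 3 * M * C * sing (1/3) t" if "\<bar>x\<bar> \<le> Y" for t x
    proof (cases "t \<le> 1")
      case True then show ?thesis using Nm_bound[OF \<open>0 < \<eta>\<close> \<open>\<eta> \<le> b\<close> C that] by simp
    next
      case False then show ?thesis using Nm0[OF \<open>0 < \<eta>\<close> \<open>\<eta> \<le> b\<close>, of t x] b \<rho>(2) C(1) sing_nonneg by simp
    qed
    then show ?thesis using C(1) \<rho>(2) by (intro exI[of _ "3 * M * C"]) auto
  qed
  have Nm_weak: "(\<integral>p. Nm \<eta> p * complex_of_real (adj F Ft p) \<partial>lborel) = (\<integral>\<tau>. rh \<eta> 0 \<tau> * complex_of_real (F 0 (\<tau>, 0)) \<partial>lborel)"
    if \<eta>: "0 < \<eta>" and T: "test_family F Ft" for \<eta> F Ft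
  proof -
    have "(\<integral>p. Nm \<eta> p * complex_of_real (adj F Ft p) \<partial>lborel) = (\<integral>\<tau>. (\<integral>q. rh \<eta> 0 \<tau> * N (q - (\<tau>, 0)) * complex_of_real (adj F Ft q) \<partial>lborel) \<partial>lborel)"
      unfolding Nm_def
    proof (rule integral_superposition[OF mw box_test_adj[OF T]])
      fix A :: real
      obtain C where C: "0 \<le> C" "\<And>t x. \<bar>x\<bar> \<le> A \<Longrightarrow> norm (N (t, x)) \<le> C * sing (1/3) t" using N(3)[of A] by blast
      have "integrable lborel (\<lambda>r :: real \<times> real. C * ((M / \<eta> * indicator {0..\<eta>} (fst r)) * sing (1/3) (snd r - fst r)))"
        by (intro integrable_mult_right integrable_convolution_kernel integrable_mult_indicator_Icc integrable_sing) auto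
      then show "\<exists>B. integrable lborel (\<lambda>r :: real \<times> real. B (fst r) (snd r)) \<and>
         (\<forall>p t x. \<bar>t\<bar> \<le> A \<longrightarrow> \<bar>x\<bar> \<le> A \<longrightarrow> norm (rh \<eta> 0 p * N ((t, x) - (p, 0))) \<le> B p t)"
        using kernel_bound[OF \<eta> C] by (intro exI[of _ "\<lambda>p t. C * ((M / \<eta> * indicator {0..\<eta>} p) * sing (1/3) (t - p))"]) blast
    qed
    also have "\<dots> = (\<integral>\<tau>. rh \<eta> 0 \<tau> * complex_of_real (F 0 (\<tau>, 0)) \<partial>lborel)"
    proof (intro Bochner_Integration.integral_cong refl)
      fix \<tau> :: real
      have "(\<integral>q. N (q - (\<tau>, 0)) * complex_of_real (adj F Ft q) \<partial>lborel) = complex_of_real (F 0 (\<tau>, 0))"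
        unfolding weak_translate[OF mN T] using N(5)[OF test_family_translate[OF T], of "(\<tau>, 0)"] by simp
      then show "(\<integral>q. rh \<eta> 0 \<tau> * N (q - (\<tau>, 0)) * complex_of_real (adj F Ft q) \<partial>lborel) = rh \<eta> 0 \<tau> * complex_of_real (F 0 (\<tau>, 0))"
        by (simp only: mult.assoc integral_mult_right_zero)
    qed
    finally show ?thesis .
  qed
  \<comment> \<open>The error is measured with the slightly worse exponent 2/5. The spare factor
    t^(1/15), where 1/15 = 2/5 - 1/3, makes both \<open>N\<close> and \<open>Nm \<eta>\<close> small
    near t = 0, uniformly in \<eta>; later times are left to the uniform continuity of
    \<open>N\<close>.\<close>
  obtain \<eta> where \<eta>: "0 < \<eta>" "\<eta> \<le> b" and small: "\<And>t x. \<bar>x\<bar> \<le> X \<Longrightarrow> norm (N (t, x) - Nm \<eta> (t, x)) \<le> \<delta> * sing (2/5) t"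
  proof -
    obtain C where C: "0 \<le> C" "\<And>t x. \<bar>x\<bar> \<le> X \<Longrightarrow> norm (N (t, x)) \<le> C * sing (1/3) t" using N(3)[of X] by blast
    define C' where "C' = C + 3 * M * C + 1"
    have C': "1 \<le> C'" using C(1) \<rho>(2) by (simp add: C'_def)
    define t0 where "t0 = min ((\<delta> / C') ^ 15) b"
    have t0: "0 < t0" "t0 \<le> (\<delta> / C') ^ 15" "t0 \<le> b" using \<delta> C' b by (auto simp: t0_def)
    \<comment> \<open>The slab begins at t0/2 so that it contains the shifted times t - \<tau> for t
      > t0 and \<tau> \<le> \<eta> \<le> t0/2.\<close>
    define K where "K = {t0/2..1} \<times> {-X..X}"
    have "compact K" unfolding K_def by (intro compact_Times) auto
    moreover have "continuous_on K N" by (rule continuous_on_subset[OF N(4)]) (use t0 in \<open>auto simp: K_def\<close>)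
    ultimately have "uniformly_continuous_on K N" by (rule compact_uniformly_continuous[rotated])
    moreover have "0 < \<delta> / (M + 1)" using \<delta> \<rho>(2) by simp
    ultimately obtain d where d: "0 < d" "\<And>p q. p \<in> K \<Longrightarrow> q \<in> K \<Longrightarrow> dist q p < d \<Longrightarrow> dist (N q) (N p) < \<delta> / (M + 1)"
      unfolding uniformly_continuous_on_def by metis
    define \<eta> where "\<eta> = min (t0 / 2) (d / 2)"
    have \<eta>: "0 < \<eta>" "\<eta> \<le> t0 / 2" "\<eta> < d" "\<eta> \<le> b" using t0 d by (auto simp: \<eta>_def)
    have "norm (N (t, x) - Nm \<eta> (t, x)) \<le> \<delta> * sing (2/5) t" if x: "\<bar>x\<bar> \<le> X" for t x
    proof -
      consider "t \<le> 0 \<or> 3 * b \<le> t" | "0 < t" "t \<le> t0" | "t0 < t" "t < 3 * b" by linarith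
      then show ?thesis
      proof cases
        case 1
        then have "N (t, x) = 0" "Nm \<eta> (t, x) = 0" using N(2)[of t x] Nm0[OF \<eta>(1,4)] b by auto
        then show ?thesis using \<delta> sing_nonneg by simp
      next
        case 2
        have t1: "t \<le> 1" using 2 t0 b by simp
        have "norm (N (t, x) - Nm \<eta> (t, x)) \<le> C * sing (1/3) t + 3 * M * C * sing (1/3) t"
          using C(2)[OF x] Nm_bound[OF \<eta>(1,4) C x t1] by (rule order_trans[OF norm_triangle_ineq4 add_mono])
        also have "\<dots> \<le> C' * sing (1/3) t" using sing_nonneg[of "1/3" t] by (simp add: C'_def algebra_simps)
        also have "sing (1/3) t = t powr (1/15) * sing (2/5) t"
          using 2 t1 by (simp add: sing_def flip: powr_add)
        also have "C' * (t powr (1/15) * sing (2/5) t) \<le> C' * (\<delta> / C' * sing (2/5) t)"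
        proof (intro mult_left_mono mult_right_mono sing_nonneg)
          have "t powr (1/15) \<le> ((\<delta> / C') ^ 15) powr (1/15)" using 2 t0 by (intro powr_mono2) auto
          also have "\<dots> = \<delta> / C'" using powr_powr[of "\<delta> / C'" 15 "1/15"] \<delta> C' by simp
          finally show "t powr (1/15) \<le> \<delta> / C'" .
        qed (use C' in auto)
        finally show ?thesis using C' by simp
      next
        case 3
        have t1: "t \<le> 1" using 3 b by simp
        have i1: "integrable lborel (\<lambda>\<tau>. rh \<eta> 0 \<tau> * N (t, x))" by (intro integrable_mult_left rhi \<eta>)
        note i2 = Nm_int[OF \<eta>(1,4) C x t1]
        have a1: "(\<integral>\<tau>. rh \<eta> 0 \<tau> * N (t, x) \<partial>lborel) = N (t, x)"
          using rh1[OF \<eta>(1)] by (subst integral_mult_left_zero) simp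
        have "N (t, x) - Nm \<eta> (t, x) = (\<integral>\<tau>. rh \<eta> 0 \<tau> * N (t, x) - rh \<eta> 0 \<tau> * N ((t, x) - (\<tau>, 0)) \<partial>lborel)"
          using Bochner_Integration.integral_diff[OF i1 i2] a1 unfolding Nm_def by metis
        also have "norm \<dots> \<le> (\<integral>\<tau>. (M / \<eta> * (\<delta> / (M + 1))) * indicator {0..\<eta>} \<tau> \<partial>lborel)"
        proof (rule Bochner_Integration.integral_norm_bound_integral[OF Bochner_Integration.integrable_diff[OF i1 i2] integrable_mult_indicator_Icc])
          fix \<tau> :: real
          show "norm (rh \<eta> 0 \<tau> * N (t, x) - rh \<eta> 0 \<tau> * N ((t, x) - (\<tau>, 0))) \<le> (M / \<eta> * (\<delta> / (M + 1))) * indicator {0..\<eta>} \<tau>"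
          proof (cases "\<tau> \<in> {0..\<eta>}")
            case True
            have "(t, x) \<in> K" "(t - \<tau>, x) \<in> K" using 3 t0 t1 \<eta> True x by (auto simp: K_def)
            moreover have "dist (t - \<tau>, x) (t, x) < d" using True \<eta> by (simp add: dist_Pair_Pair dist_real_def)
            ultimately have "norm (N (t, x) - N (t - \<tau>, x)) \<le> \<delta> / (M + 1)"
              using d(2)[of "(t, x)" "(t - \<tau>, x)"] by (simp add: dist_norm norm_minus_commute)
            then have "norm (rh \<eta> 0 \<tau>) * norm (N (t, x) - N (t - \<tau>, x)) \<le> (M / \<eta>) * (\<delta> / (M + 1))"
              using rhb[OF \<eta>(1), of \<tau>] True \<rho>(2) \<eta> by (intro mult_mono) auto
            then show ?thesis using True by (simp add: norm_mult flip: right_diff_distrib)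
          next
            case False then show ?thesis using rh0[OF \<eta>(1), of \<tau> 0] by auto
          qed
        qed
        also have "\<dots> = M / (M + 1) * \<delta>" using \<eta> by simp
        also have "\<dots> \<le> 1 * \<delta>" using \<rho>(2) \<delta> by (intro mult_right_mono) auto
        also have "\<dots> \<le> \<delta> * sing (2/5) t" using \<delta> sing_ge_one[of t "2/5"] 3 t0 t1 by simp
        finally show ?thesis .
      qed
    qed
    then show thesis using that \<eta> by blast
  qed

  \<comment> \<open>Only the fourth x-derivative on x = 0 is nonzero among the data. Restricted to x
    > 0 the series has the jump - \<open>rh \<eta> 0\<close> in that derivative, which the term -
    \<partial>_x^5 turns into the source \<open>rh \<eta> 0 t\<close> at x = 0.\<close>
  define c where "c j k t = (if j = 4 then - rh \<eta> k t else 0)" for j :: nat and k t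
  have cb: "norm (c j k t) \<le> (M / \<eta>) * (R / \<eta> + 1) ^ k * (fact k)\<^sup>2" for j k t
  proof -
    have "norm (rh \<eta> k t) = 1 / \<eta> * ((1 / \<eta>) ^ k * norm (\<rho> k (t / \<eta>)))" using \<eta> by (simp add: rh_def norm_mult norm_divide norm_power)
    also have "\<dots> \<le> 1 / \<eta> * ((1 / \<eta>) ^ k * (M * R ^ k * (fact k)\<^sup>2))" using \<eta> by (intro mult_left_mono \<rho>(4)) auto
    also have "\<dots> = (M / \<eta>) * (R / \<eta>) ^ k * (fact k)\<^sup>2" by (simp add: power_divide mult_ac)
    also have "\<dots> \<le> (M / \<eta>) * (R / \<eta> + 1) ^ k * (fact k)\<^sup>2"
      using \<eta> \<rho>(2,3) by (intro mult_right_mono mult_left_mono power_mono) auto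
    finally show ?thesis using \<eta> \<rho>(2,3) by (auto simp: c_def)
  qed
  have R1: "1 \<le> R / \<eta> + 1" "0 \<le> M / \<eta>" using \<eta> \<rho>(2,3) by auto
  have gd: "gevrey_data c"
    unfolding gevrey_data_def
  proof (intro conjI allI impI)
    fix j :: nat
    show "deriv_seq (c j)"
    proof (cases "j = 4")
      case True
      have "deriv_seq (\<lambda>k t. (-1) * rh \<eta> k t)" by (intro deriv_seq_cmult drh)
      then show ?thesis using True by (simp add: c_def[abs_def])
    next
      case False then show ?thesis by (simp add: c_def[abs_def] deriv_seq_def)
    qed
  qed (use cb R1 in blast)
  define E where "E = esol c"
  have E0: "E (t, x) = 0" if "t \<le> 0 \<or> \<eta> \<le> t" for t x
    unfolding E_def by (rule esol_zero) (use rh0[OF \<eta>(1) that] in \<open>auto simp: c_def\<close>)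
  have Eb: "norm (E (t, x)) \<le> (M / \<eta> * growth (3 * (R / \<eta> + 1) * \<bar>Y\<bar>)) * sing (2/5) t" if "\<bar>x\<bar> \<le> Y" for t x Y
  proof -
    have g: "0 \<le> growth (3 * (R / \<eta> + 1) * \<bar>Y\<bar>)" using R1 by (intro growth_nonneg) auto
    show ?thesis
    proof (cases "t \<le> 0 \<or> \<eta> \<le> t")
      case True
      then show ?thesis using mult_nonneg_nonneg[OF mult_nonneg_nonneg[OF R1(2) g] sing_nonneg] by (simp only: E0[OF True] norm_zero)
    next
      case False
      have "norm (E (t, x)) \<le> (M / \<eta>) * growth (3 * (R / \<eta> + 1) * \<bar>Y\<bar>)"
        unfolding E_def by (rule esol_bound(1)) (use cb R1 that in auto)
      also have "\<dots> = (M / \<eta> * growth (3 * (R / \<eta> + 1) * \<bar>Y\<bar>)) * 1" by simp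
      also have "\<dots> \<le> (M / \<eta> * growth (3 * (R / \<eta> + 1) * \<bar>Y\<bar>)) * sing (2/5) t"
        using False \<eta> b by (intro mult_left_mono[OF sing_ge_one] mult_nonneg_nonneg[OF R1(2) g]) auto
      finally show ?thesis .
    qed
  qed
  define Gp where "Gp p = indicator {0<..} (snd p) *\<^sub>R E p" for p
  \<comment> \<open>Subtracting the global solution \<open>E\<close> moves the support from x > 0 to
    x \<le> 0 and leaves the source unchanged. The part that becomes large for small \<eta> can thus
    be put on either side.\<close>
  define G where "G p = Gp p - (if side then 0 else E p)" for p
  have ldE: "local_dom E" unfolding E_def by (intro local_dom_continuous continuous_esol gd)
  have ldGp: "local_dom Gp"
  proof -
    have "local_dom (\<lambda>p. indicator (UNIV \<times> {0<..}) p *\<^sub>R E p)"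
      by (intro local_dom_restrict ldE borel_open open_Times) auto
    moreover have "(\<lambda>p. indicator (UNIV \<times> {0<..}) p *\<^sub>R E p) = Gp" by (auto simp: Gp_def fun_eq_iff indicator_def)
    ultimately show ?thesis by simp
  qed
  have ldG: "local_dom G"
    using local_dom_add[OF ldGp local_dom_cmult[OF ldE, of "-1"]] ldGp by (cases side) (auto simp: G_def[abs_def])
  have Gle: "norm (G p) \<le> norm (E p)" for p by (auto simp: G_def Gp_def indicator_def)
  have Gzero: "G (t, x) = 0" if "if side then x \<le> 0 else 0 < x" for t x using that by (auto simp: G_def Gp_def indicator_def split: if_splits)
  have Gw: "(\<integral>p. G p * complex_of_real (adj F Ft p) \<partial>lborel) = (\<integral>\<tau>. rh \<eta> 0 \<tau> * complex_of_real (F 0 (\<tau>, 0)) \<partial>lborel)" if T: "test_family F Ft" for F Ft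
  proof -
    have 1: "(\<integral>p. Gp p * complex_of_real (adj F Ft p) \<partial>lborel) = (\<integral>\<tau>. rh \<eta> 0 \<tau> * complex_of_real (F 0 (\<tau>, 0)) \<partial>lborel)"
      using esol_weak[OF gd T, where H="{0<..}" and \<kappa>=1] by (simp add: Gp_def E_def c_def)
    have 2: "(\<integral>p. E p * complex_of_real (adj F Ft p) \<partial>lborel) = 0"
      using esol_weak[OF gd T, where H=UNIV and \<kappa>=0] by (simp add: E_def)
    have 3: "(\<integral>p. Gp p * complex_of_real (adj F Ft p) - E p * complex_of_real (adj F Ft p) \<partial>lborel) =
       (\<integral>p. Gp p * complex_of_real (adj F Ft p) \<partial>lborel) - (\<integral>p. E p * complex_of_real (adj F Ft p) \<partial>lborel)"
      by (intro Bochner_Integration.integral_diff local_dom_integrable ldGp ldE box_test_adj[OF T])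
    show ?thesis using 1 2 3 by (cases side) (auto simp: G_def left_diff_distrib)
  qed
  have ldNm: "local_dom (Nm \<eta>)"
    unfolding local_dom_def
  proof (intro conjI allI mNm)
    fix A :: real
    obtain C where "0 \<le> C" "\<And>t x. \<bar>x\<bar> \<le> A \<Longrightarrow> norm (Nm \<eta> (t, x)) \<le> C * sing (1/3) t" using Nm_bound'[OF \<eta>, of A] by blast
    then show "\<exists>\<gamma>. integrable lborel \<gamma> \<and> (\<forall>t x. \<bar>t\<bar> \<le> A \<longrightarrow> \<bar>x\<bar> \<le> A \<longrightarrow> norm (Nm \<eta> (t, x)) \<le> \<gamma> t)"
      by (intro exI[of _ "\<lambda>t. C * sing (1/3) t"] conjI integrable_mult_right integrable_sing) auto
  qed
  \<comment> \<open>The sources add up to the point source, minus its mollification, plus its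
    mollification. On the side where \<open>G\<close> vanishes only the small difference of
    \<open>N\<close> and \<open>Nm \<eta>\<close> is left.\<close>
  define V where "V p = (N p + (-1) * Nm \<eta> p) + G p" for p
  show thesis
  proof (rule that[of V])
    show "local_dom V" unfolding V_def by (intro local_dom_add local_dom_cmult N(1) ldNm ldG)
    show "V (t, x) = 0" if "t \<le> 0 \<or> 3 * b \<le> t" for t x
    proof -
      have "N (t, x) = 0" "Nm \<eta> (t, x) = 0" "E (t, x) = 0" using that N(2)[of t x] Nm0[OF \<eta>] E0[of t x] b \<eta> by auto
      then show ?thesis using Gle[of "(t, x)"] by (simp add: V_def)
    qed
    show "\<exists>C\<ge>0. \<forall>t x. \<bar>x\<bar> \<le> Y \<longrightarrow> norm (V (t, x)) \<le> C * sing (2/5) t" for Y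
    proof -
      obtain C1 where C1: "0 \<le> C1" "\<And>t x. \<bar>x\<bar> \<le> Y \<Longrightarrow> norm (N (t, x)) \<le> C1 * sing (1/3) t" using N(3)[of Y] by blast
      obtain C2 where C2: "0 \<le> C2" "\<And>t x. \<bar>x\<bar> \<le> Y \<Longrightarrow> norm (Nm \<eta> (t, x)) \<le> C2 * sing (1/3) t" using Nm_bound'[OF \<eta>, of Y] by blast
      define C3 where "C3 = M / \<eta> * growth (3 * (R / \<eta> + 1) * \<bar>Y\<bar>)"
      have C3: "0 \<le> C3" unfolding C3_def using R1 by (intro mult_nonneg_nonneg growth_nonneg) auto
      have "norm (V (t, x)) \<le> (C1 + C2 + C3) * sing (2/5) t" if x: "\<bar>x\<bar> \<le> Y" for t x
      proof -
        have "norm (V (t, x)) \<le> norm (N (t, x)) + norm (Nm \<eta> (t, x)) + norm (G (t, x))"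
          unfolding V_def by (rule norm_triangle_mono[OF norm_triangle_mono]) auto
        also have "\<dots> \<le> C1 * sing (2/5) t + C2 * sing (2/5) t + C3 * sing (2/5) t"
        proof (intro add_mono)
          show "norm (N (t, x)) \<le> C1 * sing (2/5) t" by (rule order_trans[OF C1(2)[OF x] mult_left_mono[OF sing_mono C1(1)]]) simp
          show "norm (Nm \<eta> (t, x)) \<le> C2 * sing (2/5) t" by (rule order_trans[OF C2(2)[OF x] mult_left_mono[OF sing_mono C2(1)]]) simp
          show "norm (G (t, x)) \<le> C3 * sing (2/5) t" unfolding C3_def by (rule order_trans[OF Gle Eb[OF x]])
        qed
        finally show ?thesis by (simp add: algebra_simps)
      qed
      then show ?thesis using C1(1) C2(1) C3 by (intro exI[of _ "C1 + C2 + C3"]) auto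
    qed
    show "norm (V (t, x)) \<le> \<delta> * sing (2/5) t" if "\<bar>x\<bar> \<le> X" "if side then x \<le> 0 else 0 < x" for t x
      using small[OF that(1), of t] Gzero[OF that(2), of t] by (simp add: V_def)
    fix F Ft assume T: "test_family F Ft"
    note int = local_dom_integrable[OF _ box_test_adj[OF T]]
    have "(\<integral>p. V p * complex_of_real (adj F Ft p) \<partial>lborel) =
      (\<integral>p. (N p * complex_of_real (adj F Ft p) - Nm \<eta> p * complex_of_real (adj F Ft p)) + G p * complex_of_real (adj F Ft p) \<partial>lborel)"
      unfolding V_def by (intro Bochner_Integration.integral_cong) (auto simp: algebra_simps)
    also have "\<dots> = ((\<integral>p. N p * complex_of_real (adj F Ft p) \<partial>lborel) - (\<integral>p. Nm \<eta> p * complex_of_real (adj F Ft p) \<partial>lborel)) + (\<integral>p. G p * complex_of_real (adj F Ft p) \<partial>lborel)"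
      using int[OF N(1)] int[OF ldNm] int[OF ldG] by simp
    finally show "(\<integral>p. V p * complex_of_real (adj F Ft p) \<partial>lborel) = complex_of_real (F 0 (0, 0))"
      unfolding N(5)[OF T] Nm_weak[OF \<eta>(1) T] Gw[OF T] by simp
  qed
qed

text \<open>The source at y is carried by a solution that is small on the side of y facing the
  origin: to the left if y \<ge> 0, to the right otherwise. Its smallness exp(- y^2 / 2) makes the
  superposition converge for every q integrable against the Gaussian.\<close>

lemma instantaneous_source_solution:
  assumes b: "0 < b" "b \<le> 1/4"
    and q: "q \<in> borel_measurable borel" "integrable lborel (\<lambda>x. norm (q x) * exp (- x\<^sup>2 / 2))"
  obtains v :: "real \<times> real \<Rightarrow> complex" where
    "local_dom v"
    "\<And>t x. t \<le> 0 \<or> 3 * b \<le> t \<Longrightarrow> v (t, x) = 0"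
    "\<And>Y. \<exists>C\<ge>0. \<forall>t x. \<bar>x\<bar> \<le> Y \<longrightarrow> norm (v (t, x)) \<le> C * sing (2/5) t"
    "\<And>F Ft. test_family F Ft \<Longrightarrow>
      (\<integral>p. v p * complex_of_real (adj F Ft p) \<partial>lborel) = (\<integral>x. q x * complex_of_real (F 0 (0, x)) \<partial>lborel)"
proof -
  \<comment> \<open>Integer levels, so that only countably many solutions are chosen and the
    superposition stays measurable in y. At the level L = floor |y|, L + 1 exceeds |y|, which gives
    \<delta> L \<le> exp(- y^2 / 2); the radius 2 (L + 1) covers x - y whenever |x| < |y|.\<close>
  define \<delta> where "\<delta> L = exp (- (real L + 1)\<^sup>2 / 2)" for L :: nat
  define P where "P side L V \<longleftrightarrow> local_dom V \<and> (\<forall>t x. t \<le> 0 \<or> 3 * b \<le> t \<longrightarrow> V (t, x) = 0) \<and>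
    (\<forall>Y. \<exists>C\<ge>0. \<forall>t x. \<bar>x\<bar> \<le> Y \<longrightarrow> norm (V (t, x)) \<le> C * sing (2/5) t) \<and>
    (\<forall>t x. \<bar>x\<bar> \<le> 2 * (real L + 1) \<longrightarrow> (if side then x \<le> 0 else 0 < x) \<longrightarrow> norm (V (t, x)) \<le> \<delta> L * sing (2/5) t) \<and>
    (\<forall>F Ft. test_family F Ft \<longrightarrow> (\<integral>p. V p * complex_of_real (adj F Ft p) \<partial>lborel) = complex_of_real (F 0 (0, 0)))"
    for side L and V :: "real \<times> real \<Rightarrow> complex"
  have "\<exists>V. P side L V" for side L
    by (rule one_sided_fundamental_solution[of b "\<delta> L" "2 * (real L + 1)" side, OF b]) (auto simp: \<delta>_def P_def)
  then obtain V where "\<And>side L. P side L (V side L)" by metis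
  then have V: "local_dom (V side L)" "\<And>t x. t \<le> 0 \<or> 3 * b \<le> t \<Longrightarrow> V side L (t, x) = 0"
    "\<And>Y. \<exists>C\<ge>0. \<forall>t x. \<bar>x\<bar> \<le> Y \<longrightarrow> norm (V side L (t, x)) \<le> C * sing (2/5) t"
    "\<And>t x. \<bar>x\<bar> \<le> 2 * (real L + 1) \<Longrightarrow> (if side then x \<le> 0 else 0 < x) \<Longrightarrow> norm (V side L (t, x)) \<le> \<delta> L * sing (2/5) t"
    "\<And>F Ft. test_family F Ft \<Longrightarrow> (\<integral>p. V side L p * complex_of_real (adj F Ft p) \<partial>lborel) = complex_of_real (F 0 (0, 0))"
    for side L unfolding P_def by blast+
  have mV[measurable]: "V side L \<in> borel_measurable borel" for side L using V(1) by (simp add: local_dom_def)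
  define lev where "lev y = nat \<lfloor>\<bar>y\<bar>\<rfloor>" for y :: real
  have lev: "real (lev y) \<le> \<bar>y\<bar>" "\<bar>y\<bar> < real (lev y) + 1" for y by (simp_all add: lev_def)
  define w where "w y p = q y * V (0 \<le> y) (lev y) (p - (0, y))" for y p
  have wmeas: "(\<lambda>r. w (fst r) (snd r)) \<in> borel_measurable borel"
  proof -
    have [measurable]: "fst \<in> borel_measurable (borel :: (real \<times> real \<times> real) measure)"
      by (intro borel_measurable_continuous_onI continuous_intros)
    have f1: "(\<lambda>r :: real \<times> real \<times> real. lev (fst r)) \<in> measurable borel (count_space UNIV)" unfolding lev_def by measurable
    have f2: "(\<lambda>r. V side L (snd r - (0, fst r))) \<in> borel_measurable (borel :: (real \<times> real \<times> real) measure)" for side L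
      by (intro measurable_compose[OF _ mV] borel_measurable_continuous_onI continuous_intros)
    have f3: "(\<lambda>r. if 0 \<le> fst r then V True L (snd r - (0, fst r)) else V False L (snd r - (0, fst r))) \<in> borel_measurable (borel :: (real \<times> real \<times> real) measure)" for L
      by (rule measurable_If[OF f2 f2]) (auto intro!: borel_closed closed_Collect_le continuous_intros)
    have "(\<lambda>r. if 0 \<le> fst r then V True (lev (fst r)) (snd r - (0, fst r)) else V False (lev (fst r)) (snd r - (0, fst r))) \<in> borel_measurable (borel :: (real \<times> real \<times> real) measure)"
      by (rule measurable_compose_countable[OF f3 f1])
    also have "(\<lambda>r. if 0 \<le> fst r then V True (lev (fst r)) (snd r - (0, fst r)) else V False (lev (fst r)) (snd r - (0, fst r))) =
      (\<lambda>r. V (0 \<le> fst r) (lev (fst r)) (snd r - (0, fst r)))" by auto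
    finally have "(\<lambda>r. V (0 \<le> fst r) (lev (fst r)) (snd r - (0, fst r))) \<in> borel_measurable (borel :: (real \<times> real \<times> real) measure)" .
    moreover have "(\<lambda>r. q (fst r)) \<in> borel_measurable (borel :: (real \<times> real \<times> real) measure)"
      by (intro measurable_compose[OF _ q(1)] borel_measurable_continuous_onI continuous_intros)
    ultimately show ?thesis unfolding w_def by simp
  qed
  have wb: "\<exists>K\<ge>0. \<forall>y t x. \<bar>x\<bar> \<le> Y \<longrightarrow> norm (w y (t, x)) \<le> K * (norm (q y) * exp (- y\<^sup>2 / 2)) * sing (2/5) t" for Y
  proof -
    define n0 where "n0 = nat \<lceil>\<bar>Y\<bar>\<rceil>"
    have n0: "\<bar>Y\<bar> \<le> real n0" by (simp add: n0_def)
    obtain C where C: "\<And>side L. 0 \<le> C side L" "\<And>side L t x. \<bar>x\<bar> \<le> \<bar>Y\<bar> + real n0 + 1 \<Longrightarrow> norm (V side L (t, x)) \<le> C side L * sing (2/5) t"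
      using V(3)[of "\<bar>Y\<bar> + real n0 + 1"] by metis
    define K1 where "K1 = (\<Sum>L\<le>n0. C True L + C False L)"
    have K1: "C side L \<le> K1" if "L \<le> n0" for side L
    proof -
      have "C side L \<le> C True L + C False L" using C(1)[of True L] C(1)[of False L] by (cases side) auto
      also have "\<dots> \<le> K1" unfolding K1_def by (rule member_le_sum) (use that C(1) in auto)
      finally show ?thesis .
    qed
    have K10: "0 \<le> K1" unfolding K1_def by (intro sum_nonneg add_nonneg_nonneg C(1))
    define K where "K = K1 * exp ((real n0 + 1)\<^sup>2 / 2) + 1"
    have K0: "0 \<le> K" using K10 by (simp add: K_def)
    \<comment> \<open>At the finitely many levels up to \<open>n0\<close> the point x may lie on the
      bad side of y, and a constant pays for that. At higher levels |x| < |y|, so x - y has the sign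
      for which the solution is small.\<close>
    have Vb: "norm (V (0 \<le> y) (lev y) (t, x - y)) \<le> (K * exp (- y\<^sup>2 / 2)) * sing (2/5) t" if x: "\<bar>x\<bar> \<le> Y" for y t x
    proof (cases "lev y \<le> n0")
      case True
      then have y: "\<bar>y\<bar> \<le> real n0 + 1" using lev(2)[of y] by linarith
      then have "\<bar>x - y\<bar> \<le> \<bar>Y\<bar> + real n0 + 1" using x by linarith
      then have "norm (V (0 \<le> y) (lev y) (t, x - y)) \<le> C (0 \<le> y) (lev y) * sing (2/5) t" by (rule C(2))
      also have "\<dots> \<le> (K * exp (- y\<^sup>2 / 2)) * sing (2/5) t"
      proof (intro mult_right_mono sing_nonneg)
        have "y\<^sup>2 \<le> (real n0 + 1)\<^sup>2" using power_mono[OF y, of 2] by simp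
        then have "1 \<le> exp ((real n0 + 1)\<^sup>2 / 2) * exp (- y\<^sup>2 / 2)" by (simp flip: exp_add)
        then have "K1 * 1 \<le> K1 * (exp ((real n0 + 1)\<^sup>2 / 2) * exp (- y\<^sup>2 / 2))" using K10 by (intro mult_left_mono)
        then show "C (0 \<le> y) (lev y) \<le> K * exp (- y\<^sup>2 / 2)"
          using K1[OF True, of "0 \<le> y"] by (simp add: K_def algebra_simps add_increasing)
      qed
      finally show ?thesis .
    next
      case False
      then have "real n0 < \<bar>y\<bar>" using lev(1)[of y] by linarith
      then have y: "\<bar>x\<bar> < \<bar>y\<bar>" using x n0 by linarith
      have "norm (V (0 \<le> y) (lev y) (t, x - y)) \<le> \<delta> (lev y) * sing (2/5) t"
      proof (rule V(4))
        show "\<bar>x - y\<bar> \<le> 2 * (real (lev y) + 1)" using y lev(2)[of y] order_trans[OF abs_triangle_ineq4[of x y], of "2 * (real (lev y) + 1)"] by argo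
        show "if 0 \<le> y then x - y \<le> 0 else 0 < x - y" using y by auto
      qed
      also have "\<dots> \<le> (K * exp (- y\<^sup>2 / 2)) * sing (2/5) t"
      proof (intro mult_right_mono sing_nonneg)
        have "y\<^sup>2 \<le> (real (lev y) + 1)\<^sup>2" using power_mono[OF less_imp_le[OF lev(2)], of y 2] by simp
        then have "\<delta> (lev y) \<le> 1 * exp (- y\<^sup>2 / 2)" by (simp add: \<delta>_def)
        also have "\<dots> \<le> K * exp (- y\<^sup>2 / 2)" using K10 by (intro mult_right_mono) (auto simp: K_def)
        finally show "\<delta> (lev y) \<le> K * exp (- y\<^sup>2 / 2)" .
      qed
      finally show ?thesis .
    qed
    have "norm (w y (t, x)) \<le> K * (norm (q y) * exp (- y\<^sup>2 / 2)) * sing (2/5) t" if "\<bar>x\<bar> \<le> Y" for y t x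
    proof -
      have "norm (w y (t, x)) \<le> norm (q y) * ((K * exp (- y\<^sup>2 / 2)) * sing (2/5) t)"
        unfolding w_def norm_mult using Vb[OF that, of y t] by (intro mult_left_mono) auto
      then show ?thesis by (simp only: mult_ac)
    qed
    then show ?thesis using K0 by blast
  qed
  have wdom: "\<exists>\<beta> \<gamma>. integrable lborel \<beta> \<and> integrable lborel \<gamma> \<and>
      (\<forall>y t x. \<bar>t\<bar> \<le> A \<longrightarrow> \<bar>x\<bar> \<le> A \<longrightarrow> norm (w y (t, x)) \<le> \<beta> y * \<gamma> t)" for A
  proof -
    obtain K where "0 \<le> K" "\<And>y t x. \<bar>x\<bar> \<le> A \<Longrightarrow> norm (w y (t, x)) \<le> K * (norm (q y) * exp (- y\<^sup>2 / 2)) * sing (2/5) t" using wb[of A] by blast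
    then show ?thesis
      by (intro exI[of _ "\<lambda>y. K * (norm (q y) * exp (- y\<^sup>2 / 2))"] exI[of _ "sing (2/5)"] conjI integrable_mult_right q(2) integrable_sing) auto
  qed
  note sp = superposition[OF wmeas wdom]
  have wsec: "(\<lambda>y. w y p) \<in> borel_measurable borel" for p
    using measurable_compose[OF _ wmeas, of "\<lambda>y. (y, p)" borel] by (simp add: borel_measurable_continuous_onI continuous_intros)
  show thesis
  proof (rule that[of "\<lambda>p. \<integral>y. w y p \<partial>lborel"])
    show "local_dom (\<lambda>p. \<integral>y. w y p \<partial>lborel)" by (rule sp(1))
    show "(\<integral>y. w y (t, x) \<partial>lborel) = 0" if "t \<le> 0 \<or> 3 * b \<le> t" for t x
    proof -
      have "w y (t, x) = 0" for y using V(2)[OF that] by (simp add: w_def)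
      then show ?thesis by simp
    qed
    show "\<exists>C\<ge>0. \<forall>t x. \<bar>x\<bar> \<le> Y \<longrightarrow> norm (\<integral>y. w y (t, x) \<partial>lborel) \<le> C * sing (2/5) t" for Y
    proof -
      obtain K where K: "0 \<le> K" "\<And>y t x. \<bar>x\<bar> \<le> Y \<Longrightarrow> norm (w y (t, x)) \<le> K * (norm (q y) * exp (- y\<^sup>2 / 2)) * sing (2/5) t" using wb[of Y] by blast
      let ?B = "\<lambda>t y. K * (norm (q y) * exp (- y\<^sup>2 / 2)) * sing (2/5) t"
      have i: "integrable lborel (?B t)" for t by (intro integrable_mult_left integrable_mult_right q(2))
      have nr: "norm z \<le> r \<Longrightarrow> norm z \<le> norm r" for z :: complex and r :: real by simp
      have "norm (\<integral>y. w y (t, x) \<partial>lborel) \<le> (K * (\<integral>y. norm (q y) * exp (- y\<^sup>2 / 2) \<partial>lborel)) * sing (2/5) t" if "\<bar>x\<bar> \<le> Y" for t x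
      proof -
        have "norm (\<integral>y. w y (t, x) \<partial>lborel) \<le> (\<integral>y. ?B t y \<partial>lborel)"
        proof (rule Bochner_Integration.integral_norm_bound_integral[OF Bochner_Integration.integrable_bound[OF i] i])
          show "(\<lambda>y. w y (t, x)) \<in> borel_measurable lborel" using wsec by simp
          show "AE y in lborel. norm (w y (t, x)) \<le> norm (?B t y)" by (intro AE_I2 nr K(2) that)
          show "norm (w y (t, x)) \<le> ?B t y" for y by (rule K(2)[OF that])
        qed
        then show ?thesis by (simp only: integral_mult_left_zero integral_mult_right_zero)
      qed
      moreover have "0 \<le> K * (\<integral>y. norm (q y) * exp (- y\<^sup>2 / 2) \<partial>lborel)" using K(1) by (intro mult_nonneg_nonneg integral_nonneg_AE AE_I2) auto
      ultimately show ?thesis by blast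
    qed
    fix F Ft assume T: "test_family F Ft"
    have "(\<integral>p. (\<integral>y. w y p \<partial>lborel) * complex_of_real (adj F Ft p) \<partial>lborel) = (\<integral>y. (\<integral>p. w y p * complex_of_real (adj F Ft p) \<partial>lborel) \<partial>lborel)"
      by (rule sp(2)[OF box_test_adj[OF T]])
    also have "\<dots> = (\<integral>y. q y * complex_of_real (F 0 (0, y)) \<partial>lborel)"
    proof (intro Bochner_Integration.integral_cong refl)
      fix y :: real
      have "(\<integral>p. V (0 \<le> y) (lev y) (p - (0, y)) * complex_of_real (adj F Ft p) \<partial>lborel) = complex_of_real (F 0 (0, y))"
        unfolding weak_translate[OF mV T] using V(5)[OF test_family_translate[OF T], of "0 \<le> y" "lev y" "(0, y)"] by simp
      then show "(\<integral>p. w y p * complex_of_real (adj F Ft p) \<partial>lborel) = q y * complex_of_real (F 0 (0, y))"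
        unfolding w_def by (simp only: mult.assoc integral_mult_right_zero)
    qed
    finally show "(\<integral>p. (\<integral>y. w y p \<partial>lborel) * complex_of_real (adj F Ft p) \<partial>lborel) = (\<integral>y. q y * complex_of_real (F 0 (0, y)) \<partial>lborel)" .
  qed
qed

section \<open>Local smoothing\<close>

definition om :: "real \<Rightarrow> real" where "om \<xi> = \<xi> ^ 5 + \<xi> ^ 3 - \<xi>"

lemma omega_of_real: "omega (of_real \<xi>) = of_real (om \<xi>)"
  by (simp add: omega_def om_def)

text \<open>The difference quotient of \<open>om\<close> is a quartic form plus lower-order terms.
  Written with squares it is at least 2/3 \<xi>^4 + 3/4 \<xi>^2 - 1, and |\<xi>| \<ge> 2 absorbs the
  - 1. A bound in \<xi> alone, for all \<eta>, is what the Schur test integrates.\<close>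

lemma om_diff_ge:
  assumes "2 \<le> \<bar>\<xi>\<bar>"
  shows "(\<xi> ^ 4 / 2 * (\<xi> - \<eta>))\<^sup>2 \<le> (om \<xi> - om \<eta>)\<^sup>2"
proof -
  define Q where "Q = \<xi> ^ 4 + \<xi> ^ 3 * \<eta> + \<xi>\<^sup>2 * \<eta>\<^sup>2 + \<xi> * \<eta> ^ 3 + \<eta> ^ 4 + \<xi>\<^sup>2 + \<xi> * \<eta> + \<eta>\<^sup>2 - 1"
  have f: "om \<xi> - om \<eta> = Q * (\<xi> - \<eta>)"
    unfolding om_def Q_def by (simp add: power_numeral_reduce algebra_simps)
  have sos: "Q = (\<eta>\<^sup>2 + \<eta> * \<xi> / 2)\<^sup>2 + 3/4 * (\<eta> * \<xi> + 2/3 * \<xi>\<^sup>2)\<^sup>2 + 2/3 * \<xi> ^ 4 + (\<eta> + \<xi> / 2)\<^sup>2 + 3/4 * \<xi>\<^sup>2 - 1"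
    unfolding Q_def by (simp add: power_numeral_reduce field_simps)
  have "4 \<le> \<xi>\<^sup>2" using power_mono[OF assms, of 2] by simp
  moreover have "0 \<le> \<xi> ^ 4" by simp
  ultimately have "\<xi> ^ 4 / 2 \<le> 2/3 * \<xi> ^ 4 + 3/4 * \<xi>\<^sup>2 - 1" by linarith
  also have "\<dots> \<le> Q" unfolding sos by (simp add: add_nonneg_nonneg)
  finally have "(\<xi> ^ 4 / 2)\<^sup>2 \<le> Q\<^sup>2" by (intro power_mono) auto
  then show ?thesis unfolding f power_mult_distrib by (intro mult_right_mono) auto
qed

text \<open>The Gram kernel of the real plane waves for the weight \<open>gw\<close>. A Gaussian
  weight is taken because its transform is explicit and positive.\<close>

definition kato_kernel :: "real \<Rightarrow> real \<Rightarrow> real" where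
  "kato_kernel \<xi> \<eta> = exp (- (om \<xi> - om \<eta>)\<^sup>2 / 2) * exp (- (\<xi> - \<eta>)\<^sup>2 / 2)"

lemma kato_kernel_sym: "kato_kernel \<xi> \<eta> = kato_kernel \<eta> \<xi>"
  by (simp add: kato_kernel_def power2_commute)

lemma measurable_kato_kernel: "(\<lambda>r. kato_kernel (fst r) (snd r)) \<in> borel_measurable borel"
  unfolding kato_kernel_def om_def by (intro borel_measurable_continuous_onI continuous_intros) auto

lemma nn_integral_gaussian_scaled:
  assumes "0 < \<sigma>"
  shows "(\<integral>\<^sup>+\<eta>. ennreal (exp (- (\<sigma> * (\<xi> - \<eta>))\<^sup>2 / 2)) \<partial>lborel) = ennreal (sqrt (2 * pi) / \<sigma>)"
proof -
  have 1: "(\<integral>\<^sup>+y. ennreal (std_normal_density y) \<partial>lborel) = 1"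
  proof -
    interpret prob_space std_normal_distribution by (rule prob_space_normal_density) simp
    show ?thesis using emeasure_space_1 by (simp add: emeasure_density)
  qed
  have "(\<integral>\<^sup>+y. ennreal (std_normal_density y) \<partial>lborel) = \<bar>- \<sigma>\<bar> * (\<integral>\<^sup>+\<eta>. ennreal (std_normal_density (\<sigma> * \<xi> + (- \<sigma>) * \<eta>)) \<partial>lborel)"
    by (rule nn_integral_real_affine) (use assms in auto)
  then have "ennreal \<sigma> * (\<integral>\<^sup>+\<eta>. ennreal (std_normal_density (\<sigma> * \<xi> + (- \<sigma>) * \<eta>)) \<partial>lborel) = 1" using 1 assms by simp
  moreover have "ennreal (exp (- (\<sigma> * (\<xi> - \<eta>))\<^sup>2 / 2)) = ennreal (sqrt (2 * pi)) * ennreal (std_normal_density (\<sigma> * \<xi> + (- \<sigma>) * \<eta>))" for \<eta>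
    by (simp add: std_normal_density_eq right_diff_distrib flip: ennreal_mult)
  then have "(\<integral>\<^sup>+\<eta>. ennreal (exp (- (\<sigma> * (\<xi> - \<eta>))\<^sup>2 / 2)) \<partial>lborel) = ennreal (sqrt (2 * pi)) * (\<integral>\<^sup>+\<eta>. ennreal (std_normal_density (\<sigma> * \<xi> + (- \<sigma>) * \<eta>)) \<partial>lborel)"
    by (simp add: nn_integral_cmult)
  moreover have "ennreal (sqrt (2 * pi)) = ennreal (sqrt (2 * pi) / \<sigma>) * ennreal \<sigma>" using assms by (simp flip: ennreal_mult)
  ultimately show ?thesis by (simp add: mult.assoc)
qed

text \<open>Local smoothing by two derivatives, as a Schur test: \<open>om\<close> separates frequencies like \<open>\<xi>^4\<close>.\<close>

lemma kato_kernel_integral: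
  "(\<integral>\<^sup>+\<eta>. ennreal (kato_kernel \<xi> \<eta>) \<partial>lborel) \<le> ennreal (25 * sqrt (2 * pi) / (1 + \<xi>\<^sup>2)\<^sup>2)"
proof (cases "2 \<le> \<bar>\<xi>\<bar>")
  case True
  have x4: "4 \<le> \<xi>\<^sup>2" using power_mono[OF True, of 2] by simp
  have p4: "\<xi> ^ 4 = \<xi>\<^sup>2 * \<xi>\<^sup>2" by (simp add: power2_eq_square power4_eq_xxxx)
  have pos: "0 < \<xi> ^ 4 / 2" 
  proof -
    have "0 < \<xi>\<^sup>2" using x4 by linarith
    from mult_pos_pos[OF this this] show ?thesis by (simp only: p4 zero_less_divide_iff) simp
  qed
  have "(\<integral>\<^sup>+\<eta>. ennreal (kato_kernel \<xi> \<eta>) \<partial>lborel) \<le> (\<integral>\<^sup>+\<eta>. ennreal (exp (- (\<xi> ^ 4 / 2 * (\<xi> - \<eta>))\<^sup>2 / 2)) \<partial>lborel)"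
  proof (intro nn_integral_mono ennreal_leI)
    fix \<eta>
    have "kato_kernel \<xi> \<eta> \<le> exp (- (om \<xi> - om \<eta>)\<^sup>2 / 2) * 1" unfolding kato_kernel_def by (intro mult_left_mono) auto
    also have "\<dots> \<le> exp (- (\<xi> ^ 4 / 2 * (\<xi> - \<eta>))\<^sup>2 / 2)" using om_diff_ge[OF True, of \<eta>] by simp
    finally show "kato_kernel \<xi> \<eta> \<le> exp (- (\<xi> ^ 4 / 2 * (\<xi> - \<eta>))\<^sup>2 / 2)" .
  qed
  also have "\<dots> = ennreal (sqrt (2 * pi) / (\<xi> ^ 4 / 2))" by (rule nn_integral_gaussian_scaled[OF pos])
  also have "\<dots> \<le> ennreal (25 * sqrt (2 * pi) / (1 + \<xi>\<^sup>2)\<^sup>2)"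
  proof (intro ennreal_leI)
    have "(1 + \<xi>\<^sup>2)\<^sup>2 \<le> (5/4 * \<xi>\<^sup>2)\<^sup>2" using x4 by (intro power_mono) auto
    also have "\<dots> \<le> 25 * (\<xi> ^ 4 / 2)"
    proof -
      have "0 \<le> \<xi>\<^sup>2 * \<xi>\<^sup>2" "(5/4 * \<xi>\<^sup>2)\<^sup>2 = 25/16 * (\<xi>\<^sup>2 * \<xi>\<^sup>2)" by (simp_all add: power2_eq_square)
      then show ?thesis unfolding p4 by linarith
    qed
    finally have "1 / (\<xi> ^ 4 / 2) \<le> 25 / (1 + \<xi>\<^sup>2)\<^sup>2" using pos x4 by (simp add: field_simps add_pos_nonneg)
    then have "sqrt (2 * pi) * (1 / (\<xi> ^ 4 / 2)) \<le> sqrt (2 * pi) * (25 / (1 + \<xi>\<^sup>2)\<^sup>2)" by (intro mult_left_mono) auto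
    then show "sqrt (2 * pi) / (\<xi> ^ 4 / 2) \<le> 25 * sqrt (2 * pi) / (1 + \<xi>\<^sup>2)\<^sup>2" by (simp add: mult.commute)
  qed
  finally show ?thesis .
next
  case False
  have "(\<integral>\<^sup>+\<eta>. ennreal (kato_kernel \<xi> \<eta>) \<partial>lborel) \<le> (\<integral>\<^sup>+\<eta>. ennreal (exp (- (1 * (\<xi> - \<eta>))\<^sup>2 / 2)) \<partial>lborel)"
  proof (intro nn_integral_mono ennreal_leI)
    fix \<eta>
    have "kato_kernel \<xi> \<eta> \<le> 1 * exp (- (\<xi> - \<eta>)\<^sup>2 / 2)" unfolding kato_kernel_def by (intro mult_right_mono) auto
    then show "kato_kernel \<xi> \<eta> \<le> exp (- (1 * (\<xi> - \<eta>))\<^sup>2 / 2)" by simp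
  qed
  also have "\<dots> = ennreal (sqrt (2 * pi) / 1)" by (rule nn_integral_gaussian_scaled) simp
  \<comment> \<open>The constant 25 comes from this case: 1 + \<xi>^2 \<le> 5 when |\<xi>| <
    2.\<close>
  also have "\<dots> \<le> ennreal (25 * sqrt (2 * pi) / (1 + \<xi>\<^sup>2)\<^sup>2)"
  proof (intro ennreal_leI)
    have "\<xi>\<^sup>2 \<le> 2\<^sup>2" using False power_mono[of "\<bar>\<xi>\<bar>" 2 2] by simp
    then have "(1 + \<xi>\<^sup>2)\<^sup>2 \<le> 5\<^sup>2" by (intro power_mono) auto
    moreover have "0 < (1 + \<xi>\<^sup>2)\<^sup>2" by (intro zero_less_power add_pos_nonneg) auto
    ultimately have "1 \<le> 25 / (1 + \<xi>\<^sup>2)\<^sup>2" by (simp add: field_simps)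
    then have "sqrt (2 * pi) * 1 \<le> sqrt (2 * pi) * (25 / (1 + \<xi>\<^sup>2)\<^sup>2)" by (intro mult_left_mono) auto
    then show "sqrt (2 * pi) / 1 \<le> 25 * sqrt (2 * pi) / (1 + \<xi>\<^sup>2)\<^sup>2" by (simp add: mult.commute)
  qed
  finally show ?thesis .
qed

section \<open>Gaussian-weighted energy of superposed plane waves\<close>

definition gw :: "real \<times> real \<Rightarrow> real" where
  "gw p = std_normal_density (fst p) * std_normal_density (snd p)"

lemma measurable_gw [measurable]: "gw \<in> borel_measurable borel"
  unfolding gw_def std_normal_density_eq by (intro borel_measurable_continuous_onI continuous_intros) auto

lemma gw_pos: "0 < gw p" by (simp add: gw_def normal_density_pos)

lemma integrable_gw: "integrable lborel gw"
  using lborel_pair.integrable_mult_pair[OF integrable_std_normal_density integrable_std_normal_density]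
  by (simp add: lborel_prod gw_def[abs_def])

lemma plane_wave_real: "plane_wave (of_real \<xi>) p = exp (\<i> * of_real (om \<xi> * fst p + \<xi> * snd p))"
  by (simp add: plane_wave_def omega_of_real exp_add[symmetric] algebra_simps)

lemma norm_plane_wave_real: "norm (plane_wave (of_real \<xi>) p) = 1"
  unfolding plane_wave_real by (rule norm_exp_i_times)

lemma gw_plane_waves:
  "(\<integral>p. complex_of_real (gw p) * (plane_wave (of_real \<xi>) p * cnj (plane_wave (of_real \<eta>) p)) \<partial>lborel) = of_real (kato_kernel \<xi> \<eta>)"
proof -
  let ?a = "om \<xi> - om \<eta>" and ?c = "\<xi> - \<eta>"
  have e: "complex_of_real (gw p) * (plane_wave (of_real \<xi>) p * cnj (plane_wave (of_real \<eta>) p)) =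
    (exp (\<i> * of_real (?a * fst p)) * complex_of_real (std_normal_density (fst p))) * (exp (\<i> * of_real (?c * snd p)) * complex_of_real (std_normal_density (snd p)))" for p
    unfolding plane_wave_real gw_def by (simp add: exp_cnj algebra_simps flip: exp_add)
  have i: "integrable lborel (\<lambda>p. complex_of_real (gw p) * (plane_wave (of_real \<xi>) p * cnj (plane_wave (of_real \<eta>) p)))"
  proof (rule Bochner_Integration.integrable_bound[OF integrable_gw])
    show "(\<lambda>p. complex_of_real (gw p) * (plane_wave (of_real \<xi>) p * cnj (plane_wave (of_real \<eta>) p))) \<in> borel_measurable lborel"
    proof -
      have "continuous_on UNIV (\<lambda>p. plane_wave (of_real \<xi>) p * cnj (plane_wave (of_real \<eta>) p))"
        by (intro continuous_intros continuous_plane_wave)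
      note m = borel_measurable_continuous_onI[OF this]
      have "(\<lambda>p. complex_of_real (gw p)) \<in> borel_measurable borel" by measurable
      from borel_measurable_times[OF this m] show ?thesis by simp
    qed
  qed (simp add: norm_mult norm_plane_wave_real)
  have it: "(\<integral>p. complex_of_real (gw p) * (plane_wave (of_real \<xi>) p * cnj (plane_wave (of_real \<eta>) p)) \<partial>lborel) =
    (\<integral>t. (\<integral>x. (exp (\<i> * of_real (?a * t)) * complex_of_real (std_normal_density t)) * (exp (\<i> * of_real (?c * x)) * complex_of_real (std_normal_density x)) \<partial>lborel) \<partial>lborel)"
    unfolding integral_lborel_pair_iterated(1)[OF i] by (simp only: e fst_conv snd_conv)
  show ?thesis
    unfolding it integral_mult_right_zero integral_mult_left_zero std_normal_char kato_kernel_def by (simp only: of_real_mult)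
qed

text \<open>Expanding |f|^2 gives the quadratic form of \<open>kato_kernel\<close> in h. By 2 |a b|
  \<le> |a|^2 + |b|^2 and symmetry it is at most the integral of |h|^2 times the row integrals of
  the kernel, which are O((1 + \<xi>^2)^(-2)). The L^1 norm of h serves absolute convergence and
  does not enter the final estimate, which can therefore be used along a sequence of
  truncations.\<close>

lemma kato_smoothing:
  assumes h: "integrable lborel h"
  defines "f p \<equiv> (\<integral>\<xi>. h \<xi> * plane_wave (of_real \<xi>) p \<partial>lborel)"
  shows "f \<in> borel_measurable borel" and "\<And>p. norm (f p) \<le> (\<integral>\<xi>. norm (h \<xi>) \<partial>lborel)"
    and "(\<integral>\<^sup>+p. ennreal (gw p * (norm (f p))\<^sup>2) \<partial>lborel) \<le>
      ennreal (25 * sqrt (2 * pi)) * (\<integral>\<^sup>+\<xi>. ennreal ((norm (h \<xi>))\<^sup>2 / (1 + \<xi>\<^sup>2)\<^sup>2) \<partial>lborel)"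
proof -
  have hm[measurable]: "h \<in> borel_measurable borel" using h by auto
  have cm: "continuous_on UNIV g \<Longrightarrow> (\<lambda>r. k (g r)) \<in> borel_measurable borel" if "k \<in> borel_measurable borel"
    for g :: "'a::topological_space \<Rightarrow> real" and k :: "real \<Rightarrow> complex"
    by (rule measurable_compose[OF borel_measurable_continuous_onI that])
  have mpw': "(\<lambda>r. plane_wave (of_real (snd r)) (fst r)) \<in> borel_measurable (borel :: ((real \<times> real) \<times> real) measure)"
    unfolding plane_wave_real om_def by (intro borel_measurable_continuous_onI continuous_intros)
  have mh': "(\<lambda>r. h (snd r)) \<in> borel_measurable (borel :: ((real \<times> real) \<times> real) measure)"
    by (intro cm[OF hm] continuous_intros)
  have "(\<lambda>(p, \<xi>). h \<xi> * plane_wave (of_real \<xi>) p) \<in> borel_measurable (lborel \<Otimes>\<^sub>M lborel)"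
    using mh' mpw' by (simp add: lborel_prod case_prod_beta')
  from lborel.borel_measurable_lebesgue_integral[OF this]
  show mf0[measurable]: "f \<in> borel_measurable borel" unfolding f_def by simp
  have spw: "(\<lambda>\<xi>. plane_wave (of_real \<xi>) p) \<in> borel_measurable borel" for p
    unfolding plane_wave_real om_def by (intro borel_measurable_continuous_onI continuous_intros)
  have ih: "integrable lborel (\<lambda>\<xi>. h \<xi> * plane_wave (of_real \<xi>) p)" for p
    by (rule Bochner_Integration.integrable_bound[OF h]) (use spw in \<open>auto simp: norm_mult norm_plane_wave_real\<close>)
  show fb: "norm (f p) \<le> (\<integral>\<xi>. norm (h \<xi>) \<partial>lborel)" for p
    unfolding f_def by (rule order_trans[OF integral_norm_bound]) (simp add: norm_mult norm_plane_wave_real)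
  define Hh where "Hh r = norm (h (fst r)) * norm (h (snd r))" for r :: "real \<times> real"
  have iHh: "integrable lborel Hh"
    using lborel_pair.integrable_mult_pair[OF integrable_norm[OF h] integrable_norm[OF h]] by (simp add: lborel_prod Hh_def[abs_def])
  define \<Phi> where "\<Phi> p r = complex_of_real (gw p) * ((h (fst r) * cnj (h (snd r))) * (plane_wave (of_real (fst r)) p * cnj (plane_wave (of_real (snd r)) p)))" for p r
  have i\<Phi>: "integrable (lborel \<Otimes>\<^sub>M lborel) (\<lambda>(p, r). \<Phi> p r)"
  proof (rule Bochner_Integration.integrable_bound[OF lborel_pair.integrable_mult_pair[OF integrable_gw iHh]])
    let ?B = "borel :: ((real \<times> real) \<times> (real \<times> real)) measure"
    have a: "(\<lambda>s. gw (fst s)) \<in> borel_measurable ?B" by (intro measurable_compose[OF _ measurable_gw] borel_measurable_continuous_onI continuous_intros)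
    have b: "(\<lambda>s. h (fst (snd s))) \<in> borel_measurable ?B" "(\<lambda>s. h (snd (snd s))) \<in> borel_measurable ?B"
      by (intro cm[OF hm] continuous_intros)+
    have c: "(\<lambda>s. plane_wave (of_real (fst (snd s))) (fst s)) \<in> borel_measurable ?B" "(\<lambda>s. cnj (plane_wave (of_real (snd (snd s))) (fst s))) \<in> borel_measurable ?B"
      unfolding plane_wave_real om_def by (intro borel_measurable_continuous_onI continuous_intros)+
    have d: "(\<lambda>s. cnj (h (snd (snd s)))) \<in> borel_measurable ?B"
      by (rule measurable_compose[OF b(2)]) (intro borel_measurable_continuous_onI continuous_intros)
    show "(\<lambda>(p, r). \<Phi> p r) \<in> borel_measurable (lborel \<Otimes>\<^sub>M lborel)"
      using a b c d by (simp add: lborel_prod case_prod_beta' \<Phi>_def)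
  qed (auto simp: \<Phi>_def norm_mult norm_plane_wave_real Hh_def abs_mult)
  have e1: "(\<integral>r. \<Phi> p r \<partial>lborel) = of_real (gw p * (norm (f p))\<^sup>2)" for p
  proof -
    let ?A = "\<lambda>\<xi>. h \<xi> * plane_wave (of_real \<xi>) p"
    have icn: "integrable lborel (\<lambda>\<xi>. cnj (?A \<xi>))" using ih by (rule integrable_cnj)
    have i: "integrable lborel (\<lambda>r. ?A (fst r) * cnj (?A (snd r)))"
    proof (rule Bochner_Integration.integrable_bound[OF iHh])
      have "?A \<in> borel_measurable borel" "(\<lambda>\<xi>. cnj (?A \<xi>)) \<in> borel_measurable borel" using borel_measurable_integrable[OF ih] borel_measurable_integrable[OF icn] by simp_all
      note A = cm[OF this(1)] cm[OF this(2)]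
      have "(\<lambda>r. ?A (fst r)) \<in> borel_measurable (borel :: (real \<times> real) measure)" "(\<lambda>r. cnj (?A (snd r))) \<in> borel_measurable (borel :: (real \<times> real) measure)"
        by (intro A continuous_intros)+
      then show "(\<lambda>r. ?A (fst r) * cnj (?A (snd r))) \<in> borel_measurable lborel" by (simp del: complex_cnj_mult)
    qed (auto simp: norm_mult norm_plane_wave_real Hh_def)
    have "(\<integral>r. \<Phi> p r \<partial>lborel) = of_real (gw p) * (\<integral>r. ?A (fst r) * cnj (?A (snd r)) \<partial>lborel)"
      unfolding \<Phi>_def by (subst integral_mult_right_zero, rule arg_cong[where f="\<lambda>z. of_real (gw p) * z"], intro Bochner_Integration.integral_cong) auto
    also have "(\<integral>r. ?A (fst r) * cnj (?A (snd r)) \<partial>lborel) = (\<integral>\<xi>. ?A \<xi> * cnj (f p) \<partial>lborel)"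
      unfolding integral_lborel_pair_iterated(1)[OF i] fst_conv snd_conv
      by (simp only: integral_mult_right_zero f_def Bochner_Integration.integral_cnj)
    also have "\<dots> = f p * cnj (f p)" by (simp only: integral_mult_left_zero f_def)
    finally show ?thesis by (simp only: of_real_mult complex_norm_square)
  qed
  have e2: "(\<integral>p. \<Phi> p r \<partial>lborel) = (h (fst r) * cnj (h (snd r))) * of_real (kato_kernel (fst r) (snd r))" for r
  proof -
    have "(\<integral>p. \<Phi> p r \<partial>lborel) = (\<integral>p. (h (fst r) * cnj (h (snd r))) * (complex_of_real (gw p) * (plane_wave (of_real (fst r)) p * cnj (plane_wave (of_real (snd r)) p))) \<partial>lborel)"
      unfolding \<Phi>_def by (intro Bochner_Integration.integral_cong) auto
    then show ?thesis by (simp only: integral_mult_right_zero gw_plane_waves)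
  qed
  have fin: "integrable lborel (\<lambda>p. gw p * (norm (f p))\<^sup>2)"
    by (rule Bochner_Integration.integrable_bound[OF integrable_mult_left[OF integrable_gw, of "(\<integral>\<xi>. norm (h \<xi>) \<partial>lborel)\<^sup>2"]])
       (use fb in \<open>auto simp: abs_mult less_imp_le[OF gw_pos] intro!: mult_left_mono power_mono\<close>)
  have "complex_of_real (\<integral>p. gw p * (norm (f p))\<^sup>2 \<partial>lborel) = (\<integral>p. (\<integral>r. \<Phi> p r \<partial>lborel) \<partial>lborel)"
    unfolding e1 by (rule integral_complex_of_real[symmetric])
  also have "\<dots> = (\<integral>r. (\<integral>p. \<Phi> p r \<partial>lborel) \<partial>lborel)"
    using lborel_pair.Fubini_integral[OF i\<Phi>] by simp
  finally have eq: "complex_of_real (\<integral>p. gw p * (norm (f p))\<^sup>2 \<partial>lborel) = (\<integral>r. (h (fst r) * cnj (h (snd r))) * of_real (kato_kernel (fst r) (snd r)) \<partial>lborel)"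
    unfolding e2 .
  have mk: "(\<lambda>r. ennreal (kato_kernel (fst r) (snd r))) \<in> borel_measurable (lborel \<Otimes>\<^sub>M lborel)"
    using measurable_kato_kernel by (simp add: lborel_prod)
  have nnk: "0 \<le> kato_kernel \<xi> \<eta>" for \<xi> \<eta> by (simp add: kato_kernel_def)
  have mh1: "(\<lambda>r. h (fst r)) \<in> borel_measurable (lborel \<Otimes>\<^sub>M lborel)" "(\<lambda>r. h (snd r)) \<in> borel_measurable (lborel \<Otimes>\<^sub>M lborel)" by measurable
  have iK: "integrable lborel (\<lambda>r. (h (fst r) * cnj (h (snd r))) * complex_of_real (kato_kernel (fst r) (snd r)))"
    using lborel_pair.integrable_snd[OF i\<Phi>] unfolding e2 by simp
  let ?q = "\<lambda>\<xi>. ennreal ((norm (h \<xi>))\<^sup>2 / 2)"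
  have "(\<integral>\<^sup>+p. ennreal (gw p * (norm (f p))\<^sup>2) \<partial>lborel) = ennreal (\<integral>p. gw p * (norm (f p))\<^sup>2 \<partial>lborel)"
    by (rule nn_integral_eq_integral[OF fin]) (auto simp: less_imp_le[OF gw_pos])
  also have "\<dots> \<le> ennreal (norm (complex_of_real (\<integral>p. gw p * (norm (f p))\<^sup>2 \<partial>lborel)))" by (intro ennreal_leI) simp
  also have "\<dots> \<le> (\<integral>\<^sup>+r. ennreal (norm ((h (fst r) * cnj (h (snd r))) * complex_of_real (kato_kernel (fst r) (snd r)))) \<partial>lborel)"
    unfolding eq by (rule integral_norm_bound_ennreal[OF iK])
  also have "\<dots> \<le> (\<integral>\<^sup>+r. ?q (fst r) * ennreal (kato_kernel (fst r) (snd r)) + ?q (snd r) * ennreal (kato_kernel (fst r) (snd r)) \<partial>lborel)"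
  proof (intro nn_integral_mono)
    fix r :: "real \<times> real"
    have "norm (h (fst r)) * norm (h (snd r)) \<le> (norm (h (fst r)))\<^sup>2 / 2 + (norm (h (snd r)))\<^sup>2 / 2"
      using sum_squares_bound[of "norm (h (fst r))" "norm (h (snd r))"] by simp
    then have "norm (h (fst r)) * norm (h (snd r)) * kato_kernel (fst r) (snd r) \<le> ((norm (h (fst r)))\<^sup>2 / 2 + (norm (h (snd r)))\<^sup>2 / 2) * kato_kernel (fst r) (snd r)"
      by (intro mult_right_mono nnk)
    then have "ennreal (norm ((h (fst r) * cnj (h (snd r))) * complex_of_real (kato_kernel (fst r) (snd r)))) \<le> ennreal ((norm (h (fst r)))\<^sup>2 / 2 * kato_kernel (fst r) (snd r) + (norm (h (snd r)))\<^sup>2 / 2 * kato_kernel (fst r) (snd r))"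
      using nnk by (intro ennreal_leI) (simp add: norm_mult distrib_right)
    also have "\<dots> = ?q (fst r) * ennreal (kato_kernel (fst r) (snd r)) + ?q (snd r) * ennreal (kato_kernel (fst r) (snd r))"
    proof -
      have "0 \<le> a \<Longrightarrow> 0 \<le> b \<Longrightarrow> 0 \<le> k \<Longrightarrow> ennreal (a * k + b * k) = ennreal a * ennreal k + ennreal b * ennreal k" for a b k
        by (simp add: ennreal_mult)
      then show ?thesis by (simp only: nnk divide_nonneg_nonneg zero_le_power2 zero_le_numeral)
    qed
    finally show "ennreal (norm ((h (fst r) * cnj (h (snd r))) * complex_of_real (kato_kernel (fst r) (snd r)))) \<le> ?q (fst r) * ennreal (kato_kernel (fst r) (snd r)) + ?q (snd r) * ennreal (kato_kernel (fst r) (snd r))" .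
  qed
  also have "\<dots> = (\<integral>\<^sup>+r. ?q (fst r) * ennreal (kato_kernel (fst r) (snd r)) \<partial>(lborel \<Otimes>\<^sub>M lborel)) + (\<integral>\<^sup>+r. ?q (snd r) * ennreal (kato_kernel (fst r) (snd r)) \<partial>(lborel \<Otimes>\<^sub>M lborel))"
    unfolding lborel_prod[symmetric] using mk mh1 by (intro nn_integral_add) auto
  also have "(\<integral>\<^sup>+r. ?q (fst r) * ennreal (kato_kernel (fst r) (snd r)) \<partial>(lborel \<Otimes>\<^sub>M lborel)) = (\<integral>\<^sup>+\<xi>. ?q \<xi> * (\<integral>\<^sup>+\<eta>. ennreal (kato_kernel \<xi> \<eta>) \<partial>lborel) \<partial>lborel)"
  proof -
    have k1: "(\<lambda>\<eta>. ennreal (kato_kernel \<xi> \<eta>)) \<in> borel_measurable lborel" for \<xi> using measurable_compose[OF _ mk, of "\<lambda>\<eta>. (\<xi>, \<eta>)" lborel] by simp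
    have "(\<lambda>r. ?q (fst r) * ennreal (kato_kernel (fst r) (snd r))) \<in> borel_measurable (lborel \<Otimes>\<^sub>M lborel)" using mk mh1 by measurable
    from lborel.nn_integral_fst[OF this, symmetric] show ?thesis using k1 by (simp add: nn_integral_cmult)
  qed
  also have "(\<integral>\<^sup>+r. ?q (snd r) * ennreal (kato_kernel (fst r) (snd r)) \<partial>(lborel \<Otimes>\<^sub>M lborel)) = (\<integral>\<^sup>+\<xi>. ?q \<xi> * (\<integral>\<^sup>+\<eta>. ennreal (kato_kernel \<xi> \<eta>) \<partial>lborel) \<partial>lborel)"
  proof -
    have k1: "(\<lambda>\<eta>. ennreal (kato_kernel \<eta> \<xi>)) \<in> borel_measurable lborel" for \<xi> using measurable_compose[OF _ mk, of "\<lambda>\<eta>. (\<eta>, \<xi>)" lborel] by simp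
    have "(\<lambda>r. ?q (snd r) * ennreal (kato_kernel (fst r) (snd r))) \<in> borel_measurable (lborel \<Otimes>\<^sub>M lborel)" using mk mh1 by measurable
    from lborel_pair.nn_integral_snd[OF this, symmetric] show ?thesis using k1 by (simp add: nn_integral_cmult kato_kernel_sym)
  qed
  also have "(\<integral>\<^sup>+\<xi>. ?q \<xi> * (\<integral>\<^sup>+\<eta>. ennreal (kato_kernel \<xi> \<eta>) \<partial>lborel) \<partial>lborel) + (\<integral>\<^sup>+\<xi>. ?q \<xi> * (\<integral>\<^sup>+\<eta>. ennreal (kato_kernel \<xi> \<eta>) \<partial>lborel) \<partial>lborel)
    \<le> (\<integral>\<^sup>+\<xi>. ?q \<xi> * ennreal (25 * sqrt (2 * pi) / (1 + \<xi>\<^sup>2)\<^sup>2) \<partial>lborel) + (\<integral>\<^sup>+\<xi>. ?q \<xi> * ennreal (25 * sqrt (2 * pi) / (1 + \<xi>\<^sup>2)\<^sup>2) \<partial>lborel)"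
    by (intro add_mono nn_integral_mono mult_left_mono kato_kernel_integral) auto
  also have "\<dots> = (\<integral>\<^sup>+\<xi>. ?q \<xi> * ennreal (25 * sqrt (2 * pi) / (1 + \<xi>\<^sup>2)\<^sup>2) + ?q \<xi> * ennreal (25 * sqrt (2 * pi) / (1 + \<xi>\<^sup>2)\<^sup>2) \<partial>lborel)"
    by (rule nn_integral_add[symmetric]) auto
  also have "\<dots> = (\<integral>\<^sup>+\<xi>. ennreal (25 * sqrt (2 * pi)) * ennreal ((norm (h \<xi>))\<^sup>2 / (1 + \<xi>\<^sup>2)\<^sup>2) \<partial>lborel)"
    by (intro nn_integral_cong) (simp flip: ennreal_mult ennreal_plus add: mult.commute)
  also have "\<dots> = ennreal (25 * sqrt (2 * pi)) * (\<integral>\<^sup>+\<xi>. ennreal ((norm (h \<xi>))\<^sup>2 / (1 + \<xi>\<^sup>2)\<^sup>2) \<partial>lborel)"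
    by (rule nn_integral_cmult) auto
  finally show "(\<integral>\<^sup>+p. ennreal (gw p * (norm (f p))\<^sup>2) \<partial>lborel) \<le>
      ennreal (25 * sqrt (2 * pi)) * (\<integral>\<^sup>+\<xi>. ennreal ((norm (h \<xi>))\<^sup>2 / (1 + \<xi>\<^sup>2)\<^sup>2) \<partial>lborel)" .
qed

section \<open>The group solution\<close>

text \<open>Convergence in L^2 says nothing about a single time slice, but fast convergence does: S,
  the sum of 4^n |f (n+1) - f n|^2, has integral at most the sum of c / 4^n, and it bounds the n-th
  error pointwise with a geometric factor. The majorant can then be restricted to slices.\<close>

lemma riesz_fischer_dominated:
  fixes f :: "nat \<Rightarrow> 'a \<Rightarrow> complex"
  assumes f[measurable]: "\<And>n. f n \<in> borel_measurable M" and c: "0 \<le> c"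
    and le: "\<And>n. (\<integral>\<^sup>+p. ennreal ((norm (f (Suc n) p - f n p))\<^sup>2) \<partial>M) \<le> ennreal (c / 16 ^ n)"
  obtains U S where "U \<in> borel_measurable M" "S \<in> borel_measurable M" "(\<integral>\<^sup>+p. S p \<partial>M) < \<infinity>"
    "\<And>n p. S p < \<infinity> \<Longrightarrow> norm (U p - f n p) \<le> 2 / 2 ^ n * sqrt (enn2real (S p))"
proof -
  define S where "S p = (\<Sum>n. ennreal (4 ^ n * (norm (f (Suc n) p - f n p))\<^sup>2))" for p
  define U where "U p = lim (\<lambda>n. f n p)" for p
  have mS: "S \<in> borel_measurable M" unfolding S_def by measurable
  have mU: "U \<in> borel_measurable M" unfolding U_def by (rule borel_measurable_lim_metric) measurable
  have "(\<integral>\<^sup>+p. S p \<partial>M) = (\<Sum>n. \<integral>\<^sup>+p. ennreal (4 ^ n * (norm (f (Suc n) p - f n p))\<^sup>2) \<partial>M)"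
    unfolding S_def by (rule nn_integral_suminf) measurable
  also have "\<dots> \<le> (\<Sum>n. ennreal (c * (1/4) ^ n))"
  proof (intro suminf_le summableI)
    fix n
    have "(\<integral>\<^sup>+p. ennreal (4 ^ n * (norm (f (Suc n) p - f n p))\<^sup>2) \<partial>M) = ennreal (4 ^ n) * (\<integral>\<^sup>+p. ennreal ((norm (f (Suc n) p - f n p))\<^sup>2) \<partial>M)"
      by (subst nn_integral_cmult[symmetric]) (auto simp: ennreal_mult)
    also have "\<dots> \<le> ennreal (4 ^ n) * ennreal (c / 16 ^ n)" by (intro mult_left_mono le) auto
    also have "\<dots> = ennreal (4 ^ n * (c / 16 ^ n))" by (rule ennreal_mult[symmetric]) (use c in auto)
    also have "4 ^ n * (c / 16 ^ n) = c * (1/4) ^ n"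
    proof -
      have "(16::real) ^ n = 4 ^ n * 4 ^ n" by (simp flip: power_mult_distrib)
      then show ?thesis by (simp add: power_divide)
    qed
    finally show "(\<integral>\<^sup>+p. ennreal (4 ^ n * (norm (f (Suc n) p - f n p))\<^sup>2) \<partial>M) \<le> ennreal (c * (1/4) ^ n)" .
  qed
  also have "\<dots> = ennreal (\<Sum>n. c * (1/4) ^ n)"
    by (rule suminf_ennreal2) (auto intro!: summable_mult summable_geometric mult_nonneg_nonneg c)
  finally have fin: "(\<integral>\<^sup>+p. S p \<partial>M) < \<infinity>" by (simp add: le_less_trans)
  have bd: "norm (U p - f n p) \<le> 2 / 2 ^ n * sqrt (enn2real (S p))" if fp: "S p < \<infinity>" for n p
  proof -
    define s where "s = sqrt (enn2real (S p))"
    have s0: "0 \<le> s" by (simp add: s_def)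
    have step: "norm (f (Suc n) p - f n p) \<le> s / 2 ^ n" for n
    proof -
      have "ennreal (4 ^ n * (norm (f (Suc n) p - f n p))\<^sup>2) \<le> S p"
      proof -
        have gen: "T n \<le> suminf T" for T :: "nat \<Rightarrow> ennreal"
          using sum_le_suminf[of T "{n}"] by (simp add: summableI)
        show ?thesis unfolding S_def by (rule gen)
      qed
      then have "enn2real (ennreal (4 ^ n * (norm (f (Suc n) p - f n p))\<^sup>2)) \<le> enn2real (S p)"
        using fp by (intro enn2real_mono) (simp_all only: infinity_ennreal_def)
      then have "4 ^ n * (norm (f (Suc n) p - f n p))\<^sup>2 \<le> enn2real (S p)"
        by (subst (asm) enn2real_ennreal) auto
      moreover have "(2 ^ n * d)\<^sup>2 = 4 ^ n * d\<^sup>2" for d :: real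
      proof -
        have e: "((2::real) ^ n)\<^sup>2 = 4 ^ n" by (simp add: power2_eq_square flip: power_mult_distrib)
        show ?thesis unfolding power_mult_distrib e ..
      qed
      ultimately have "(2 ^ n * norm (f (Suc n) p - f n p))\<^sup>2 \<le> enn2real (S p)" by (simp only:)
      then have "2 ^ n * norm (f (Suc n) p - f n p) \<le> s" unfolding s_def by (rule real_le_rsqrt)
      then show ?thesis by (simp add: field_simps)
    qed
    have tel: "norm (f (n + k) p - f n p) \<le> s * (2 / 2 ^ n - 2 / 2 ^ (n + k))" for n k
    proof (induction k)
      case (Suc k)
      have "norm (f (n + Suc k) p - f n p) \<le> norm (f (Suc (n + k)) p - f (n + k) p) + norm (f (n + k) p - f n p)"
        using norm_triangle_ineq[of "f (Suc (n + k)) p - f (n + k) p" "f (n + k) p - f n p"] by simp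
      also have "\<dots> \<le> s / 2 ^ (n + k) + s * (2 / 2 ^ n - 2 / 2 ^ (n + k))" by (intro add_mono step Suc)
      also have "\<dots> = s * (2 / 2 ^ n - 2 / 2 ^ (n + Suc k))" by (simp add: field_simps)
      finally show ?case .
    qed simp
    have tel': "norm (f (n + k) p - f n p) \<le> 2 / 2 ^ n * s" for n k
    proof -
      have "s * (2 / 2 ^ n - 2 / 2 ^ (n + k)) \<le> s * (2 / 2 ^ n)" using s0 by (intro mult_left_mono) auto
      then show ?thesis using tel[of n k] by (simp add: mult.commute)
    qed
    have "Cauchy (\<lambda>n. f n p)"
    proof (rule CauchyI)
      fix e :: real assume e: "0 < e"
      have "(\<lambda>n. 2 * s * (1/2) ^ n) \<longlonglongrightarrow> 2 * s * 0" by (intro tendsto_mult_left LIMSEQ_power_zero) simp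
      then have "(\<lambda>n. 2 * s * (1/2) ^ n) \<longlonglongrightarrow> 0" by simp
      then have "\<forall>\<^sub>F n in sequentially. 2 * s * (1/2) ^ n < e / 2" using e by (intro order_tendstoD(2)) auto
      then obtain N where "2 * s * (1/2) ^ N < e / 2" by (auto simp: eventually_sequentially)
      then have N: "norm (f (N + k) p - f N p) < e / 2" for k using tel'[of N k] by (simp add: power_divide)
      have "norm (f m p - f n p) < e" if "m \<ge> N" "n \<ge> N" for m n
      proof -
        have "norm (f m p - f N p) < e / 2" "norm (f n p - f N p) < e / 2" using N[of "m - N"] N[of "n - N"] that by auto
        then show ?thesis using norm_triangle_ineq4[of "f m p - f N p" "f n p - f N p"] by simp
      qed
      then show "\<exists>M. \<forall>m\<ge>M. \<forall>n\<ge>M. norm (f m p - f n p) < e" by blast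
    qed
    then have "(\<lambda>k. f k p) \<longlonglongrightarrow> U p" unfolding U_def by (simp add: Cauchy_convergent_iff convergent_LIMSEQ_iff)
    then have "(\<lambda>k. f (k + n) p) \<longlonglongrightarrow> U p" by (rule LIMSEQ_ignore_initial_segment)
    then have "(\<lambda>k. norm (f (n + k) p - f n p)) \<longlonglongrightarrow> norm (U p - f n p)" by (intro tendsto_intros) (simp add: add.commute)
    then show ?thesis unfolding s_def[symmetric] by (rule LIMSEQ_le_const2) (use tel' in auto)
  qed
  show thesis by (rule that[OF mU mS fin bd])
qed

text \<open>The n-th error is at most 2 / 2^n times one fixed integral. Applied with Lebesgue
  measure of the plane as well as on a single time slice.\<close>

lemma limit_by_domination:
  fixes U :: "'a \<Rightarrow> complex" and u :: "nat \<Rightarrow> 'a \<Rightarrow> complex"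
  assumes [measurable]: "U \<in> borel_measurable M" "\<And>n. u n \<in> borel_measurable M" "\<psi> \<in> borel_measurable M"
    and D: "integrable M D" and dom: "AE x in M. \<forall>n. norm (U x - u n x) * norm (\<psi> x) \<le> 2 / 2 ^ n * D x"
    and i0: "integrable M (\<lambda>x. u 0 x * \<psi> x)"
  shows "integrable M (\<lambda>x. U x * \<psi> x)" "(\<lambda>n. \<integral>x. u n x * \<psi> x \<partial>M) \<longlonglongrightarrow> (\<integral>x. U x * \<psi> x \<partial>M)"
proof -
  have iD: "integrable M (\<lambda>x. (U x - u n x) * \<psi> x)" for n
  proof (rule Bochner_Integration.integrable_bound[OF integrable_mult_right[OF D, of "2 / 2 ^ n"]])
    show "AE x in M. norm ((U x - u n x) * \<psi> x) \<le> norm (2 / 2 ^ n * D x)"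
      using dom
    proof eventually_elim
      fix x assume "\<forall>n. norm (U x - u n x) * norm (\<psi> x) \<le> 2 / 2 ^ n * D x"
      then have "norm ((U x - u n x) * \<psi> x) \<le> 2 / 2 ^ n * D x" by (simp add: norm_mult)
      then show "norm ((U x - u n x) * \<psi> x) \<le> norm (2 / 2 ^ n * D x)" by (metis abs_ge_self order_trans real_norm_def)
    qed
  qed measurable
  have "integrable M (\<lambda>x. (U x - u 0 x) * \<psi> x + u 0 x * \<psi> x)" by (intro Bochner_Integration.integrable_add iD i0)
  then show iU: "integrable M (\<lambda>x. U x * \<psi> x)" by (simp add: left_diff_distrib)
  have iu: "integrable M (\<lambda>x. u n x * \<psi> x)" for n
    using Bochner_Integration.integrable_diff[OF iU iD[of n]] by (simp add: left_diff_distrib)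
  have "norm ((\<integral>x. u n x * \<psi> x \<partial>M) - (\<integral>x. U x * \<psi> x \<partial>M)) \<le> 2 * (\<integral>x. D x \<partial>M) * (1/2) ^ n" for n
  proof -
    have "(\<integral>x. U x * \<psi> x \<partial>M) - (\<integral>x. u n x * \<psi> x \<partial>M) = (\<integral>x. (U x - u n x) * \<psi> x \<partial>M)"
      using iU iu by (simp add: left_diff_distrib)
    also have "norm \<dots> \<le> (\<integral>x. norm ((U x - u n x) * \<psi> x) \<partial>M)" by (rule integral_norm_bound)
    also have "\<dots> \<le> (\<integral>x. 2 / 2 ^ n * D x \<partial>M)"
    proof (rule integral_mono_AE[OF integrable_norm[OF iD] integrable_mult_right[OF D]])
      show "AE x in M. norm ((U x - u n x) * \<psi> x) \<le> 2 / 2 ^ n * D x"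
        using dom by eventually_elim (simp add: norm_mult)
    qed
    finally show ?thesis by (simp add: norm_minus_commute power_divide)
  qed
  note le = this
  have "(\<lambda>n. (\<integral>x. u n x * \<psi> x \<partial>M) - (\<integral>x. U x * \<psi> x \<partial>M)) \<longlonglongrightarrow> 0"
  proof (rule Lim_null_comparison[OF always_eventually[OF allI[OF le]]])
    have "(\<lambda>n. 2 * (\<integral>x. D x \<partial>M) * (1/2) ^ n) \<longlonglongrightarrow> 2 * (\<integral>x. D x \<partial>M) * 0"
      by (rule tendsto_mult_left, rule LIMSEQ_power_zero) simp
    then show "(\<lambda>n. 2 * (\<integral>x. D x \<partial>M) * (1/2) ^ n) \<longlonglongrightarrow> 0" by simp
  qed
  then show "(\<lambda>n. \<integral>x. u n x * \<psi> x \<partial>M) \<longlonglongrightarrow> (\<integral>x. U x * \<psi> x \<partial>M)" by (rule LIM_zero_cancel)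
qed

section \<open>Superpositions of plane waves with integrable amplitude\<close>

lemma frequency_fubini:
  assumes h: "integrable lborel h" and \<psi>: "integrable lborel \<psi>"
  shows "(\<integral>x. (\<integral>\<xi>. h \<xi> * plane_wave (of_real \<xi>) (a, x) \<partial>lborel) * \<psi> x \<partial>lborel) =
    (\<integral>\<xi>. h \<xi> * (\<integral>x. plane_wave (of_real \<xi>) (a, x) * \<psi> x \<partial>lborel) \<partial>lborel)"
proof -
  have [measurable]: "h \<in> borel_measurable borel" "\<psi> \<in> borel_measurable borel" using h \<psi> by auto
  have pw[measurable]: "(\<lambda>r. plane_wave (of_real (fst r)) (a, snd r)) \<in> borel_measurable (borel \<Otimes>\<^sub>M borel)"
    unfolding borel_prod plane_wave_real om_def by (intro borel_measurable_continuous_onI continuous_intros)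
  have "integrable (lborel \<Otimes>\<^sub>M lborel) (\<lambda>(\<xi>, x). h \<xi> * plane_wave (of_real \<xi>) (a, x) * \<psi> x)"
  proof (rule Bochner_Integration.integrable_bound[OF lborel_pair.integrable_mult_pair[OF integrable_norm[OF h] integrable_norm[OF \<psi>]]])
    have "(\<lambda>r. h (fst r) * plane_wave (of_real (fst r)) (a, snd r) * \<psi> (snd r)) \<in> borel_measurable (borel \<Otimes>\<^sub>M borel)" by measurable
    then show "(\<lambda>(\<xi>, x). h \<xi> * plane_wave (of_real \<xi>) (a, x) * \<psi> x) \<in> borel_measurable (lborel \<Otimes>\<^sub>M lborel)"
      by (simp add: case_prod_beta' lborel_prod borel_prod)
  qed (auto simp: norm_mult norm_plane_wave_real)
  from lborel_pair.Fubini_integral[OF this]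
  have "(\<integral>x. (\<integral>\<xi>. h \<xi> * plane_wave (of_real \<xi>) (a, x) * \<psi> x \<partial>lborel) \<partial>lborel) = (\<integral>\<xi>. (\<integral>x. h \<xi> * plane_wave (of_real \<xi>) (a, x) * \<psi> x \<partial>lborel) \<partial>lborel)" by simp
  then show ?thesis by (simp only: mult.assoc integral_mult_right_zero) (simp only: mult.assoc[symmetric] integral_mult_left_zero)
qed

lemma frequency_weak:
  assumes h: "integrable lborel h" and T: "test_family F Ft"
  shows "(\<integral>p. (indicator ({..<a} \<times> UNIV) p *\<^sub>R (\<integral>\<xi>. h \<xi> * plane_wave (of_real \<xi>) p \<partial>lborel)) * complex_of_real (adj F Ft p) \<partial>lborel) =
    - (\<integral>x. (\<integral>\<xi>. h \<xi> * plane_wave (of_real \<xi>) (a, x) \<partial>lborel) * complex_of_real (F 0 (a, x)) \<partial>lborel)"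
proof -
  note T' = test_familyD[OF T]
  have hm: "h \<in> borel_measurable borel" using h by auto
  have S: "{..<a} \<times> UNIV \<in> sets (borel :: (real \<times> real) measure)" "UNIV \<times> {..<a} \<times> UNIV \<in> sets (borel :: (real \<times> real \<times> real) measure)"
    by (intro borel_open open_Times; simp)+
  define w where "w \<xi> p = h \<xi> * (indicator ({..<a} \<times> UNIV) p *\<^sub>R plane_wave (of_real \<xi>) p)" for \<xi> and p :: "real \<times> real"
  have wm: "(\<lambda>r. w (fst r) (snd r)) \<in> borel_measurable borel"
  proof -
    have "(\<lambda>r. plane_wave (of_real (fst r)) (snd r)) \<in> borel_measurable (borel :: (real \<times> real \<times> real) measure)"
      unfolding plane_wave_real om_def by (intro borel_measurable_continuous_onI continuous_intros)
    moreover have "(\<lambda>r. h (fst r)) \<in> borel_measurable (borel :: (real \<times> real \<times> real) measure)"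
      by (rule measurable_compose[OF borel_measurable_continuous_onI hm]) (intro continuous_intros)
    ultimately have "(\<lambda>r. h (fst r) * (indicator (UNIV \<times> {..<a} \<times> UNIV) r *\<^sub>R plane_wave (of_real (fst r)) (snd r))) \<in> borel_measurable (borel :: (real \<times> real \<times> real) measure)"
      using S(2) by measurable
    moreover have "(\<lambda>r. h (fst r) * (indicator (UNIV \<times> {..<a} \<times> UNIV) r *\<^sub>R plane_wave (of_real (fst r)) (snd r))) = (\<lambda>r. w (fst r) (snd r))"
      by (auto simp: fun_eq_iff w_def indicator_def)
    ultimately show ?thesis by simp
  qed
  have wd: "\<exists>\<beta> \<gamma>. integrable lborel \<beta> \<and> integrable lborel \<gamma> \<and> (\<forall>\<xi> t x. \<bar>t\<bar> \<le> A \<longrightarrow> \<bar>x\<bar> \<le> A \<longrightarrow> norm (w \<xi> (t, x)) \<le> \<beta> \<xi> * \<gamma> t)" for A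
    by (intro exI[of _ "\<lambda>\<xi>. norm (h \<xi>)"] exI[of _ "\<lambda>t. 1 * indicator {-A..A} t"] conjI integrable_norm h integrable_mult_indicator_Icc)
       (auto simp: w_def norm_mult norm_plane_wave_real indicator_def abs_le_iff)
  have iF: "integrable lborel (\<lambda>x. complex_of_real (F 0 (a, x)))"
  proof -
    obtain B where "\<And>x. B \<le> \<bar>x\<bar> \<Longrightarrow> F 0 (a, x) = 0" using box_test_section_x(2)[OF T'(1)] by blast
    then show ?thesis by (intro integrable_continuous_bounded_support[of _ B] continuous_intros box_test_section_x(1)[OF T'(1)]) auto
  qed
  have "indicator ({..<a} \<times> UNIV) p *\<^sub>R (\<integral>\<xi>. h \<xi> * plane_wave (of_real \<xi>) p \<partial>lborel) = (\<integral>\<xi>. w \<xi> p \<partial>lborel)" for p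
    by (auto simp: w_def indicator_def)
  then have "(\<integral>p. (indicator ({..<a} \<times> UNIV) p *\<^sub>R (\<integral>\<xi>. h \<xi> * plane_wave (of_real \<xi>) p \<partial>lborel)) * complex_of_real (adj F Ft p) \<partial>lborel) =
    (\<integral>\<xi>. (\<integral>p. w \<xi> p * complex_of_real (adj F Ft p) \<partial>lborel) \<partial>lborel)"
    using superposition(2)[OF wm wd box_test_adj[OF T]] by simp
  also have "\<dots> = (\<integral>\<xi>. h \<xi> * (- (\<integral>x. plane_wave (of_real \<xi>) (a, x) * complex_of_real (F 0 (a, x)) \<partial>lborel)) \<partial>lborel)"
    unfolding w_def mult.assoc integral_mult_right_zero plane_wave_weak[OF T] ..
  also have "\<dots> = - (\<integral>\<xi>. h \<xi> * (\<integral>x. plane_wave (of_real \<xi>) (a, x) * complex_of_real (F 0 (a, x)) \<partial>lborel) \<partial>lborel)" by simp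
  finally show ?thesis unfolding frequency_fubini[OF h iF] .
qed

section \<open>Gaussian domination and truncation in frequency\<close>

lemma std_normal_density_antimono: "\<bar>x\<bar> \<le> A \<Longrightarrow> std_normal_density A \<le> std_normal_density x"
  using power_mono[of "\<bar>x\<bar>" A 2] by (simp add: std_normal_density_eq divide_right_mono)

lemma box_test_le_gw:
  assumes "box_test h" obtains K where "0 \<le> K" "\<And>p. \<bar>h p\<bar> \<le> K * gw p"
proof -
  obtain A K where A: "0 < A" "0 \<le> K" "\<And>t x. \<bar>h (t, x)\<bar> \<le> K" "\<And>t x. A \<le> \<bar>t\<bar> \<or> A \<le> \<bar>x\<bar> \<Longrightarrow> h (t, x) = 0"
    using box_test_bound[OF assms] by blast
  have "\<bar>h p\<bar> \<le> (K / gw (A, A)) * gw p" for p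
  proof (cases "\<bar>fst p\<bar> \<le> A \<and> \<bar>snd p\<bar> \<le> A")
    case True
    have "K * gw (A, A) \<le> K * gw p"
      unfolding gw_def fst_conv snd_conv using True A by (intro mult_left_mono mult_mono std_normal_density_antimono) auto
    then have "K \<le> (K / gw (A, A)) * gw p" using gw_pos[of "(A, A)"] by (simp add: field_simps)
    then show ?thesis using A(3)[of "fst p" "snd p"] by simp
  next
    case False
    then have "h p = 0" using A(4)[of "fst p" "snd p"] by auto
    then show ?thesis using gw_pos[of p] gw_pos[of "(A, A)"] A(2) by simp
  qed
  moreover have "0 \<le> K / gw (A, A)" using A(2) gw_pos[of "(A, A)"] by simp
  ultimately show thesis using that by blast
qed

text \<open>The conjugate of \<open>FT \<phi>\<close> for real \<phi>, the factor with which
  \<open>Hs_rep\<close> pairs the frequency function.\<close>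

abbreviation fhat :: "(real \<Rightarrow> real) \<Rightarrow> real \<Rightarrow> complex" where
  "fhat \<phi> \<xi> \<equiv> \<integral>x. exp (\<i> * of_real \<xi> * of_real x) * complex_of_real (\<phi> x) \<partial>lborel"

lemma measurable_fhat:
  assumes c: "continuous_on UNIV \<phi>" shows "fhat \<phi> \<in> borel_measurable borel"
proof -
  have "(\<lambda>r. exp (\<i> * of_real (fst r) * of_real (snd r)) * complex_of_real (\<phi> (snd r))) \<in> borel_measurable (borel :: (real \<times> real) measure)"
    by (intro borel_measurable_continuous_onI continuous_intros continuous_on_compose2[OF c]) auto
  then have "(\<lambda>(\<xi>, x). exp (\<i> * of_real \<xi> * of_real x) * complex_of_real (\<phi> x)) \<in> borel_measurable (lborel \<Otimes>\<^sub>M lborel)" by (simp add: lborel_prod case_prod_beta')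
  from lborel.borel_measurable_lebesgue_integral[OF this] show ?thesis by simp
qed

text \<open>In place of Cauchy-Schwarz: |g| \<le> 1 + |g|^2, and both terms are integrable against
  (1 + \<xi>^2)^(-2), the decay of the transform.\<close>

lemma fhat_product_integrable:
  assumes gm[measurable]: "g \<in> borel_measurable borel" and gi: "integrable lborel (\<lambda>\<xi>. (norm (g \<xi>))\<^sup>2 / (1 + \<xi>\<^sup>2)\<^sup>2)"
    and c: "continuous_on UNIV \<phi>" and M: "\<And>\<xi>. norm (fhat \<phi> \<xi>) * (1 + \<xi>\<^sup>2)\<^sup>2 \<le> M"
  shows "integrable lborel (\<lambda>\<xi>. g \<xi> * fhat \<phi> \<xi>)"
proof -
  have M0: "0 \<le> M" using M[of 0] by (auto intro: order_trans[OF norm_ge_zero])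
  note fm = measurable_fhat[OF c]
  have "integrable lborel (\<lambda>\<xi>. M * (inverse (1 + \<xi>\<^sup>2) + (norm (g \<xi>))\<^sup>2 / (1 + \<xi>\<^sup>2)\<^sup>2))"
    by (intro integrable_mult_right Bochner_Integration.integrable_add integrable_inverse_1_plus_square' gi)
  then show ?thesis
  proof (rule Bochner_Integration.integrable_bound)
    show "(\<lambda>\<xi>. g \<xi> * fhat \<phi> \<xi>) \<in> borel_measurable lborel" using borel_measurable_times[OF gm fm] by simp
    show "AE \<xi> in lborel. norm (g \<xi> * fhat \<phi> \<xi>) \<le> norm (M * (inverse (1 + \<xi>\<^sup>2) + (norm (g \<xi>))\<^sup>2 / (1 + \<xi>\<^sup>2)\<^sup>2))"
    proof (rule AE_I2)
      fix \<xi> :: real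
      have y1: "1 \<le> 1 + \<xi>\<^sup>2" by simp
      have pos: "0 < (1 + \<xi>\<^sup>2)\<^sup>2" by (intro zero_less_power add_pos_nonneg) auto
      have "norm (g \<xi> * fhat \<phi> \<xi>) = norm (g \<xi>) * norm (fhat \<phi> \<xi>)" by (rule norm_mult)
      also have "\<dots> \<le> (1 + (norm (g \<xi>))\<^sup>2) * (M / (1 + \<xi>\<^sup>2)\<^sup>2)"
      proof (rule mult_mono)
        show "norm (g \<xi>) \<le> 1 + (norm (g \<xi>))\<^sup>2" using zero_le_power2[of "norm (g \<xi>) - 1/2"] by (simp add: power2_eq_square algebra_simps)
        show "norm (fhat \<phi> \<xi>) \<le> M / (1 + \<xi>\<^sup>2)\<^sup>2" using M[of \<xi>] pos by (simp only: pos_le_divide_eq)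
      qed auto
      also have "\<dots> = M * (1 / (1 + \<xi>\<^sup>2)\<^sup>2 + (norm (g \<xi>))\<^sup>2 / (1 + \<xi>\<^sup>2)\<^sup>2)" by (simp add: algebra_simps add_divide_distrib)
      also have "\<dots> \<le> M * (inverse (1 + \<xi>\<^sup>2) + (norm (g \<xi>))\<^sup>2 / (1 + \<xi>\<^sup>2)\<^sup>2)"
      proof (intro mult_left_mono add_right_mono M0)
        have "(1 + \<xi>\<^sup>2) ^ 1 \<le> (1 + \<xi>\<^sup>2)\<^sup>2" using y1 by (intro power_increasing) auto
        then have "inverse ((1 + \<xi>\<^sup>2)\<^sup>2) \<le> inverse (1 + \<xi>\<^sup>2)"
          unfolding power_one_right by (rule le_imp_inverse_le) (use y1 in linarith)
        then show "1 / (1 + \<xi>\<^sup>2)\<^sup>2 \<le> inverse (1 + \<xi>\<^sup>2)" by (simp add: inverse_eq_divide)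
      qed
      finally show "norm (g \<xi> * fhat \<phi> \<xi>) \<le> norm (M * (inverse (1 + \<xi>\<^sup>2) + (norm (g \<xi>))\<^sup>2 / (1 + \<xi>\<^sup>2)\<^sup>2))"
        unfolding real_norm_def by (rule order_trans[OF _ abs_ge_self])
    qed
  qed
qed

lemma integrable_truncated:
  assumes g[measurable]: "g \<in> borel_measurable borel" and i: "integrable lborel (\<lambda>\<xi>. (norm (g \<xi>))\<^sup>2 / (1 + \<xi>\<^sup>2)\<^sup>2)"
  shows "integrable lborel (\<lambda>\<xi>. complex_of_real (indicator {-r..r} \<xi> / (2 * pi)) * g \<xi>)"
proof -
  have "integrable lborel (\<lambda>\<xi>. 1 * indicator {-r..r} \<xi> + (1 + r\<^sup>2)\<^sup>2 * ((norm (g \<xi>))\<^sup>2 / (1 + \<xi>\<^sup>2)\<^sup>2))"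
    by (intro Bochner_Integration.integrable_add integrable_mult_indicator_Icc integrable_mult_right i)
  then show ?thesis
  proof (rule Bochner_Integration.integrable_bound)
    have "norm (complex_of_real (indicator {-r..r} \<xi> / (2 * pi)) * g \<xi>) \<le> 1 * indicator {-r..r} \<xi> + (1 + r\<^sup>2)\<^sup>2 * ((norm (g \<xi>))\<^sup>2 / (1 + \<xi>\<^sup>2)\<^sup>2)" for \<xi>
    proof (cases "\<xi> \<in> {-r..r}")
      case True
      then have "\<xi>\<^sup>2 \<le> r\<^sup>2" using power_mono[of "\<bar>\<xi>\<bar>" r 2] by (auto simp: abs_le_iff)
      then have le: "(1 + \<xi>\<^sup>2)\<^sup>2 \<le> (1 + r\<^sup>2)\<^sup>2" by (intro power_mono) auto
      have pos: "0 < (1 + \<xi>\<^sup>2)\<^sup>2" by (intro zero_less_power add_pos_nonneg) auto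
      have "1 \<le> (1 + r\<^sup>2)\<^sup>2 / (1 + \<xi>\<^sup>2)\<^sup>2" using le pos by simp
      then have "(norm (g \<xi>))\<^sup>2 * 1 \<le> (norm (g \<xi>))\<^sup>2 * ((1 + r\<^sup>2)\<^sup>2 / (1 + \<xi>\<^sup>2)\<^sup>2)" by (intro mult_left_mono) auto
      moreover have "norm (g \<xi>) \<le> 1 + (norm (g \<xi>))\<^sup>2"
        using zero_le_power2[of "norm (g \<xi>) - 1/2"] by (simp add: power2_eq_square algebra_simps)
      moreover have "norm (complex_of_real (indicator {-r..r} \<xi> / (2 * pi)) * g \<xi>) \<le> 1 * norm (g \<xi>)"
        unfolding norm_mult using True pi_gt3 by (intro mult_right_mono) (auto simp: norm_divide)
      ultimately show ?thesis using True by (simp add: mult_ac)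
    qed simp
    then show "AE \<xi> in lborel. norm (complex_of_real (indicator {-r..r} \<xi> / (2 * pi)) * g \<xi>) \<le> norm (1 * indicator {-r..r} \<xi> + (1 + r\<^sup>2)\<^sup>2 * ((norm (g \<xi>))\<^sup>2 / (1 + \<xi>\<^sup>2)\<^sup>2))"
    proof (intro AE_I2)
      fix \<xi> :: real
      have nr: "norm z \<le> r \<Longrightarrow> norm z \<le> norm r" for z :: complex and r :: real by simp
      assume "\<And>\<xi>. norm (complex_of_real (indicator {-r..r} \<xi> / (2 * pi)) * g \<xi>) \<le> 1 * indicator {-r..r} \<xi> + (1 + r\<^sup>2)\<^sup>2 * ((norm (g \<xi>))\<^sup>2 / (1 + \<xi>\<^sup>2)\<^sup>2)"
      then show "norm (complex_of_real (indicator {-r..r} \<xi> / (2 * pi)) * g \<xi>) \<le> norm (1 * indicator {-r..r} \<xi> + (1 + r\<^sup>2)\<^sup>2 * ((norm (g \<xi>))\<^sup>2 / (1 + \<xi>\<^sup>2)\<^sup>2))"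
        by (rule nr)
    qed
  qed measurable
qed

text \<open>Since g need not be integrable, U is the limit of truncations in frequency, taken in the
  space L^2 with weight \<open>gw\<close>, where \<open>kato_smoothing\<close> controls the
  increments. All three conclusions concern one slice: the Gaussian integrability feeds
  \<open>instantaneous_source_solution\<close>, the Fourier formula identifies the slice with the
  group, and the last one gives the source created by the cut.\<close>

lemma free_solution:
  assumes gm[measurable]: "g \<in> borel_measurable borel" and gi: "integrable lborel (\<lambda>\<xi>. (norm (g \<xi>))\<^sup>2 / (1 + \<xi>\<^sup>2)\<^sup>2)"
  obtains U :: "real \<times> real \<Rightarrow> complex" where
    "U \<in> borel_measurable borel" "integrable lborel (\<lambda>p. gw p * (norm (U p))\<^sup>2)"
    "AE a in lborel. integrable lborel (\<lambda>x. norm (U (a, x)) * exp (- x\<^sup>2 / 2)) \<and>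
       (\<forall>\<phi> M. continuous_on UNIV \<phi> \<longrightarrow> (\<exists>B. \<forall>x. B \<le> \<bar>x\<bar> \<longrightarrow> \<phi> x = 0) \<longrightarrow>
          (\<forall>\<xi>. norm (fhat \<phi> \<xi>) * (1 + \<xi>\<^sup>2)\<^sup>2 \<le> M) \<longrightarrow>
          (\<integral>x. U (a, x) * complex_of_real (\<phi> x) \<partial>lborel) =
            (\<integral>\<xi>. g \<xi> * exp (\<i> * of_real (om \<xi> * a)) * fhat \<phi> \<xi> \<partial>lborel) / (2 * pi)) \<and>
       (\<forall>F Ft. test_family F Ft \<longrightarrow>
          (\<integral>p. (indicator ({..<a} \<times> UNIV) p *\<^sub>R U p) * complex_of_real (adj F Ft p) \<partial>lborel) =
          - (\<integral>x. U (a, x) * complex_of_real (F 0 (a, x)) \<partial>lborel))"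
proof -
  define G where "G \<xi> = (norm (g \<xi>))\<^sup>2 / (1 + \<xi>\<^sup>2)\<^sup>2" for \<xi>
  have G0: "0 \<le> G \<xi>" for \<xi> by (simp add: G_def)
  have Gi: "integrable lborel G" using gi by (simp add: G_def[abs_def])
  have Gm[measurable]: "G \<in> borel_measurable borel" using Gi by auto
  define T where "T k \<xi> = indicator {\<xi>. real k < \<bar>\<xi>\<bar>} \<xi> * G \<xi>" for k :: nat and \<xi>
  have mset[measurable]: "{\<xi>::real. real k < \<bar>\<xi>\<bar>} \<in> sets borel" for k by (intro borel_open open_Collect_less continuous_intros)
  have Tm[measurable]: "T k \<in> borel_measurable borel" for k unfolding T_def by measurable
  have T0: "0 \<le> T k \<xi>" "T k \<xi> \<le> G \<xi>" for k \<xi> using G0 by (auto simp: T_def indicator_def)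
  have Ti: "integrable lborel (T k)" for k
    by (rule Bochner_Integration.integrable_bound[OF Gi]) (use T0 G0 in \<open>auto intro!: AE_I2\<close>)
  have "(\<lambda>k. \<integral>\<xi>. T k \<xi> \<partial>lborel) \<longlonglongrightarrow> (\<integral>\<xi>. 0 \<partial>(lborel :: real measure))"
  proof (rule integral_dominated_convergence[OF _ _ Gi])
    show "AE \<xi> in lborel. (\<lambda>k. T k \<xi>) \<longlonglongrightarrow> 0"
    proof (rule AE_I2)
      fix \<xi> :: real
      have "T k \<xi> = 0" if "k \<ge> nat \<lceil>\<bar>\<xi>\<bar>\<rceil>" for k
      proof -
        have "\<bar>\<xi>\<bar> \<le> real k" using that by linarith
        then show ?thesis by (simp add: T_def)
      qed
      then have "\<forall>\<^sub>F k in sequentially. T k \<xi> = 0" unfolding eventually_sequentially by blast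
      then show "(\<lambda>k. T k \<xi>) \<longlonglongrightarrow> 0" by (rule tendsto_eventually)
    qed
    show "AE \<xi> in lborel. norm (T k \<xi>) \<le> G \<xi>" for k using T0 by (auto intro!: AE_I2)
  qed auto
  then have Tlim: "(\<lambda>k. \<integral>\<xi>. T k \<xi> \<partial>lborel) \<longlonglongrightarrow> 0" by simp
  have "\<exists>k\<ge>n. (\<integral>\<xi>. T k \<xi> \<partial>lborel) \<le> 1 / 16 ^ n" for n
  proof -
    have "\<forall>\<^sub>F k in sequentially. (\<integral>\<xi>. T k \<xi> \<partial>lborel) < 1 / 16 ^ n" by (rule order_tendstoD(2)[OF Tlim]) simp
    then obtain K where "\<And>k. K \<le> k \<Longrightarrow> (\<integral>\<xi>. T k \<xi> \<partial>lborel) < 1 / 16 ^ n" by (auto simp: eventually_sequentially)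
    then show ?thesis by (intro exI[of _ "max K n"]) (auto intro: less_imp_le)
  qed
  \<comment> \<open>Radii beyond which at most 16^(-n) of the weighted energy is left: this is the
    rate for which \<open>riesz_fischer_dominated\<close> gives a pointwise majorant.\<close>
  then obtain R where R: "\<And>n. n \<le> R n" "\<And>n. (\<integral>\<xi>. T (R n) \<xi> \<partial>lborel) \<le> 1 / 16 ^ n" by metis
  define h where "h n \<xi> = complex_of_real (indicator {-real (R n)..real (R n)} \<xi> / (2 * pi)) * g \<xi>" for n \<xi>
  have ih: "integrable lborel (h n)" for n unfolding h_def by (rule integrable_truncated[OF gm gi])
  define u where "u n p = (\<integral>\<xi>. h n \<xi> * plane_wave (of_real \<xi>) p \<partial>lborel)" for n p
  have um[measurable]: "u n \<in> borel_measurable borel" for n unfolding u_def by (rule kato_smoothing(1)[OF ih])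
  obtain B where B: "0 \<le> B" "\<And>p. norm (u 0 p) \<le> B"
    using kato_smoothing(2)[OF ih[of 0]] unfolding u_def by (metis integral_nonneg_AE[OF AE_I2] norm_ge_zero)
  have spw: "(\<lambda>\<xi>. plane_wave (of_real \<xi>) p) \<in> borel_measurable borel" for p
    unfolding plane_wave_real om_def by (intro borel_measurable_continuous_onI continuous_intros)
  have ihp: "integrable lborel (\<lambda>\<xi>. h n \<xi> * plane_wave (of_real \<xi>) p)" for n p
    by (rule Bochner_Integration.integrable_bound[OF ih[of n]])
       (use spw borel_measurable_integrable[OF ih[of n]] in \<open>auto simp: norm_mult norm_plane_wave_real\<close>)
  have energy: "(\<integral>\<^sup>+p. ennreal (gw p * (norm (u (Suc n) p - u n p))\<^sup>2) \<partial>lborel) \<le> ennreal (50 * sqrt (2 * pi) / 16 ^ n)" for n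
  proof -
    have d: "u (Suc n) p - u n p = (\<integral>\<xi>. (h (Suc n) \<xi> - h n \<xi>) * plane_wave (of_real \<xi>) p \<partial>lborel)" for p
      unfolding u_def left_diff_distrib by (rule Bochner_Integration.integral_diff[symmetric]) (rule ihp)+
    have hb: "(norm (h (Suc n) \<xi> - h n \<xi>))\<^sup>2 / (1 + \<xi>\<^sup>2)\<^sup>2 \<le> T (R n) \<xi> + T (R (Suc n)) \<xi>" for \<xi>
    proof -
      define j where "j = (indicator {-real (R (Suc n))..real (R (Suc n))} \<xi> / (2 * pi) - indicator {-real (R n)..real (R n)} \<xi> / (2 * pi) :: real)"
      have "h (Suc n) \<xi> - h n \<xi> = complex_of_real j * g \<xi>" by (simp add: h_def j_def left_diff_distrib)
      then have "(norm (h (Suc n) \<xi> - h n \<xi>))\<^sup>2 / (1 + \<xi>\<^sup>2)\<^sup>2 = j\<^sup>2 * G \<xi>" by (simp add: norm_mult power_mult_distrib G_def)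
      also have "\<dots> \<le> (indicator {\<xi>. real (R n) < \<bar>\<xi>\<bar>} \<xi> + indicator {\<xi>. real (R (Suc n)) < \<bar>\<xi>\<bar>} \<xi>) * G \<xi>"
      proof (intro mult_right_mono G0)
        have "1 / (2 * pi) \<le> 1" using pi_gt3 by simp
        then have "(1 / (2 * pi))\<^sup>2 \<le> 1\<^sup>2" by (intro power_mono) auto
        then show "j\<^sup>2 \<le> indicator {\<xi>. real (R n) < \<bar>\<xi>\<bar>} \<xi> + indicator {\<xi>. real (R (Suc n)) < \<bar>\<xi>\<bar>} \<xi>"
          by (auto simp: j_def indicator_def abs_le_iff not_less power_divide)
      qed
      also have "\<dots> = T (R n) \<xi> + T (R (Suc n)) \<xi>" by (simp add: T_def distrib_right)
      finally show ?thesis .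
    qed
    have "(\<integral>\<^sup>+\<xi>. ennreal ((norm (h (Suc n) \<xi> - h n \<xi>))\<^sup>2 / (1 + \<xi>\<^sup>2)\<^sup>2) \<partial>lborel) \<le> (\<integral>\<^sup>+\<xi>. ennreal (T (R n) \<xi> + T (R (Suc n)) \<xi>) \<partial>lborel)"
      by (intro nn_integral_mono ennreal_leI hb)
    also have "\<dots> = ennreal (\<integral>\<xi>. T (R n) \<xi> + T (R (Suc n)) \<xi> \<partial>lborel)"
      by (rule nn_integral_eq_integral) (use Ti T0 in \<open>auto intro!: add_nonneg_nonneg\<close>)
    also have "\<dots> \<le> ennreal (2 / 16 ^ n)"
    proof (intro ennreal_leI)
      have "(1::real) / 16 ^ Suc n \<le> 1 / 16 ^ n" by (simp add: field_simps)
      then show "(\<integral>\<xi>. T (R n) \<xi> + T (R (Suc n)) \<xi> \<partial>lborel) \<le> 2 / 16 ^ n"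
        using R(2)[of n] R(2)[of "Suc n"] Ti by simp
    qed
    finally have "ennreal (25 * sqrt (2 * pi)) * (\<integral>\<^sup>+\<xi>. ennreal ((norm (h (Suc n) \<xi> - h n \<xi>))\<^sup>2 / (1 + \<xi>\<^sup>2)\<^sup>2) \<partial>lborel) \<le> ennreal (25 * sqrt (2 * pi)) * ennreal (2 / 16 ^ n)"
      by (intro mult_left_mono) auto
    also have "\<dots> = ennreal (25 * sqrt (2 * pi) * (2 / 16 ^ n))" by (rule ennreal_mult[symmetric]) auto
    finally show ?thesis unfolding d
      using kato_smoothing(3)[OF Bochner_Integration.integrable_diff[OF ih[of "Suc n"] ih[of n]]] by (auto intro: order_trans)
  qed
  define W where "W = density lborel (\<lambda>p. ennreal (gw p))"
  have setsW: "sets W = sets borel" by (simp add: W_def)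
  note msW = measurable_cong_sets[OF setsW refl]
  obtain U S where US: "U \<in> borel_measurable W" "S \<in> borel_measurable W" "(\<integral>\<^sup>+p. S p \<partial>W) < \<infinity>"
    "\<And>n p. S p < \<infinity> \<Longrightarrow> norm (U p - u n p) \<le> 2 / 2 ^ n * sqrt (enn2real (S p))"
  proof (rule riesz_fischer_dominated[of u W "50 * sqrt (2 * pi)"])
    show "u n \<in> borel_measurable W" for n using um by (simp add: msW)
    show "(\<integral>\<^sup>+p. ennreal ((norm (u (Suc n) p - u n p))\<^sup>2) \<partial>W) \<le> ennreal (50 * sqrt (2 * pi) / 16 ^ n)" for n
    proof -
      have "(\<integral>\<^sup>+p. ennreal ((norm (u (Suc n) p - u n p))\<^sup>2) \<partial>W) = (\<integral>\<^sup>+p. ennreal (gw p) * ennreal ((norm (u (Suc n) p - u n p))\<^sup>2) \<partial>lborel)"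
        unfolding W_def by (rule nn_integral_density) (use um in measurable)
      also have "\<dots> = (\<integral>\<^sup>+p. ennreal (gw p * (norm (u (Suc n) p - u n p))\<^sup>2) \<partial>lborel)"
        by (intro nn_integral_cong ennreal_mult[symmetric] less_imp_le[OF gw_pos]) auto
      finally show ?thesis using energy[of n] by simp
    qed
  qed (auto intro: that)
  have Um[measurable]: "U \<in> borel_measurable borel" and Sm[measurable]: "S \<in> borel_measurable borel" using US(1,2) by (auto simp: msW)
  have fin: "(\<integral>\<^sup>+p. ennreal (gw p) * S p \<partial>lborel) < \<infinity>"
    using US(3) unfolding W_def by (subst (asm) nn_integral_density) auto
  have Sfin: "AE p in lborel. S p < \<infinity>"
  proof -
    have "AE p in lborel. ennreal (gw p) * S p \<noteq> \<infinity>" by (rule nn_integral_PInf_AE) (use fin in auto)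
    then show ?thesis
    proof eventually_elim
      fix p assume "ennreal (gw p) * S p \<noteq> \<infinity>"
      then show "S p < \<infinity>" using gw_pos[of p] by (auto simp: ennreal_mult_eq_top_iff less_top)
    qed
  qed
  define s where "s p = enn2real (S p)" for p
  have s0: "0 \<le> s p" for p by (simp add: s_def)
  have sm[measurable]: "s \<in> borel_measurable borel" unfolding s_def by measurable
  \<comment> \<open>Integrable over the plane, hence on almost every slice. On such a slice a
    multiple of it dominates the errors against every test function, so the exceptional set of times
    does not depend on the test function.\<close>
  define D where "D p = gw p * (1 + s p)" for p
  have Di: "integrable lborel D"
  proof -
    have "integrable lborel (\<lambda>p. gw p * s p)"
    proof (rule integrableI_nonneg)
      have "(\<integral>\<^sup>+p. ennreal (gw p * s p) \<partial>lborel) \<le> (\<integral>\<^sup>+p. ennreal (gw p) * S p \<partial>lborel)"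
        by (intro nn_integral_mono) (use s0 in \<open>auto simp: ennreal_mult less_imp_le[OF gw_pos] s_def ennreal_enn2real_if intro!: mult_left_mono\<close>)
      then show "(\<integral>\<^sup>+p. ennreal (gw p * s p) \<partial>lborel) < \<infinity>" using fin by (rule le_less_trans)
    qed (use s0 less_imp_le[OF gw_pos] in auto)
    from Bochner_Integration.integrable_add[OF integrable_gw this] show ?thesis by (simp add: D_def[abs_def] distrib_left)
  qed
  have Ub: "norm (U p - u n p) \<le> 2 / 2 ^ n * (1 + s p)" "(norm (U p - u 0 p))\<^sup>2 \<le> 4 * s p" if "S p < \<infinity>" for n p
  proof -
    have "sqrt (s p) \<le> 1 + s p" by (rule real_le_lsqrt) (use s0[of p] in \<open>auto simp: power2_eq_square algebra_simps\<close>)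
    then have "2 / 2 ^ n * sqrt (s p) \<le> 2 / 2 ^ n * (1 + s p)" by (intro mult_left_mono) auto
    then show "norm (U p - u n p) \<le> 2 / 2 ^ n * (1 + s p)" using US(4)[OF that, of n] by (simp add: s_def)
    have "norm (U p - u 0 p) \<le> 2 * sqrt (s p)" using US(4)[OF that, of 0] by (simp add: s_def)
    then have "(norm (U p - u 0 p))\<^sup>2 \<le> (2 * sqrt (s p))\<^sup>2" by (intro power_mono) auto
    then show "(norm (U p - u 0 p))\<^sup>2 \<le> 4 * s p" using s0[of p] by (simp add: power_mult_distrib)
  qed
  have UL2: "integrable lborel (\<lambda>p. gw p * (norm (U p))\<^sup>2)"
  proof (rule Bochner_Integration.integrable_bound[OF integrable_mult_right[OF Di, of "8 + 2 * B\<^sup>2"]])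
    show "AE p in lborel. norm (gw p * (norm (U p))\<^sup>2) \<le> norm ((8 + 2 * B\<^sup>2) * D p)"
      using Sfin
    proof eventually_elim
      fix p assume p: "S p < \<infinity>"
      have "norm (U p) \<le> norm (U p - u 0 p) + norm (u 0 p)" using norm_triangle_ineq[of "U p - u 0 p" "u 0 p"] by simp
      then have "(norm (U p))\<^sup>2 \<le> (norm (U p - u 0 p) + norm (u 0 p))\<^sup>2" by (intro power_mono) auto
      also have "\<dots> \<le> 2 * (norm (U p - u 0 p))\<^sup>2 + 2 * (norm (u 0 p))\<^sup>2"
        using sum_squares_bound[of "norm (U p - u 0 p)" "norm (u 0 p)"] by (simp add: power2_sum)
      also have "\<dots> \<le> 2 * (4 * s p) + 2 * B\<^sup>2" using Ub(2)[OF p] power_mono[OF B(2)[of p], of 2] by simp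
      also have "\<dots> \<le> (8 + 2 * B\<^sup>2) * (1 + s p)" using s0[of p] by (simp add: algebra_simps)
      finally have "gw p * (norm (U p))\<^sup>2 \<le> gw p * ((8 + 2 * B\<^sup>2) * (1 + s p))" by (intro mult_left_mono less_imp_le[OF gw_pos])
      then show "norm (gw p * (norm (U p))\<^sup>2) \<le> norm ((8 + 2 * B\<^sup>2) * D p)"
        using s0[of p] by (simp add: D_def abs_mult less_imp_le[OF gw_pos] mult_ac abs_of_nonneg[OF add_nonneg_nonneg])
    qed
  qed measurable
  have A1: "AE a in lborel. integrable lborel (\<lambda>x. D (a, x))"
    using lborel_pair.AE_integrable_fst'[of D] Di by (simp add: lborel_prod)
  have A2: "AE a in lborel. AE x in lborel. S (a, x) < \<infinity>"
  proof (rule lborel_pair.AE_pair[of "\<lambda>p. S p < \<infinity>"])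
    show "AE p in lborel \<Otimes>\<^sub>M lborel. S p < \<infinity>" unfolding lborel_prod by (rule Sfin)
  qed
  have secm: "(\<lambda>x. k (a, x)) \<in> borel_measurable borel" if "k \<in> borel_measurable borel" for k :: "real \<times> real \<Rightarrow> complex" and a
    by (rule measurable_compose[OF borel_measurable_continuous_onI that]) (intro continuous_intros)
  show thesis
  proof (rule that[OF Um UL2])
    show "AE a in lborel. integrable lborel (\<lambda>x. norm (U (a, x)) * exp (- x\<^sup>2 / 2)) \<and>
       (\<forall>\<phi> M. continuous_on UNIV \<phi> \<longrightarrow> (\<exists>B. \<forall>x. B \<le> \<bar>x\<bar> \<longrightarrow> \<phi> x = 0) \<longrightarrow>
          (\<forall>\<xi>. norm (fhat \<phi> \<xi>) * (1 + \<xi>\<^sup>2)\<^sup>2 \<le> M) \<longrightarrow>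
          (\<integral>x. U (a, x) * complex_of_real (\<phi> x) \<partial>lborel) =
            (\<integral>\<xi>. g \<xi> * exp (\<i> * of_real (om \<xi> * a)) * fhat \<phi> \<xi> \<partial>lborel) / (2 * pi)) \<and>
       (\<forall>F Ft. test_family F Ft \<longrightarrow>
          (\<integral>p. (indicator ({..<a} \<times> UNIV) p *\<^sub>R U p) * complex_of_real (adj F Ft p) \<partial>lborel) =
          - (\<integral>x. U (a, x) * complex_of_real (F 0 (a, x)) \<partial>lborel))"
      using A1 A2
    proof eventually_elim
      fix a assume a1: "integrable lborel (\<lambda>x. D (a, x))" and a2: "AE x in lborel. S (a, x) < \<infinity>"
      have na: "0 < std_normal_density a" by (simp add: normal_density_pos)
      have lim: "(\<lambda>n. \<integral>x. u n (a, x) * complex_of_real (\<phi> x) \<partial>lborel) \<longlonglongrightarrow> (\<integral>x. U (a, x) * complex_of_real (\<phi> x) \<partial>lborel)"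
        and il: "integrable lborel (\<lambda>x. complex_of_real (\<phi> x))"
        if c: "continuous_on UNIV \<phi>" and z: "\<And>x. A \<le> \<bar>x\<bar> \<Longrightarrow> \<phi> x = 0" for \<phi> A
      proof -
        have "bounded (\<phi> ` {-A..A})" by (intro compact_imp_bounded compact_continuous_image continuous_on_subset[OF c]) auto
        then obtain K where K: "\<forall>x\<in>{-A..A}. \<bar>\<phi> x\<bar> \<le> K" by (auto simp: bounded_iff)
        define K' where "K' = \<bar>K\<bar> / gw (a, A)"
        have ph: "\<bar>\<phi> x\<bar> \<le> K' * gw (a, x)" for x
        proof (cases "\<bar>x\<bar> \<le> A")
          case True
          then have xA: "x \<in> {-A..A}" by auto
          have "\<bar>K\<bar> * gw (a, A) \<le> \<bar>K\<bar> * gw (a, x)"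
            unfolding gw_def fst_conv snd_conv using na True by (intro mult_left_mono std_normal_density_antimono) auto
          then have "\<bar>K\<bar> \<le> K' * gw (a, x)" using gw_pos[of "(a, A)"] by (simp add: K'_def field_simps)
          then show ?thesis using K xA abs_ge_self[of K] order_trans by (meson order_trans)
        next
          case False
          then have "\<phi> x = 0" using z[of x] by simp
          then show ?thesis using gw_pos[of "(a, x)"] gw_pos[of "(a, A)"] by (simp add: K'_def)
        qed
        show il: "integrable lborel (\<lambda>x. complex_of_real (\<phi> x))"
          by (rule integrable_continuous_bounded_support[of _ A]) (use z in \<open>auto intro!: continuous_intros c\<close>)
        have pm: "(\<lambda>x. complex_of_real (\<phi> x)) \<in> borel_measurable lborel" using borel_measurable_integrable[OF il] .
        have i0: "integrable lborel (\<lambda>x. u 0 (a, x) * complex_of_real (\<phi> x))"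
        proof (rule Bochner_Integration.integrable_bound[OF integrable_mult_right[OF il, of "of_real B"]])
          show "AE x in lborel. norm (u 0 (a, x) * complex_of_real (\<phi> x)) \<le> norm (complex_of_real B * complex_of_real (\<phi> x))"
            using B by (intro AE_I2) (auto simp: norm_mult intro!: mult_right_mono)
        qed (use pm secm[OF um] in auto)
        show "(\<lambda>n. \<integral>x. u n (a, x) * complex_of_real (\<phi> x) \<partial>lborel) \<longlonglongrightarrow> (\<integral>x. U (a, x) * complex_of_real (\<phi> x) \<partial>lborel)"
        proof (rule limit_by_domination(2)[of "\<lambda>x. U (a, x)" lborel "\<lambda>n x. u n (a, x)" "\<lambda>x. complex_of_real (\<phi> x)" "\<lambda>x. K' * D (a, x)"])
          show "integrable lborel (\<lambda>x. K' * D (a, x))" by (rule integrable_mult_right[OF a1])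
          show "(\<lambda>x. complex_of_real (\<phi> x)) \<in> borel_measurable lborel" by (rule pm)
          show "integrable lborel (\<lambda>x. u 0 (a, x) * complex_of_real (\<phi> x))" by (rule i0)
          show "AE x in lborel. \<forall>n. norm (U (a, x) - u n (a, x)) * norm (complex_of_real (\<phi> x)) \<le> 2 / 2 ^ n * (K' * D (a, x))"
            using a2
          proof eventually_elim
            fix x assume p: "S (a, x) < \<infinity>"
            show "\<forall>n. norm (U (a, x) - u n (a, x)) * norm (complex_of_real (\<phi> x)) \<le> 2 / 2 ^ n * (K' * D (a, x))"
            proof
              fix n
              have "norm (U (a, x) - u n (a, x)) * \<bar>\<phi> x\<bar> \<le> (2 / 2 ^ n * (1 + s (a, x))) * (K' * gw (a, x))"
                using s0[of "(a, x)"] by (intro mult_mono Ub(1)[OF p] ph) auto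
              then show "norm (U (a, x) - u n (a, x)) * norm (complex_of_real (\<phi> x)) \<le> 2 / 2 ^ n * (K' * D (a, x))"
                unfolding D_def norm_of_real by (simp only: mult_ac)
            qed
          qed
        qed (use secm[OF um] secm[OF Um] in auto)
      qed
      have c1: "integrable lborel (\<lambda>x. norm (U (a, x)) * exp (- x\<^sup>2 / 2))"
      proof (rule Bochner_Integration.integrable_bound[OF integrable_mult_right[OF a1, of "(B + 2) * sqrt (2 * pi) / std_normal_density a"]])
        show "AE x in lborel. norm (norm (U (a, x)) * exp (- x\<^sup>2 / 2)) \<le> norm ((B + 2) * sqrt (2 * pi) / std_normal_density a * D (a, x))"
          using a2
        proof eventually_elim
          fix x assume p: "S (a, x) < \<infinity>"
          have "norm (U (a, x)) \<le> norm (U (a, x) - u 0 (a, x)) + norm (u 0 (a, x))" using norm_triangle_ineq[of "U (a, x) - u 0 (a, x)" "u 0 (a, x)"] by simp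
          also have "\<dots> \<le> 2 * (1 + s (a, x)) + B" using Ub(1)[OF p, of 0] B(2)[of "(a, x)"] by simp
          also have "\<dots> \<le> (B + 2) * (1 + s (a, x))" using B(1) s0[of "(a, x)"] by (simp add: algebra_simps)
          finally have "norm (U (a, x)) * exp (- x\<^sup>2 / 2) \<le> ((B + 2) * (1 + s (a, x))) * exp (- x\<^sup>2 / 2)" by (intro mult_right_mono) auto
          also have "\<dots> = (B + 2) * sqrt (2 * pi) / std_normal_density a * D (a, x)"
          proof -
            have "exp (- x\<^sup>2 / 2) = sqrt (2 * pi) * std_normal_density x" by (simp add: std_normal_density_eq)
            then show ?thesis using na by (simp add: D_def gw_def)
          qed
          finally have le: "norm (U (a, x)) * exp (- x\<^sup>2 / 2) \<le> (B + 2) * sqrt (2 * pi) / std_normal_density a * D (a, x)" .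
          have "\<bar>norm (U (a, x)) * exp (- x\<^sup>2 / 2)\<bar> = norm (U (a, x)) * exp (- x\<^sup>2 / 2)" by simp
          then show "norm (norm (U (a, x)) * exp (- x\<^sup>2 / 2)) \<le> norm ((B + 2) * sqrt (2 * pi) / std_normal_density a * D (a, x))"
            using le abs_ge_self order_trans unfolding real_norm_def by metis
        qed
      qed (use secm[OF Um] in measurable)
      have c2: "(\<integral>x. U (a, x) * complex_of_real (\<phi> x) \<partial>lborel) =
            (\<integral>\<xi>. g \<xi> * exp (\<i> * of_real (om \<xi> * a)) * fhat \<phi> \<xi> \<partial>lborel) / (2 * pi)"
        if c: "continuous_on UNIV \<phi>" and z: "\<exists>B. \<forall>x. B \<le> \<bar>x\<bar> \<longrightarrow> \<phi> x = 0" and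
          M: "\<forall>\<xi>. norm (fhat \<phi> \<xi>) * (1 + \<xi>\<^sup>2)\<^sup>2 \<le> M" for \<phi> M
      proof -
        obtain A where A: "\<And>x. A \<le> \<bar>x\<bar> \<Longrightarrow> \<phi> x = 0" using z by blast
        note l = lim[where A=A, OF c A] and il = il[where A=A, OF c A]
        define q where "q \<xi> = g \<xi> * exp (\<i> * of_real (om \<xi> * a)) * fhat \<phi> \<xi>" for \<xi>
        have qi: "integrable lborel q"
          unfolding q_def
        proof (rule fhat_product_integrable[OF _ _ c])
          have "(\<lambda>\<xi>. exp (\<i> * complex_of_real (om \<xi> * a))) \<in> borel_measurable borel"
            unfolding om_def by (intro borel_measurable_continuous_onI continuous_intros)
          then show "(\<lambda>\<xi>. g \<xi> * exp (\<i> * complex_of_real (om \<xi> * a))) \<in> borel_measurable borel" by measurable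
        qed (use gi M in \<open>auto simp: norm_mult\<close>)
        have qm[measurable]: "q \<in> borel_measurable borel" using borel_measurable_integrable[OF qi] by simp
        have "(\<lambda>n. \<integral>\<xi>. complex_of_real (indicator {-real (R n)..real (R n)} \<xi> / (2 * pi)) * q \<xi> \<partial>lborel) \<longlonglongrightarrow> (\<integral>\<xi>. complex_of_real (1 / (2 * pi)) * q \<xi> \<partial>lborel)"
        proof (rule integral_dominated_convergence[OF _ _ integrable_norm[OF qi]])
          show "AE \<xi> in lborel. (\<lambda>n. complex_of_real (indicator {-real (R n)..real (R n)} \<xi> / (2 * pi)) * q \<xi>) \<longlonglongrightarrow> complex_of_real (1 / (2 * pi)) * q \<xi>"
          proof (rule AE_I2)
            fix \<xi> :: real
            have "complex_of_real (indicator {-real (R n)..real (R n)} \<xi> / (2 * pi)) * q \<xi> = complex_of_real (1 / (2 * pi)) * q \<xi>" if "n \<ge> nat \<lceil>\<bar>\<xi>\<bar>\<rceil>" for n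
            proof -
              have "\<bar>\<xi>\<bar> \<le> real n" using that by linarith
              then have "\<bar>\<xi>\<bar> \<le> real (R n)" using R(1)[of n] by linarith
              then show ?thesis by (simp add: abs_le_iff)
            qed
            then have "\<forall>\<^sub>F n in sequentially. complex_of_real (indicator {-real (R n)..real (R n)} \<xi> / (2 * pi)) * q \<xi> = complex_of_real (1 / (2 * pi)) * q \<xi>"
              unfolding eventually_sequentially by blast
            then show "(\<lambda>n. complex_of_real (indicator {-real (R n)..real (R n)} \<xi> / (2 * pi)) * q \<xi>) \<longlonglongrightarrow> complex_of_real (1 / (2 * pi)) * q \<xi>"
              by (rule tendsto_eventually)
          qed
          show "AE \<xi> in lborel. norm (complex_of_real (indicator {-real (R n)..real (R n)} \<xi> / (2 * pi)) * q \<xi>) \<le> norm (q \<xi>)" for n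
          proof (rule AE_I2)
            fix \<xi> :: real
            have "norm (complex_of_real (indicator {-real (R n)..real (R n)} \<xi> / (2 * pi)) * q \<xi>) \<le> 1 * norm (q \<xi>)"
              unfolding norm_mult using pi_gt3 by (intro mult_right_mono) (auto simp: indicator_def norm_divide)
            then show "norm (complex_of_real (indicator {-real (R n)..real (R n)} \<xi> / (2 * pi)) * q \<xi>) \<le> norm (q \<xi>)" by simp
          qed
        qed measurable
        moreover have "(\<integral>\<xi>. complex_of_real (indicator {-real (R n)..real (R n)} \<xi> / (2 * pi)) * q \<xi> \<partial>lborel) = (\<integral>x. u n (a, x) * complex_of_real (\<phi> x) \<partial>lborel)" for n
        proof -
          have pwx: "plane_wave (of_real \<xi>) (a, x) * complex_of_real (\<phi> x) = exp (\<i> * of_real (om \<xi> * a)) * (exp (\<i> * of_real \<xi> * of_real x) * complex_of_real (\<phi> x))" for \<xi> x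
            unfolding plane_wave_real by (simp add: exp_add algebra_simps)
          have "(\<integral>x. u n (a, x) * complex_of_real (\<phi> x) \<partial>lborel) = (\<integral>\<xi>. h n \<xi> * (\<integral>x. plane_wave (of_real \<xi>) (a, x) * complex_of_real (\<phi> x) \<partial>lborel) \<partial>lborel)"
            unfolding u_def by (rule frequency_fubini[OF ih il])
          also have "\<dots> = (\<integral>\<xi>. complex_of_real (indicator {-real (R n)..real (R n)} \<xi> / (2 * pi)) * q \<xi> \<partial>lborel)"
            unfolding pwx integral_mult_right_zero h_def q_def by (simp only: mult.assoc)
          finally show ?thesis by simp
        qed
        ultimately have "(\<lambda>n. \<integral>x. u n (a, x) * complex_of_real (\<phi> x) \<partial>lborel) \<longlonglongrightarrow> (\<integral>\<xi>. complex_of_real (1 / (2 * pi)) * q \<xi> \<partial>lborel)"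
          by (simp only:)
        from LIMSEQ_unique[OF l this] show ?thesis unfolding q_def by simp
      qed
      have c3: "(\<integral>p. (indicator ({..<a} \<times> UNIV) p *\<^sub>R U p) * complex_of_real (adj F Ft p) \<partial>lborel) =
          - (\<integral>x. U (a, x) * complex_of_real (F 0 (a, x)) \<partial>lborel)" if TF: "test_family F Ft" for F Ft
      proof -
        note T' = test_familyD[OF TF]
        obtain A' where A': "\<And>x. A' \<le> \<bar>x\<bar> \<Longrightarrow> F 0 (a, x) = 0" using box_test_section_x(2)[OF T'(1)] by blast
        have S: "{..<a} \<times> UNIV \<in> sets (borel :: (real \<times> real) measure)" by (intro borel_open open_Times; simp)
        \<comment> \<open>The cut is moved into the test function. This destroys continuity but
          keeps measurability and the bound by \<open>gw\<close>, which is what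
          \<open>limit_by_domination\<close> uses.\<close>
        define \<psi> where "\<psi> p = complex_of_real (indicator ({..<a} \<times> UNIV) p * adj F Ft p)" for p
        have pm: "\<psi> \<in> borel_measurable lborel"
          unfolding \<psi>_def using S box_test_measurable[OF box_test_adj[OF TF]] by measurable
        obtain K' where ad: "\<And>p. \<bar>adj F Ft p\<bar> \<le> K' * gw p" using box_test_le_gw[OF box_test_adj[OF TF]] by blast
        have psb: "norm (\<psi> p) \<le> K' * gw p" for p
          using ad[of p] order_trans[OF abs_ge_zero ad[of p]] by (auto simp: \<psi>_def indicator_def)
        have i0: "integrable lborel (\<lambda>p. u 0 p * \<psi> p)"
        proof (rule Bochner_Integration.integrable_bound[OF integrable_mult_right[OF integrable_gw, of "B * K'"]])
          show "AE p in lborel. norm (u 0 p * \<psi> p) \<le> norm (B * K' * gw p)"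
          proof (rule AE_I2)
            fix p
            have "norm (u 0 p * \<psi> p) \<le> B * (K' * gw p)" unfolding norm_mult by (intro mult_mono B psb) auto
            then show "norm (u 0 p * \<psi> p) \<le> norm (B * K' * gw p)" by (metis abs_ge_self mult.assoc order_trans real_norm_def)
          qed
        qed (use pm um in auto)
        have "(\<lambda>n. \<integral>p. u n p * \<psi> p \<partial>lborel) \<longlonglongrightarrow> (\<integral>p. U p * \<psi> p \<partial>lborel)"
        proof (rule limit_by_domination(2)[of U lborel u \<psi> "\<lambda>p. K' * D p"])
          show "integrable lborel (\<lambda>p. K' * D p)" by (rule integrable_mult_right[OF Di])
          show "\<psi> \<in> borel_measurable lborel" by (rule pm)
          show "integrable lborel (\<lambda>p. u 0 p * \<psi> p)" by (rule i0)
          show "AE p in lborel. \<forall>n. norm (U p - u n p) * norm (\<psi> p) \<le> 2 / 2 ^ n * (K' * D p)"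
            using Sfin
          proof eventually_elim
            fix p assume p: "S p < \<infinity>"
            show "\<forall>n. norm (U p - u n p) * norm (\<psi> p) \<le> 2 / 2 ^ n * (K' * D p)"
            proof
              fix n
              have "norm (U p - u n p) * norm (\<psi> p) \<le> (2 / 2 ^ n * (1 + s p)) * (K' * gw p)"
                using s0[of p] by (intro mult_mono Ub(1)[OF p] psb) auto
              then show "norm (U p - u n p) * norm (\<psi> p) \<le> 2 / 2 ^ n * (K' * D p)" unfolding D_def by (simp only: mult_ac)
            qed
          qed
        qed (use um Um in auto)
        moreover have "v p * \<psi> p = (indicator ({..<a} \<times> UNIV) p *\<^sub>R v p) * complex_of_real (adj F Ft p)" for v :: "real \<times> real \<Rightarrow> complex" and p
          by (auto simp: \<psi>_def indicator_def)
        moreover have "(\<integral>p. (indicator ({..<a} \<times> UNIV) p *\<^sub>R u n p) * complex_of_real (adj F Ft p) \<partial>lborel) = - (\<integral>x. u n (a, x) * complex_of_real (F 0 (a, x)) \<partial>lborel)" for n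
          unfolding u_def by (rule frequency_weak[OF ih TF])
        ultimately have l1: "(\<lambda>n. - (\<integral>x. u n (a, x) * complex_of_real (F 0 (a, x)) \<partial>lborel)) \<longlonglongrightarrow> (\<integral>p. (indicator ({..<a} \<times> UNIV) p *\<^sub>R U p) * complex_of_real (adj F Ft p) \<partial>lborel)"
          by (simp only:)
        have "(\<lambda>n. \<integral>x. u n (a, x) * complex_of_real (F 0 (a, x)) \<partial>lborel) \<longlonglongrightarrow> (\<integral>x. U (a, x) * complex_of_real (F 0 (a, x)) \<partial>lborel)"
          by (rule lim[where A=A', OF box_test_section_x(1)[OF T'(1)] A'])
        from tendsto_minus[OF this] l1 show ?thesis by (rule LIMSEQ_unique[rotated])
      qed
      show "integrable lborel (\<lambda>x. norm (U (a, x)) * exp (- x\<^sup>2 / 2)) \<and>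
       (\<forall>\<phi> M. continuous_on UNIV \<phi> \<longrightarrow> (\<exists>B. \<forall>x. B \<le> \<bar>x\<bar> \<longrightarrow> \<phi> x = 0) \<longrightarrow>
          (\<forall>\<xi>. norm (fhat \<phi> \<xi>) * (1 + \<xi>\<^sup>2)\<^sup>2 \<le> M) \<longrightarrow>
          (\<integral>x. U (a, x) * complex_of_real (\<phi> x) \<partial>lborel) =
            (\<integral>\<xi>. g \<xi> * exp (\<i> * of_real (om \<xi> * a)) * fhat \<phi> \<xi> \<partial>lborel) / (2 * pi)) \<and>
       (\<forall>F Ft. test_family F Ft \<longrightarrow>
          (\<integral>p. (indicator ({..<a} \<times> UNIV) p *\<^sub>R U p) * complex_of_real (adj F Ft p) \<partial>lborel) =
          - (\<integral>x. U (a, x) * complex_of_real (F 0 (a, x)) \<partial>lborel))"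
      proof (intro conjI allI impI c1)
        show "(\<integral>x. U (a, x) * complex_of_real (\<phi> x) \<partial>lborel) =
            (\<integral>\<xi>. g \<xi> * exp (\<i> * of_real (om \<xi> * a)) * fhat \<phi> \<xi> \<partial>lborel) / (2 * pi)"
          if "continuous_on UNIV \<phi>" "\<exists>B. \<forall>x. B \<le> \<bar>x\<bar> \<longrightarrow> \<phi> x = 0" "\<forall>\<xi>. norm (fhat \<phi> \<xi>) * (1 + \<xi>\<^sup>2)\<^sup>2 \<le> M" for \<phi> M
          by (rule c2[OF that])
      qed (rule c3)
    qed
  qed
qed

section \<open>Extinction of the group solution\<close>

definition L2_box :: "(real \<times> real \<Rightarrow> complex) \<Rightarrow> bool" where
  "L2_box w \<longleftrightarrow> w \<in> borel_measurable borel \<and>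
     (\<forall>A. integrable lborel (\<lambda>p. indicator ({-A..A} \<times> {-A..A}) p * (norm (w p))\<^sup>2))"

lemma sets_square: "{-A..A} \<times> {-A..A} \<in> sets (borel :: (real \<times> real) measure)"
  by (auto intro!: borel_closed closed_Times)

lemma integrable_square: "integrable lborel (indicator ({-A..A} \<times> {-A..A}) :: real \<times> real \<Rightarrow> real)"
  by (intro integrable_real_indicator emeasure_bounded_finite bounded_Times bounded_closed_interval)
     (auto simp: sets_square)

lemma L2_box_integrable:
  assumes w: "L2_box w" and h: "box_test h"
  shows "integrable lborel (\<lambda>p. w p * complex_of_real (h p))"
proof -
  obtain A M where A: "0 < A" "0 \<le> M" "\<And>t x. \<bar>h (t, x)\<bar> \<le> M"
    "\<And>t x. A \<le> \<bar>t\<bar> \<or> A \<le> \<bar>x\<bar> \<Longrightarrow> h (t, x) = 0" using box_test_bound[OF h] by blast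
  have wm: "w \<in> borel_measurable borel" using w by (simp add: L2_box_def)
  have "integrable lborel (\<lambda>p. M * (indicator ({-A..A} \<times> {-A..A}) p + indicator ({-A..A} \<times> {-A..A}) p * (norm (w p))\<^sup>2))"
    using w by (intro integrable_mult_right Bochner_Integration.integrable_add integrable_square) (auto simp: L2_box_def)
  then show ?thesis
  proof (rule Bochner_Integration.integrable_bound)
    show "(\<lambda>p. w p * complex_of_real (h p)) \<in> borel_measurable lborel"
      using wm box_test_measurable[OF h] by measurable
    show "AE p in lborel. norm (w p * complex_of_real (h p)) \<le> norm (M * (indicator ({-A..A} \<times> {-A..A}) p + indicator ({-A..A} \<times> {-A..A}) p * (norm (w p))\<^sup>2))"
    proof (rule AE_I2)
      fix p :: "real \<times> real"
      obtain t x where p: "p = (t, x)" by force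
      show "norm (w p * complex_of_real (h p)) \<le> norm (M * (indicator ({-A..A} \<times> {-A..A}) p + indicator ({-A..A} \<times> {-A..A}) p * (norm (w p))\<^sup>2))"
      proof (cases "\<bar>t\<bar> \<le> A \<and> \<bar>x\<bar> \<le> A")
        case True
        have "norm (w p) \<le> 1 + (norm (w p))\<^sup>2" using zero_le_power2[of "norm (w p) - 1/2"] by (simp add: power2_eq_square algebra_simps)
        then have "norm (w p) * \<bar>h p\<bar> \<le> (1 + (norm (w p))\<^sup>2) * M" using A(3)[of t x] p by (intro mult_mono) auto
        moreover have "p \<in> {-A..A} \<times> {-A..A}" using True by (auto simp: p)
        ultimately show ?thesis using A(2) by (simp add: norm_mult mult_ac abs_mult)
      next
        case False
        then have "h p = 0" using A(4)[of t x] by (auto simp: p)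
        then show ?thesis by simp
      qed
    qed
  qed
qed

lemma L2_box_gw:
  assumes [measurable]: "U \<in> borel_measurable borel" and i: "integrable lborel (\<lambda>p. gw p * (norm (U p))\<^sup>2)"
  shows "L2_box U"
  unfolding L2_box_def
proof (intro conjI allI)
  fix A :: real
  have m: "{-A..A} \<times> {-A..A} \<in> sets (borel :: (real \<times> real) measure)" by (rule sets_square)
  show "integrable lborel (\<lambda>p. indicator ({-A..A} \<times> {-A..A}) p * (norm (U p))\<^sup>2)"
  proof (rule Bochner_Integration.integrable_bound[OF integrable_mult_right[OF i, of "1 / gw (A, A)"]])
    show "AE p in lborel. norm (indicator ({-A..A} \<times> {-A..A}) p * (norm (U p))\<^sup>2) \<le> norm (1 / gw (A, A) * (gw p * (norm (U p))\<^sup>2))"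
    proof (rule AE_I2)
      fix p :: "real \<times> real"
      have pos: "0 < gw (A, A)" "0 < gw p" by (rule gw_pos)+
      show "norm (indicator ({-A..A} \<times> {-A..A}) p * (norm (U p))\<^sup>2) \<le> norm (1 / gw (A, A) * (gw p * (norm (U p))\<^sup>2))"
      proof (cases "p \<in> {-A..A} \<times> {-A..A}")
        case True
        then have "\<bar>fst p\<bar> \<le> A" "\<bar>snd p\<bar> \<le> A" by auto
        then have "gw (A, A) \<le> gw p"
          unfolding gw_def fst_conv snd_conv by (intro mult_mono std_normal_density_antimono) auto
        then have "1 * (norm (U p))\<^sup>2 \<le> (gw p / gw (A, A)) * (norm (U p))\<^sup>2" using pos by (intro mult_right_mono) auto
        then show ?thesis using True pos by (simp add: abs_mult)
      qed simp
    qed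
    show "(\<lambda>p. indicator ({-A..A} \<times> {-A..A}) p * (norm (U p))\<^sup>2) \<in> borel_measurable lborel" using m by measurable
  qed
qed simp

lemma L2_box_add:
  assumes "L2_box v" "L2_box w" shows "L2_box (\<lambda>p. v p + w p)"
  unfolding L2_box_def
proof (intro conjI allI)
  have [measurable]: "v \<in> borel_measurable borel" "w \<in> borel_measurable borel" using assms by (auto simp: L2_box_def)
  show "(\<lambda>p. v p + w p) \<in> borel_measurable borel" by measurable
  fix A :: real
  let ?I = "\<lambda>p. indicator ({-A..A} \<times> {-A..A}) p :: real"
  have m: "{-A..A} \<times> {-A..A} \<in> sets (borel :: (real \<times> real) measure)" by (rule sets_square)
  have "integrable lborel (\<lambda>p. 2 * (?I p * (norm (v p))\<^sup>2) + 2 * (?I p * (norm (w p))\<^sup>2))"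
    using assms by (intro Bochner_Integration.integrable_add integrable_mult_right) (auto simp: L2_box_def)
  then show "integrable lborel (\<lambda>p. ?I p * (norm (v p + w p))\<^sup>2)"
  proof (rule Bochner_Integration.integrable_bound)
    show "AE p in lborel. norm (?I p * (norm (v p + w p))\<^sup>2) \<le> norm (2 * (?I p * (norm (v p))\<^sup>2) + 2 * (?I p * (norm (w p))\<^sup>2))"
    proof (rule AE_I2)
      fix p
      have "(norm (v p + w p))\<^sup>2 \<le> (norm (v p) + norm (w p))\<^sup>2" by (intro power_mono norm_triangle_ineq) auto
      also have "\<dots> \<le> 2 * (norm (v p))\<^sup>2 + 2 * (norm (w p))\<^sup>2"
        using sum_squares_bound[of "norm (v p)" "norm (w p)"] by (simp add: power2_sum)
      finally show "norm (?I p * (norm (v p + w p))\<^sup>2) \<le> norm (2 * (?I p * (norm (v p))\<^sup>2) + 2 * (?I p * (norm (w p))\<^sup>2))"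
        by (auto simp: indicator_def)
    qed
    show "(\<lambda>p. ?I p * (norm (v p + w p))\<^sup>2) \<in> borel_measurable lborel" using m by measurable
  qed
qed

lemma controlled_solution:
  assumes gm: "g \<in> borel_measurable borel" and gi: "integrable lborel (\<lambda>\<xi>. (norm (g \<xi>))\<^sup>2 / (1 + \<xi>\<^sup>2)\<^sup>2)"
    and t01: "t0 < t1"
  obtains w :: "real \<times> real \<Rightarrow> complex" where
    "L2_box w"
    "\<And>F Ft. test_family F Ft \<Longrightarrow> (\<integral>p. w p * complex_of_real (adj F Ft p) \<partial>lborel) = 0"
    "\<And>t x. t1 \<le> t \<Longrightarrow> w (t, x) = 0"
    "AE t in lborel. t \<le> t0 \<longrightarrow> integrable lborel (\<lambda>x. norm (w (t, x)) * exp (- x\<^sup>2 / 2)) \<and>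
       (\<forall>\<phi> M. continuous_on UNIV \<phi> \<longrightarrow> (\<exists>B. \<forall>x. B \<le> \<bar>x\<bar> \<longrightarrow> \<phi> x = 0) \<longrightarrow>
          (\<forall>\<xi>. norm (fhat \<phi> \<xi>) * (1 + \<xi>\<^sup>2)\<^sup>2 \<le> M) \<longrightarrow>
          (\<integral>x. w (t, x) * complex_of_real (\<phi> x) \<partial>lborel) =
            (\<integral>\<xi>. g \<xi> * exp (\<i> * of_real (om \<xi> * t)) * fhat \<phi> \<xi> \<partial>lborel) / (2 * pi))"
proof -
  obtain U where U: "U \<in> borel_measurable borel" "integrable lborel (\<lambda>p. gw p * (norm (U p))\<^sup>2)"
    and AEU: "AE a in lborel. integrable lborel (\<lambda>x. norm (U (a, x)) * exp (- x\<^sup>2 / 2)) \<and>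
       (\<forall>\<phi> M. continuous_on UNIV \<phi> \<longrightarrow> (\<exists>B. \<forall>x. B \<le> \<bar>x\<bar> \<longrightarrow> \<phi> x = 0) \<longrightarrow>
          (\<forall>\<xi>. norm (fhat \<phi> \<xi>) * (1 + \<xi>\<^sup>2)\<^sup>2 \<le> M) \<longrightarrow>
          (\<integral>x. U (a, x) * complex_of_real (\<phi> x) \<partial>lborel) =
            (\<integral>\<xi>. g \<xi> * exp (\<i> * of_real (om \<xi> * a)) * fhat \<phi> \<xi> \<partial>lborel) / (2 * pi)) \<and>
       (\<forall>F Ft. test_family F Ft \<longrightarrow>
          (\<integral>p. (indicator ({..<a} \<times> UNIV) p *\<^sub>R U p) * complex_of_real (adj F Ft p) \<partial>lborel) =
          - (\<integral>x. U (a, x) * complex_of_real (F 0 (a, x)) \<partial>lborel))"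
    by (rule free_solution[OF gm gi]) (rule that; assumption)
  define tm where "tm = (t0 + t1) / 2"
  \<comment> \<open>The slice properties hold for almost every time only, so the cutting time is
    taken from an interval of positive measure.\<close>
  have "\<exists>a. t0 < a \<and> a < tm \<and> integrable lborel (\<lambda>x. norm (U (a, x)) * exp (- x\<^sup>2 / 2)) \<and>
       (\<forall>F Ft. test_family F Ft \<longrightarrow>
          (\<integral>p. (indicator ({..<a} \<times> UNIV) p *\<^sub>R U p) * complex_of_real (adj F Ft p) \<partial>lborel) =
          - (\<integral>x. U (a, x) * complex_of_real (F 0 (a, x)) \<partial>lborel))" (is "\<exists>a. ?P a")
  proof (rule ccontr)
    assume no: "\<nexists>a. ?P a"
    have "AE a in lborel. a \<notin> {t0<..<tm}" using AEU
    proof eventually_elim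
      case (elim a)
      then have "\<not> (t0 < a \<and> a < tm)" using no by blast
      then show ?case by simp
    qed
    moreover have "{t0<..<tm} \<in> sets lborel" by simp
    ultimately have "emeasure lborel {t0<..<tm} = 0" by (subst (asm) AE_iff_measurable[of "{t0<..<tm}"]) auto
    then show False using t01 by (simp add: tm_def)
  qed
  then obtain a where a: "t0 < a" "a < tm" "integrable lborel (\<lambda>x. norm (U (a, x)) * exp (- x\<^sup>2 / 2))"
    "\<And>F Ft. test_family F Ft \<Longrightarrow> (\<integral>p. (indicator ({..<a} \<times> UNIV) p *\<^sub>R U p) * complex_of_real (adj F Ft p) \<partial>lborel) =
          - (\<integral>x. U (a, x) * complex_of_real (F 0 (a, x)) \<partial>lborel)" by blast
  \<comment> \<open>The correction lives for the time 3 b \<le> (t1 - t0) / 2. Started at a, before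
    the midpoint \<open>tm\<close>, it is over by t1.\<close>
  define b where "b = min (1/4) ((t1 - t0) / 6)"
  have b: "0 < b" "b \<le> 1/4" "a + 3 * b \<le> t1" using t01 a(2) by (auto simp: b_def tm_def min_def field_simps)
  have qm: "(\<lambda>x. U (a, x)) \<in> borel_measurable borel"
    by (rule measurable_compose[OF borel_measurable_continuous_onI U(1)]) (intro continuous_intros)
  obtain v where v: "local_dom v" "\<And>t x. t \<le> 0 \<or> 3 * b \<le> t \<Longrightarrow> v (t, x) = 0"
    "\<And>Y. \<exists>C\<ge>0. \<forall>t x. \<bar>x\<bar> \<le> Y \<longrightarrow> norm (v (t, x)) \<le> C * sing (2/5) t"
    "\<And>F Ft. test_family F Ft \<Longrightarrow> (\<integral>p. v p * complex_of_real (adj F Ft p) \<partial>lborel) = (\<integral>x. U (a, x) * complex_of_real (F 0 (0, x)) \<partial>lborel)"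
    by (rule instantaneous_source_solution[OF b(1,2) qm a(3)]) (rule that; assumption)
  have vm: "v \<in> borel_measurable borel" using v(1) by (simp add: local_dom_def)
  define U1 where "U1 p = indicator ({..<a} \<times> UNIV) p *\<^sub>R U p" for p
  define v1 where "v1 p = v (p - (a, 0))" for p
  have S: "{..<a} \<times> UNIV \<in> sets (borel :: (real \<times> real) measure)" by (intro borel_open open_Times; simp)
  have LU: "L2_box U1"
  proof (rule L2_box_gw)
    show m: "U1 \<in> borel_measurable borel" unfolding U1_def using S U(1) by measurable
    show "integrable lborel (\<lambda>p. gw p * (norm (U1 p))\<^sup>2)"
    proof (rule Bochner_Integration.integrable_bound[OF U(2)])
      show "AE p in lborel. norm (gw p * (norm (U1 p))\<^sup>2) \<le> norm (gw p * (norm (U p))\<^sup>2)"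
        by (intro AE_I2) (auto simp: U1_def indicator_def abs_mult)
    qed (use m in measurable)
  qed
  have v1m: "v1 \<in> borel_measurable borel"
    unfolding v1_def by (rule measurable_compose[OF borel_measurable_continuous_onI vm]) (intro continuous_intros)
  \<comment> \<open>Squaring turns the exponent 2/5 into 4/5, still below 1.\<close>
  have Lv: "L2_box v1"
    unfolding L2_box_def
  proof (intro conjI allI v1m)
    fix A :: real
    obtain C where C: "0 \<le> C" "\<And>t x. \<bar>x\<bar> \<le> A \<Longrightarrow> norm (v (t, x)) \<le> C * sing (2/5) t" using v(3)[of A] by blast
    have i1: "integrable lborel (\<lambda>t. sing (4/5) (- a + 1 * t))" by (intro lborel_integrable_real_affine integrable_sing) auto
    have "integrable lborel (\<lambda>p. sing (4/5) (- a + 1 * fst p) * (C\<^sup>2 * indicator {-A..A} (snd p)))"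
      using lborel_pair.integrable_mult_pair[OF i1 integrable_mult_indicator_Icc[of "C\<^sup>2" "-A" A]] by (simp add: lborel_prod)
    then show "integrable lborel (\<lambda>p. indicator ({-A..A} \<times> {-A..A}) p * (norm (v1 p))\<^sup>2)"
    proof (rule Bochner_Integration.integrable_bound)
      show "AE p in lborel. norm (indicator ({-A..A} \<times> {-A..A}) p * (norm (v1 p))\<^sup>2) \<le> norm (sing (4/5) (- a + 1 * fst p) * (C\<^sup>2 * indicator {-A..A} (snd p)))"
      proof (rule AE_I2)
        fix p :: "real \<times> real"
        obtain t x where p: "p = (t, x)" by force
        have sq: "(sing (2/5) y)\<^sup>2 = sing (4/5) y" for y by (auto simp: sing_def power2_eq_square simp flip: powr_add)
        show "norm (indicator ({-A..A} \<times> {-A..A}) p * (norm (v1 p))\<^sup>2) \<le> norm (sing (4/5) (- a + 1 * fst p) * (C\<^sup>2 * indicator {-A..A} (snd p)))"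
        proof (cases "p \<in> {-A..A} \<times> {-A..A}")
          case True
          then have "\<bar>x\<bar> \<le> A" by (auto simp: p)
          then have "(norm (v (t - a, x)))\<^sup>2 \<le> (C * sing (2/5) (t - a))\<^sup>2" by (intro power_mono C(2)) auto
          then have "(norm (v1 p))\<^sup>2 \<le> C\<^sup>2 * sing (4/5) (t - a)" by (simp add: v1_def p power_mult_distrib sq)
          then show ?thesis using True sing_nonneg[of "4/5" "t - a"] by (simp add: p abs_mult mult_ac)
        qed simp
      qed
      show "(\<lambda>p. indicator ({-A..A} \<times> {-A..A}) p * (norm (v1 p))\<^sup>2) \<in> borel_measurable lborel"
        using v1m sets_square[of A] by measurable
    qed
  qed
  show thesis
  proof (rule that[of "\<lambda>p. U1 p + v1 p"])
    show "L2_box (\<lambda>p. U1 p + v1 p)" by (rule L2_box_add[OF LU Lv])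
    show "U1 (t, x) + v1 (t, x) = 0" if "t1 \<le> t" for t x
    proof -
      have "a \<le> t" "3 * b \<le> t - a" using that b by auto
      then show ?thesis using v(2)[of "t - a" x] by (simp add: U1_def v1_def)
    qed
    show "(\<integral>p. (U1 p + v1 p) * complex_of_real (adj F Ft p) \<partial>lborel) = 0" if T: "test_family F Ft" for F Ft
    proof -
      have "(\<integral>p. v1 p * complex_of_real (adj F Ft p) \<partial>lborel) = (\<integral>x. U (a, x) * complex_of_real (F 0 (a, x)) \<partial>lborel)"
        unfolding v1_def weak_translate[OF vm T] v(4)[OF test_family_translate[OF T]] by simp
      moreover have "(\<integral>p. U1 p * complex_of_real (adj F Ft p) \<partial>lborel) = - (\<integral>x. U (a, x) * complex_of_real (F 0 (a, x)) \<partial>lborel)"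
        unfolding U1_def by (rule a(4)[OF T])
      ultimately show ?thesis
        using L2_box_integrable[OF LU box_test_adj[OF T]] L2_box_integrable[OF Lv box_test_adj[OF T]] by (simp add: distrib_right)
    qed
    have eq: "U1 (t, x) + v1 (t, x) = U (t, x)" if "t \<le> t0" for t x
      using that a(1) v(2)[of "t - a" x] by (simp add: U1_def v1_def)
    show "AE t in lborel. t \<le> t0 \<longrightarrow> integrable lborel (\<lambda>x. norm (U1 (t, x) + v1 (t, x)) * exp (- x\<^sup>2 / 2)) \<and>
       (\<forall>\<phi> M. continuous_on UNIV \<phi> \<longrightarrow> (\<exists>B. \<forall>x. B \<le> \<bar>x\<bar> \<longrightarrow> \<phi> x = 0) \<longrightarrow>
          (\<forall>\<xi>. norm (fhat \<phi> \<xi>) * (1 + \<xi>\<^sup>2)\<^sup>2 \<le> M) \<longrightarrow>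
          (\<integral>x. (U1 (t, x) + v1 (t, x)) * complex_of_real (\<phi> x) \<partial>lborel) =
            (\<integral>\<xi>. g \<xi> * exp (\<i> * of_real (om \<xi> * t)) * fhat \<phi> \<xi> \<partial>lborel) / (2 * pi))"
      using AEU
    proof eventually_elim
      case (elim t)
      show ?case
      proof (intro impI)
        assume t: "t \<le> t0"
        show "integrable lborel (\<lambda>x. norm (U1 (t, x) + v1 (t, x)) * exp (- x\<^sup>2 / 2)) \<and>
       (\<forall>\<phi> M. continuous_on UNIV \<phi> \<longrightarrow> (\<exists>B. \<forall>x. B \<le> \<bar>x\<bar> \<longrightarrow> \<phi> x = 0) \<longrightarrow>
          (\<forall>\<xi>. norm (fhat \<phi> \<xi>) * (1 + \<xi>\<^sup>2)\<^sup>2 \<le> M) \<longrightarrow>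
          (\<integral>x. (U1 (t, x) + v1 (t, x)) * complex_of_real (\<phi> x) \<partial>lborel) =
            (\<integral>\<xi>. g \<xi> * exp (\<i> * of_real (om \<xi> * t)) * fhat \<phi> \<xi> \<partial>lborel) / (2 * pi))"
          unfolding eq[OF t] using elim by (intro conjI) (elim conjE, assumption)+
      qed
    qed
  qed
qed

section \<open>Sobolev data\<close>

lemma cnj_FT: "cnj (FT \<phi> \<xi>) = fhat \<phi> \<xi>"
proof -
  have "cnj (FT \<phi> \<xi>) = (\<integral>x. cnj (complex_of_real (\<phi> x) * cis (- (x * \<xi>))) \<partial>lborel)"
    unfolding FT_def by (rule Bochner_Integration.integral_cnj[symmetric])
  also have "\<dots> = fhat \<phi> \<xi>"
    by (intro Bochner_Integration.integral_cong) (auto simp: cis_cnj cis_conv_exp exp_cnj mult_ac)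
  finally show ?thesis .
qed

lemma test1_family:
  assumes "test1 U \<phi>"
  obtains A where "\<And>j x. A \<le> \<bar>x\<bar> \<Longrightarrow> (deriv ^^ j) \<phi> x = 0"
    "\<And>j x. ((deriv ^^ j) \<phi> has_real_derivative (deriv ^^ Suc j) \<phi> x) (at x)"
proof -
  have "bounded (supp_cl \<phi>)" using assms by (auto simp: test1_def intro: compact_imp_bounded)
  then obtain B where B: "\<And>x. x \<in> supp_cl \<phi> \<Longrightarrow> \<bar>x\<bar> \<le> B" by (auto simp: bounded_iff)
  have z0: "\<phi> x = 0" if "B < \<bar>x\<bar>" for x
    using B[of x] that closure_subset[of "{x. \<phi> x \<noteq> 0}"] by (force simp: supp_cl_def)
  have z: "(deriv ^^ j) \<phi> x = 0" if "B < \<bar>x\<bar>" for j x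
    using that
  proof (induction j arbitrary: x)
    case 0 then show ?case using z0 by simp
  next
    case (Suc j)
    have "open {y. B < \<bar>y\<bar>}" by (intro open_Collect_less continuous_intros)
    then have "((deriv ^^ j) \<phi> has_real_derivative 0) (at x)"
      using has_field_derivative_transform_within_open[of "\<lambda>_. 0" 0 x "{y. B < \<bar>y\<bar>}" "(deriv ^^ j) \<phi>"] Suc by auto
    then show ?case by (simp add: DERIV_imp_deriv)
  qed
  have d: "((deriv ^^ j) \<phi> has_real_derivative (deriv ^^ Suc j) \<phi> x) (at x)" for j x
    using assms by (simp add: test1_def smooth1_def DERIV_deriv_iff_real_differentiable)
  show thesis by (rule that[of "B + 1"]) (use z d in auto)
qed

lemma test1_fourier:
  assumes "test1 U \<phi>"
  shows "continuous_on UNIV \<phi>" "\<exists>B. \<forall>x. B \<le> \<bar>x\<bar> \<longrightarrow> \<phi> x = 0" "\<exists>M. \<forall>\<xi>. norm (fhat \<phi> \<xi>) * (1 + \<xi>\<^sup>2)\<^sup>2 \<le> M"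
proof -
  obtain A where A: "\<And>j x. A \<le> \<bar>x\<bar> \<Longrightarrow> (deriv ^^ j) \<phi> x = 0"
    "\<And>j x. ((deriv ^^ j) \<phi> has_real_derivative (deriv ^^ Suc j) \<phi> x) (at x)" by (rule test1_family[OF assms]) (rule that; assumption)
  show "continuous_on UNIV \<phi>"
    using A(2)[of 0] by (auto intro!: continuous_at_imp_continuous_on DERIV_isCont)
  show "\<exists>B. \<forall>x. B \<le> \<bar>x\<bar> \<longrightarrow> \<phi> x = 0" using A(1)[of _ 0] by auto
  have "\<exists>M. \<forall>\<xi>. norm (\<integral>x. exp (\<i> * of_real \<xi> * of_real x) * (\<lambda>j x. complex_of_real ((deriv ^^ j) \<phi> x)) 0 x \<partial>lborel) * (1 + \<xi>\<^sup>2)\<^sup>2 \<le> M"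
    by (rule fourier_decay[of _ A]) (use A in \<open>auto intro!: has_vector_derivative_of_real_complex simp del: funpow.simps\<close>)
  then show "\<exists>M. \<forall>\<xi>. norm (fhat \<phi> \<xi>) * (1 + \<xi>\<^sup>2)\<^sup>2 \<le> M" by simp
qed

section \<open>Reflection in frequency\<close>

lemma integral_uminus: "(\<integral>\<xi>. f (- \<xi>) \<partial>lborel) = (\<integral>\<xi>. f \<xi> \<partial>lborel)" for f :: "real \<Rightarrow> 'b::{banach, second_countable_topology}"
  using lborel_integral_real_affine[of "-1" f 0] by simp

lemma fhat_uminus: "fhat \<phi> (- \<xi>) = cnj (fhat \<phi> \<xi>)"
proof -
  have "cnj (fhat \<phi> \<xi>) = (\<integral>x. cnj (exp (\<i> * of_real \<xi> * of_real x) * complex_of_real (\<phi> x)) \<partial>lborel)"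
    by (rule Bochner_Integration.integral_cnj[symmetric])
  then show ?thesis by (simp add: exp_cnj)
qed

lemma fhat_reflect: "fhat (\<lambda>x. \<phi> (- x)) \<xi> = fhat \<phi> (- \<xi>)"
  using integral_uminus[of "\<lambda>x. exp (\<i> * of_real (- \<xi>) * of_real x) * complex_of_real (\<phi> x)"] by simp

lemma test1_product_integrable:
  assumes "g \<in> borel_measurable borel" "integrable lborel (\<lambda>\<xi>. (norm (g \<xi>))\<^sup>2 / (1 + \<xi>\<^sup>2)\<^sup>2)" "test1 U \<phi>"
  shows "integrable lborel (\<lambda>\<xi>. g \<xi> * fhat \<phi> \<xi>)"
  using fhat_product_integrable[OF assms(1,2) test1_fourier(1)[OF assms(3)]] test1_fourier(3)[OF assms(3)] by blast

text \<open>Hermitian symmetry characterises transforms of real distributions. The group preserves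
  it because \<open>om\<close> is odd.\<close>

definition Hs_data :: "real \<Rightarrow> (real \<Rightarrow> complex) \<Rightarrow> bool" where
  "Hs_data s g \<longleftrightarrow> g \<in> borel_measurable borel \<and> integrable lborel (\<lambda>\<xi>. (1 + \<xi>\<^sup>2) powr s * (norm (g \<xi>))\<^sup>2) \<and>
     (\<forall>\<xi>. g (- \<xi>) = cnj (g \<xi>))"

lemma powr_weight_ge: "-2 \<le> s \<Longrightarrow> 1 / (1 + \<xi>\<^sup>2)\<^sup>2 \<le> (1 + (\<xi>::real)\<^sup>2) powr s"
proof -
  assume s: "-2 \<le> s"
  have "(1 + \<xi>\<^sup>2) powr (-2) \<le> (1 + \<xi>\<^sup>2) powr s" using s by (intro powr_mono) auto
  moreover have "0 < 1 + \<xi>\<^sup>2" by (simp add: add_pos_nonneg)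
  then have "(1 + \<xi>\<^sup>2) powr (-2) = 1 / (1 + \<xi>\<^sup>2)\<^sup>2" by (simp add: powr_minus powr_numeral inverse_eq_divide)
  ultimately show ?thesis by simp
qed

text \<open>Reduces all s \<ge> -2 to the single weight (1 + \<xi>^2)^(-2), the one that a local
  gain of two derivatives compensates.\<close>

lemma weighted_L2_weaken:
  assumes s: "-2 \<le> s" and [measurable]: "g \<in> borel_measurable borel"
    and i: "integrable lborel (\<lambda>\<xi>. (1 + \<xi>\<^sup>2) powr s * (norm (g \<xi>))\<^sup>2)"
  shows "integrable lborel (\<lambda>\<xi>. (norm (g \<xi>))\<^sup>2 / (1 + \<xi>\<^sup>2)\<^sup>2)"
proof (rule Bochner_Integration.integrable_bound[OF i])
  show "AE \<xi> in lborel. norm ((norm (g \<xi>))\<^sup>2 / (1 + \<xi>\<^sup>2)\<^sup>2) \<le> norm ((1 + \<xi>\<^sup>2) powr s * (norm (g \<xi>))\<^sup>2)"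
  proof (rule AE_I2)
    fix \<xi> :: real
    have "1 / (1 + \<xi>\<^sup>2)\<^sup>2 * (norm (g \<xi>))\<^sup>2 \<le> (1 + \<xi>\<^sup>2) powr s * (norm (g \<xi>))\<^sup>2" by (intro mult_right_mono powr_weight_ge s) auto
    then show "norm ((norm (g \<xi>))\<^sup>2 / (1 + \<xi>\<^sup>2)\<^sup>2) \<le> norm ((1 + \<xi>\<^sup>2) powr s * (norm (g \<xi>))\<^sup>2)" by (simp add: abs_mult)
  qed
qed measurable

text \<open>A representative is known only through its pairings, so Hermitian symmetry at every
  \<xi> cannot be read off. Averaging g with the conjugate of its reflection enforces it and changes
  no pairing with a real test function, since these pairings are real.\<close>

lemma Hs_half_data:
  assumes s: "-2 \<le> s" and u: "u \<in> Hs_half s"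
  obtains g where "Hs_data s g" "\<And>\<phi>. test1 {0<..} \<phi> \<Longrightarrow> complex_of_real (u \<phi>) = (\<integral>\<xi>. g \<xi> * fhat \<phi> \<xi> \<partial>lborel) / (2 * pi)"
proof -
  obtain g S where gS: "Hs_rep s g S" "\<And>\<phi>. test1 {0<..} \<phi> \<Longrightarrow> u \<phi> = S \<phi>" using u by (auto simp: Hs_half_def Hs_half_rep_def)
  have gm[measurable]: "g \<in> borel_measurable borel" and gi: "integrable lborel (\<lambda>\<xi>. (1 + \<xi>\<^sup>2) powr s * (norm (g \<xi>))\<^sup>2)"
    and gr: "\<And>\<phi>. test1 UNIV \<phi> \<Longrightarrow> complex_of_real (S \<phi>) = (\<integral>\<xi>. g \<xi> * fhat \<phi> \<xi> \<partial>lborel) / (2 * pi)"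
    using gS(1) by (auto simp: Hs_rep_def cnj_FT)
  define g' where "g' \<xi> = (g \<xi> + cnj (g (- \<xi>))) / 2" for \<xi>
  have ngm[measurable]: "(\<lambda>\<xi>. cnj (g (- \<xi>))) \<in> borel_measurable borel"
    by (rule measurable_compose[OF measurable_compose[OF _ gm]]) (auto intro!: borel_measurable_continuous_onI continuous_intros)
  have g'm: "g' \<in> borel_measurable borel" unfolding g'_def by measurable
  have gi': "integrable lborel (\<lambda>\<xi>. (1 + \<xi>\<^sup>2) powr s * (norm (g (- \<xi>)))\<^sup>2)"
    using lborel_integrable_real_affine[OF gi, of "-1" 0] by simp
  have g'i: "integrable lborel (\<lambda>\<xi>. (1 + \<xi>\<^sup>2) powr s * (norm (g' \<xi>))\<^sup>2)"
  proof (rule Bochner_Integration.integrable_bound[OF Bochner_Integration.integrable_add[OF gi gi']])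
    show "AE \<xi> in lborel. norm ((1 + \<xi>\<^sup>2) powr s * (norm (g' \<xi>))\<^sup>2) \<le> norm ((1 + \<xi>\<^sup>2) powr s * (norm (g \<xi>))\<^sup>2 + (1 + \<xi>\<^sup>2) powr s * (norm (g (- \<xi>)))\<^sup>2)"
    proof (rule AE_I2)
      fix \<xi> :: real
      have "norm (g' \<xi>) \<le> (norm (g \<xi>) + norm (g (- \<xi>))) / 2"
        using norm_triangle_ineq[of "g \<xi>" "cnj (g (- \<xi>))"] by (simp add: g'_def norm_divide)
      then have "(norm (g' \<xi>))\<^sup>2 \<le> ((norm (g \<xi>) + norm (g (- \<xi>))) / 2)\<^sup>2" by (intro power_mono) auto
      also have "\<dots> \<le> (norm (g \<xi>))\<^sup>2 + (norm (g (- \<xi>)))\<^sup>2"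
      proof -
        have "0 \<le> 3/4 * a\<^sup>2 + 3/4 * c\<^sup>2 - a * c / 2" for a c :: real
          using sum_squares_bound[of a c] zero_le_power2[of a] zero_le_power2[of c] by linarith
        from this[of "norm (g \<xi>)" "norm (g (- \<xi>))"] show ?thesis by (simp add: power2_eq_square field_simps)
      qed
      finally have "(1 + \<xi>\<^sup>2) powr s * (norm (g' \<xi>))\<^sup>2 \<le> (1 + \<xi>\<^sup>2) powr s * ((norm (g \<xi>))\<^sup>2 + (norm (g (- \<xi>)))\<^sup>2)"
        by (intro mult_left_mono) auto
      then show "norm ((1 + \<xi>\<^sup>2) powr s * (norm (g' \<xi>))\<^sup>2) \<le> norm ((1 + \<xi>\<^sup>2) powr s * (norm (g \<xi>))\<^sup>2 + (1 + \<xi>\<^sup>2) powr s * (norm (g (- \<xi>)))\<^sup>2)"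
        by (simp add: distrib_left)
    qed
  qed (use g'm in measurable)
  show thesis
  proof (rule that[of g'])
    show "Hs_data s g'" unfolding Hs_data_def using g'm g'i by (auto simp: g'_def add.commute)
    fix \<phi> assume \<phi>: "test1 {0<..} \<phi>"
    then have \<phi>': "test1 UNIV \<phi>" by (simp add: test1_def)
    let ?I = "\<integral>\<xi>. g \<xi> * fhat \<phi> \<xi> \<partial>lborel"
    have i: "integrable lborel (\<lambda>\<xi>. g \<xi> * fhat \<phi> \<xi>)" by (rule test1_product_integrable[OF gm weighted_L2_weaken[OF s gm gi] \<phi>])
    have e: "cnj (g (- \<xi>)) * fhat \<phi> \<xi> = cnj (g (- \<xi>) * fhat \<phi> (- \<xi>))" for \<xi> by (simp only: fhat_uminus complex_cnj_mult complex_cnj_cnj)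
    have i': "integrable lborel (\<lambda>\<xi>. cnj (g (- \<xi>)) * fhat \<phi> \<xi>)"
      unfolding e using lborel_integrable_real_affine[OF i, of "-1" 0] by (intro integrable_cnj) simp
    have "(\<integral>\<xi>. cnj (g (- \<xi>)) * fhat \<phi> \<xi> \<partial>lborel) = cnj (\<integral>\<xi>. g (- \<xi>) * fhat \<phi> (- \<xi>) \<partial>lborel)"
      unfolding e by (rule Bochner_Integration.integral_cnj)
    also have "\<dots> = cnj ?I" using integral_uminus[of "\<lambda>\<xi>. g \<xi> * fhat \<phi> \<xi>"] by simp
    also have "\<dots> = ?I"
    proof -
      have "?I = complex_of_real (S \<phi> * (2 * pi))" using gr[OF \<phi>'] by (simp add: field_simps)
      then show ?thesis by (simp only: complex_cnj_complex_of_real)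
    qed
    finally have I': "(\<integral>\<xi>. cnj (g (- \<xi>)) * fhat \<phi> \<xi> \<partial>lborel) = ?I" .
    have "(\<integral>\<xi>. g' \<xi> * fhat \<phi> \<xi> \<partial>lborel) = (\<integral>\<xi>. (g \<xi> * fhat \<phi> \<xi> + cnj (g (- \<xi>)) * fhat \<phi> \<xi>) / 2 \<partial>lborel)"
      by (intro Bochner_Integration.integral_cong) (auto simp: g'_def distrib_right)
    also have "\<dots> = (?I + ?I) / 2" by (subst integral_divide_zero) (simp only: Bochner_Integration.integral_add[OF i i'] I')
    finally show "complex_of_real (u \<phi>) = (\<integral>\<xi>. g' \<xi> * fhat \<phi> \<xi> \<partial>lborel) / (2 * pi)"
      using gr[OF \<phi>'] gS(2)[OF \<phi>] by simp
  qed
qed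

text \<open>The group on the frequency side: a multiplier of modulus one, so every weighted L^2 norm
  is preserved.\<close>

definition flow :: "(real \<Rightarrow> complex) \<Rightarrow> real \<Rightarrow> real \<Rightarrow> complex" where
  "flow g t \<xi> = g \<xi> * exp (\<i> * of_real (om \<xi> * t))"

text \<open>Taking the real part only adapts the type: for Hermitian data the pairing is
  real.\<close>

definition flow_distr :: "(real \<Rightarrow> complex) \<Rightarrow> real \<Rightarrow> distr" where
  "flow_distr g t \<phi> = Re ((\<integral>\<xi>. flow g t \<xi> * fhat \<phi> \<xi> \<partial>lborel) / (2 * pi))"

lemma Hs_data_flow:
  assumes "Hs_data s g" shows "Hs_data s (flow g t)"
proof -
  have m: "(\<lambda>\<xi>. exp (\<i> * complex_of_real (om \<xi> * t))) \<in> borel_measurable borel"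
    unfolding om_def by (intro borel_measurable_continuous_onI continuous_intros)
  have "om (- \<xi>) = - om \<xi>" for \<xi> by (simp add: om_def)
  then show ?thesis using assms borel_measurable_times[OF _ m] unfolding Hs_data_def flow_def by (auto simp: norm_mult exp_cnj)
qed

lemma Hs_data_diff:
  assumes f: "Hs_data s f" and g: "Hs_data s g" shows "Hs_data s (\<lambda>\<xi>. f \<xi> - g \<xi>)"
  unfolding Hs_data_def
proof (intro conjI)
  have [measurable]: "f \<in> borel_measurable borel" "g \<in> borel_measurable borel" using f g by (auto simp: Hs_data_def)
  show "(\<lambda>\<xi>. f \<xi> - g \<xi>) \<in> borel_measurable borel" by measurable
  have fi: "integrable lborel (\<lambda>\<xi>. 2 * ((1 + \<xi>\<^sup>2) powr s * (norm (f \<xi>))\<^sup>2) + 2 * ((1 + \<xi>\<^sup>2) powr s * (norm (g \<xi>))\<^sup>2))"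
    using f g by (intro Bochner_Integration.integrable_add integrable_mult_right) (auto simp: Hs_data_def)
  show "integrable lborel (\<lambda>\<xi>. (1 + \<xi>\<^sup>2) powr s * (norm (f \<xi> - g \<xi>))\<^sup>2)"
  proof (rule Bochner_Integration.integrable_bound[OF fi])
    show "AE \<xi> in lborel. norm ((1 + \<xi>\<^sup>2) powr s * (norm (f \<xi> - g \<xi>))\<^sup>2) \<le> norm (2 * ((1 + \<xi>\<^sup>2) powr s * (norm (f \<xi>))\<^sup>2) + 2 * ((1 + \<xi>\<^sup>2) powr s * (norm (g \<xi>))\<^sup>2))"
    proof (rule AE_I2)
      fix \<xi> :: real
      have "(norm (f \<xi> - g \<xi>))\<^sup>2 \<le> (norm (f \<xi>) + norm (g \<xi>))\<^sup>2" by (intro power_mono norm_triangle_ineq4) auto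
      also have "\<dots> \<le> 2 * (norm (f \<xi>))\<^sup>2 + 2 * (norm (g \<xi>))\<^sup>2"
        using sum_squares_bound[of "norm (f \<xi>)" "norm (g \<xi>)"] by (simp add: power2_sum)
      finally have "(1 + \<xi>\<^sup>2) powr s * (norm (f \<xi> - g \<xi>))\<^sup>2 \<le> (1 + \<xi>\<^sup>2) powr s * (2 * (norm (f \<xi>))\<^sup>2 + 2 * (norm (g \<xi>))\<^sup>2)"
        by (intro mult_left_mono) auto
      then show "norm ((1 + \<xi>\<^sup>2) powr s * (norm (f \<xi> - g \<xi>))\<^sup>2) \<le> norm (2 * ((1 + \<xi>\<^sup>2) powr s * (norm (f \<xi>))\<^sup>2) + 2 * ((1 + \<xi>\<^sup>2) powr s * (norm (g \<xi>))\<^sup>2))"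
        by (simp add: algebra_simps)
    qed
  qed measurable
qed (use f g in \<open>auto simp: Hs_data_def\<close>)

text \<open>Hermitian symmetry of the data makes the pairing with real test functions real.\<close>

lemma Hs_data_rep:
  assumes g: "Hs_data s g" and v: "\<And>\<phi>. test1 UNIV \<phi> \<Longrightarrow> v \<phi> = Re ((\<integral>\<xi>. g \<xi> * fhat \<phi> \<xi> \<partial>lborel) / (2 * pi))"
  shows "Hs_half_rep s g v"
  unfolding Hs_half_rep_def
proof (intro exI[of _ v] conjI allI impI)
  show "Hs_rep s g v" unfolding Hs_rep_def cnj_FT
  proof (intro conjI allI impI)
    show "g \<in> borel_measurable lborel" "integrable lborel (\<lambda>\<xi>. (1 + \<xi>\<^sup>2) powr s * (cmod (g \<xi>))\<^sup>2)" using g by (auto simp: Hs_data_def)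
    fix \<phi> assume \<phi>: "test1 UNIV \<phi>"
    let ?I = "\<integral>\<xi>. g \<xi> * fhat \<phi> \<xi> \<partial>lborel"
    have e: "g (- \<xi>) * fhat \<phi> (- \<xi>) = cnj (g \<xi> * fhat \<phi> \<xi>)" for \<xi> using g by (simp only: Hs_data_def fhat_uminus complex_cnj_mult)
    have "?I = (\<integral>\<xi>. g (- \<xi>) * fhat \<phi> (- \<xi>) \<partial>lborel)" using integral_uminus[of "\<lambda>\<xi>. g \<xi> * fhat \<phi> \<xi>"] by simp
    also have "\<dots> = cnj ?I" unfolding e by (rule Bochner_Integration.integral_cnj)
    finally have "Im ?I = Im (cnj ?I)" by (rule arg_cong)
    then have "Im ?I = 0" unfolding cnj.sel by linarith
    then show "complex_of_real (v \<phi>) = ?I / (2 * pi)" unfolding v[OF \<phi>]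
      using of_real_Re[of "?I / (2 * pi)"] by (simp add: complex_is_Real_iff)
  qed
qed simp

text \<open>The norm on the half-line is an infimum over extensions, hence at most the weighted L^2
  distance of the whole-line transforms, which tends to 0 by dominated convergence. The shift c lets
  the statement serve both ends of the time interval.\<close>

lemma flow_continuous:
  assumes s: "-2 \<le> s" and g: "Hs_data s g"
  shows "cont_Hs_half s I (\<lambda>t. flow_distr g (t - c))"
  unfolding cont_Hs_half_def
proof (intro conjI ballI allI impI)
  fix t
  show "flow_distr g (t - c) \<in> Hs_half s"
    unfolding Hs_half_def using Hs_data_rep[OF Hs_data_flow[OF g], of "flow_distr g (t - c)" "t - c"] by (auto simp: flow_distr_def)
next
  fix t e :: real assume e: "0 < e"
  have gm: "g \<in> borel_measurable borel" and gi: "integrable lborel (\<lambda>\<xi>. (1 + \<xi>\<^sup>2) powr s * (norm (g \<xi>))\<^sup>2)" using g by (auto simp: Hs_data_def)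
  define H where "H t' = (\<integral>\<xi>. (1 + \<xi>\<^sup>2) powr s * (norm (flow g (t' - c) \<xi> - flow g (t - c) \<xi>))\<^sup>2 \<partial>lborel)" for t'
  have fm: "flow g y \<in> borel_measurable borel" for y using Hs_data_flow[OF g] by (auto simp: Hs_data_def)
  have nf: "norm (flow g y \<xi>) = norm (g \<xi>)" for y \<xi> by (simp add: flow_def norm_mult)
  have "continuous_on UNIV H"
    unfolding continuous_on_sequentially H_def comp_def
  proof (intro allI ballI impI)
    fix x xs assume "(\<forall>n. xs n \<in> UNIV) \<and> xs \<longlonglongrightarrow> (x::real)"
    then have xs: "xs \<longlonglongrightarrow> x" by simp
    show "(\<lambda>n. \<integral>\<xi>. (1 + \<xi>\<^sup>2) powr s * (norm (flow g (xs n - c) \<xi> - flow g (t - c) \<xi>))\<^sup>2 \<partial>lborel) \<longlonglongrightarrow> (\<integral>\<xi>. (1 + \<xi>\<^sup>2) powr s * (norm (flow g (x - c) \<xi> - flow g (t - c) \<xi>))\<^sup>2 \<partial>lborel)"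
    proof (rule integral_dominated_convergence[where w="\<lambda>\<xi>. 4 * ((1 + \<xi>\<^sup>2) powr s * (norm (g \<xi>))\<^sup>2)"])
      show "integrable lborel (\<lambda>\<xi>. 4 * ((1 + \<xi>\<^sup>2) powr s * (norm (g \<xi>))\<^sup>2))" by (rule integrable_mult_right[OF gi])
      show "AE \<xi> in lborel. (\<lambda>n. (1 + \<xi>\<^sup>2) powr s * (norm (flow g (xs n - c) \<xi> - flow g (t - c) \<xi>))\<^sup>2) \<longlonglongrightarrow> (1 + \<xi>\<^sup>2) powr s * (norm (flow g (x - c) \<xi> - flow g (t - c) \<xi>))\<^sup>2"
        unfolding flow_def by (intro AE_I2 tendsto_intros xs)
      show "AE \<xi> in lborel. norm ((1 + \<xi>\<^sup>2) powr s * (norm (flow g (xs n - c) \<xi> - flow g (t - c) \<xi>))\<^sup>2) \<le> 4 * ((1 + \<xi>\<^sup>2) powr s * (norm (g \<xi>))\<^sup>2)" for n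
      proof (rule AE_I2)
        fix \<xi> :: real
        have "norm (flow g (xs n - c) \<xi> - flow g (t - c) \<xi>) \<le> 2 * norm (g \<xi>)"
          using norm_triangle_ineq4[of "flow g (xs n - c) \<xi>" "flow g (t - c) \<xi>"] by (simp add: nf)
        then have "(norm (flow g (xs n - c) \<xi> - flow g (t - c) \<xi>))\<^sup>2 \<le> (2 * norm (g \<xi>))\<^sup>2" by (intro power_mono) auto
        then have "(1 + \<xi>\<^sup>2) powr s * (norm (flow g (xs n - c) \<xi> - flow g (t - c) \<xi>))\<^sup>2 \<le> (1 + \<xi>\<^sup>2) powr s * (2 * norm (g \<xi>))\<^sup>2" by (intro mult_left_mono) auto
        then show "norm ((1 + \<xi>\<^sup>2) powr s * (norm (flow g (xs n - c) \<xi> - flow g (t - c) \<xi>))\<^sup>2) \<le> 4 * ((1 + \<xi>\<^sup>2) powr s * (norm (g \<xi>))\<^sup>2)"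
          by (simp add: power_mult_distrib mult_ac)
      qed
    qed (use fm in measurable)
  qed
  moreover have "H t = 0" by (simp add: H_def)
  moreover have "0 < (2 * pi * e)\<^sup>2" using e by simp
  ultimately have "\<exists>d>0. \<forall>t'\<in>UNIV. dist t' t < d \<longrightarrow> dist (H t') (H t) < (2 * pi * e)\<^sup>2"
    unfolding continuous_on_iff by (elim ballE[of _ _ t] allE impE) auto
  then obtain d where d: "0 < d" "\<And>t'. \<bar>t' - t\<bar> < d \<Longrightarrow> \<bar>H t'\<bar> < (2 * pi * e)\<^sup>2"
    unfolding \<open>H t = 0\<close> dist_real_def by auto
  have "Hs_half_norm s (\<lambda>\<phi>. flow_distr g (t' - c) \<phi> - flow_distr g (t - c) \<phi>) < e" if "\<bar>t' - t\<bar> < d" for t'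
  proof -
    let ?f = "\<lambda>\<xi>. flow g (t' - c) \<xi> - flow g (t - c) \<xi>"
    have fd: "Hs_data s ?f" by (intro Hs_data_diff Hs_data_flow g)
    have "Hs_half_rep s ?f (\<lambda>\<phi>. flow_distr g (t' - c) \<phi> - flow_distr g (t - c) \<phi>)"
    proof (rule Hs_data_rep[OF fd])
      fix \<phi> assume \<phi>: "test1 UNIV \<phi>"
      have i: "integrable lborel (\<lambda>\<xi>. flow g y \<xi> * fhat \<phi> \<xi>)" for y
        using Hs_data_flow[OF g] by (intro test1_product_integrable[OF _ weighted_L2_weaken[OF s] \<phi>]) (auto simp: Hs_data_def)
      have "(\<integral>\<xi>. ?f \<xi> * fhat \<phi> \<xi> \<partial>lborel) = (\<integral>\<xi>. flow g (t' - c) \<xi> * fhat \<phi> \<xi> \<partial>lborel) - (\<integral>\<xi>. flow g (t - c) \<xi> * fhat \<phi> \<xi> \<partial>lborel)"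
        unfolding left_diff_distrib by (rule Bochner_Integration.integral_diff[OF i i])
      then show "flow_distr g (t' - c) \<phi> - flow_distr g (t - c) \<phi> = Re ((\<integral>\<xi>. ?f \<xi> * fhat \<phi> \<xi> \<partial>lborel) / (2 * pi))"
        unfolding flow_distr_def by (simp only: diff_divide_distrib minus_complex.simps)
    qed
    then have "Hs_half_norm s (\<lambda>\<phi>. flow_distr g (t' - c) \<phi> - flow_distr g (t - c) \<phi>) \<le> sqrt (H t') / (2 * pi)"
      unfolding Hs_half_norm_def H_def
      by (intro cInf_lower bdd_belowI[of _ 0]) (auto intro!: divide_nonneg_nonneg integral_nonneg_AE)
    also have "\<dots> < e"
    proof -
      have "sqrt (H t') < 2 * pi * e" using d(2)[OF that] e by (intro real_less_lsqrt) auto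
      then show ?thesis by (simp add: divide_less_eq mult.commute)
    qed
    finally show ?thesis .
  qed
  then show "\<exists>\<delta>>0. \<forall>t'\<in>I. \<bar>t' - t\<bar> < \<delta> \<longrightarrow> Hs_half_norm s (\<lambda>\<phi>. flow_distr g (t' - c) \<phi> - flow_distr g (t - c) \<phi>) < e"
    using d(1) by blast
qed

section \<open>Reflection and conclusion\<close>

lemma lborel_distr_reflect: "distr lborel borel (\<lambda>p. c - p) = (lborel :: 'a::euclidean_space measure)"
  using lborel_affine[of "-1" c] by (simp add: density_1)

lemma integral_reflect:
  fixes f :: "'a::euclidean_space \<Rightarrow> 'b::{banach, second_countable_topology}"
  assumes "f \<in> borel_measurable borel"
  shows "(\<integral>p. f (c - p) \<partial>lborel) = (\<integral>p. f p \<partial>lborel)"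
proof -
  have "(\<integral>p. f p \<partial>distr lborel borel (\<lambda>p. c - p)) = (\<integral>p. f (c - p) \<partial>lborel)"
    using assms by (intro integral_distr) auto
  then show ?thesis unfolding lborel_distr_reflect by simp
qed

lemma integrable_reflect:
  fixes f :: "'a::euclidean_space \<Rightarrow> 'b::{banach, second_countable_topology}"
  assumes "integrable lborel f" shows "integrable lborel (\<lambda>p. f (c - p))"
proof -
  have "integrable (distr lborel borel (\<lambda>p. c - p)) f" using assms unfolding lborel_distr_reflect .
  then show ?thesis by (rule integrable_distr[rotated]) simp
qed

lemma AE_reflect: "AE p in lborel. P p \<Longrightarrow> AE p in lborel. P (c - p)" for c :: "'a::euclidean_space"
  by (rule AE_distrD[of "\<lambda>p. c - p" lborel borel P]) (simp, simp only: lborel_distr_reflect)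

lemma L2_box_reflect:
  assumes w: "L2_box w" shows "L2_box (\<lambda>p. w (c - p))"
  unfolding L2_box_def
proof (intro conjI allI)
  have wm: "w \<in> borel_measurable borel" using w by (simp add: L2_box_def)
  show m: "(\<lambda>p. w (c - p)) \<in> borel_measurable borel" by (rule measurable_compose[OF _ wm]) simp
  fix A :: real
  let ?A = "A + \<bar>fst c\<bar> + \<bar>snd c\<bar>"
  have "integrable lborel (\<lambda>p. indicator ({-?A..?A} \<times> {-?A..?A}) p * (norm (w p))\<^sup>2)" using w by (simp only: L2_box_def)
  from integrable_reflect[OF this, of c]
  show "integrable lborel (\<lambda>p. indicator ({-A..A} \<times> {-A..A}) p * (norm (w (c - p)))\<^sup>2)"
  proof (rule Bochner_Integration.integrable_bound)
    show "(\<lambda>p. indicator ({-A..A} \<times> {-A..A}) p * (norm (w (c - p)))\<^sup>2) \<in> borel_measurable lborel"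
      using m sets_square[of A] by measurable
    show "AE p in lborel. norm (indicator ({-A..A} \<times> {-A..A}) p * (norm (w (c - p)))\<^sup>2) \<le> norm (indicator ({-?A..?A} \<times> {-?A..?A}) (c - p) * (norm (w (c - p)))\<^sup>2)"
    proof (rule AE_I2)
      fix p
      have "c - p \<in> {-?A..?A} \<times> {-?A..?A}" if "p \<in> {-A..A} \<times> {-A..A}"
        using that by (cases c; cases p) auto
      then show "norm (indicator ({-A..A} \<times> {-A..A}) p * (norm (w (c - p)))\<^sup>2) \<le> norm (indicator ({-?A..?A} \<times> {-?A..?A}) (c - p) * (norm (w (c - p)))\<^sup>2)"
        by (cases "p \<in> {-A..A} \<times> {-A..A}") (simp_all only: indicator_simps, simp_all)
    qed
  qed
qed

lemma box_test_reflect: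
  assumes h: "box_test h" shows "box_test (\<lambda>p. k * h (c - p))"
proof -
  obtain A where A: "\<And>t x. A \<le> \<bar>t\<bar> \<or> A \<le> \<bar>x\<bar> \<Longrightarrow> h (t, x) = 0" using h by (auto simp: box_test_def)
  have gen: "A \<le> \<bar>e - a\<bar>" if "A + \<bar>e\<bar> + f \<le> \<bar>a\<bar>" "0 \<le> f" for a e f :: real using that by linarith
  have "h (c - (t, x)) = 0" if "A + \<bar>fst c\<bar> + \<bar>snd c\<bar> \<le> \<bar>t\<bar> \<or> A + \<bar>fst c\<bar> + \<bar>snd c\<bar> \<le> \<bar>x\<bar>" for t x
    using that gen[of "fst c" "\<bar>snd c\<bar>" t] gen[of "snd c" "\<bar>fst c\<bar>" x] A[of "fst c - t" "snd c - x"]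
    by (cases c) (auto simp: algebra_simps)
  moreover have "continuous_on UNIV (\<lambda>p. k * h (c - p))"
    by (intro continuous_intros continuous_on_compose2[OF box_test_cont[OF h]]) auto
  ultimately show ?thesis unfolding box_test_def by (auto intro!: exI[of _ "A + \<bar>fst c\<bar> + \<bar>snd c\<bar>"])
qed

lemma test_family_reflect:
  assumes "test_family F Ft"
  shows "test_family (\<lambda>j p. (-1) ^ j * F j (c - p)) (\<lambda>p. -1 * Ft (c - p))"
proof -
  note T = test_familyD[OF assms]
  have chain: "((\<lambda>y. f (d - y)) has_real_derivative - D) (at x)" if "(f has_real_derivative D) (at (d - x))" for f d D and x :: real
  proof -
    have "((\<lambda>y. d - y) has_real_derivative -1) (at x)" by (auto intro!: derivative_eq_intros)
    from DERIV_chain2[of f D "\<lambda>y. d - y", OF that this] show ?thesis by simp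
  qed
  have "((\<lambda>y. (-1) ^ j * F j (c - (t, y))) has_real_derivative (-1) ^ Suc j * F (Suc j) (c - (t, x))) (at x)" for j t x
    using DERIV_cmult[OF chain[OF T(3)[of j "fst c - t" "snd c - x"]], of "(-1) ^ j"] by (cases c) simp
  moreover have "((\<lambda>s. (-1) ^ 0 * F 0 (c - (s, x))) has_real_derivative -1 * Ft (c - (t, x))) (at t)" for t x
    using chain[OF T(4)[of "snd c - x" "fst c - t"]] by (cases c) simp
  ultimately show ?thesis unfolding test_family_def by (intro conjI allI box_test_reflect T)
qed

text \<open>Every term of P has odd order, so a point reflection of the plane only changes the sign
  of the transposed operator.\<close>

lemma weak_reflect:
  assumes w: "w \<in> borel_measurable borel" and TF: "test_family F Ft"
    and weak: "\<And>F Ft. test_family F Ft \<Longrightarrow> (\<integral>p. w p * complex_of_real (adj F Ft p) \<partial>lborel) = 0"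
  shows "(\<integral>p. w (c - p) * complex_of_real (adj F Ft p) \<partial>lborel) = 0"
proof -
  let ?a = "adj (\<lambda>j p. (-1) ^ j * F j (c - p)) (\<lambda>p. -1 * Ft (c - p))"
  note TF' = test_family_reflect[OF TF, of c]
  have a: "?a p = - adj F Ft (c - p)" for p by (simp add: adj_def)
  have "(\<lambda>p. w p * complex_of_real (?a p)) \<in> borel_measurable borel"
    using w box_test_measurable[OF box_test_adj[OF TF']] by measurable
  from integral_reflect[OF this, of c] have "(\<integral>p. w (c - p) * complex_of_real (?a (c - p)) \<partial>lborel) = 0"
    by (simp only: weak[OF TF'])
  then show ?thesis unfolding a by simp
qed

text \<open>A function that vanishes on an open set has vanishing derivatives there, so one box
  serves all iterated partial derivatives.\<close>

lemma test2_family: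
  assumes "test2 U \<phi>"
  shows "test_family (\<lambda>j. pds (replicate j False) \<phi>) (pds [True] \<phi>)"
proof -
  have sm: "smooth2 \<phi>" and "compact (supp_cl \<phi>)" using assms by (auto simp: test2_def)
  then have "bounded (supp_cl \<phi>)" by (auto intro: compact_imp_bounded)
  then obtain B where B: "\<And>p. p \<in> supp_cl \<phi> \<Longrightarrow> norm p \<le> B" by (auto simp: bounded_iff)
  have z0: "\<phi> (t, x) = 0" if "B < \<bar>t\<bar> \<or> B < \<bar>x\<bar>" for t x
  proof (rule ccontr)
    assume "\<phi> (t, x) \<noteq> 0"
    then have "(t, x) \<in> supp_cl \<phi>" using closure_subset[of "{p. \<phi> p \<noteq> 0}"] by (auto simp: supp_cl_def)
    then have "norm (t, x) \<le> B" by (rule B)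
    then show False using that norm_fst_le[of t x] norm_snd_le[of x t] by auto
  qed
  have z: "pds ds \<phi> (t, x) = 0" if "B < \<bar>t\<bar> \<or> B < \<bar>x\<bar>" for ds t x
    using that
  proof (induction ds arbitrary: t x)
    case Nil then show ?case using z0 by simp
  next
    case (Cons d ds)
    have o: "open {y. C \<or> B < \<bar>y\<bar>}" for C
      by (cases C) (auto intro!: open_Collect_less continuous_intros)
    have "((\<lambda>\<tau>. pds ds \<phi> (\<tau>, x)) has_real_derivative 0) (at t)"
      by (rule has_field_derivative_transform_within_open[OF DERIV_const o[of "B < \<bar>x\<bar>"]]) (use Cons in auto)
    moreover have "((\<lambda>y. pds ds \<phi> (t, y)) has_real_derivative 0) (at x)"
      by (rule has_field_derivative_transform_within_open[OF DERIV_const o[of "B < \<bar>t\<bar>"]]) (use Cons in auto)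
    ultimately show ?case by (auto simp: pdiff_def DERIV_imp_deriv)
  qed
  have b: "box_test (pds ds \<phi>)" for ds
    unfolding box_test_def using sm z by (auto simp: smooth2_def intro!: exI[of _ "B + 1"])
  have "((\<lambda>y. pds ds \<phi> (t, y)) has_real_derivative pds (False # ds) \<phi> (t, x)) (at x)" for ds t x
    using sm by (simp add: smooth2_def pdiff_def DERIV_deriv_iff_real_differentiable)
  moreover have "((\<lambda>\<tau>. pds ds \<phi> (\<tau>, x)) has_real_derivative pds (True # ds) \<phi> (t, x)) (at t)" for ds t x
    using sm by (simp add: smooth2_def pdiff_def DERIV_deriv_iff_real_differentiable)
  ultimately show ?thesis unfolding test_family_def replicate_Suc replicate_0 using b by blast
qed

text \<open>A continuous function of bounded support is dominated by a multiple of the Gaussian; the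
  product is then integrable, and the real part passes through the integral.\<close>

lemma section_Re:
  fixes w :: "real \<Rightarrow> complex"
  assumes wm: "w \<in> borel_measurable borel" and i: "integrable lborel (\<lambda>x. norm (w x) * exp (- x\<^sup>2 / 2))"
    and c: "continuous_on UNIV \<phi>" and z: "\<exists>B. \<forall>x. B \<le> \<bar>x\<bar> \<longrightarrow> \<phi> x = 0"
  shows "(\<integral>x. Re (w x) * \<phi> x \<partial>lborel) = Re (\<integral>x. w x * complex_of_real (\<phi> x) \<partial>lborel)"
proof -
  obtain B where B: "\<And>x. B \<le> \<bar>x\<bar> \<Longrightarrow> \<phi> x = 0" using z by blast
  have "bounded (\<phi> ` {-B..B})" by (intro compact_imp_bounded compact_continuous_image continuous_on_subset[OF c]) auto
  then obtain K where K: "\<forall>x\<in>{-B..B}. \<bar>\<phi> x\<bar> \<le> K" by (auto simp: bounded_iff)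
  define L where "L = \<bar>K\<bar> * exp (B\<^sup>2 / 2)"
  have ph: "\<bar>\<phi> x\<bar> \<le> L * exp (- x\<^sup>2 / 2)" for x
  proof (cases "\<bar>x\<bar> \<le> B")
    case True
    then have "x\<^sup>2 \<le> B\<^sup>2" using power_mono[of "\<bar>x\<bar>" B 2] by simp
    then have "1 \<le> exp (B\<^sup>2 / 2) * exp (- x\<^sup>2 / 2)" by (simp flip: exp_add add: diff_divide_distrib)
    then have "\<bar>K\<bar> * 1 \<le> \<bar>K\<bar> * (exp (B\<^sup>2 / 2) * exp (- x\<^sup>2 / 2))" by (intro mult_left_mono) auto
    moreover have "\<bar>\<phi> x\<bar> \<le> \<bar>K\<bar>" using K True abs_ge_self[of K] by (meson abs_le_iff atLeastAtMost_iff minus_le_iff order_trans)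
    ultimately show ?thesis by (simp add: L_def mult.assoc)
  next
    case False
    then show ?thesis using B[of x] by (simp add: L_def)
  qed
  have "integrable lborel (\<lambda>x. w x * complex_of_real (\<phi> x))"
  proof (rule Bochner_Integration.integrable_bound[OF integrable_mult_right[OF i, of L]])
    show "(\<lambda>x. w x * complex_of_real (\<phi> x)) \<in> borel_measurable lborel"
      using wm borel_measurable_continuous_onI[OF c] by measurable
    show "AE x in lborel. norm (w x * complex_of_real (\<phi> x)) \<le> norm (L * (norm (w x) * exp (- x\<^sup>2 / 2)))"
    proof (rule AE_I2)
      fix x :: real
      have "norm (w x) * \<bar>\<phi> x\<bar> \<le> norm (w x) * (L * exp (- x\<^sup>2 / 2))" by (intro mult_left_mono ph) auto
      also have "\<dots> \<le> \<bar>L * (norm (w x) * exp (- x\<^sup>2 / 2))\<bar>" using abs_ge_self[of "L * (norm (w x) * exp (- x\<^sup>2 / 2))"] by (simp only: mult_ac)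
      finally show "norm (w x * complex_of_real (\<phi> x)) \<le> norm (L * (norm (w x) * exp (- x\<^sup>2 / 2)))" by (simp only: norm_mult norm_of_real real_norm_def)
    qed
  qed
  from integral_Re[OF this] show ?thesis by simp
qed

lemma measurable_section: "w \<in> borel_measurable borel \<Longrightarrow> (\<lambda>x. w (a, x)) \<in> borel_measurable borel"
  for w :: "real \<times> real \<Rightarrow> complex" and a :: real
  by (erule measurable_compose[OF borel_measurable_continuous_onI, rotated]) (intro continuous_intros)

theorem theorem1p3:
  fixes T \<epsilon> s :: real and u0 uT :: distr
  assumes "0 < \<epsilon>" and "\<epsilon> < T / 2"
    and "-7/4 < s" and "s < 5/2" and "s \<noteq> 1/2" and "s \<noteq> 3/2"
    and "u0 \<in> Hs_half s" and "uT \<in> Hs_half s"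
  shows "\<exists>(u :: real \<times> real \<Rightarrow> real) (v0 :: real \<Rightarrow> distr) (v1 :: real \<Rightarrow> distr).
           L2_loc ({0..T} \<times> {0<..}) u
         \<and> cont_Hs_half s {0..\<epsilon>} v0
         \<and> cont_Hs_half s {T - \<epsilon>..T} v1
         \<and> (AE t in lborel. t \<in> {0..\<epsilon>} \<longrightarrow> distr_eq_half (v0 t) (section_distr u t))
         \<and> (AE t in lborel. t \<in> {T - \<epsilon>..T} \<longrightarrow> distr_eq_half (v1 t) (section_distr u t))
         \<and> weak_sol T u
         \<and> distr_eq_half (v0 0) u0
         \<and> distr_eq_half (v1 T) uT"
proof -
  have flow0: "flow g 0 = g" for g by (auto simp: flow_def)
  have s: "-2 \<le> s" and e: "\<epsilon> < T - \<epsilon>" using assms by auto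
  obtain g0 where g0: "Hs_data s g0" "\<And>\<phi>. test1 {0<..} \<phi> \<Longrightarrow> complex_of_real (u0 \<phi>) = (\<integral>\<xi>. g0 \<xi> * fhat \<phi> \<xi> \<partial>lborel) / (2 * pi)"
    by (rule Hs_half_data[OF s assms(7)]) blast
  obtain gT where gT: "Hs_data s gT" "\<And>\<phi>. test1 {0<..} \<phi> \<Longrightarrow> complex_of_real (uT \<phi>) = (\<integral>\<xi>. gT \<xi> * fhat \<phi> \<xi> \<partial>lborel) / (2 * pi)"
    by (rule Hs_half_data[OF s assms(8)]) blast
  have m0: "g0 \<in> borel_measurable borel" and i0: "integrable lborel (\<lambda>\<xi>. (norm (g0 \<xi>))\<^sup>2 / (1 + \<xi>\<^sup>2)\<^sup>2)"
    using g0(1) weighted_L2_weaken[OF s] by (auto simp: Hs_data_def)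
  have mT: "gT \<in> borel_measurable borel" and iT: "integrable lborel (\<lambda>\<xi>. (norm (gT \<xi>))\<^sup>2 / (1 + \<xi>\<^sup>2)\<^sup>2)"
    using gT(1) weighted_L2_weaken[OF s] by (auto simp: Hs_data_def)
  \<comment> \<open>Reflection in x reflects the frequency: this is the transform of the mirrored
    terminal state, from which the second solution starts.\<close>
  have m1: "(\<lambda>\<xi>. gT (- \<xi>)) \<in> borel_measurable borel" by (rule measurable_compose[OF _ mT]) simp
  have i1: "integrable lborel (\<lambda>\<xi>. (norm (gT (- \<xi>)))\<^sup>2 / (1 + \<xi>\<^sup>2)\<^sup>2)" using integrable_reflect[OF iT, of 0] by simp
  obtain w0 where w0: "L2_box w0" "\<And>F Ft. test_family F Ft \<Longrightarrow> (\<integral>p. w0 p * complex_of_real (adj F Ft p) \<partial>lborel) = 0"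
    "\<And>t x. T - \<epsilon> \<le> t \<Longrightarrow> w0 (t, x) = 0"
    "AE t in lborel. t \<le> \<epsilon> \<longrightarrow> integrable lborel (\<lambda>x. norm (w0 (t, x)) * exp (- x\<^sup>2 / 2)) \<and>
       (\<forall>\<phi> M. continuous_on UNIV \<phi> \<longrightarrow> (\<exists>B. \<forall>x. B \<le> \<bar>x\<bar> \<longrightarrow> \<phi> x = 0) \<longrightarrow> (\<forall>\<xi>. norm (fhat \<phi> \<xi>) * (1 + \<xi>\<^sup>2)\<^sup>2 \<le> M) \<longrightarrow>
          (\<integral>x. w0 (t, x) * complex_of_real (\<phi> x) \<partial>lborel) = (\<integral>\<xi>. g0 \<xi> * exp (\<i> * of_real (om \<xi> * t)) * fhat \<phi> \<xi> \<partial>lborel) / (2 * pi))"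
    by (rule controlled_solution[OF m0 i0 e]) (rule that; assumption)
  obtain w1 where w1: "L2_box w1" "\<And>F Ft. test_family F Ft \<Longrightarrow> (\<integral>p. w1 p * complex_of_real (adj F Ft p) \<partial>lborel) = 0"
    "\<And>t x. T - \<epsilon> \<le> t \<Longrightarrow> w1 (t, x) = 0"
    "AE t in lborel. t \<le> \<epsilon> \<longrightarrow> integrable lborel (\<lambda>x. norm (w1 (t, x)) * exp (- x\<^sup>2 / 2)) \<and>
       (\<forall>\<phi> M. continuous_on UNIV \<phi> \<longrightarrow> (\<exists>B. \<forall>x. B \<le> \<bar>x\<bar> \<longrightarrow> \<phi> x = 0) \<longrightarrow> (\<forall>\<xi>. norm (fhat \<phi> \<xi>) * (1 + \<xi>\<^sup>2)\<^sup>2 \<le> M) \<longrightarrow>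
          (\<integral>x. w1 (t, x) * complex_of_real (\<phi> x) \<partial>lborel) = (\<integral>\<xi>. gT (- \<xi>) * exp (\<i> * of_real (om \<xi> * t)) * fhat \<phi> \<xi> \<partial>lborel) / (2 * pi))"
    by (rule controlled_solution[OF m1 i1 e]) (rule that; assumption)
  \<comment> \<open>Each of \<open>w0\<close> and \<open>w1\<close> vanishes from T - \<epsilon> on.
    After the reflection the second summand vanishes up to time \<epsilon>, so on either end
    interval only one summand is present.\<close>
  define W where "W p = w0 p + w1 ((T, 0) - p)" for p
  define u where "u p = Re (W p)" for p
  have wm: "w0 \<in> borel_measurable borel" "w1 \<in> borel_measurable borel" using w0(1) w1(1) by (auto simp: L2_box_def)
  have W: "L2_box W" unfolding W_def by (rule L2_box_add[OF w0(1) L2_box_reflect[OF w1(1)]])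
  then have Wm[measurable]: "W \<in> borel_measurable borel" by (simp add: L2_box_def)
  have "L2_loc ({0..T} \<times> {0<..}) u" unfolding L2_loc_def
  proof (intro conjI allI impI)
    show um: "u \<in> borel_measurable lborel" unfolding u_def by measurable
    fix K :: "(real \<times> real) set" assume K: "compact K \<and> K \<subseteq> {0..T} \<times> {0<..}"
    then obtain A where A: "\<And>p. p \<in> K \<Longrightarrow> norm p \<le> A" using compact_imp_bounded[of K] by (auto simp: bounded_iff)
    have KA: "K \<subseteq> {-A..A} \<times> {-A..A}"
    proof
      fix p assume "p \<in> K"
      then have "norm (fst p) \<le> A" "norm (snd p) \<le> A" using A[of p] norm_fst_le[of "fst p" "snd p"] norm_snd_le[of "snd p" "fst p"] by auto
      then show "p \<in> {-A..A} \<times> {-A..A}" by (cases p) auto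
    qed
    have Ks: "K \<in> sets lborel" using K by (auto intro: borel_compact)
    have "integrable lborel (\<lambda>p. indicator ({-A..A} \<times> {-A..A}) p * (norm (W p))\<^sup>2)" using W by (simp add: L2_box_def)
    then show "set_integrable lborel K (\<lambda>p. (u p)\<^sup>2)" unfolding set_integrable_def
    proof (rule Bochner_Integration.integrable_bound)
      show "(\<lambda>p. indicator K p *\<^sub>R (u p)\<^sup>2) \<in> borel_measurable lborel" using Ks um by measurable
      show "AE p in lborel. norm (indicator K p *\<^sub>R (u p)\<^sup>2) \<le> norm (indicator ({-A..A} \<times> {-A..A}) p * (norm (W p))\<^sup>2)"
      proof (rule AE_I2)
        fix p
        have "(u p)\<^sup>2 \<le> (norm (W p))\<^sup>2" unfolding u_def using power_mono[OF abs_Re_le_cmod[of "W p"], of 2] by simp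
        then show "norm (indicator K p *\<^sub>R (u p)\<^sup>2) \<le> norm (indicator ({-A..A} \<times> {-A..A}) p * (norm (W p))\<^sup>2)"
          using KA[THEN subsetD, of p] by (cases "p \<in> K") simp_all
      qed
    qed
  qed
  moreover have "weak_sol T u" unfolding weak_sol_def
  proof (intro allI impI)
    fix \<phi> assume "test2 ({0<..<T} \<times> {0<..}) \<phi>"
    then have TF: "test_family (\<lambda>j. pds (replicate j False) \<phi>) (pds [True] \<phi>)" (is "test_family ?F ?Ft") by (rule test2_family)
    have a: "- pds [True] \<phi> p - pds [False] \<phi> p - pds [False, False, False] \<phi> p + pds [False, False, False, False, False] \<phi> p = adj ?F ?Ft p" for p
      by (simp add: adj_def numeral_eq_Suc)
    note b = box_test_adj[OF TF]
    have "(\<integral>p. W p * complex_of_real (adj ?F ?Ft p) \<partial>lborel) = 0"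
      unfolding W_def distrib_right
      by (subst Bochner_Integration.integral_add[OF L2_box_integrable[OF w0(1) b] L2_box_integrable[OF L2_box_reflect[OF w1(1)] b]])
        (simp only: w0(2)[OF TF] weak_reflect[OF wm(2) TF w1(2)] add_0)
    then have "(\<integral>p. u p * adj ?F ?Ft p \<partial>lborel) = 0"
      unfolding u_def using integral_Re[OF L2_box_integrable[OF W b]] by simp
    then show "(\<integral>p. u p * (- pds [True] \<phi> p - pds [False] \<phi> p - pds [False, False, False] \<phi> p + pds [False, False, False, False, False] \<phi> p) \<partial>lborel) = 0"
      unfolding a .
  qed
  \<comment> \<open>The continuous representative is the group itself, with which the sections of u
    agree at almost every time. The form t - 0 matches \<open>flow_continuous\<close> with c =
    0.\<close>
  moreover have "AE t in lborel. t \<in> {0..\<epsilon>} \<longrightarrow> distr_eq_half (flow_distr g0 (t - 0)) (section_distr u t)"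
    using w0(4)
  proof eventually_elim
    case (elim t)
    show ?case unfolding distr_eq_half_def
    proof (intro impI allI)
      fix \<phi> assume t: "t \<in> {0..\<epsilon>}" and "test1 {0<..} \<phi>"
      note f = test1_fourier[OF this(2)]
      from t elim have i: "integrable lborel (\<lambda>x. norm (w0 (t, x)) * exp (- x\<^sup>2 / 2))" by auto
      have "u (t, x) = Re (w0 (t, x))" for x using w1(3)[of "T - t" "- x"] t by (simp add: u_def W_def)
      then have "section_distr u t \<phi> = Re (\<integral>x. w0 (t, x) * complex_of_real (\<phi> x) \<partial>lborel)"
        unfolding section_distr_def using section_Re[OF measurable_section[OF wm(1)] i f(1,2)] by simp
      also have "(\<integral>x. w0 (t, x) * complex_of_real (\<phi> x) \<partial>lborel) = (\<integral>\<xi>. flow g0 t \<xi> * fhat \<phi> \<xi> \<partial>lborel) / (2 * pi)"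
        unfolding flow_def using elim t f by auto
      finally show "flow_distr g0 (t - 0) \<phi> = section_distr u t \<phi>" by (simp add: flow_distr_def)
    qed
  qed
  moreover have "AE t in lborel. t \<in> {T - \<epsilon>..T} \<longrightarrow> distr_eq_half (flow_distr gT (t - T)) (section_distr u t)"
    using AE_reflect[OF w1(4), of T]
  proof eventually_elim
    case (elim t)
    show ?case unfolding distr_eq_half_def
    proof (intro impI allI)
      fix \<phi> assume t: "t \<in> {T - \<epsilon>..T}" and "test1 {0<..} \<phi>"
      note f = test1_fourier[OF this(2)]
      from t elim have i: "integrable lborel (\<lambda>x. norm (w1 (T - t, x)) * exp (- x\<^sup>2 / 2))" by auto
      let ?\<psi> = "\<lambda>x. \<phi> (- x)"
      have c: "continuous_on UNIV ?\<psi>" by (intro continuous_on_compose2[OF f(1)] continuous_intros) auto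
      have z: "\<exists>B. \<forall>x. B \<le> \<bar>x\<bar> \<longrightarrow> ?\<psi> x = 0" using f(2) by (metis abs_minus_cancel)
      obtain M where M: "\<And>\<xi>. norm (fhat \<phi> \<xi>) * (1 + \<xi>\<^sup>2)\<^sup>2 \<le> M" using f(3) by blast
      have M': "\<forall>\<xi>. norm (fhat ?\<psi> \<xi>) * (1 + \<xi>\<^sup>2)\<^sup>2 \<le> M"
        unfolding fhat_reflect using M[of "- \<xi>" for \<xi>] by (simp only: power2_minus simp_thms)
      have "u (t, x) = Re (w1 (T - t, - x))" for x using w0(3)[of t x] t by (simp add: u_def W_def)
      then have "section_distr u t \<phi> = (\<integral>x. Re (w1 (T - t, x)) * ?\<psi> x \<partial>lborel)"
        unfolding section_distr_def using integral_uminus[of "\<lambda>x. Re (w1 (T - t, x)) * ?\<psi> x"] by simp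
      also have "\<dots> = Re (\<integral>x. w1 (T - t, x) * complex_of_real (?\<psi> x) \<partial>lborel)"
        by (rule section_Re[OF measurable_section[OF wm(2)] i c z])
      also have "(\<integral>x. w1 (T - t, x) * complex_of_real (?\<psi> x) \<partial>lborel) =
          (\<integral>\<xi>. gT (- \<xi>) * exp (\<i> * of_real (om \<xi> * (T - t))) * fhat ?\<psi> \<xi> \<partial>lborel) / (2 * pi)"
        using elim t c z M' by auto
      \<comment> \<open>Since \<open>om\<close> is odd, reflecting the frequency reverses the phase,
        which turns the elapsed time T - t of the mirrored solution into t - T for the original
        group.\<close>
      also have "(\<integral>\<xi>. gT (- \<xi>) * exp (\<i> * of_real (om \<xi> * (T - t))) * fhat ?\<psi> \<xi> \<partial>lborel) = (\<integral>\<xi>. flow gT (t - T) (- \<xi>) * fhat \<phi> (- \<xi>) \<partial>lborel)"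
      proof -
        have "om (- \<xi>) * (t - T) = om \<xi> * (T - t)" for \<xi> by (simp add: om_def algebra_simps)
        then show ?thesis unfolding flow_def fhat_reflect by (simp only:)
      qed
      also have "\<dots> = (\<integral>\<xi>. flow gT (t - T) \<xi> * fhat \<phi> \<xi> \<partial>lborel)" by (rule integral_uminus)
      finally show "flow_distr gT (t - T) \<phi> = section_distr u t \<phi>" by (simp add: flow_distr_def)
    qed
  qed
  moreover have "distr_eq_half (flow_distr g0 (0 - 0)) u0" "distr_eq_half (flow_distr gT (T - T)) uT"
    unfolding distr_eq_half_def diff_self flow_distr_def flow0
    using arg_cong[OF g0(2), of _ Re] arg_cong[OF gT(2), of _ Re] by auto
  ultimately show ?thesis using flow_continuous[OF s g0(1), of "{0..\<epsilon>}" 0] flow_continuous[OF s gT(1), of "{T - \<epsilon>..T}" T]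
    by blast
qed

end
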